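(* There is an absolute constant $C>0$ such that the following holds. Let $N$ be a positive integer, let $0<\delta\le 1$, let $A \subset \{1,\dots,N\}\times \{1,\dots,N\}$ with $|A| \geq \delta N^2$, and let $0<\varepsilon \leq 1/2$. Then either $N \leq \exp\big(C\varepsilon^{-C}\big)$, or there exists an integer $d \neq 0$ such that $$\#\{(x,y) \in A : (x+d, y)\in A \text{ and } (x,y+d^2) \in A\} \geq (\delta^3-\varepsilon) N^2.$$ *)

theory Defs
  imports Complex_Main
begin

end

theory Submission
  imports Defs "HOL-Analysis.Analysis"
begin

text \<open>
  The proof is an energy increment over \<open>t \<approx> \<epsilon>\<^sup>-\<^sup>2\<close> scales, with polynomial losses at each scale. For a function \<open>f\<close> on the torus \<open>(\<int>/N)\<^sup>2\<close>
  consider displacements \<open>d\<close> that are multiples of a step \<open>\<gamma>\<close> and the dual function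
  \<open>F(x, y) = E\<^sub>d f(x, y - d\<^sup>2) f(x + d, y - d\<^sup>2)\<close>.
  The main point is that \<open>F\<close> is, in \<open>L\<^sup>2\<close>, almost invariant under smoothing in the \<open>y\<close>-direction along a progression with a
  highly divisible step. Otherwise half the difference \<open>R\<close> of \<open>F\<close> and its smoothing correlates with \<open>F\<close>; PET induction shows that
  the Fourier transforms of many multiplicative derivatives of \<open>R(x, \<cdot>)\<close> have a large coefficient. Expanding \<open>R\<close> again in terms of
  \<open>F\<close>, a Weyl sum argument shows that the large frequencies of different derivatives differ by major arc frequencies, so that
  \<open>R(x, \<cdot>)\<close> has Fourier mass near a single frequency for many \<open>x\<close>; a second application of the Weyl sum argument shows that this
  frequency is itself major arc, where smoothing acts as the identity and \<open>R\<close> vanishes.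
  Among the scales there is one at which the smoothings of \<open>f\<close> at consecutive scales are close in \<open>L\<^sup>2\<close>. At this scale the count of
  configurations is close to \<open>E f(x, y) f(x + d, y) (S f)(x, y)\<close> with a smoothing operator \<open>S\<close>, which is at least \<open>\<delta>\<^sup>3\<close> by the
  inequality for paths of length three in a bipartite graph.
\<close>

section \<open>Averages, periodic functions and exponentials\<close>

text \<open>The Weyl sum argument only places frequencies within about M^-2 of fractions with small
  denominator, M being the size of the displacements. On the whole torus the number of such
  frequencies grows with N/M^2, and no pigeonholing over them would be affordable. Hence y is
  restricted to windows b + \<gamma>^2 y with 0 \<le> y < n = t^10 M^2, each turned into a cyclic
  group of its own; then the number of candidates is a power of t.

  Denominators are absorbed by W, a factorial divisible by every integer up to a fixed power of t:
  after multiplication by W a nearly rational frequency is nearly integral. Since log W is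
  polynomial in t, and each of the t levels costs a bounded power of W, the size of N needed is exp
  of a power of 1/\<epsilon>.

  Displacements are not uniform on an interval. They have the form i + k j + a + b - \<sigma> + c:
  one layer for each Cauchy-Schwarz step, a dilation k that makes large common divisors rare, and
  two long variables \<sigma>, c, so that up to a small error the displacement is a difference of
  two independent uniform variables, as the path inequality requires.\<close>

definition avg :: "'a set \<Rightarrow> ('a \<Rightarrow> 'b::real_vector) \<Rightarrow> 'b" where
 "avg S f = (1 / real (card S)) *\<^sub>R (\<Sum>s\<in>S. f s)"

lemma avg_cong: "(\<And>s. s \<in> S \<Longrightarrow> f s = g s) \<Longrightarrow> avg S f = avg S g"
 unfolding avg_def by (metis (no_types, lifting) sum.cong)

lemma avg_zero [simp]: "avg S (\<lambda>s. 0) = 0"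
 by (simp add: avg_def)

lemma avg_const: "finite S \<Longrightarrow> S \<noteq> {} \<Longrightarrow> avg S (\<lambda>s. c) = c"
 by (simp add: avg_def sum_constant_scaleR)

lemma avg_add: "avg S (\<lambda>s. f s + g s) = avg S f + avg S g"
 by (simp add: avg_def sum.distrib scaleR_add_right)

lemma avg_diff: "avg S (\<lambda>s. f s - g s) = avg S f - avg S g"
 by (simp add: avg_def sum_subtractf scaleR_diff_right)

lemma avg_sum: "avg S (\<lambda>s. \<Sum>x\<in>X. f s x) = (\<Sum>x\<in>X. avg S (\<lambda>s. f s x))"
 unfolding avg_def by (subst sum.swap) (simp add: scaleR_sum_right)

lemma avg_cmult: "avg S (\<lambda>s. c * f s) = c * avg S f" for c :: "'b::real_algebra"
 by (simp add: avg_def sum_distrib_left)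

lemma avg_multc: "avg S (\<lambda>s. f s * c) = avg S f * c" for c :: "'b::real_algebra"
 by (simp add: avg_def sum_distrib_right)

lemma avg_swap: "avg A (\<lambda>a. avg B (\<lambda>b. f a b)) = avg B (\<lambda>b. avg A (\<lambda>a. f a b))"
 unfolding avg_def scaleR_sum_right
 by (subst sum.swap) (simp add: mult.commute)

lemma avg_Times: "avg (A \<times> B) f = avg A (\<lambda>a. avg B (\<lambda>b. f (a, b)))"
 by (simp add: avg_def scaleR_sum_right card_cartesian_product sum.cartesian_product)

lemma avg_mono: "(\<And>s. s \<in> S \<Longrightarrow> f s \<le> (g s :: real)) \<Longrightarrow> avg S f \<le> avg S g"
 unfolding avg_def by (simp add: sum_mono divide_right_mono)

lemma avg_nonneg: "(\<And>s. s \<in> S \<Longrightarrow> 0 \<le> (f s :: real)) \<Longrightarrow> 0 \<le> avg S f"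
 unfolding avg_def by (simp add: sum_nonneg)

text \<open>\<open>avg\<close> over an empty or infinite set is 0, and the hypothesis 0 \<le> c
  covers exactly this case. Nested averages can therefore be bounded without carrying finiteness and
  nonemptiness along.\<close>

lemma avg_le: "(\<And>s. s \<in> S \<Longrightarrow> f s \<le> (c :: real)) \<Longrightarrow> 0 \<le> c \<Longrightarrow> avg S f \<le> c"
 using avg_mono[of S f "\<lambda>_. c"] avg_const[of S c]
 by (cases "finite S \<and> S \<noteq> {}") (auto simp: avg_def)

lemma avg_ge: "finite S \<Longrightarrow> S \<noteq> {} \<Longrightarrow> (\<And>s. s \<in> S \<Longrightarrow> c \<le> (f s :: real)) \<Longrightarrow> c \<le> avg S f"
 using avg_mono[of S "\<lambda>_. c" f] avg_const[of S c] by simp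

lemma norm_avg_le: "norm (avg S f) \<le> avg S (\<lambda>s. norm (f s))"
 for f :: "'a \<Rightarrow> 'b::real_normed_vector"
 by (simp add: avg_def divide_right_mono norm_sum)

lemma norm_avg_bound: "(\<And>s. s \<in> S \<Longrightarrow> norm (f s) \<le> c) \<Longrightarrow> 0 \<le> c \<Longrightarrow> norm (avg S f) \<le> c"
 for f :: "'a \<Rightarrow> 'b::real_normed_vector"
 by (rule order_trans[OF norm_avg_le avg_le])

lemma abs_avg_bound: "(\<And>s. s \<in> S \<Longrightarrow> \<bar>f s\<bar> \<le> c) \<Longrightarrow> 0 \<le> c \<Longrightarrow> \<bar>avg S f\<bar> \<le> (c::real)"
 using norm_avg_bound[of S f c] by simp

lemma avg_exists_ge:
 assumes "finite S" "S \<noteq> {}" shows "\<exists>s\<in>S. avg S f \<le> (f s :: real)"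
proof (rule ccontr)
 assume "\<not> ?thesis"
 then have "(\<Sum>s\<in>S. f s) < (\<Sum>s\<in>S. avg S f)"
  using assms by (intro sum_strict_mono) auto
 then show False using assms by (simp add: avg_def)
qed

lemma avg_cauchy: "(avg S (\<lambda>s. f s * g s))\<^sup>2 \<le> avg S (\<lambda>s. (f s)\<^sup>2) * avg S (\<lambda>s. (g s :: real)\<^sup>2)"
proof -
 have "(\<Sum>s\<in>S. f s * g s)\<^sup>2 \<le> (\<Sum>s\<in>S. (f s)\<^sup>2) * (\<Sum>s\<in>S. (g s)\<^sup>2)"
  by (rule Cauchy_Schwarz_ineq_sum)
 then show ?thesis
  by (simp add: avg_def power2_eq_square divide_right_mono)
qed

lemma avg_square: "(avg S f)\<^sup>2 \<le> avg S (\<lambda>s. (f s :: real)\<^sup>2)"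
proof (cases "finite S \<and> S \<noteq> {}")
 case True
 then show ?thesis using avg_cauchy[of S f "\<lambda>_. 1"] avg_const[of S "1::real"] by simp
qed (auto simp: avg_def)

lemma avg_pow4: "(avg S f) ^ 4 \<le> avg S (\<lambda>s. (f s :: real) ^ 4)"
proof -
 have "(avg S f) ^ 4 = ((avg S f)\<^sup>2)\<^sup>2" by simp
 also have "\<dots> \<le> (avg S (\<lambda>s. (f s)\<^sup>2))\<^sup>2"
  by (rule power_mono[OF avg_square]) simp
 also have "\<dots> \<le> avg S (\<lambda>s. ((f s)\<^sup>2)\<^sup>2)" by (rule avg_square)
 finally show ?thesis by simp
qed

lemma avg_pow8: "(avg S f) ^ 8 \<le> avg S (\<lambda>s. (f s :: real) ^ 8)"
proof -
 have "(avg S f) ^ 8 = ((avg S f) ^ 4)\<^sup>2" by simp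
 also have "\<dots> \<le> (avg S (\<lambda>s. (f s) ^ 4))\<^sup>2"
  by (rule power_mono[OF avg_pow4]) simp
 also have "\<dots> \<le> avg S (\<lambda>s. ((f s) ^ 4)\<^sup>2)" by (rule avg_square)
 finally show ?thesis by simp
qed

lemma avg_norm_square: "(norm (avg S f))\<^sup>2 \<le> avg S (\<lambda>s. (norm (f s))\<^sup>2)"
 for f :: "'a \<Rightarrow> 'b::real_normed_vector"
proof -
 have "(norm (avg S f))\<^sup>2 \<le> (avg S (\<lambda>s. norm (f s)))\<^sup>2"
  by (rule power_mono[OF norm_avg_le]) simp
 also have "\<dots> \<le> avg S (\<lambda>s. (norm (f s))\<^sup>2)" by (rule avg_square)
 finally show ?thesis .
qed

lemma avg_mult_avg: "avg A f * avg B g = avg A (\<lambda>a. avg B (\<lambda>b. f a * (g b :: 'b::real_algebra)))"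
 by (simp add: avg_cmult avg_multc)

lemma avg_of_real: "avg S (\<lambda>s. of_real (f s)) = (of_real (avg S f) :: 'b::real_algebra_1)"
 unfolding avg_def scaleR_conv_of_real real_scaleR_def of_real_mult by simp

lemma avg_cnj: "avg S (\<lambda>s. cnj (f s)) = cnj (avg S f)"
 by (simp add: avg_def scaleR_conv_of_real)

text \<open>Markov's inequality in its popularity form: f is at most b plus the indicator of {b
  \<le> f}, so the density of that set is at least the mean minus b.\<close>

lemma avg_large_card:
 assumes "finite S" "S \<noteq> {}" "\<And>s. s \<in> S \<Longrightarrow> (f s :: real) \<le> 1" "c \<le> avg S f" "0 \<le> b" "b \<le> c"
 shows "(c - b) * real (card S) \<le> real (card {s\<in>S. b \<le> f s})"
proof -
 have "c * real (card S) \<le> (\<Sum>s\<in>S. f s)"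
  using assms by (simp add: avg_def field_simps card_gt_0_iff)
 also have "\<dots> \<le> (\<Sum>s\<in>S. (if b \<le> f s then 1 else 0) + b)"
  using assms(3)[THEN order_trans] assms(5) by (intro sum_mono) (auto intro: add_increasing2)
 also have "\<dots> = real (card {s\<in>S. b \<le> f s}) + b * real (card S)"
  using assms by (simp add: sum.distrib sum.If_cases Int_def)
 finally show ?thesis by (simp add: algebra_simps)
qed

text \<open>Functions on Z/n are kept as n-periodic functions on the integers, so that progressions,
  windows and shifts by arbitrary integers need no coercions.\<close>

definition per :: "int \<Rightarrow> (int \<Rightarrow> 'a) \<Rightarrow> bool" where
 "per n f \<longleftrightarrow> (\<forall>x. f (x + n) = f x)"

lemma perD: "per n f \<Longrightarrow> f (x + n) = f x"
 by (simp add: per_def)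

lemma per_add_mult: assumes "per n f" shows "f (x + n * k) = f x"
proof -
 have nn: "f (x + n * int m) = f x" for m x
 proof (induction m arbitrary: x)
  case (Suc m)
  have "f (x + n * int (Suc m)) = f ((x + n * int m) + n)" by (simp add: algebra_simps)
  then show ?case using Suc perD[OF assms] by metis
 qed simp
 show ?thesis
 proof (cases "k \<ge> 0")
  case True then show ?thesis using nn[of x "nat k"] by simp
 next
  case False then show ?thesis using nn[of "x + n * k" "nat (- k)"] by simp
 qed
qed

lemma per_mod: "per n f \<Longrightarrow> f (x mod n) = f x"
 using per_add_mult[of n f "x mod n" "x div n"] by (simp add: mult.commute)

lemma bij_mod_shift:
 assumes "0 < (n::int)" shows "bij_betw (\<lambda>x. (x + a) mod n) {0..<n} {0..<n}"
proof -
 have inj: "inj_on (\<lambda>x. (x + a) mod n) {0..<n}"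
 proof (rule inj_onI)
  fix x y assume xy: "x \<in> {0..<n}" "y \<in> {0..<n}" and "(x + a) mod n = (y + a) mod n"
  then have "((x + a) - a) mod n = ((y + a) - a) mod n" by (metis mod_diff_left_eq)
  then show "x = y" using xy by simp
 qed
 moreover have "(\<lambda>x. (x + a) mod n) ` {0..<n} \<subseteq> {0..<n}" using assms by auto
 ultimately show ?thesis
  by (simp add: bij_betw_def endo_inj_surj)
qed

lemma avg_shift:
 assumes "per n f" shows "avg {0..<n} (\<lambda>x. f (x + a)) = avg {0..<n} f"
proof (cases "0 < n")
 case True
 have "(\<Sum>x\<in>{0..<n}. f (x + a)) = (\<Sum>x\<in>{0..<n}. f ((x + a) mod n))"
  by (simp add: per_mod[OF assms])
 also have "\<dots> = (\<Sum>x\<in>{0..<n}. f x)"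
  by (rule sum.reindex_bij_betw[OF bij_mod_shift[OF True]])
 finally show ?thesis by (simp add: avg_def)
qed (simp add: avg_def)

section \<open>The exponential e(x) and the distance to the nearest integer\<close>

definition ee :: "real \<Rightarrow> complex" where "ee x = cis (2 * pi * x)"

lemma ee_add: "ee (x + y) = ee x * ee y"
 by (simp add: ee_def cis_mult ring_distribs)

lemma ee_diff: "ee (x - y) = ee x * ee (- y)"
 using ee_add[of x "- y"] by simp

lemma ee_0 [simp]: "ee 0 = 1" by (simp add: ee_def)

lemma norm_ee [simp]: "norm (ee x) = 1" by (simp add: ee_def)

lemma cnj_ee [simp]: "cnj (ee x) = ee (- x)" by (simp add: ee_def cis_cnj)

lemma ee_int [simp]: "ee (of_int m) = 1"
 by (simp add: ee_def)

lemma ee_add_int: "ee (x + of_int m) = ee x" by (simp add: ee_add)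

lemma norm_ee_minus_1: "norm (ee x - 1) = 2 * \<bar>sin (pi * x)\<bar>"
proof -
 have "(norm (ee x - 1))\<^sup>2 = (cos (2*pi*x) - 1)\<^sup>2 + (sin (2*pi*x))\<^sup>2"
  by (simp add: ee_def cmod_power2)
 also have "\<dots> = 2 - 2 * cos (2 * (pi*x))"
  using sin_cos_squared_add[of "2*pi*x"] by (simp add: power2_eq_square algebra_simps)
 also have "\<dots> = (2 * \<bar>sin (pi * x)\<bar>)\<^sup>2"
  by (subst cos_double_sin) (simp add: power2_eq_square)
 finally show ?thesis by (rule power2_eq_imp_eq) auto
qed

lemma ee_upper: "norm (ee x - 1) \<le> 8 * \<bar>x\<bar>"
proof -
 have "\<bar>sin (pi * x)\<bar> \<le> \<bar>pi * x\<bar>" by (rule abs_sin_x_le_abs_x)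
 also have "\<dots> \<le> 4 * \<bar>x\<bar>" using pi_less_4 by (simp add: abs_mult mult_right_mono)
 finally show ?thesis by (simp add: norm_ee_minus_1)
qed

lemma ee_dist: "norm (ee x - ee y) \<le> 8 * \<bar>x - y\<bar>"
proof -
 have "ee x - ee y = (ee (x - y) - 1) * ee y"
  using ee_add[of "x - y" y] by (simp add: algebra_simps)
 then show ?thesis using ee_upper[of "x - y"] by (simp add: norm_mult)
qed

text \<open>The Taylor bound sin z \<ge> z - z^3/6 gives sin z \<ge> z/3 on [0, 2], and z = pi |x|
  lies there because |x| \<le> 1/2.\<close>

lemma ee_lower: assumes "\<bar>x\<bar> \<le> 1/2" shows "\<bar>x\<bar> \<le> norm (ee x - 1)"
proof -
 define z where "z = pi * \<bar>x\<bar>"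
 have z: "0 \<le> z" "z \<le> 2" "2 * \<bar>x\<bar> \<le> z"
  using assms pi_less_4 pi_ge_two mult_mono[of pi 4 "\<bar>x\<bar>" "1/2"] by (auto simp: z_def mult_right_mono)
 have "\<bar>sin z - (\<Sum>m<3. sin_coeff m * z ^ m)\<bar> \<le> inverse (fact 3) * \<bar>z\<bar> ^ 3"
  by (rule Maclaurin_sin_bound)
 moreover have "(\<Sum>m<3. sin_coeff m * z ^ m) = z"
  by (simp add: eval_nat_numeral sin_coeff_def)
 ultimately have "\<bar>sin z - z\<bar> \<le> z ^ 3 / 6" using z by (simp add: eval_nat_numeral field_simps)
 moreover have "z ^ 3 \<le> 4 * z"
  using z mult_mono[of "z*z" 4 z z] mult_mono[of z 2 z 2] by (simp add: power3_eq_cube)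
 ultimately have "z - 4 * z / 6 \<le> sin z" by linarith
 moreover have "\<bar>sin (pi * x)\<bar> = \<bar>sin z\<bar>" by (cases "x \<ge> 0") (auto simp: z_def)
 ultimately show ?thesis using z by (simp add: norm_ee_minus_1)
qed

text \<open>The distance of x to the nearest integer is at most k. In the existential form errors
  are added and scaled through the witness, without rounding.\<close>

definition near :: "real \<Rightarrow> real \<Rightarrow> bool" where
 "near k x \<longleftrightarrow> (\<exists>m::int. \<bar>x - of_int m\<bar> \<le> k)"

lemma near_mono: "near k x \<Longrightarrow> k \<le> k' \<Longrightarrow> near k' x"
 unfolding near_def using order_trans by blast

lemma near_add: "near k x \<Longrightarrow> near k' y \<Longrightarrow> near (k + k') (x + y)"
 unfolding near_def
proof (elim exE)
 fix m m' :: int assume "\<bar>x - of_int m\<bar> \<le> k" "\<bar>y - of_int m'\<bar> \<le> k'"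
 then show "\<exists>m. \<bar>x + y - of_int m\<bar> \<le> k + k'" by (intro exI[of _ "m + m'"]) auto
qed

lemma near_minus: "near k x \<Longrightarrow> near k (- x)"
 unfolding near_def
proof (elim exE)
 fix m :: int assume "\<bar>x - of_int m\<bar> \<le> k"
 then show "\<exists>m. \<bar>- x - of_int m\<bar> \<le> k" by (intro exI[of _ "- m"]) auto
qed

lemma near_diff: "near k x \<Longrightarrow> near k' y \<Longrightarrow> near (k + k') (x - y)"
 using near_add[of k x k' "- y"] near_minus by simp

lemma near_mult: assumes "near k x" shows "near (of_int \<bar>q\<bar> * k) (of_int q * x)"
proof -
 from assms obtain m :: int where "\<bar>x - of_int m\<bar> \<le> k" by (auto simp: near_def)
 then have "\<bar>of_int q\<bar> * \<bar>x - of_int m\<bar> \<le> \<bar>of_int q\<bar> * k" by (intro mult_left_mono) auto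
 then have "\<bar>of_int q * x - of_int (q * m)\<bar> \<le> of_int \<bar>q\<bar> * k"
  by (simp add: abs_mult[symmetric] algebra_simps)
 then show ?thesis unfolding near_def by blast
qed

lemma geom_telescope:
 fixes \<alpha> :: real
 assumes "u \<le> v"
 shows "(ee \<alpha> - 1) * (\<Sum>d\<in>{u..<v::int}. ee (\<alpha> * d)) = ee (\<alpha> * v) - ee (\<alpha> * u)"
 using assms
proof (induction v rule: int_ge_induct)
 case (step i)
 have "{u..<i + 1} = insert i {u..<i}" using step by auto
 then show ?case using step by (simp add: ring_distribs ee_add)
qed simp

text \<open>Multiplying the geometric sum by e(\<alpha>) - 1 leaves two boundary terms of modulus 1,
  so a sum of size c forces |e(\<alpha>) - 1| \<le> 2/c; \<open>ee_lower\<close> turns this into a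
  distance. The constant phase \<mu> factors out.\<close>

lemma geom_near:
 fixes \<alpha> \<mu> :: real
 assumes "c \<le> norm (\<Sum>d\<in>{u..<v::int}. ee (\<alpha> * d + \<mu>))" "0 < c"
 shows "near (2 / c) \<alpha>"
proof -
 let ?S = "\<Sum>d\<in>{u..<v}. ee (\<alpha> * d)"
 have eq: "(\<Sum>d\<in>{u..<v}. ee (\<alpha> * d + \<mu>)) = ?S * ee \<mu>"
  by (simp add: ee_add sum_distrib_right)
 have c: "c \<le> norm ?S" using assms by (simp add: eq norm_mult)
 have uv: "u \<le> v" using assms by (cases "u \<le> v") auto
 define x where "x = \<alpha> - of_int (round \<alpha>)"
 have x: "\<bar>x\<bar> \<le> 1/2" using of_int_round_abs_le[of \<alpha>] by (simp add: x_def abs_minus_commute)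
 have "ee x = ee \<alpha>" using ee_add_int[of \<alpha> "- round \<alpha>"] by (simp add: x_def)
 then have "\<bar>x\<bar> \<le> norm (ee \<alpha> - 1)" using ee_lower[OF x] by simp
 then have "\<bar>x\<bar> * c \<le> norm (ee \<alpha> - 1) * norm ?S"
  using c assms by (intro mult_mono) auto
 also have "\<dots> = norm (ee (\<alpha> * v) - ee (\<alpha> * u))"
  using geom_telescope[OF uv, of \<alpha>] by (simp add: norm_mult[symmetric])
 also have "\<dots> \<le> 2" using norm_triangle_ineq4[of "ee (\<alpha> * v)" "ee (\<alpha> * u)"] by simp
 finally have "\<bar>x\<bar> \<le> 2 / c" using assms by (simp add: field_simps)
 then show ?thesis unfolding near_def x_def by blast
qed

section \<open>Diophantine approximation\<close>

lemma cnj_ee_mult: "cnj (ee a) * ee b = ee (b - a)"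
 by (simp add: ee_diff[of b a])

lemma near_mod_int: "near \<kappa> (x + of_int m) \<longleftrightarrow> near \<kappa> x"
 unfolding near_def
proof
 assume "\<exists>k. \<bar>x + of_int m - of_int k\<bar> \<le> \<kappa>"
 then obtain k :: int where "\<bar>x + of_int m - of_int k\<bar> \<le> \<kappa>" by blast
 then show "\<exists>k. \<bar>x - of_int k\<bar> \<le> \<kappa>" by (intro exI[of _ "k - m"]) (auto simp: algebra_simps)
next
 assume "\<exists>k. \<bar>x - of_int k\<bar> \<le> \<kappa>"
 then obtain k :: int where "\<bar>x - of_int k\<bar> \<le> \<kappa>" by blast
 then show "\<exists>k. \<bar>x + of_int m - of_int k\<bar> \<le> \<kappa>" by (intro exI[of _ "k + m"]) (auto simp: algebra_simps)
qed

lemma pigeonhole_fibre: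
 assumes "finite S" "f ` S \<subseteq> B" "finite B" "B \<noteq> {}"
 shows "\<exists>b\<in>B. real (card S) \<le> real (card B) * real (card {s\<in>S. f s = b})"
proof (rule ccontr)
 assume "\<not> ?thesis"
 then have lt: "\<And>b. b \<in> B \<Longrightarrow> real (card B) * real (card {s\<in>S. f s = b}) < real (card S)" by force
 have "S = (\<Union>b\<in>B. {s\<in>S. f s = b})" using assms by auto
 then have "card S \<le> (\<Sum>b\<in>B. card {s\<in>S. f s = b})" using card_UN_le[OF assms(3)] by metis
 then have "real (card B) * real (card S) \<le> real (card B) * (\<Sum>b\<in>B. real (card {s\<in>S. f s = b}))"
  by (intro mult_left_mono) (simp_all only: of_nat_sum[symmetric] of_nat_le_iff of_nat_0_le_iff)
 also have "\<dots> = (\<Sum>b\<in>B. real (card B) * real (card {s\<in>S. f s = b}))" by (simp add: sum_distrib_left)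
 also have "\<dots> < (\<Sum>b\<in>B. real (card S))" using assms lt by (intro sum_strict_mono) auto
 finally show False by simp
qed

lemma card_int_le_span:
 assumes "T \<subseteq> {a..b::int}" "a \<le> b" shows "real (card T) \<le> real_of_int (b - a) + 1"
 using card_mono[OF _ assms(1)] assms(2) by (simp add: of_nat_diff)

text \<open>Vinogradov's lemma: a linear phase close to integers on a dense set of h must have a
  slope close to a fraction with denominator O(1/\<rho>). The constant \<alpha> cancels in
  differences. The auxiliary length H' is short enough that errors \<kappa> accumulated along it
  cannot wrap around modulo 1, and the precision gained in the end is a factor H'.\<close>

lemma vinogradov:
 fixes H H' :: int and \<beta> \<alpha> \<rho> \<kappa> :: real
 assumes S: "S \<subseteq> {0..<H}" "\<rho> * H \<le> card S" and \<rho>: "0 < \<rho>" "\<rho> \<le> 1"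
  and H': "0 < H'" "H' \<le> H" "4 * \<kappa> * H' < 1" "32 \<le> \<rho> * H'" and \<kappa>: "0 \<le> \<kappa>"
  and nr: "\<And>h. h \<in> S \<Longrightarrow> near \<kappa> (h * \<beta> + \<alpha>)"
 shows "\<exists>q::int. 1 \<le> q \<and> q \<le> 8 / \<rho> \<and> near (64 * \<kappa> / (\<rho>\<^sup>2 * H')) (q * \<beta>)"
proof -
 have finS: "finite S" using S(1) finite_subset by blast
 have "(\<lambda>h. h div H') ` S \<subseteq> {0..H div H'}"
  using S(1) H' by (auto simp: zdiv_mono1 pos_imp_zdiv_nonneg_iff)
 moreover have Hd: "0 \<le> H div H'" using H' by (simp add: pos_imp_zdiv_nonneg_iff)
 ultimately obtain b where b: "real (card S) \<le> real (card {0..H div H'}) * real (card {s\<in>S. s div H' = b})"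
  using pigeonhole_fibre[OF finS, of "\<lambda>h. h div H'" "{0..H div H'}"] by auto
 \<comment> \<open>Some block of length H' still contains \<rho>H'/2 elements of S; the rest of the
   proof takes place in this block.\<close>
 define T where "T = {s\<in>S. s div H' = b}"
 have finT: "finite T" using finS by (simp add: T_def)
 have TI: "T \<subseteq> {b * H'..b * H' + H' - 1}"
 proof
  fix s assume "s \<in> T"
  then have "s = b * H' + s mod H'" using div_mult_mod_eq[of s H'] by (simp add: T_def)
  then show "s \<in> {b * H'..b * H' + H' - 1}"
   using pos_mod_bound[OF H'(1), of s] pos_mod_sign[OF H'(1), of s] unfolding atLeastAtMost_iff by linarith
 qed
 have "(H div H') * H' \<le> H" using H'(1) div_mult_mod_eq[of H H'] pos_mod_sign[OF H'(1), of H] by linarith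
 then have "real_of_int (H div H') * H' \<le> H" by (metis of_int_le_iff of_int_mult)
 then have "real (card {0..H div H'}) * H' \<le> 2 * H" using H' Hd by (simp add: algebra_simps)
 then have "real (card {0..H div H'}) * real_of_int H' * real (card T) \<le> 2 * real_of_int H * real (card T)" by (intro mult_right_mono) auto
 moreover have "(\<rho> * H) * H' \<le> real (card {0..H div H'}) * real (card T) * H'"
  using order_trans[OF S(2) b] H' unfolding T_def by (intro mult_right_mono) auto
 ultimately have "H * (\<rho> * H') \<le> H * (2 * real (card T))" by (simp only: mult_ac)
 then have cT: "\<rho> * H' / 2 \<le> card T"
  using H' by (subst (asm) mult_le_cancel_left_pos) auto
 define l where "l = \<lceil>4 / \<rho>\<rceil>"
 have l: "4 / \<rho> \<le> l" "l \<le> 4 / \<rho> + 1" "1 \<le> l"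
  using \<rho> unfolding l_def by (auto simp: ceiling_correct less_imp_le le_of_int_ceiling)
 let ?f = "\<lambda>h. h div l"
 let ?B = "{b * H' div l..(b * H' + H' - 1) div l}"
 have sub: "?f ` T \<subseteq> ?B" using l by (auto dest!: subsetD[OF TI] intro!: zdiv_mono1)
 have "(b * H' + H' - 1) div l \<le> b * H' div l + (H' - 1) div l + 1"
 proof -
  have "b * H' + H' - 1 = ((b * H') div l + (H' - 1) div l) * l + ((b * H') mod l + (H' - 1) mod l)"
   using div_mult_mod_eq[of "b * H'" l] div_mult_mod_eq[of "H' - 1" l] by (simp add: algebra_simps)
  moreover have "(b * H') mod l + (H' - 1) mod l < 2 * l"
   using pos_mod_bound[of l "b * H'"] pos_mod_bound[of l "H' - 1"] l by linarith
  ultimately have "b * H' + H' - 1 < ((b * H') div l + (H' - 1) div l + 2) * l"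
   by (simp only: distrib_right)
  moreover have "((b * H' + H' - 1) div l) * l \<le> b * H' + H' - 1"
   using div_mult_mod_eq[of "b * H' + H' - 1" l] pos_mod_sign[of l "b * H' + H' - 1"] l by linarith
  ultimately have "((b * H' + H' - 1) div l) * l < ((b * H') div l + (H' - 1) div l + 2) * l" by linarith
  then have "(b * H' + H' - 1) div l < b * H' div l + (H' - 1) div l + 2"
   using l by (simp add: mult_less_cancel_right)
  then show ?thesis by simp
 qed
 moreover have "0 \<le> (H' - 1) div l" using l H' by (simp add: pos_imp_zdiv_nonneg_iff)
 ultimately have "int (card ?B) \<le> (H' - 1) div l + 2" by simp
 then have "real (card ?B) \<le> real_of_int ((H' - 1) div l) + 2" by linarith
 moreover have "real_of_int ((H' - 1) div l) \<le> \<rho> * H' / 4"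
 proof -
  have "((H' - 1) div l) * l \<le> H'" 
   using div_mult_mod_eq[of "H' - 1" l] pos_mod_sign[of l "H' - 1"] l by linarith
  then have "real_of_int ((H' - 1) div l) * l \<le> H'" by (metis of_int_le_iff of_int_mult)
  moreover have "real_of_int ((H' - 1) div l) * (4 / \<rho>) \<le> real_of_int ((H' - 1) div l) * l"
   using l H' by (intro mult_left_mono) (auto simp: pos_imp_zdiv_nonneg_iff)
  ultimately have "real_of_int ((H' - 1) div l) * (4 / \<rho>) \<le> H'" by linarith
  then show ?thesis using \<rho> by (simp add: field_simps)
 qed
 ultimately have "real (card ?B) \<le> \<rho> * H' / 4 + 2" by linarith
 also have "\<dots> < \<rho> * H' / 2" using H' by simp
 finally have "card ?B < card T" using cT by linarith
 then have "card (?f ` T) < card T" using card_mono[OF _ sub] by simp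
 \<comment> \<open>There are fewer cells of length l, about 4/\<rho>, than points of T. Two points
   in one cell have a difference q < l, with q\<beta> within 2\<kappa> of an integer.\<close>
 then have "\<not> inj_on ?f T" using card_image by fastforce
 then obtain h1 h2 where h: "h1 \<in> T" "h2 \<in> T" "h1 < h2" "h1 div l = h2 div l"
  unfolding inj_on_def by (metis linorder_neqE)
 define q where "q = h2 - h1"
 have lpos: "0 < l" using l by simp
 have "h1 = h2 div l * l + h1 mod l" using div_mult_mod_eq[of h1 l] h(4) by simp
 moreover have "h2 = h2 div l * l + h2 mod l" by simp
 ultimately have "q = h2 mod l - h1 mod l" unfolding q_def by linarith
 then have "q < l"
  using pos_mod_bound[OF lpos, of h2] pos_mod_sign[OF lpos, of h1] by linarith
 then have q: "1 \<le> q" "q \<le> 4 / \<rho>" using l h by (auto simp: q_def)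
 have diff: "near (2 * \<kappa>) ((y - x) * \<beta>)" if "x \<in> T" "y \<in> T" for x y :: int
  using near_diff[OF nr[of y] nr[of x]] that by (simp add: T_def algebra_simps)
 have "near (2 * \<kappa>) (q * \<beta>)" using diff[OF h(1,2)] by (simp add: q_def)
 then obtain m :: int where m: "\<bar>q * \<beta> - m\<bar> \<le> 2 * \<kappa>" by (auto simp: near_def)
 define \<theta> where "\<theta> = q * \<beta> - m"
 define x where "x = Min T" define y where "y = Max T"
 have Tne: "T \<noteq> {}" using h by auto
 have xy: "x \<in> T" "y \<in> T" using finT Tne by (auto simp: x_def y_def)
 have "T \<subseteq> {x..y}" using finT by (auto simp: x_def y_def)
 then have "real (card T) \<le> real_of_int (y - x) + 1"
  using xy by (intro card_int_le_span) auto
 then have t: "\<rho> * H' / 4 \<le> y - x" using cT H' by linarith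
 have tpos: "0 < y - x" using t H' by linarith
 have tH: "y - x < H'" using subsetD[OF TI xy(1)] subsetD[OF TI xy(2)] by auto
 have "near (q * (2 * \<kappa>)) (q * ((y - x) * \<beta>))"
  using near_mult[OF diff[OF xy], of q] q by simp
 moreover have "q * ((y - x) * \<beta>) = (y - x) * \<theta> + of_int ((y - x) * m)"
  by (simp add: \<theta>_def algebra_simps)
 ultimately have "near (q * (2 * \<kappa>)) ((y - x) * \<theta>)" by (simp only: near_mod_int)
 then obtain m' :: int where m': "\<bar>(y - x) * \<theta> - m'\<bar> \<le> q * (2 * \<kappa>)"
  unfolding near_def by blast
 have "\<bar>(y - x) * \<theta>\<bar> \<le> (y - x) * (2 * \<kappa>)"
  unfolding abs_mult using m tpos \<theta>_def by (simp add: mult_left_mono)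
 also have "\<dots> \<le> H' * (2 * \<kappa>)" using tH \<kappa> by (intro mult_right_mono) auto
 finally have a1: "\<bar>(y - x) * \<theta>\<bar> \<le> H' * (2 * \<kappa>)" .
 have "q \<le> H'" using subsetD[OF TI h(1)] subsetD[OF TI h(2)] by (auto simp: q_def)
 then have "q * (2 * \<kappa>) \<le> H' * (2 * \<kappa>)" using \<kappa> by (intro mult_right_mono) auto
 moreover have "2 * (H' * (2 * \<kappa>)) < 1" using H'(3) by (simp add: mult_ac)
 \<comment> \<open>Both (y - x)\<theta> and its distance to m' are at most 2H'\<kappa> < 1/2, so m'
   = 0. Dividing by the long distance y - x of the extreme points then improves the error of
   q\<beta> from \<kappa> to about \<kappa>/H'.\<close>
 ultimately have "\<bar>real_of_int m'\<bar> < 1" using a1 m' by linarith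
 then have "m' = 0" by simp
 then have "\<bar>\<theta>\<bar> * (y - x) \<le> q * (2 * \<kappa>)" using m' tpos by (simp add: abs_mult mult.commute)
 also have "\<dots> \<le> 4 / \<rho> * (2 * \<kappa>)" using q \<kappa> by (intro mult_right_mono) auto
 finally have "\<bar>\<theta>\<bar> * (\<rho> * H' / 4) \<le> 4 / \<rho> * (2 * \<kappa>)"
  using mult_left_mono[OF t, of "\<bar>\<theta>\<bar>"] by simp
 then have "\<bar>\<theta>\<bar> \<le> 32 * \<kappa> / (\<rho>\<^sup>2 * H')" using \<rho> H' by (simp add: field_simps power2_eq_square)
 also have "\<dots> \<le> 64 * \<kappa> / (\<rho>\<^sup>2 * H')" using \<rho> H' \<kappa> by (intro divide_right_mono) auto
 finally have "near (64 * \<kappa> / (\<rho>\<^sup>2 * H')) (q * \<beta>)" unfolding near_def \<theta>_def by blast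
 moreover have "q \<le> 8 / \<rho>" using q \<rho> by (simp add: field_simps)
 ultimately show ?thesis using q by blast
qed

text \<open>If m1 and m2 are integers within \<kappa> of h\<beta> and k\<beta>, then |h m2 - k m1|
  \<le> 2H\<kappa> < 1, hence h m2 = k m1. So m1/h is a fraction u/g with g = gcd h k, and scaling
  h\<beta> - m1 by g/h gives the error g\<kappa>/|h|.\<close>

lemma near_gcd:
 fixes h k H :: int and \<kappa> \<beta> :: real
 assumes "h \<noteq> 0" "\<bar>h\<bar> \<le> H" "\<bar>k\<bar> \<le> H" "near \<kappa> (h * \<beta>)" "near \<kappa> (k * \<beta>)" "2 * H * \<kappa> < (1::real)"
 shows "near (gcd h k * \<kappa> / \<bar>h\<bar>) (gcd h k * \<beta>)"
proof -
 obtain m1 where m1: "\<bar>h * \<beta> - of_int m1\<bar> \<le> \<kappa>" using assms(4) by (auto simp: near_def)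
 obtain m2 where m2: "\<bar>k * \<beta> - of_int m2\<bar> \<le> \<kappa>" using assms(5) by (auto simp: near_def)
 have \<kappa>: "0 \<le> \<kappa>" using m1 by linarith
 have "of_int (h * m2 - k * m1) = k * (h * \<beta> - of_int m1) - h * (k * \<beta> - of_int m2)"
  by (simp add: algebra_simps)
 then have "\<bar>real_of_int (h * m2 - k * m1)\<bar> \<le> \<bar>real_of_int k\<bar> * \<bar>h * \<beta> - of_int m1\<bar> + \<bar>real_of_int h\<bar> * \<bar>k * \<beta> - of_int m2\<bar>"
  by (metis abs_mult abs_triangle_ineq4)
 also have "\<dots> \<le> H * \<kappa> + H * \<kappa>"
  using assms(2,3) m1 m2 by (intro add_mono mult_mono) auto
 finally have "h * m2 = k * m1" using assms(6) by linarith
 define g where "g = gcd h k"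
 have g: "0 < g" using assms(1) by (simp add: g_def)
 obtain h' k' where hk: "h = g * h'" "k = g * k'" "coprime h' k'"
  unfolding g_def using gcd_coprime_exists[of h k] assms(1) by (metis gcd_eq_0_iff mult.commute)
 have "h' * m2 = k' * m1" using \<open>h * m2 = k * m1\<close> hk g by simp
 then have "h' dvd m1" using hk(3) by (metis coprime_dvd_mult_right_iff dvd_triv_left)
 then obtain u where u: "m1 = h' * u" by auto
 have "h' \<noteq> 0" using hk assms(1) by auto
 have "g * \<beta> - u = (g / h) * (h * \<beta> - m1)"
  using hk u g \<open>h' \<noteq> 0\<close> by (simp add: field_simps)
 then have "\<bar>g * \<beta> - u\<bar> = (g / \<bar>h\<bar>) * \<bar>h * \<beta> - m1\<bar>" using g by (simp add: abs_mult)
 also have "\<dots> \<le> (g / \<bar>h\<bar>) * \<kappa>" using m1 g by (intro mult_left_mono) auto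
 finally show ?thesis unfolding near_def g_def by (intro exI[of _ u]) simp
qed

text \<open>Major arcs for the frequencies \<theta>/n. The range is two-sided because differences of
  frequencies from {0..<n} are tested, and \<kappa> bounds the distance of q\<theta>/n, not of
  \<theta>/n, to the integers.\<close>

definition arcs :: "int \<Rightarrow> int \<Rightarrow> real \<Rightarrow> int set" where
 "arcs n Q \<kappa> = {\<theta>. \<bar>\<theta>\<bar> \<le> n \<and> (\<exists>q::int. 1 \<le> q \<and> q \<le> Q \<and> near \<kappa> (q * (\<theta> / n)))}"

lemma finite_arcs: "finite (arcs n Q \<kappa>)"
 by (rule finite_subset[of _ "{-n..n}"]) (auto simp: arcs_def)

text \<open>Union bound over q and the integer m near q\<theta>/n. Since |\<theta>| \<le> n, at most
  2Q + 3 values of m occur, and the solutions of |q\<theta> - mn| \<le> \<kappa>n span an interval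
  of length at most 2\<kappa>n. With \<kappa> of order M^-2 and n comparable to M^2 the count stays
  bounded by the parameters.\<close>

lemma card_arcs:
 assumes "0 < n" "1 \<le> Q" "0 \<le> \<kappa>" "\<kappa> \<le> 1"
 shows "real (card (arcs n Q \<kappa>)) \<le> Q * (2 * Q + 3) * (2 * \<kappa> * n + 1)"
proof -
 let ?I = "{1..Q} \<times> {-Q-1..Q+1}"
 let ?F = "\<lambda>(q, m). {\<theta>::int. \<bar>q * \<theta> - m * n\<bar> \<le> \<kappa> * n}"
 have sub: "arcs n Q \<kappa> \<subseteq> (\<Union>p\<in>?I. ?F p)"
 proof
  fix \<theta> assume th: "\<theta> \<in> arcs n Q \<kappa>"
  then obtain q m :: int where q: "q \<in> {1..Q}" and m: "\<bar>q * (\<theta> / n) - of_int m\<bar> \<le> \<kappa>"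
   by (auto simp: arcs_def near_def)
  have "\<bar>q * (\<theta> / n)\<bar> \<le> real_of_int Q * 1"
   using q th assms unfolding abs_mult by (intro mult_mono) (auto simp: arcs_def)
  then have "\<bar>real_of_int m\<bar> \<le> Q + 1" using m assms by linarith
  then have m': "m \<in> {-Q-1..Q+1}" by (auto simp: abs_le_iff)
  have "\<bar>q * \<theta> - m * n\<bar> = \<bar>q * (\<theta> / n) - m\<bar> * n"
  proof -
   have "(q * (\<theta> / n) - m) * n = q * \<theta> - m * n" using assms by (simp add: field_simps)
   then show ?thesis using assms by (metis abs_mult abs_of_pos of_int_0_less_iff of_int_abs of_int_diff of_int_mult)
  qed
  also have "\<dots> \<le> \<kappa> * n" using m assms by (intro mult_right_mono) auto
  finally show "\<theta> \<in> (\<Union>p\<in>?I. ?F p)" using q m' by (intro UN_I[of "(q, m)"]) auto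
 qed
 have F: "finite (?F p) \<and> real (card (?F p)) \<le> 2 * \<kappa> * n + 1" if "p \<in> ?I" for p
 proof -
  obtain q m where pq: "p = (q, m)" by (cases p)
  then have p: "p = (q, m)" "1 \<le> q" using that by auto
  let ?S = "?F p"
  have key: "y - x \<le> 2 * \<kappa> * n" if "x \<in> ?S" "y \<in> ?S" "x \<le> y" for x y
  proof -
   have "q * (y - x) \<le> 2 * \<kappa> * n" using that p by (simp add: algebra_simps)
   moreover have "real_of_int (y - x) \<le> q * (y - x)" using p that by (simp add: mult_le_cancel_right1)
   ultimately show ?thesis by linarith
  qed
  show ?thesis
  proof (cases "?S = {}")
   case True then show ?thesis using assms by (simp only: card.empty) simp
  next
   case False
   then obtain x0 where x0: "x0 \<in> ?S" by blast
   let ?k = "\<lfloor>2 * \<kappa> * n\<rfloor>"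
   have "\<bar>y - x0\<bar> \<le> ?k" if "y \<in> ?S" for y
    using key[OF x0 that] key[OF that x0] by (simp add: le_floor_iff abs_le_iff) linarith
   then have "?S \<subseteq> {x0 - ?k..x0 + ?k}" by (force simp: abs_le_iff)
   then have fin: "finite ?S" by (rule finite_subset) simp
   let ?x = "Min ?S" and ?y = "Max ?S"
   have mem: "?x \<in> ?S" "?y \<in> ?S" using fin False by (rule Min_in, rule Max_in)
   have "?S \<subseteq> {?x..?y}" using fin by auto
   then have "real (card ?S) \<le> real_of_int (?y - ?x) + 1"
    using Min_le[OF fin mem(2)] by (rule card_int_le_span)
   then show ?thesis using key[OF mem] Min_le[OF fin mem(2)] fin by linarith
  qed
 qed
 have "card (arcs n Q \<kappa>) \<le> card (\<Union>p\<in>?I. ?F p)"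
  using sub F by (intro card_mono) auto
 also have "\<dots> \<le> (\<Sum>p\<in>?I. card (?F p))" by (rule card_UN_le) simp
 finally have "real (card (arcs n Q \<kappa>)) \<le> (\<Sum>p\<in>?I. real (card (?F p)))"
  by (simp only: of_nat_sum[symmetric] of_nat_le_iff)
 also have "\<dots> \<le> (\<Sum>p\<in>?I. 2 * \<kappa> * n + 1)" using F by (intro sum_mono) blast
 also have "\<dots> = real (card ?I) * (2 * \<kappa> * n + 1)" by (simp only: sum_constant)
 also have "real (card ?I) = Q * (2 * Q + 3)"
  using assms by (simp add: card_cartesian_product)
 finally show ?thesis by simp
qed

text \<open>Weyl differencing: the squared modulus is a sum over h of geometric sums of frequency
  2h\<beta>, the linear term contributing only unimodular factors. For a positive proportion of h
  the geometric sum is comparable to D, so 2h\<beta> is within O(1/D) of an integer, and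
  Vinogradov's lemma sharpens this to an error of order D^-2 for one small multiple of
  \<beta>.\<close>

lemma weyl:
 fixes u v D :: int and \<beta> \<nu> \<mu> \<rho> :: real
 assumes vu: "u \<le> v" "v \<le> u + D" and big: "\<rho> * D \<le> norm (\<Sum>Z\<in>{u..<v}. ee (\<beta> * Z\<^sup>2 + \<nu> * Z + \<mu>))"
  and \<rho>: "0 < \<rho>" "\<rho> \<le> 1" and D: "16384 / \<rho> ^ 4 \<le> D"
 shows "\<exists>q::int. 1 \<le> q \<and> q \<le> 64 / \<rho>\<^sup>2 \<and> near (2 ^ 20 / (\<rho> ^ 8 * D\<^sup>2)) (q * \<beta>)"
proof -
 have Dpos: "0 < D" using D \<rho> by (smt (verit) divide_pos_pos of_int_le_0_iff zero_less_power)
 let ?p = "\<lambda>Z::int. \<beta> * Z\<^sup>2 + \<nu> * Z + \<mu>"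
 let ?V = "\<lambda>h::int. norm (\<Sum>Z\<in>{max u (u-h)..<min v (v-h)}. ee ((2 * h * \<beta>) * Z))"
 have "of_real ((norm (\<Sum>Z\<in>{u..<v}. ee (?p Z)))\<^sup>2) = (\<Sum>Z\<in>{u..<v}. \<Sum>Z'\<in>{u..<v}. cnj (ee (?p Z)) * ee (?p Z'))"
  by (subst complex_norm_square, subst mult.commute, simp only: cnj_sum sum_product)
 also have "\<dots> = (\<Sum>Z\<in>{u..<v}. \<Sum>h\<in>{u-Z..<v-Z}. cnj (ee (?p Z)) * ee (?p (Z + h)))"
 proof (rule sum.cong[OF refl])
  fix Z assume "Z \<in> {u..<v}"
  show "(\<Sum>Z'\<in>{u..<v}. cnj (ee (?p Z)) * ee (?p Z')) = (\<Sum>h\<in>{u-Z..<v-Z}. cnj (ee (?p Z)) * ee (?p (Z + h)))"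
   by (rule sum.reindex_bij_witness[of _ "\<lambda>h. Z + h" "\<lambda>Z'. Z' - Z"]) auto
 qed
 also have "\<dots> = (\<Sum>h\<in>{-D<..<D}. \<Sum>Z\<in>{max u (u-h)..<min v (v-h)}. cnj (ee (?p Z)) * ee (?p (Z + h)))"
  unfolding sum.Sigma[OF finite_atLeastLessThan_int ballI[OF finite_atLeastLessThan_int]]
   sum.Sigma[OF finite_greaterThanLessThan_int ballI[OF finite_atLeastLessThan_int]]
  by (rule sum.reindex_bij_witness[of _ "\<lambda>(h, Z). (Z, h)" "\<lambda>(Z, h). (h, Z)"]) (use vu in auto)
 also have "\<dots> = (\<Sum>h\<in>{-D<..<D}. (\<Sum>Z\<in>{max u (u-h)..<min v (v-h)}. ee ((2 * h * \<beta>) * Z)) * ee (\<beta> * h\<^sup>2 + \<nu> * h))"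
 proof (rule sum.cong[OF refl], unfold sum_distrib_right, rule sum.cong[OF refl])
  fix h Z :: int
  have "cnj (ee (?p Z)) * ee (?p (Z + h)) = ee (?p (Z + h) - ?p Z)" by (rule cnj_ee_mult)
  also have "?p (Z + h) - ?p Z = (2 * h * \<beta>) * Z + (\<beta> * h\<^sup>2 + \<nu> * h)"
   by (simp add: power2_eq_square algebra_simps)
  finally show "cnj (ee (?p Z)) * ee (?p (Z + h)) = ee ((2 * h * \<beta>) * Z) * ee (\<beta> * h\<^sup>2 + \<nu> * h)"
   by (simp only: ee_add)
 qed
 finally have E: "of_real ((norm (\<Sum>Z\<in>{u..<v}. ee (?p Z)))\<^sup>2) = (\<Sum>h\<in>{-D<..<D}. (\<Sum>Z\<in>{max u (u-h)..<min v (v-h)}. ee ((2 * h * \<beta>) * Z)) * ee (\<beta> * h\<^sup>2 + \<nu> * h))"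
  (is "_ = ?X") .
 have "(norm (\<Sum>Z\<in>{u..<v}. ee (?p Z)))\<^sup>2 = norm ?X"
  unfolding E[symmetric] norm_of_real by (rule abs_power2[symmetric])
 also have "\<dots> \<le> (\<Sum>h\<in>{-D<..<D}. ?V h)"
  by (rule order_trans[OF norm_sum]) (simp add: norm_mult)
 finally have "(norm (\<Sum>Z\<in>{u..<v}. ee (?p Z)))\<^sup>2 \<le> (\<Sum>h\<in>{-D<..<D}. ?V h)" .
 moreover have "(\<rho> * D)\<^sup>2 \<le> (norm (\<Sum>Z\<in>{u..<v}. ee (?p Z)))\<^sup>2"
  using \<rho> Dpos big by (intro power_mono) auto
 ultimately have sq: "(\<rho> * D)\<^sup>2 \<le> (\<Sum>h\<in>{-D<..<D}. ?V h)" by linarith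
 have Vle: "?V h \<le> D" for h
 proof -
  have "?V h \<le> (\<Sum>Z\<in>{max u (u-h)..<min v (v-h)}. 1)" by (rule order_trans[OF norm_sum]) simp
  also have "\<dots> \<le> D" using vu by simp
  finally show ?thesis .
 qed
 define c where "c = \<rho>\<^sup>2 * D / 4"
 define S where "S = {h\<in>{-D<..<D}. c \<le> ?V h}"
 have c0: "0 < c" using \<rho> Dpos by (simp add: c_def)
 have "(\<Sum>h\<in>{-D<..<D}. ?V h) \<le> (\<Sum>h\<in>{-D<..<D}. (if c \<le> ?V h then real_of_int D else 0) + c)"
  using Vle c0 by (intro sum_mono) (auto intro: add_increasing2)
 also have "\<dots> = real (card S) * D + real (card {-D<..<D}) * c"
  by (simp add: sum.distrib sum.If_cases S_def Int_def)
 also have "\<dots> \<le> real (card S) * D + 2 * D * c"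
  using Dpos c0 by (intro add_left_mono mult_right_mono) auto
 finally have "\<rho>\<^sup>2 * D * D \<le> (real (card S) + 2 * c) * D"
  using sq by (simp add: power2_eq_square algebra_simps)
 then have "\<rho>\<^sup>2 * D \<le> real (card S) + 2 * c"
  by (rule mult_right_le_imp_le) (use Dpos in simp)
 then have cS: "2 * c \<le> card S" unfolding c_def by linarith
 define S1 where "S1 = {h\<in>{0..<D}. near (2 / c) (h * (2 * \<beta>) + 0)}"
 have Snear: "near (2 / c) (h * (2 * \<beta>))" if "h \<in> S" for h
 proof -
  have "c \<le> norm (\<Sum>Z\<in>{max u (u-h)..<min v (v-h)}. ee ((2 * h * \<beta>) * Z + 0))"
   using that by (simp add: S_def)
  from geom_near[OF this c0] show ?thesis by (simp add: mult_ac)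
 qed
 have SD: "- D < h \<and> h < D" if "h \<in> S" for h using that unfolding S_def by (simp only: mem_Collect_eq greaterThanLessThan_iff)
 have S1I: "h \<in> S1" if "0 \<le> h" "h < D" "near (2 / c) (h * (2 * \<beta>))" for h
  using that unfolding S1_def by simp
 have "S \<subseteq> S1 \<union> uminus ` S1"
 proof
  fix h assume h: "h \<in> S"
  show "h \<in> S1 \<union> uminus ` S1"
  proof (cases "0 \<le> h")
   case True then show ?thesis using S1I Snear[OF h] SD[OF h] by blast
  next
   case False
   have "near (2 / c) (real_of_int (- h) * (2 * \<beta>))" using near_minus[OF Snear[OF h]] by simp
   then have "- h \<in> S1" using False SD[OF h] by (intro S1I) auto
   then show ?thesis by (metis UnI2 image_eqI minus_minus)
  qed
 qed
 moreover have finS1: "finite S1" by (rule finite_subset[of _ "{0..<D}"]) (auto simp: S1_def)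
 ultimately have "card S \<le> card (S1 \<union> uminus ` S1)" by (intro card_mono) auto
 also have "\<dots> \<le> card S1 + card S1"
  by (rule order_trans[OF card_Un_le]) (simp add: card_image_le finS1)
 finally have S1c: "(\<rho>\<^sup>2 / 4) * D \<le> card S1" using cS unfolding c_def by linarith
 \<comment> \<open>With \<kappa> = 2/c = 8/(\<rho>^2 D) this length gives 4\<kappa>H' \<le> 1/2, and
   the lower bound on D makes (\<rho>^2/4) H' at least 32: the two requirements of Vinogradov's
   lemma.\<close>
 define H' where "H' = \<lfloor>\<rho>\<^sup>2 * D / 64\<rfloor>"
 have r4: "\<rho> ^ 4 = \<rho>\<^sup>2 * \<rho>\<^sup>2" by (simp only: power_add[symmetric]) simp
 have D': "16384 \<le> \<rho>\<^sup>2 * (\<rho>\<^sup>2 * D)"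
 proof -
  have "16384 \<le> \<rho> ^ 4 * D" using D \<rho> by (simp add: field_simps)
  then show ?thesis by (simp only: r4 mult.assoc)
 qed
 have r2: "\<rho>\<^sup>2 \<le> 1" "0 < \<rho>\<^sup>2" using \<rho> by (auto simp: power_le_one)
 have "\<rho>\<^sup>2 * (\<rho>\<^sup>2 * D) \<le> 1 * (\<rho>\<^sup>2 * D)" using r2 Dpos by (intro mult_right_mono) auto
 then have D'': "16384 \<le> \<rho>\<^sup>2 * D" using D' by linarith
 have H1: "\<rho>\<^sup>2 * D / 128 \<le> H'" "H' \<le> \<rho>\<^sup>2 * D / 64" using D'' unfolding H'_def by linarith+
 have H0: "0 < H'" using H1 D'' by linarith
 have "\<rho>\<^sup>2 * D \<le> 1 * real_of_int D" using r2 Dpos by (intro mult_right_mono) auto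
 then have v1: "H' \<le> D" using H1 Dpos by linarith
 have "4 * (2/c) * H' \<le> 4 * (2/c) * (\<rho>\<^sup>2 * D / 64)" using H1 c0 by (intro mult_left_mono) auto
 also have "\<dots> < 1" using \<rho> Dpos by (simp add: c_def)
 finally have v2: "4 * (2/c) * H' < 1" .
 have v3: "32 \<le> \<rho>\<^sup>2 / 4 * H'"
  using D' mult_left_mono[OF H1(1), of "\<rho>\<^sup>2 / 4"] r2 by linarith
 have v4: "S1 \<subseteq> {0..<D}" unfolding S1_def by blast
 have v5: "near (2/c) (h * (2 * \<beta>) + 0)" if "h \<in> S1" for h using that unfolding S1_def by blast
 obtain q :: int where q: "1 \<le> q" "q \<le> 8 / (\<rho>\<^sup>2/4)" "near (64 * (2/c) / ((\<rho>\<^sup>2/4)\<^sup>2 * H')) (q * (2 * \<beta>))"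
  using vinogradov[OF v4 S1c _ _ H0 v1 v2 v3 _ v5] r2 c0 by auto
 have q2: "q \<le> 32 / \<rho>\<^sup>2" using q(2) by simp
 have "64 * (2/c) / ((\<rho>\<^sup>2/4)\<^sup>2 * H') \<le> 64 * (2/c) / ((\<rho>\<^sup>2/4)\<^sup>2 * (\<rho>\<^sup>2 * D / 128))"
  using H1 H0 r2 c0 Dpos by (intro divide_left_mono mult_left_mono mult_pos_pos) auto
 also have "\<dots> = 2 ^ 20 / (\<rho> ^ 8 * D\<^sup>2)"
  using \<rho> Dpos by (simp add: c_def field_simps eval_nat_numeral)
 finally have "near (2 ^ 20 / (\<rho> ^ 8 * D\<^sup>2)) (of_int (2 * q) * \<beta>)"
  using q(3) near_mono by (simp add: mult_ac)
 then show ?thesis using q(1) q2 by (intro exI[of _ "2 * q"]) auto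
qed

section \<open>PET induction\<close>

definition dl :: "int \<Rightarrow> (int \<Rightarrow> real) \<Rightarrow> int \<Rightarrow> real" where
 "dl \<tau> g y = g y * g (y + \<tau>)"

lemma dl_commute: "dl a (dl b g) = dl b (dl a g)"
 by (rule ext) (simp add: dl_def add_ac mult_ac)

lemma per_dl: "per n g \<Longrightarrow> per n (dl \<tau> g)"
 unfolding per_def dl_def
proof
 fix x assume g: "\<forall>x. g (x + n) = g x"
 have "x + n + \<tau> = (x + \<tau>) + n" by simp
 then show "g (x + n) * g (x + n + \<tau>) = g x * g (x + \<tau>)" using g by metis
qed

lemma dl_bound: "(\<And>y. \<bar>g y\<bar> \<le> 1) \<Longrightarrow> \<bar>dl \<tau> g y\<bar> \<le> 1"
 unfolding dl_def abs_mult by (metis abs_ge_zero mult_le_one)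

lemma per_comp_add: "per n g \<Longrightarrow> per n (\<lambda>y. g (y + a))"
 unfolding per_def
proof
 fix x assume g: "\<forall>x. g (x + n) = g x"
 have "x + n + a = (x + a) + n" by simp
 then show "g (x + n + a) = g (x + a)" using g by metis
qed

lemma per_mult: "per n f \<Longrightarrow> per n g \<Longrightarrow> per n (\<lambda>y. f y * g y)"
 by (simp add: per_def)

text \<open>The factor u does not depend on a. Once the average over a is innermost, Cauchy-Schwarz
  over z and y discards u at the price of doubling a.\<close>

lemma cs_step:
 fixes u :: "'z \<Rightarrow> 'y \<Rightarrow> real"
 assumes "\<And>z y. \<bar>u z y\<bar> \<le> 1"
 shows "(avg A (\<lambda>a. avg Z (\<lambda>z. avg Y (\<lambda>y. u z y * p a z y))))\<^sup>2
  \<le> avg A (\<lambda>a. avg A (\<lambda>a'. avg Z (\<lambda>z. avg Y (\<lambda>y. p a z y * p a' z y))))"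
proof -
 let ?P = "\<lambda>z y. avg A (\<lambda>a. p a z y)"
 have u2: "(u z y)\<^sup>2 \<le> 1" for z y
  using assms[of z y] by (simp add: abs_square_le_1)
 have "avg A (\<lambda>a. avg Z (\<lambda>z. avg Y (\<lambda>y. u z y * p a z y))) = avg Z (\<lambda>z. avg A (\<lambda>a. avg Y (\<lambda>y. u z y * p a z y)))"
  by (rule avg_swap)
 also have "\<dots> = avg Z (\<lambda>z. avg Y (\<lambda>y. avg A (\<lambda>a. u z y * p a z y)))"
  by (rule avg_cong, rule avg_swap)
 also have "\<dots> = avg Z (\<lambda>z. avg Y (\<lambda>y. u z y * ?P z y))" by (simp only: avg_cmult)
 finally have "(avg A (\<lambda>a. avg Z (\<lambda>z. avg Y (\<lambda>y. u z y * p a z y))))\<^sup>2 = (avg Z (\<lambda>z. avg Y (\<lambda>y. u z y * ?P z y)))\<^sup>2"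
  by simp
 also have "\<dots> \<le> avg Z (\<lambda>z. (avg Y (\<lambda>y. u z y * ?P z y))\<^sup>2)" by (rule avg_square)
 also have "\<dots> \<le> avg Z (\<lambda>z. avg Y (\<lambda>y. (u z y * ?P z y)\<^sup>2))" by (intro avg_mono avg_square)
 also have "\<dots> \<le> avg Z (\<lambda>z. avg Y (\<lambda>y. (?P z y)\<^sup>2))"
 proof (intro avg_mono)
  fix z y show "(u z y * ?P z y)\<^sup>2 \<le> (?P z y)\<^sup>2"
   using mult_right_mono[OF u2[of z y], of "(?P z y)\<^sup>2"] by (simp add: power_mult_distrib)
 qed
 also have "\<dots> = avg Z (\<lambda>z. avg Y (\<lambda>y. avg A (\<lambda>a. avg A (\<lambda>a'. p a z y * p a' z y))))"
  by (simp only: power2_eq_square avg_mult_avg)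
 also have "\<dots> = avg Z (\<lambda>z. avg A (\<lambda>a. avg Y (\<lambda>y. avg A (\<lambda>a'. p a z y * p a' z y))))"
  by (rule avg_cong, rule avg_swap)
 also have "\<dots> = avg Z (\<lambda>z. avg A (\<lambda>a. avg A (\<lambda>a'. avg Y (\<lambda>y. p a z y * p a' z y))))"
  by (rule avg_cong, rule avg_cong, rule avg_swap)
 also have "\<dots> = avg A (\<lambda>a. avg Z (\<lambda>z. avg A (\<lambda>a'. avg Y (\<lambda>y. p a z y * p a' z y))))"
  by (rule avg_swap)
 also have "\<dots> = avg A (\<lambda>a. avg A (\<lambda>a'. avg Z (\<lambda>z. avg Y (\<lambda>y. p a z y * p a' z y))))"
  by (rule avg_cong, rule avg_swap)
 finally show ?thesis .
qed

lemma avg_unit: "avg {()} f = f ()" by (simp add: avg_def)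

lemma avg_dl_shift:
 assumes "per n g"
 shows "avg {0..<n} (dl \<tau> (\<lambda>y. g (y + b))) = avg {0..<n} (dl \<tau> g)"
 using avg_shift[OF per_dl[OF assms], of \<tau> b] by (simp add: dl_def[abs_def] add_ac)

lemma abs_mult_le1: "\<bar>a\<bar> \<le> 1 \<Longrightarrow> \<bar>b\<bar> \<le> 1 \<Longrightarrow> \<bar>a * b :: real\<bar> \<le> 1"
 unfolding abs_mult by (metis abs_ge_zero mult_le_one)

lemma lin1:
 assumes g: "per n g" and u: "\<And>y. \<bar>u y\<bar> \<le> 1"
 shows "(avg C (\<lambda>c. avg {0..<n} (\<lambda>y. u y * g (y + \<tau> * c))))\<^sup>2
  \<le> avg C (\<lambda>c. avg C (\<lambda>c'. avg {0..<n} (dl (\<tau> * (c' - c)) g)))"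
proof -
 have "(avg C (\<lambda>c. avg {0..<n} (\<lambda>y. u y * g (y + \<tau> * c))))\<^sup>2
  \<le> avg C (\<lambda>c. avg C (\<lambda>c'. avg {0..<n} (\<lambda>y. g (y + \<tau> * c) * g (y + \<tau> * c'))))"
  using cs_step[of "\<lambda>z::unit. u" C "{()}" "{0..<n}" "\<lambda>c z y. g (y + \<tau> * c)"] u by (simp add: avg_unit)
 also have "\<dots> = avg C (\<lambda>c. avg C (\<lambda>c'. avg {0..<n} (dl (\<tau> * (c' - c)) g)))"
 proof (rule avg_cong, rule avg_cong)
  fix c c'
  show "avg {0..<n} (\<lambda>y. g (y + \<tau> * c) * g (y + \<tau> * c')) = avg {0..<n} (dl (\<tau> * (c' - c)) g)"
   using avg_shift[OF per_dl[OF g], of "\<tau> * (c' - c)" "\<tau> * c"] by (simp add: dl_def algebra_simps)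
 qed
 finally show ?thesis .
qed

text \<open>Each function to be removed consumes one layer. Cauchy-Schwarz in b removes u; the
  substitution y -> y - \<alpha>c makes the two copies of v independent of c, so that
  \<open>lin1\<close> in c removes them as well. The second derivative is along the gap \<tau> -
  \<alpha> of the two displacement coefficients.\<close>

lemma lin2:
 assumes g: "per n g" and v: "per n v" and u: "\<And>y. \<bar>u y\<bar> \<le> 1" and vb: "\<And>y. \<bar>v y\<bar> \<le> 1"
 shows "(avg B (\<lambda>b. avg C (\<lambda>c. avg {0..<n} (\<lambda>y. u y * (v (y + \<alpha> * (b + c)) * g (y + \<tau> * (b + c)))))))^4
  \<le> avg B (\<lambda>b. avg B (\<lambda>b'. avg C (\<lambda>c. avg C (\<lambda>c'. avg {0..<n} (dl ((\<tau> - \<alpha>) * (c' - c)) (dl (\<tau> * (b' - b)) g))))))"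
proof -
 let ?X = "avg B (\<lambda>b. avg C (\<lambda>c. avg {0..<n} (\<lambda>y. u y * (v (y + \<alpha> * (b + c)) * g (y + \<tau> * (b + c))))))"
 let ?V = "\<lambda>b b' y. v (y + \<alpha> * b) * v (y + \<alpha> * b')"
 let ?G = "\<lambda>b b' y. dl (\<tau> * (b' - b)) g (y + \<tau> * b)"
 have "?X\<^sup>2 \<le> avg B (\<lambda>b. avg B (\<lambda>b'. avg C (\<lambda>c. avg {0..<n} (\<lambda>y. (v (y + \<alpha> * (b + c)) * g (y + \<tau> * (b + c))) * (v (y + \<alpha> * (b' + c)) * g (y + \<tau> * (b' + c)))))))"
  using cs_step[of "\<lambda>z. u" B C "{0..<n}" "\<lambda>b c y. v (y + \<alpha> * (b + c)) * g (y + \<tau> * (b + c))"] u by simp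
 also have "\<dots> = avg B (\<lambda>b. avg B (\<lambda>b'. avg C (\<lambda>c. avg {0..<n} (\<lambda>y. ?V b b' y * ?G b b' (y + (\<tau> - \<alpha>) * c)))))"
 proof (rule avg_cong, rule avg_cong, rule avg_cong)
  fix b b' c
  have p: "per n (\<lambda>y. ?V b b' y * ?G b b' (y + (\<tau> - \<alpha>) * c))"
   by (intro per_mult per_comp_add[OF v] per_comp_add[OF per_comp_add[OF per_dl[OF g]]])
  show "avg {0..<n} (\<lambda>y. (v (y + \<alpha> * (b + c)) * g (y + \<tau> * (b + c))) * (v (y + \<alpha> * (b' + c)) * g (y + \<tau> * (b' + c))))
   = avg {0..<n} (\<lambda>y. ?V b b' y * ?G b b' (y + (\<tau> - \<alpha>) * c))"
   unfolding avg_shift[OF p, of "\<alpha> * c", symmetric]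
   by (intro avg_cong) (simp add: dl_def algebra_simps)
 qed
 finally have X2: "?X\<^sup>2 \<le> \<dots>" .
 have "?X ^ 4 = (?X\<^sup>2)\<^sup>2" by simp
 also have "\<dots> \<le> (avg B (\<lambda>b. avg B (\<lambda>b'. avg C (\<lambda>c. avg {0..<n} (\<lambda>y. ?V b b' y * ?G b b' (y + (\<tau> - \<alpha>) * c))))))\<^sup>2"
  by (rule power_mono[OF X2]) simp
 also have "\<dots> \<le> avg B (\<lambda>b. avg B (\<lambda>b'. (avg C (\<lambda>c. avg {0..<n} (\<lambda>y. ?V b b' y * ?G b b' (y + (\<tau> - \<alpha>) * c))))\<^sup>2))"
  by (rule order_trans[OF avg_square], intro avg_mono avg_square)
 also have "\<dots> \<le> avg B (\<lambda>b. avg B (\<lambda>b'. avg C (\<lambda>c. avg C (\<lambda>c'. avg {0..<n} (dl ((\<tau> - \<alpha>) * (c' - c)) (?G b b'))))))"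
  by (intro avg_mono lin1 per_comp_add per_dl g abs_mult_le1 vb)
 also have "\<dots> = avg B (\<lambda>b. avg B (\<lambda>b'. avg C (\<lambda>c. avg C (\<lambda>c'. avg {0..<n} (dl ((\<tau> - \<alpha>) * (c' - c)) (dl (\<tau> * (b' - b)) g))))))"
  by (rule avg_cong, rule avg_cong, rule avg_cong, rule avg_cong, intro avg_dl_shift per_dl g)
 finally show ?thesis .
qed

text \<open>The same with three functions, removed in the order u, v, w by the layers a, b, c. What
  remains are derivatives of g along \<tau>, \<tau> - \<alpha> and \<tau> - \<beta>. The exponent is
  8 since each of the three steps squares.\<close>

lemma lin3:
 assumes g: "per n g" and v: "per n v" and w: "per n w"
  and u: "\<And>y. \<bar>u y\<bar> \<le> 1" and vb: "\<And>y. \<bar>v y\<bar> \<le> 1" and wb: "\<And>y. \<bar>w y\<bar> \<le> 1"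
 shows "(avg A (\<lambda>a. avg B (\<lambda>b. avg C (\<lambda>c. avg {0..<n} (\<lambda>y. u y * (v (y + \<alpha> * (a + b + c)) * (w (y + \<beta> * (a + b + c)) * g (y + \<tau> * (a + b + c)))))))))^8
  \<le> avg A (\<lambda>a. avg A (\<lambda>a'. avg B (\<lambda>b. avg B (\<lambda>b'. avg C (\<lambda>c. avg C (\<lambda>c'.
   avg {0..<n} (dl ((\<tau> - \<beta>) * (c' - c)) (dl ((\<tau> - \<alpha>) * (b' - b)) (dl (\<tau> * (a' - a)) g)))))))))"
proof -
 let ?X = "avg A (\<lambda>a. avg B (\<lambda>b. avg C (\<lambda>c. avg {0..<n} (\<lambda>y. u y * (v (y + \<alpha> * (a + b + c)) * (w (y + \<beta> * (a + b + c)) * g (y + \<tau> * (a + b + c))))))))"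
 let ?V = "\<lambda>a a' y. v (y + \<alpha> * a) * v (y + \<alpha> * a')"
 let ?W = "\<lambda>a a' y. w (y + \<beta> * a) * w (y + \<beta> * a')"
 let ?G = "\<lambda>a a' y. dl (\<tau> * (a' - a)) g (y + \<tau> * a)"
 let ?q = "\<lambda>a z y. v (y + \<alpha> * (a + fst z + snd z)) * (w (y + \<beta> * (a + fst z + snd z)) * g (y + \<tau> * (a + fst z + snd z)))"
 have "?X\<^sup>2 \<le> avg A (\<lambda>a. avg A (\<lambda>a'. avg (B \<times> C) (\<lambda>z. avg {0..<n} (\<lambda>y. ?q a z y * ?q a' z y))))"
  using cs_step[of "\<lambda>z. u" A "B \<times> C" "{0..<n}" ?q] u by (simp add: avg_Times)
 also have "\<dots> = avg A (\<lambda>a. avg A (\<lambda>a'. avg B (\<lambda>b. avg C (\<lambda>c. avg {0..<n} (\<lambda>y. ?V a a' y * (?W a a' (y + (\<beta> - \<alpha>) * (b + c)) * ?G a a' (y + (\<tau> - \<alpha>) * (b + c))))))))"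
  unfolding avg_Times
 proof (rule avg_cong, rule avg_cong, rule avg_cong, rule avg_cong)
  fix a a' b c
  have p: "per n (\<lambda>y. ?V a a' y * (?W a a' (y + (\<beta> - \<alpha>) * (b + c)) * ?G a a' (y + (\<tau> - \<alpha>) * (b + c))))"
   by (intro per_mult per_comp_add[OF v] per_comp_add[OF per_comp_add[OF w]] per_comp_add[OF per_comp_add[OF per_dl[OF g]]])
  show "avg {0..<n} (\<lambda>y. ?q a (b, c) y * ?q a' (b, c) y)
   = avg {0..<n} (\<lambda>y. ?V a a' y * (?W a a' (y + (\<beta> - \<alpha>) * (b + c)) * ?G a a' (y + (\<tau> - \<alpha>) * (b + c))))"
   unfolding avg_shift[OF p, of "\<alpha> * (b + c)", symmetric]
   by (intro avg_cong) (simp add: dl_def algebra_simps)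
 qed
 finally have X2: "?X\<^sup>2 \<le> \<dots>" .
 have "?X ^ 8 = (?X\<^sup>2) ^ 4" by simp
 also have "\<dots> \<le> (avg A (\<lambda>a. avg A (\<lambda>a'. avg B (\<lambda>b. avg C (\<lambda>c. avg {0..<n} (\<lambda>y. ?V a a' y * (?W a a' (y + (\<beta> - \<alpha>) * (b + c)) * ?G a a' (y + (\<tau> - \<alpha>) * (b + c)))))))))^4"
  by (rule power_mono[OF X2]) simp
 also have "\<dots> \<le> avg A (\<lambda>a. avg A (\<lambda>a'. (avg B (\<lambda>b. avg C (\<lambda>c. avg {0..<n} (\<lambda>y. ?V a a' y * (?W a a' (y + (\<beta> - \<alpha>) * (b + c)) * ?G a a' (y + (\<tau> - \<alpha>) * (b + c)))))))^4))"
  by (rule order_trans[OF avg_pow4], intro avg_mono avg_pow4)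
 also have "\<dots> \<le> avg A (\<lambda>a. avg A (\<lambda>a'. avg B (\<lambda>b. avg B (\<lambda>b'. avg C (\<lambda>c. avg C (\<lambda>c'.
   avg {0..<n} (dl ((\<tau> - \<alpha> - (\<beta> - \<alpha>)) * (c' - c)) (dl ((\<tau> - \<alpha>) * (b' - b)) (?G a a')))))))))"
  by (intro avg_mono lin2 per_mult per_comp_add per_dl g w abs_mult_le1 vb wb)
 also have "\<dots> = avg A (\<lambda>a. avg A (\<lambda>a'. avg B (\<lambda>b. avg B (\<lambda>b'. avg C (\<lambda>c. avg C (\<lambda>c'.
   avg {0..<n} (dl ((\<tau> - \<beta>) * (c' - c)) (dl ((\<tau> - \<alpha>) * (b' - b)) (dl (\<tau> * (a' - a)) g)))))))))"
 proof (rule avg_cong, rule avg_cong, rule avg_cong, rule avg_cong, rule avg_cong, rule avg_cong)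
  fix a a' b b' c c'
  have "dl ((\<tau> - \<alpha>) * (b' - b)) (?G a a') = (\<lambda>y. dl ((\<tau> - \<alpha>) * (b' - b)) (dl (\<tau> * (a' - a)) g) (y + \<tau> * a))"
   by (rule ext) (simp add: dl_def add_ac)
  then show "avg {0..<n} (dl ((\<tau> - \<alpha> - (\<beta> - \<alpha>)) * (c' - c)) (dl ((\<tau> - \<alpha>) * (b' - b)) (?G a a')))
   = avg {0..<n} (dl ((\<tau> - \<beta>) * (c' - c)) (dl ((\<tau> - \<alpha>) * (b' - b)) (dl (\<tau> * (a' - a)) g)))"
   using avg_dl_shift[OF per_dl[OF per_dl[OF g]], of "(\<tau> - \<beta>) * (c' - c)"] by simp
 qed
 finally show ?thesis .
qed

text \<open>The functions \<open>f\<^sub>0\<close> and \<open>f\<^sub>1\<close> are eliminated using one layer of the difference parameter each.\<close>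

lemma pet1:
 fixes f0 f1 f2 :: "int \<Rightarrow> int \<Rightarrow> real" and wv :: "'w \<Rightarrow> int"
 assumes b0: "\<And>x y. \<bar>f0 x y\<bar> \<le> 1" and b1: "\<And>x y. \<bar>f1 x y\<bar> \<le> 1"
  and p0: "per N f0" and p1: "per N f1" and p2: "per N f2" and q2: "\<And>x. per n (f2 x)" and q1: "\<And>x. per n (f1 x)"
 shows "(avg I (\<lambda>i. avg J (\<lambda>j. avg W (\<lambda>w. avg {0..<N} (\<lambda>x. avg {0..<n} (\<lambda>y.
    f0 x y * (f1 (x + \<gamma> * (i + j + wv w)) y * f2 x (y + (i + j + wv w)\<^sup>2))))))))^4
  \<le> avg I (\<lambda>i. avg I (\<lambda>i'. avg J (\<lambda>j. avg J (\<lambda>j'. avg W (\<lambda>w. avg {0..<N} (\<lambda>x. avg {0..<n} (\<lambda>y.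
    f2 x y * (f2 x (y + (2 * (i + j + wv w) * (i' - i) + (i' - i)\<^sup>2))
     * (f2 (x - \<gamma> * (j' - j)) (y + (2 * (i + j + wv w) * (j' - j) + (j' - j)\<^sup>2))
     * f2 (x - \<gamma> * (j' - j)) (y + (2 * (i + j + wv w) * (i' - i + (j' - j)) + (i' - i + (j' - j))\<^sup>2)))))))))))"
proof -
 let ?X = "avg I (\<lambda>i. avg J (\<lambda>j. avg W (\<lambda>w. avg {0..<N} (\<lambda>x. avg {0..<n} (\<lambda>y.
    f0 x y * (f1 (x + \<gamma> * (i + j + wv w)) y * f2 x (y + (i + j + wv w)\<^sup>2)))))))"
 let ?p = "\<lambda>i z y. f1 (snd (snd z) + \<gamma> * (i + fst z + wv (fst (snd z)))) y * f2 (snd (snd z)) (y + (i + fst z + wv (fst (snd z)))\<^sup>2)"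
 let ?u = "\<lambda>i i' x y. f1 x y * f1 (x + \<gamma> * (i' - i)) y"
 let ?r = "\<lambda>i i' j z y. f2 (snd z - \<gamma> * (i + j + wv (fst z))) (y + (i + j + wv (fst z))\<^sup>2)
   * f2 (snd z - \<gamma> * (i + j + wv (fst z))) (y + (i' + j + wv (fst z))\<^sup>2)"
 have perx: "per N (\<lambda>x. avg {0..<n} (\<lambda>y. F (f1 (x + a)) (f1 (x + b)) (f2 (x + c)) (f2 (x + d)) y))" for F a b c d
  using perD[OF p1] perD[OF p2] unfolding per_def by (simp add: add.assoc add.commute[of _ N] add.left_commute[of _ N])
 have "?X\<^sup>2 \<le> avg I (\<lambda>i. avg I (\<lambda>i'. avg (J \<times> (W \<times> {0..<N})) (\<lambda>z. avg {0..<n} (\<lambda>y. ?p i z y * ?p i' z y))))"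
  using cs_step[of "\<lambda>z. f0 (snd (snd z))" I "J \<times> (W \<times> {0..<N})" "{0..<n}" ?p] b0 by (simp add: avg_Times)
 also have "\<dots> = avg I (\<lambda>i. avg I (\<lambda>i'. avg J (\<lambda>j. avg (W \<times> {0..<N}) (\<lambda>z. avg {0..<n} (\<lambda>y. ?u i i' (snd z) y * ?r i i' j z y)))))"
  unfolding avg_Times
 proof (rule avg_cong, rule avg_cong, rule avg_cong, rule avg_cong)
  fix i i' j w
  \<comment> \<open>Substituting x -> x - \<gamma>d moves the displacement from f1 to f2. The copies
    of f1 then do not involve j and w, so the second Cauchy-Schwarz, in j, can discard them.\<close>
  let ?d = "i + j + wv w"
  let ?F = "\<lambda>g1 g2 g3 g4 y. (g1 y * g2 y) * (g3 (y + (i + j + wv w)\<^sup>2) * g4 (y + (i' + j + wv w)\<^sup>2))"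
  show "avg {0..<N} (\<lambda>x. avg {0..<n} (\<lambda>y. ?p i (j, w, x) y * ?p i' (j, w, x) y))
    = avg {0..<N} (\<lambda>x. avg {0..<n} (\<lambda>y. ?u i i' (snd (w, x)) y * ?r i i' j (w, x) y))"
   using avg_shift[OF perx[of ?F 0 "\<gamma> * (i' - i)" "- \<gamma> * ?d" "- \<gamma> * ?d"], of "\<gamma> * ?d"]
   by (simp add: algebra_simps)
 qed
 finally have X2: "?X\<^sup>2 \<le> \<dots>" .
 have "?X ^ 4 = (?X\<^sup>2)\<^sup>2" by simp
 also have "\<dots> \<le> (avg I (\<lambda>i. avg I (\<lambda>i'. avg J (\<lambda>j. avg (W \<times> {0..<N}) (\<lambda>z. avg {0..<n} (\<lambda>y. ?u i i' (snd z) y * ?r i i' j z y))))))\<^sup>2"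
  by (rule power_mono[OF X2]) simp
 also have "\<dots> \<le> avg I (\<lambda>i. avg I (\<lambda>i'. (avg J (\<lambda>j. avg (W \<times> {0..<N}) (\<lambda>z. avg {0..<n} (\<lambda>y. ?u i i' (snd z) y * ?r i i' j z y))))\<^sup>2))"
  by (rule order_trans[OF avg_square], intro avg_mono avg_square)
 also have "\<dots> \<le> avg I (\<lambda>i. avg I (\<lambda>i'. avg J (\<lambda>j. avg J (\<lambda>j'. avg (W \<times> {0..<N}) (\<lambda>z. avg {0..<n} (\<lambda>y. ?r i i' j z y * ?r i i' j' z y))))))"
  by (intro avg_mono cs_step abs_mult_le1 b1)
 also have "\<dots> = avg I (\<lambda>i. avg I (\<lambda>i'. avg J (\<lambda>j. avg J (\<lambda>j'. avg W (\<lambda>w. avg {0..<N} (\<lambda>x. avg {0..<n} (\<lambda>y.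
    f2 x y * (f2 x (y + (2 * (i + j + wv w) * (i' - i) + (i' - i)\<^sup>2))
     * (f2 (x - \<gamma> * (j' - j)) (y + (2 * (i + j + wv w) * (j' - j) + (j' - j)\<^sup>2))
     * f2 (x - \<gamma> * (j' - j)) (y + (2 * (i + j + wv w) * (i' - i + (j' - j)) + (i' - i + (j' - j))\<^sup>2)))))))))))"
  unfolding avg_Times
 proof (rule avg_cong, rule avg_cong, rule avg_cong, rule avg_cong, rule avg_cong)
  fix i i' j j' w
  define d where "d = i + j + wv w"
  define h where "h = i' - i"
  define k where "k = j' - j"
  let ?F = "\<lambda>g1 g2 g3 g4 y. (g3 (y + d\<^sup>2) * g3 (y + (d + h)\<^sup>2)) * (g4 (y + (d + k)\<^sup>2) * g4 (y + (d + h + k)\<^sup>2))"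
  have e: "i' + j + wv w = d + h" "i + j' + wv w = d + k" "i' + j' + wv w = d + h + k"
   by (auto simp: d_def h_def k_def)
  have "avg {0..<N} (\<lambda>x. avg {0..<n} (\<lambda>y. ?r i i' j (w, x) y * ?r i i' j' (w, x) y))
    = avg {0..<N} (\<lambda>x. avg {0..<n} (\<lambda>y. ?F (f1 x) (f1 x) (f2 (x - \<gamma> * d)) (f2 (x - \<gamma> * (d + k))) y))"
   unfolding fst_conv snd_conv e d_def[symmetric] by simp
  also have "\<dots> = avg {0..<N} (\<lambda>x. avg {0..<n} (\<lambda>y. ?F (f1 x) (f1 x) (f2 x) (f2 (x - \<gamma> * k)) y))"
   using avg_shift[OF perx[of ?F 0 0 "- \<gamma> * d" "- \<gamma> * (d + k)"], of "\<gamma> * d"]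
   by (simp add: algebra_simps)
  also have "\<dots> = avg {0..<N} (\<lambda>x. avg {0..<n} (\<lambda>y.
    f2 x y * (f2 x (y + (2 * d * h + h\<^sup>2)) * (f2 (x - \<gamma> * k) (y + (2 * d * k + k\<^sup>2)) * f2 (x - \<gamma> * k) (y + (2 * d * (h + k) + (h + k)\<^sup>2))))))"
  proof (rule avg_cong)
   fix x
   have p: "per n (\<lambda>y. f2 x y * (f2 x (y + (2 * d * h + h\<^sup>2)) * (f2 (x - \<gamma> * k) (y + (2 * d * k + k\<^sup>2)) * f2 (x - \<gamma> * k) (y + (2 * d * (h + k) + (h + k)\<^sup>2)))))"
    by (intro per_mult per_comp_add q2)
   \<comment> \<open>The common d^2 disappears by a shift of y, and the remaining displacements are
     linear in d, with coefficients 2h, 2k and 2(h + k).\<close>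
   have s: "(d + h)\<^sup>2 = d\<^sup>2 + (2 * d * h + h\<^sup>2)" "(d + k)\<^sup>2 = d\<^sup>2 + (2 * d * k + k\<^sup>2)"
    "(d + h + k)\<^sup>2 = d\<^sup>2 + (2 * d * (h + k) + (h + k)\<^sup>2)"
    by (auto simp: power2_eq_square algebra_simps)
   show "avg {0..<n} (\<lambda>y. ?F (f1 x) (f1 x) (f2 x) (f2 (x - \<gamma> * k)) y) = avg {0..<n} (\<lambda>y. f2 x y * (f2 x (y + (2 * d * h + h\<^sup>2)) * (f2 (x - \<gamma> * k) (y + (2 * d * k + k\<^sup>2)) * f2 (x - \<gamma> * k) (y + (2 * d * (h + k) + (h + k)\<^sup>2)))))"
    unfolding avg_shift[OF p, of "d\<^sup>2", symmetric] s
    by (intro avg_cong) (simp only: add.assoc mult.assoc)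
  qed
  finally show "avg {0..<N} (\<lambda>x. avg {0..<n} (\<lambda>y. ?r i i' j (w, x) y * ?r i i' j' (w, x) y))
   = avg {0..<N} (\<lambda>x. avg {0..<n} (\<lambda>y.
    f2 x y * (f2 x (y + (2 * (i + j + wv w) * (i' - i) + (i' - i)\<^sup>2))
     * (f2 (x - \<gamma> * (j' - j)) (y + (2 * (i + j + wv w) * (j' - j) + (j' - j)\<^sup>2))
     * f2 (x - \<gamma> * (j' - j)) (y + (2 * (i + j + wv w) * (i' - i + (j' - j)) + (i' - i + (j' - j))\<^sup>2))))))"
   by (simp only: d_def h_def k_def)
 qed
 finally show ?thesis .
qed

section \<open>Fourier analysis on cyclic groups\<close>

lemma avg_reindex: "inj_on f A \<Longrightarrow> avg (f ` A) g = avg A (\<lambda>a. g (f a))"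
 by (simp add: avg_def card_image sum.reindex)

lemma avg_dl3_shift:
 assumes "per n g"
 shows "avg {0..<n} (dl t1 (dl t2 (dl t3 (\<lambda>y. g (y + b))))) = avg {0..<n} (dl t1 (dl t2 (dl t3 g)))"
proof -
 have "dl t2 (dl t3 (\<lambda>y. g (y + b))) = (\<lambda>y. dl t2 (dl t3 g) (y + b))"
  by (rule ext) (simp add: dl_def add_ac)
 then show ?thesis using avg_dl_shift[OF per_dl[OF per_dl[OF assms]]] by simp
qed

text \<open>With h = i' - i and m = k(j' - j), \<open>pet1\<close> leaves displacements that are
  linear in a + b + c with coefficients 2h, 2m and 2(h + m). Taking the last factor as g in
  \<open>lin3\<close>, the derivatives are along 2(h + m) with a, along 2m with b and along 2h with
  c. The exponent 32 is 4 times 8.\<close>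

lemma pet:
 fixes f0 f1 f2 :: "int \<Rightarrow> int \<Rightarrow> real" and k s :: int
 assumes b0: "\<And>x y. \<bar>f0 x y\<bar> \<le> 1" and b1: "\<And>x y. \<bar>f1 x y\<bar> \<le> 1" and b2: "\<And>x y. \<bar>f2 x y\<bar> \<le> 1"
  and p0: "per N f0" and p1: "per N f1" and p2: "per N f2" and q2: "\<And>x. per n (f2 x)" and q1: "\<And>x. per n (f1 x)"
  and k: "1 \<le> k"
 shows "(avg I (\<lambda>i. avg J (\<lambda>j. avg A (\<lambda>a. avg B (\<lambda>b. avg C (\<lambda>c. avg {0..<N} (\<lambda>x. avg {0..<n} (\<lambda>y.
    f0 x y * (f1 (x + \<gamma> * (i + k * j + (a + b + c + s))) y * f2 x (y + (i + k * j + (a + b + c + s))\<^sup>2))))))))))^32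
  \<le> avg I (\<lambda>i. avg I (\<lambda>i'. avg J (\<lambda>j. avg J (\<lambda>j'. avg {0..<N} (\<lambda>x.
    avg A (\<lambda>a. avg A (\<lambda>a'. avg B (\<lambda>b. avg B (\<lambda>b'. avg C (\<lambda>c. avg C (\<lambda>c'. avg {0..<n}
     (dl (2 * (i' - i) * (c' - c)) (dl (2 * (k * (j' - j)) * (b' - b)) (dl (2 * (i' - i + k * (j' - j)) * (a' - a)) (f2 x)))))))))))))))"
  (is "?X ^ 32 \<le> ?R")
proof -
 let ?wv = "\<lambda>(a, b, c). a + b + c + s"
 let ?K = "(\<lambda>j. k * j) ` J"
 have inj: "inj_on (\<lambda>j. k * j) J" using k by (auto simp: inj_on_def)
 let ?D = "\<lambda>i j a b c. i + k * j + (a + b + c + s)"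
 let ?h = "\<lambda>i i'. i' - i" and ?m = "\<lambda>j j'. k * j' - k * j"
 let ?v = "\<lambda>i i' j x y. f2 x (y + (2 * (i + k * j + s) * ?h i i' + (?h i i')\<^sup>2))"
 let ?w = "\<lambda>i j j' x y. f2 (x - \<gamma> * ?m j j') (y + (2 * (i + k * j + s) * ?m j j' + (?m j j')\<^sup>2))"
 let ?g = "\<lambda>i i' j j' x y. f2 (x - \<gamma> * ?m j j') (y + (2 * (i + k * j + s) * (?h i i' + ?m j j') + (?h i i' + ?m j j')\<^sup>2))"
 let ?Y = "\<lambda>i i' j j' x. avg A (\<lambda>a. avg B (\<lambda>b. avg C (\<lambda>c. avg {0..<n} (\<lambda>y. f2 x y * (?v i i' j x (y + (2 * ?h i i') * (a + b + c)) *
   (?w i j j' x (y + (2 * ?m j j') * (a + b + c)) * ?g i i' j j' x (y + (2 * (?h i i' + ?m j j')) * (a + b + c))))))))"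
 have "?X ^ 4 \<le> avg I (\<lambda>i. avg I (\<lambda>i'. avg J (\<lambda>j. avg J (\<lambda>j'. avg A (\<lambda>a. avg B (\<lambda>b. avg C (\<lambda>c. avg {0..<N} (\<lambda>x. avg {0..<n} (\<lambda>y.
    f2 x y * (f2 x (y + (2 * ?D i j a b c * ?h i i' + (?h i i')\<^sup>2))
     * (f2 (x - \<gamma> * ?m j j') (y + (2 * ?D i j a b c * ?m j j' + (?m j j')\<^sup>2))
     * f2 (x - \<gamma> * ?m j j') (y + (2 * ?D i j a b c * (?h i i' + ?m j j') + (?h i i' + ?m j j')\<^sup>2)))))))))))))"
  using pet1[of f0 f1 N f2 n I ?K "A \<times> (B \<times> C)" \<gamma> ?wv, OF b0 b1 p0 p1 p2 q2 q1]
  by (simp only: avg_Times avg_reindex[OF inj] prod.case)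
 also have "\<dots> = avg I (\<lambda>i. avg I (\<lambda>i'. avg J (\<lambda>j. avg J (\<lambda>j'. avg {0..<N} (\<lambda>x. ?Y i i' j j' x)))))"
 proof (rule avg_cong, rule avg_cong, rule avg_cong, rule avg_cong)
  fix i i' j j'
  let ?P = "\<lambda>x a b c y. f2 x y * (f2 x (y + (2 * ?D i j a b c * ?h i i' + (?h i i')\<^sup>2))
     * (f2 (x - \<gamma> * ?m j j') (y + (2 * ?D i j a b c * ?m j j' + (?m j j')\<^sup>2))
     * f2 (x - \<gamma> * ?m j j') (y + (2 * ?D i j a b c * (?h i i' + ?m j j') + (?h i i' + ?m j j')\<^sup>2))))"
  have "avg A (\<lambda>a. avg B (\<lambda>b. avg C (\<lambda>c. avg {0..<N} (\<lambda>x. avg {0..<n} (?P x a b c)))))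
    = avg A (\<lambda>a. avg B (\<lambda>b. avg {0..<N} (\<lambda>x. avg C (\<lambda>c. avg {0..<n} (?P x a b c)))))"
   by (rule avg_cong, rule avg_cong, rule avg_swap)
  also have "\<dots> = avg A (\<lambda>a. avg {0..<N} (\<lambda>x. avg B (\<lambda>b. avg C (\<lambda>c. avg {0..<n} (?P x a b c)))))"
   by (rule avg_cong, rule avg_swap)
  also have "\<dots> = avg {0..<N} (\<lambda>x. avg A (\<lambda>a. avg B (\<lambda>b. avg C (\<lambda>c. avg {0..<n} (?P x a b c)))))"
   by (rule avg_swap)
  also have "\<dots> = avg {0..<N} (\<lambda>x. ?Y i i' j j' x)"
   by (rule avg_cong, rule avg_cong, rule avg_cong, rule avg_cong, rule avg_cong) (simp add: algebra_simps)
  finally show "avg A (\<lambda>a. avg B (\<lambda>b. avg C (\<lambda>c. avg {0..<N} (\<lambda>x. avg {0..<n} (?P x a b c))))) = avg {0..<N} (\<lambda>x. ?Y i i' j j' x)" .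
 qed
 finally have X4: "?X ^ 4 \<le> avg I (\<lambda>i. avg I (\<lambda>i'. avg J (\<lambda>j. avg J (\<lambda>j'. avg {0..<N} (\<lambda>x. ?Y i i' j j' x)))))" .
 have "?X ^ 32 = (?X ^ 4) ^ 8" by simp
 also have "\<dots> \<le> (avg I (\<lambda>i. avg I (\<lambda>i'. avg J (\<lambda>j. avg J (\<lambda>j'. avg {0..<N} (\<lambda>x. ?Y i i' j j' x)))))) ^ 8"
  by (rule power_mono[OF X4]) simp
 also have "\<dots> \<le> avg I (\<lambda>i. (avg I (\<lambda>i'. avg J (\<lambda>j. avg J (\<lambda>j'. avg {0..<N} (\<lambda>x. ?Y i i' j j' x))))) ^ 8)"
  by (rule avg_pow8)
 also have "\<dots> \<le> avg I (\<lambda>i. avg I (\<lambda>i'. (avg J (\<lambda>j. avg J (\<lambda>j'. avg {0..<N} (\<lambda>x. ?Y i i' j j' x)))) ^ 8))"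
  by (rule avg_mono, rule avg_pow8)
 also have "\<dots> \<le> avg I (\<lambda>i. avg I (\<lambda>i'. avg J (\<lambda>j. (avg J (\<lambda>j'. avg {0..<N} (\<lambda>x. ?Y i i' j j' x))) ^ 8)))"
  by (rule avg_mono, rule avg_mono, rule avg_pow8)
 also have "\<dots> \<le> avg I (\<lambda>i. avg I (\<lambda>i'. avg J (\<lambda>j. avg J (\<lambda>j'. (avg {0..<N} (\<lambda>x. ?Y i i' j j' x)) ^ 8))))"
  by (rule avg_mono, rule avg_mono, rule avg_mono, rule avg_pow8)
 also have "\<dots> \<le> avg I (\<lambda>i. avg I (\<lambda>i'. avg J (\<lambda>j. avg J (\<lambda>j'. avg {0..<N} (\<lambda>x. (?Y i i' j j' x) ^ 8)))))"
  by (rule avg_mono, rule avg_mono, rule avg_mono, rule avg_mono, rule avg_pow8)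
 also have "\<dots> \<le> avg I (\<lambda>i. avg I (\<lambda>i'. avg J (\<lambda>j. avg J (\<lambda>j'. avg {0..<N} (\<lambda>x. 
   avg A (\<lambda>a. avg A (\<lambda>a'. avg B (\<lambda>b. avg B (\<lambda>b'. avg C (\<lambda>c. avg C (\<lambda>c'.
   avg {0..<n} (dl ((2 * (?h i i' + ?m j j') - 2 * ?m j j') * (c' - c)) (dl ((2 * (?h i i' + ?m j j') - 2 * ?h i i') * (b' - b)) (dl ((2 * (?h i i' + ?m j j')) * (a' - a)) (?g i i' j j' x)))))))))))))))"
  by (rule avg_mono, rule avg_mono, rule avg_mono, rule avg_mono, rule avg_mono, rule lin3)
   (intro per_comp_add q2 b2)+
 also have "\<dots> = ?R"
 proof (rule avg_cong, rule avg_cong, rule avg_cong, rule avg_cong)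
  fix i i' j j'
  let ?Q = "\<lambda>x. avg A (\<lambda>a. avg A (\<lambda>a'. avg B (\<lambda>b. avg B (\<lambda>b'. avg C (\<lambda>c. avg C (\<lambda>c'. avg {0..<n}
     (dl (2 * (i' - i) * (c' - c)) (dl (2 * (k * (j' - j)) * (b' - b)) (dl (2 * (i' - i + k * (j' - j)) * (a' - a)) (f2 x))))))))))"
  have Q: "per N ?Q" using p2 unfolding per_def by simp
  have e: "2 * (?h i i' + ?m j j') - 2 * ?m j j' = 2 * (i' - i)" "2 * (?h i i' + ?m j j') - 2 * ?h i i' = 2 * (k * (j' - j))"
   "2 * (?h i i' + ?m j j') = 2 * (i' - i + k * (j' - j))" by (auto simp: algebra_simps)
  show "avg {0..<N} (\<lambda>x. avg A (\<lambda>a. avg A (\<lambda>a'. avg B (\<lambda>b. avg B (\<lambda>b'. avg C (\<lambda>c. avg C (\<lambda>c'.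
   avg {0..<n} (dl ((2 * (?h i i' + ?m j j') - 2 * ?m j j') * (c' - c)) (dl ((2 * (?h i i' + ?m j j') - 2 * ?h i i') * (b' - b)) (dl ((2 * (?h i i' + ?m j j')) * (a' - a)) (?g i i' j j' x)))))))))))
   = avg {0..<N} ?Q"
   unfolding avg_dl3_shift[OF q2] e(1) e(2) unfolding e(3)
   using avg_shift[OF Q, of "- (\<gamma> * ?m j j')"] by (simp only: add_uminus_conv_diff)
 qed
 finally show ?thesis .
qed

text \<open>The average autocorrelation is a mean of squares. Its positivity is what allows
  \<open>twisted_correlation\<close> to drop phases.\<close>

lemma avg_dl_pos:
 assumes "per n g"
 shows "avg C (\<lambda>c. avg C (\<lambda>c'. avg {0..<n} (dl (v * (c' - c)) g))) = avg {0..<n} (\<lambda>y. (avg C (\<lambda>c. g (y + v * c)))\<^sup>2)"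
proof -
 have "avg {0..<n} (\<lambda>y. (avg C (\<lambda>c. g (y + v * c)))\<^sup>2) = avg {0..<n} (\<lambda>y. avg C (\<lambda>c. avg C (\<lambda>c'. g (y + v * c) * g (y + v * c'))))"
  by (simp only: power2_eq_square avg_mult_avg)
 also have "\<dots> = avg C (\<lambda>c. avg {0..<n} (\<lambda>y. avg C (\<lambda>c'. g (y + v * c) * g (y + v * c'))))"
  by (rule avg_swap)
 also have "\<dots> = avg C (\<lambda>c. avg C (\<lambda>c'. avg {0..<n} (\<lambda>y. g (y + v * c) * g (y + v * c'))))"
  by (rule avg_cong, rule avg_swap)
 also have "\<dots> = avg C (\<lambda>c. avg C (\<lambda>c'. avg {0..<n} (dl (v * (c' - c)) g)))"
 proof (rule avg_cong, rule avg_cong)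
  fix c c'
  show "avg {0..<n} (\<lambda>y. g (y + v * c) * g (y + v * c')) = avg {0..<n} (dl (v * (c' - c)) g)"
   using avg_shift[OF per_dl[OF assms], of "v * (c' - c)" "v * c"] by (simp add: dl_def algebra_simps)
 qed
 finally show ?thesis by simp
qed

section \<open>Characters and Fourier coefficients on Z/n\<close>

definition ch :: "int \<Rightarrow> int \<Rightarrow> complex" where
 "ch n z = ee (of_int z / of_int n)"

lemma ch_add: "ch n (a + b) = ch n a * ch n b"
 by (simp add: ch_def ee_add add_divide_distrib)

lemma norm_ch [simp]: "norm (ch n a) = 1" by (simp add: ch_def)

lemma cnj_ch: "cnj (ch n a) = ch n (- a)" by (simp add: ch_def)

lemma cnj_ch_mult: "cnj (ch n a) * ch n b = ch n (b - a)"
 by (simp only: ch_def cnj_ee_mult of_int_diff diff_divide_distrib)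

lemma ch_0 [simp]: "ch n 0 = 1" by (simp add: ch_def)

lemma ch_period: "0 < n \<Longrightarrow> ch n (a + n * b) = ch n a"
proof -
 assume "0 < n"
 then have "real_of_int (a + n * b) / n = real_of_int a / n + real_of_int b" by (simp add: field_simps)
 then show ?thesis by (simp only: ch_def ee_add_int)
qed

definition ft :: "int \<Rightarrow> (int \<Rightarrow> real) \<Rightarrow> int \<Rightarrow> complex" where
 "ft n g \<xi> = avg {0..<n} (\<lambda>y. of_real (g y) * ch n (- (\<xi> * y)))"

lemma orthogonality:
 fixes z :: int
 assumes "0 < n"
 shows "(\<Sum>\<xi>\<in>{0..<n}. ch n (\<xi> * z)) = (if n dvd z then of_int n else 0)"
proof (cases "n dvd z")
 case True
 then obtain w where w: "z = n * w" by auto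
 have "ch n (\<xi> * z) = 1" for \<xi> :: int
  using ch_period[OF assms, of 0 "\<xi> * w"] by (simp add: w mult.left_commute)
 then show ?thesis using True assms by simp
next
 case False
 let ?\<alpha> = "real_of_int z / n"
 have ne: "ee ?\<alpha> \<noteq> 1"
 proof
  assume "ee ?\<alpha> = 1"
  define x where "x = ?\<alpha> - of_int (round ?\<alpha>)"
  have x: "\<bar>x\<bar> \<le> 1/2" using of_int_round_abs_le[of ?\<alpha>] by (simp add: x_def abs_minus_commute)
  have "ee x = ee ?\<alpha>" using ee_add_int[of ?\<alpha> "- round ?\<alpha>"] by (simp add: x_def)
  then have "x = 0" using ee_lower[OF x] \<open>ee ?\<alpha> = 1\<close> by simp
  then have "real_of_int z = real_of_int (n * round ?\<alpha>)" using assms by (simp add: x_def field_simps)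
  then have "z = n * round ?\<alpha>" by (simp only: of_int_eq_iff)
  then show False using False by (metis dvd_triv_left)
 qed
 have "(ee ?\<alpha> - 1) * (\<Sum>d\<in>{0..<n}. ee (?\<alpha> * d)) = ee (?\<alpha> * n) - ee (?\<alpha> * (0::int))"
  using assms by (intro geom_telescope) simp
 also have "\<dots> = 0" using assms by simp
 finally have "(\<Sum>d\<in>{0..<n}. ee (?\<alpha> * d)) = 0" using ne by simp
 then show ?thesis using False by (simp add: ch_def mult.commute)
qed

text \<open>The autocorrelation of g is the Fourier transform of its power spectrum. Expanding the
  squared coefficients and summing over \<xi>, orthogonality selects z = y + \<tau> modulo
  n.\<close>

lemma ft_dl:
 assumes "0 < n" "per n g"
 shows "of_real (avg {0..<n} (dl \<tau> g)) = (\<Sum>\<xi>\<in>{0..<n}. of_real ((norm (ft n g \<xi>))\<^sup>2) * ch n (\<xi> * \<tau>))"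
proof -
 have "(\<Sum>\<xi>\<in>{0..<n}. of_real ((norm (ft n g \<xi>))\<^sup>2) * ch n (\<xi> * \<tau>))
  = (\<Sum>\<xi>\<in>{0..<n}. avg {0..<n} (\<lambda>y. avg {0..<n} (\<lambda>z. of_real (g y * g z) * ch n (\<xi> * (y + \<tau> - z)))))"
 proof (rule sum.cong[OF refl])
  fix \<xi>
  have "of_real ((norm (ft n g \<xi>))\<^sup>2) = cnj (ft n g \<xi>) * ft n g \<xi>"
   by (subst complex_norm_square) (rule mult.commute)
  also have "\<dots> = avg {0..<n} (\<lambda>y. of_real (g y) * ch n (\<xi> * y)) * avg {0..<n} (\<lambda>z. of_real (g z) * ch n (- (\<xi> * z)))"
   unfolding ft_def by (simp add: avg_cnj[symmetric] cnj_ch)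
  also have "\<dots> = avg {0..<n} (\<lambda>y. avg {0..<n} (\<lambda>z. (of_real (g y) * ch n (\<xi> * y)) * (of_real (g z) * ch n (- (\<xi> * z)))))"
   by (rule avg_mult_avg)
  finally have "of_real ((norm (ft n g \<xi>))\<^sup>2) * ch n (\<xi> * \<tau>)
   = avg {0..<n} (\<lambda>y. avg {0..<n} (\<lambda>z. (of_real (g y) * ch n (\<xi> * y)) * (of_real (g z) * ch n (- (\<xi> * z))) * ch n (\<xi> * \<tau>)))"
   by (simp only: avg_multc)
  also have "\<dots> = avg {0..<n} (\<lambda>y. avg {0..<n} (\<lambda>z. of_real (g y * g z) * ch n (\<xi> * (y + \<tau> - z))))"
  proof (rule avg_cong, rule avg_cong)
   fix y z
   have "ch n (\<xi> * (y + \<tau> - z)) = ch n (\<xi> * y + (- (\<xi> * z)) + \<xi> * \<tau>)"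
    by (simp add: algebra_simps)
   then show "(of_real (g y) * ch n (\<xi> * y)) * (of_real (g z) * ch n (- (\<xi> * z))) * ch n (\<xi> * \<tau>) = of_real (g y * g z) * ch n (\<xi> * (y + \<tau> - z))"
    by (simp only: ch_add of_real_mult mult_ac)
  qed
  finally show "of_real ((norm (ft n g \<xi>))\<^sup>2) * ch n (\<xi> * \<tau>) = avg {0..<n} (\<lambda>y. avg {0..<n} (\<lambda>z. of_real (g y * g z) * ch n (\<xi> * (y + \<tau> - z))))" .
 qed
 also have "\<dots> = avg {0..<n} (\<lambda>y. \<Sum>\<xi>\<in>{0..<n}. avg {0..<n} (\<lambda>z. of_real (g y * g z) * ch n (\<xi> * (y + \<tau> - z))))"
  by (rule avg_sum[symmetric])
 also have "\<dots> = avg {0..<n} (\<lambda>y. avg {0..<n} (\<lambda>z. \<Sum>\<xi>\<in>{0..<n}. of_real (g y * g z) * ch n (\<xi> * (y + \<tau> - z))))"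
  by (rule avg_cong, rule avg_sum[symmetric])
 also have "\<dots> = avg {0..<n} (\<lambda>y. of_real (g y * g (y + \<tau>)))"
 proof (rule avg_cong)
  fix y
  let ?z = "(y + \<tau>) mod n"
  have z: "?z \<in> {0..<n}" using assms by simp
  have iff: "n dvd (y + \<tau> - z) \<longleftrightarrow> z = ?z" if "z \<in> {0..<n}" for z
   using that by (auto simp: mod_eq_dvd_iff[symmetric])
  have "avg {0..<n} (\<lambda>z. \<Sum>\<xi>\<in>{0..<n}. of_real (g y * g z) * ch n (\<xi> * (y + \<tau> - z)))
   = avg {0..<n} (\<lambda>z. if z = ?z then of_real (g y * g z) * of_int n else 0)"
  proof (rule avg_cong)
   fix z assume "z \<in> {0..<n}"
   then show "(\<Sum>\<xi>\<in>{0..<n}. of_real (g y * g z) * ch n (\<xi> * (y + \<tau> - z))) = (if z = ?z then of_real (g y * g z) * of_int n else (0::complex))"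
    using orthogonality[OF assms(1), of "y + \<tau> - z"] iff by (simp add: sum_distrib_left[symmetric])
  qed
  also have "\<dots> = of_real (g y * g ?z)"
   using z assms by (simp add: avg_def scaleR_conv_of_real sum.delta)
  finally show "avg {0..<n} (\<lambda>z. \<Sum>\<xi>\<in>{0..<n}. of_real (g y * g z) * ch n (\<xi> * (y + \<tau> - z))) = of_real (g y * g (y + \<tau>))"
   by (simp only: per_mod[OF assms(2)])
 qed
 finally show ?thesis by (simp only: avg_of_real dl_def[abs_def])
qed

lemma parseval:
 assumes "0 < n" "per n g"
 shows "(\<Sum>\<xi>\<in>{0..<n}. (norm (ft n g \<xi>))\<^sup>2) = avg {0..<n} (\<lambda>y. (g y)\<^sup>2)"
proof -
 have "of_real (\<Sum>\<xi>\<in>{0..<n}. (norm (ft n g \<xi>))\<^sup>2) = (of_real (avg {0..<n} (\<lambda>y. (g y)\<^sup>2)) :: complex)"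
  using ft_dl[OF assms, of 0] by (simp add: dl_def[abs_def] power2_eq_square)
 then show ?thesis by (simp only: of_real_eq_iff)
qed

lemma parseval_le:
 assumes "0 < n" "per n g" "\<And>y. \<bar>g y\<bar> \<le> 1"
 shows "(\<Sum>\<xi>\<in>{0..<n}. (norm (ft n g \<xi>))\<^sup>2) \<le> 1"
 unfolding parseval[OF assms(1,2)] using assms(3) by (intro avg_le) (auto simp: abs_square_le_1)

text \<open>A Fejer-type multiplier: averaging the shifts v(c' - c) over c, c' in C multiplies the
  Fourier coefficient at \<xi> by the weight at z = \<xi>v. Hence it lies in [0, 1], and it is large
  only if z/n is nearly integral when C is a long interval.\<close>

definition wt :: "int \<Rightarrow> int set \<Rightarrow> int \<Rightarrow> real" where
 "wt n C z = (norm (avg C (\<lambda>c. ch n (z * c))))\<^sup>2"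

lemma wt_nonneg: "0 \<le> wt n C z" by (simp add: wt_def)

lemma wt_le_1: "wt n C z \<le> 1"
 unfolding wt_def by (simp add: power_le_one norm_avg_bound)

lemma wt_conv: "of_real (wt n C z) = avg C (\<lambda>c. avg C (\<lambda>c'. ch n (z * (c' - c))))"
proof -
 have "of_real (wt n C z) = cnj (avg C (\<lambda>c. ch n (z * c))) * avg C (\<lambda>c. ch n (z * c))"
  unfolding wt_def by (subst complex_norm_square) (rule mult.commute)
 also have "\<dots> = avg C (\<lambda>c. avg C (\<lambda>c'. cnj (ch n (z * c)) * ch n (z * c')))"
  by (simp only: avg_cnj[symmetric] avg_mult_avg)
 also have "\<dots> = avg C (\<lambda>c. avg C (\<lambda>c'. ch n (z * (c' - c))))"
  by (simp only: cnj_ch_mult right_diff_distrib)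
 finally show ?thesis .
qed

lemma avg_dl_wt:
 assumes "0 < n" "per n g"
 shows "avg C (\<lambda>c. avg C (\<lambda>c'. avg {0..<n} (dl (v * (c' - c)) g)))
  = (\<Sum>\<xi>\<in>{0..<n}. (norm (ft n g \<xi>))\<^sup>2 * wt n C (\<xi> * v))" (is "?L = ?R")
proof -
 have "of_real ?L = avg C (\<lambda>c. avg C (\<lambda>c'. of_real (avg {0..<n} (dl (v * (c' - c)) g))))"
  by (simp only: avg_of_real)
 also have "\<dots> = avg C (\<lambda>c. avg C (\<lambda>c'. \<Sum>\<xi>\<in>{0..<n}. of_real ((norm (ft n g \<xi>))\<^sup>2) * ch n (\<xi> * (v * (c' - c)))))"
  by (simp only: ft_dl[OF assms])
 also have "\<dots> = (\<Sum>\<xi>\<in>{0..<n}. of_real ((norm (ft n g \<xi>))\<^sup>2) * of_real (wt n C (\<xi> * v)))"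
  by (simp only: avg_sum avg_cmult wt_conv) (simp add: mult.assoc)
 finally have "of_real ?L = (of_real ?R :: complex)" by simp
 then show ?thesis by (simp only: of_real_eq_iff)
qed

text \<open>On average over the derivatives, the energy at a frequency \<xi> is dominated by the
  energy at frequency 0. There the coefficient is the mean of the derivative, which
  \<open>ft_dl\<close> expresses through |ft g|^2; squaring produces pairs \<eta>, \<theta> and
  averaging over c, c' the weight at (\<theta> - \<eta>)v. The bound is uniform in \<xi>.\<close>

lemma twisted_correlation:
 assumes n: "0 < n" and g: "per n g"
 shows "avg C (\<lambda>c. avg C (\<lambda>c'. (norm (ft n (dl (v * (c' - c)) g) \<xi>))\<^sup>2))
  \<le> (\<Sum>\<eta>\<in>{0..<n}. (norm (ft n g \<eta>))\<^sup>2 * (\<Sum>\<theta>\<in>{0..<n}. (norm (ft n g \<theta>))\<^sup>2 * wt n C ((\<theta> - \<eta>) * v)))"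
proof -
 \<comment> \<open>The squared coefficient of h at \<xi> is a Fourier transform of the
   autocorrelation of h.\<close>
 have tw: "of_real ((norm (ft n h \<xi>))\<^sup>2) = avg {0..<n} (\<lambda>s. ch n (\<xi> * s) * of_real (avg {0..<n} (\<lambda>z. h (z + s) * h z)))"
  if h: "per n h" for h \<xi>
 proof -
  have p: "per n (\<lambda>y. of_real (h y) * ch n (\<xi> * y))"
   unfolding per_def
  proof
   fix y
   have "\<xi> * (y + n) = \<xi> * y + n * \<xi>" by (simp add: algebra_simps)
   then show "of_real (h (y + n)) * ch n (\<xi> * (y + n)) = of_real (h y) * ch n (\<xi> * y)"
    by (simp only: perD[OF h] ch_period[OF n])
  qed
  have "of_real ((norm (ft n h \<xi>))\<^sup>2) = avg {0..<n} (\<lambda>z. of_real (h z) * ch n (- (\<xi> * z))) * cnj (avg {0..<n} (\<lambda>y. of_real (h y) * ch n (- (\<xi> * y))))"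
   unfolding ft_def by (rule complex_norm_square)
  also have "\<dots> = avg {0..<n} (\<lambda>z. avg {0..<n} (\<lambda>y. (of_real (h z) * ch n (- (\<xi> * z))) * (of_real (h y) * ch n (\<xi> * y))))"
   by (simp add: avg_cnj[symmetric] avg_mult_avg cnj_ch)
  also have "\<dots> = avg {0..<n} (\<lambda>z. avg {0..<n} (\<lambda>s. (of_real (h z) * ch n (- (\<xi> * z))) * (of_real (h (s + z)) * ch n (\<xi> * (s + z)))))"
   by (rule avg_cong, unfold avg_cmult) (simp only: avg_shift[OF p])
  also have "\<dots> = avg {0..<n} (\<lambda>z. avg {0..<n} (\<lambda>s. ch n (\<xi> * s) * of_real (h (z + s) * h z)))"
  proof (rule avg_cong, rule avg_cong)
   fix z s
   have "ch n (\<xi> * s) = ch n (- (\<xi> * z) + \<xi> * (s + z))"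
    by (simp add: algebra_simps)
   then show "(of_real (h z) * ch n (- (\<xi> * z))) * (of_real (h (s + z)) * ch n (\<xi> * (s + z))) = ch n (\<xi> * s) * of_real (h (z + s) * h z)"
    by (simp only: ch_add of_real_mult mult_ac add.commute[of s z])
  qed
  also have "\<dots> = avg {0..<n} (\<lambda>s. avg {0..<n} (\<lambda>z. ch n (\<xi> * s) * of_real (h (z + s) * h z)))"
   by (rule avg_swap)
  also have "\<dots> = avg {0..<n} (\<lambda>s. ch n (\<xi> * s) * of_real (avg {0..<n} (\<lambda>z. h (z + s) * h z)))"
   by (simp only: avg_cmult avg_of_real)
  finally show ?thesis .
 qed
 have key: "of_real (avg C (\<lambda>c. avg C (\<lambda>c'. (norm (ft n (dl (v * (c' - c)) g) \<xi>))\<^sup>2)))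
   = avg {0..<n} (\<lambda>s. ch n (\<xi> * s) * of_real (avg C (\<lambda>c. avg C (\<lambda>c'. avg {0..<n} (dl (v * (c' - c)) (dl s g))))))" for \<xi>
 proof -
  have "of_real (avg C (\<lambda>c. avg C (\<lambda>c'. (norm (ft n (dl (v * (c' - c)) g) \<xi>))\<^sup>2)))
   = avg C (\<lambda>c. avg C (\<lambda>c'. avg {0..<n} (\<lambda>s. ch n (\<xi> * s) * of_real (avg {0..<n} (\<lambda>z. dl (v * (c' - c)) g (z + s) * dl (v * (c' - c)) g z)))))"
   by (simp only: tw[OF per_dl[OF g], symmetric] avg_of_real)
  also have "\<dots> = avg C (\<lambda>c. avg C (\<lambda>c'. avg {0..<n} (\<lambda>s. ch n (\<xi> * s) * of_real (avg {0..<n} (dl (v * (c' - c)) (dl s g))))))"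
   by (simp add: dl_def[abs_def] mult_ac add_ac)
  also have "\<dots> = avg C (\<lambda>c. avg {0..<n} (\<lambda>s. avg C (\<lambda>c'. ch n (\<xi> * s) * of_real (avg {0..<n} (dl (v * (c' - c)) (dl s g))))))"
   by (rule avg_cong, rule avg_swap)
  also have "\<dots> = avg {0..<n} (\<lambda>s. avg C (\<lambda>c. avg C (\<lambda>c'. ch n (\<xi> * s) * of_real (avg {0..<n} (dl (v * (c' - c)) (dl s g))))))"
   by (rule avg_swap)
  finally show ?thesis by (simp only: avg_cmult avg_of_real)
 qed
 \<comment> \<open>Derivatives commute, so the s-autocorrelation of the derivative along v(c' - c)
   is the mean of that derivative of \<open>dl s g\<close>. Averaged over c, c' it is nonnegative by
   \<open>avg_dl_pos\<close>, so removing the character of s can only increase the modulus.\<close>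
 have pos: "0 \<le> avg C (\<lambda>c. avg C (\<lambda>c'. avg {0..<n} (dl (v * (c' - c)) (dl s g))))" for s
  unfolding avg_dl_pos[OF per_dl[OF g]] by (intro avg_nonneg) auto
 have "avg C (\<lambda>c. avg C (\<lambda>c'. (norm (ft n (dl (v * (c' - c)) g) \<xi>))\<^sup>2))
   \<le> norm (of_real (avg C (\<lambda>c. avg C (\<lambda>c'. (norm (ft n (dl (v * (c' - c)) g) \<xi>))\<^sup>2))) :: complex)"
  by (simp only: norm_of_real abs_ge_self)
 also have "\<dots> \<le> avg {0..<n} (\<lambda>s. avg C (\<lambda>c. avg C (\<lambda>c'. avg {0..<n} (dl (v * (c' - c)) (dl s g)))))"
  unfolding key using pos by (intro order_trans[OF norm_avg_le] avg_mono) (simp add: norm_mult)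
 also have "\<dots> = avg C (\<lambda>c. avg C (\<lambda>c'. (norm (ft n (dl (v * (c' - c)) g) 0))\<^sup>2))"
 proof -
  have "of_real (avg C (\<lambda>c. avg C (\<lambda>c'. (norm (ft n (dl (v * (c' - c)) g) 0))\<^sup>2)))
   = (of_real (avg {0..<n} (\<lambda>s. avg C (\<lambda>c. avg C (\<lambda>c'. avg {0..<n} (dl (v * (c' - c)) (dl s g)))))) :: complex)"
   unfolding key by (simp add: avg_of_real)
  then show ?thesis by (simp only: of_real_eq_iff)
 qed
 also have "\<dots> = avg C (\<lambda>c. avg C (\<lambda>c'. (avg {0..<n} (dl (v * (c' - c)) g))\<^sup>2))"
  by (simp add: ft_def avg_of_real norm_power[symmetric] power2_abs)
 also have "\<dots> = (\<Sum>\<eta>\<in>{0..<n}. (norm (ft n g \<eta>))\<^sup>2 * (\<Sum>\<theta>\<in>{0..<n}. (norm (ft n g \<theta>))\<^sup>2 * wt n C ((\<theta> - \<eta>) * v)))" (is "?L = ?R")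
 proof -
  have sq: "of_real ((avg {0..<n} (dl t g))\<^sup>2) = (\<Sum>\<eta>\<in>{0..<n}. \<Sum>\<theta>\<in>{0..<n}. of_real ((norm (ft n g \<eta>))\<^sup>2 * (norm (ft n g \<theta>))\<^sup>2) * ch n ((\<theta> - \<eta>) * t))" for t
  proof -
   have "of_real ((avg {0..<n} (dl t g))\<^sup>2) = cnj (of_real (avg {0..<n} (dl t g))) * (of_real (avg {0..<n} (dl t g)) :: complex)"
    by (simp add: power2_eq_square)
   also have "\<dots> = (\<Sum>\<eta>\<in>{0..<n}. \<Sum>\<theta>\<in>{0..<n}. cnj (of_real ((norm (ft n g \<eta>))\<^sup>2) * ch n (\<eta> * t)) * (of_real ((norm (ft n g \<theta>))\<^sup>2) * ch n (\<theta> * t)))"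
    unfolding ft_dl[OF n g] cnj_sum sum_product ..
   also have "\<dots> = (\<Sum>\<eta>\<in>{0..<n}. \<Sum>\<theta>\<in>{0..<n}. of_real ((norm (ft n g \<eta>))\<^sup>2 * (norm (ft n g \<theta>))\<^sup>2) * ch n ((\<theta> - \<eta>) * t))"
   proof (rule sum.cong[OF refl], rule sum.cong[OF refl])
    fix \<eta> \<theta>
    have "ch n ((\<theta> - \<eta>) * t) = cnj (ch n (\<eta> * t)) * ch n (\<theta> * t)"
     unfolding cnj_ch_mult by (simp add: left_diff_distrib)
    then show "cnj (of_real ((norm (ft n g \<eta>))\<^sup>2) * ch n (\<eta> * t)) * (of_real ((norm (ft n g \<theta>))\<^sup>2) * ch n (\<theta> * t))
     = of_real ((norm (ft n g \<eta>))\<^sup>2 * (norm (ft n g \<theta>))\<^sup>2) * ch n ((\<theta> - \<eta>) * t)"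
     by (simp only: complex_cnj_mult complex_cnj_complex_of_real of_real_mult mult_ac)
   qed
   finally show ?thesis .
  qed
  have "of_real ?L = avg C (\<lambda>c. avg C (\<lambda>c'. \<Sum>\<eta>\<in>{0..<n}. \<Sum>\<theta>\<in>{0..<n}. of_real ((norm (ft n g \<eta>))\<^sup>2 * (norm (ft n g \<theta>))\<^sup>2) * ch n ((\<theta> - \<eta>) * (v * (c' - c)))))"
   by (simp only: sq[symmetric] avg_of_real)
  also have "\<dots> = (\<Sum>\<eta>\<in>{0..<n}. \<Sum>\<theta>\<in>{0..<n}. of_real ((norm (ft n g \<eta>))\<^sup>2 * (norm (ft n g \<theta>))\<^sup>2) * of_real (wt n C ((\<theta> - \<eta>) * v)))"
   by (simp only: avg_sum avg_cmult wt_conv) (simp add: mult.assoc)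
  also have "\<dots> = of_real ?R" by (simp add: sum_distrib_left mult.assoc)
  finally show ?thesis by (simp only: of_real_eq_iff)
 qed
 finally show ?thesis .
qed

section \<open>Quadratic phases are major arc\<close>

text \<open>A duality argument. Coefficients c X align the large averages; with Z = X + \<delta> the
  function b depends on Z and y only, and Cauchy-Schwarz in these variables removes it. What is left
  are sums over Z of differences of two phases, one for each pair X, X', while a enters only through
  its bound.\<close>

lemma weyl_pairs:
 fixes D :: int and a b :: "int \<Rightarrow> 'y \<Rightarrow> complex" and l be :: "int \<Rightarrow> real" and \<rho> :: real
 defines "ph \<equiv> \<lambda>X Z. l X * of_int (Z - X) + be X * of_int ((Z - X)\<^sup>2)"
 assumes S: "S \<subseteq> {0..<D}" and D: "0 < D" and \<rho>: "0 \<le> \<rho>"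
  and ab: "\<And>X y. norm (a X y) \<le> 1" "\<And>Z y. norm (b Z y) \<le> 1"
  and big: "\<And>X. X \<in> S \<Longrightarrow> \<rho> \<le> norm (avg Y (\<lambda>y. avg {0..<D} (\<lambda>\<delta>. a X y * b (X + \<delta>) y * ee (l X * of_int \<delta> + be X * of_int (\<delta>\<^sup>2)))))"
 shows "(\<rho> * card S)\<^sup>2 \<le> (2 / D) * (\<Sum>X\<in>S. \<Sum>X'\<in>S. norm (\<Sum>Z\<in>{max X X'..<min X X' + D}. ee (ph X' Z - ph X Z)))"
  (is "_ \<le> (2 / D) * ?W")
proof -
 have finS: "finite S" using S finite_subset by blast
 let ?V = "\<lambda>X. avg Y (\<lambda>y. avg {0..<D} (\<lambda>\<delta>. a X y * b (X + \<delta>) y * ee (l X * of_int \<delta> + be X * of_int (\<delta>\<^sup>2))))"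
 define c where "c X = cnj (sgn (?V X))" for X
 have c1: "norm (c X) \<le> 1" for X by (simp add: c_def norm_sgn)
 have cV: "c X * ?V X = of_real (norm (?V X))" for X
 proof (cases "?V X = 0")
  case False
  have "c X * ?V X = cnj (?V X) * ?V X / of_real (norm (?V X))"
   by (simp add: c_def sgn_eq)
  also have "cnj (?V X) * ?V X = of_real ((norm (?V X))\<^sup>2)"
   by (subst complex_norm_square) (rule mult.commute)
  finally show ?thesis using False by (simp add: power2_eq_square)
 qed (simp add: c_def)
 \<comment> \<open>T collects, for given Z and y, all X whose interval of length D contains Z. Since
   X lies in {0..<D}, the values Z < 2D suffice.\<close>
 define T where "T Z y = (\<Sum>X\<in>S. if X \<le> Z \<and> Z < X + D then c X * a X y * ee (ph X Z) else 0)" for Z y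
 have inner: "(\<Sum>X\<in>S. c X * avg {0..<D} (\<lambda>\<delta>. a X y * b (X + \<delta>) y * ee (l X * of_int \<delta> + be X * of_int (\<delta>\<^sup>2))))
   = (1 / of_int D) * (\<Sum>Z\<in>{0..<2*D}. b Z y * T Z y)" for y
 proof -
  have "c X * avg {0..<D} (\<lambda>\<delta>. a X y * b (X + \<delta>) y * ee (l X * of_int \<delta> + be X * of_int (\<delta>\<^sup>2)))
   = (1 / of_int D) * (\<Sum>Z\<in>{0..<2*D}. b Z y * (if X \<le> Z \<and> Z < X + D then c X * a X y * ee (ph X Z) else 0))" if "X \<in> S" for X
  proof -
   have X: "0 \<le> X" "X < D" using that S by auto
   have "(\<Sum>\<delta>\<in>{0..<D}. a X y * b (X + \<delta>) y * ee (l X * of_int \<delta> + be X * of_int (\<delta>\<^sup>2)))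
    = (\<Sum>Z\<in>{X..<X + D}. a X y * b Z y * ee (ph X Z))"
    by (rule sum.reindex_bij_witness[of _ "\<lambda>Z. Z - X" "\<lambda>\<delta>. X + \<delta>"]) (auto simp: ph_def)
   then have "c X * avg {0..<D} (\<lambda>\<delta>. a X y * b (X + \<delta>) y * ee (l X * of_int \<delta> + be X * of_int (\<delta>\<^sup>2)))
    = (1 / of_int D) * (\<Sum>Z\<in>{X..<X + D}. b Z y * (c X * a X y * ee (ph X Z)))"
    using D by (simp add: avg_def scaleR_conv_of_real sum_distrib_left mult_ac)
   also have "(\<Sum>Z\<in>{X..<X + D}. b Z y * (c X * a X y * ee (ph X Z)))
    = (\<Sum>Z\<in>{0..<2*D}. b Z y * (if X \<le> Z \<and> Z < X + D then c X * a X y * ee (ph X Z) else 0))"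
    using X by (intro sum.mono_neutral_cong_left) auto
   finally show ?thesis .
  qed
  then have "(\<Sum>X\<in>S. c X * avg {0..<D} (\<lambda>\<delta>. a X y * b (X + \<delta>) y * ee (l X * of_int \<delta> + be X * of_int (\<delta>\<^sup>2))))
   = (\<Sum>X\<in>S. (1 / of_int D) * (\<Sum>Z\<in>{0..<2*D}. b Z y * (if X \<le> Z \<and> Z < X + D then c X * a X y * ee (ph X Z) else 0)))"
   by (intro sum.cong) auto
  also have "\<dots> = (1 / of_int D) * (\<Sum>Z\<in>{0..<2*D}. b Z y * T Z y)"
   unfolding T_def sum_distrib_left by (rule sum.swap)
  finally show ?thesis .
 qed
 have Tsq: "(\<Sum>Z\<in>{0..<2*D}. (norm (T Z y))\<^sup>2) \<le> ?W" for y
 proof -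
  let ?t = "\<lambda>X Z. if X \<le> Z \<and> Z < X + D then c X * a X y * ee (ph X Z) else 0"
  have "of_real (\<Sum>Z\<in>{0..<2*D}. (norm (T Z y))\<^sup>2) = (\<Sum>Z\<in>{0..<2*D}. cnj (T Z y) * T Z y)"
   by (simp only: of_real_sum complex_norm_square mult.commute)
  also have "\<dots> = (\<Sum>Z\<in>{0..<2*D}. \<Sum>X\<in>S. \<Sum>X'\<in>S. cnj (?t X Z) * ?t X' Z)"
   unfolding T_def cnj_sum sum_product ..
  also have "\<dots> = (\<Sum>X\<in>S. \<Sum>Z\<in>{0..<2*D}. \<Sum>X'\<in>S. cnj (?t X Z) * ?t X' Z)"
   by (rule sum.swap)
  also have "\<dots> = (\<Sum>X\<in>S. \<Sum>X'\<in>S. \<Sum>Z\<in>{0..<2*D}. cnj (?t X Z) * ?t X' Z)"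
   by (rule sum.cong[OF refl], rule sum.swap)
  also have "\<dots> = (\<Sum>X\<in>S. \<Sum>X'\<in>S. (cnj (c X * a X y) * (c X' * a X' y)) * (\<Sum>Z\<in>{max X X'..<min X X' + D}. ee (ph X' Z - ph X Z)))"
  proof (rule sum.cong[OF refl], rule sum.cong[OF refl])
   fix X X' assume "X \<in> S" "X' \<in> S"
   then have X: "0 \<le> X" "X < D" "0 \<le> X'" "X' < D" using S by auto
   have "(\<Sum>Z\<in>{0..<2*D}. cnj (?t X Z) * ?t X' Z) = (\<Sum>Z\<in>{max X X'..<min X X' + D}. cnj (c X * a X y * ee (ph X Z)) * (c X' * a X' y * ee (ph X' Z)))"
    using X by (intro sum.mono_neutral_cong_right) auto
   also have "\<dots> = (\<Sum>Z\<in>{max X X'..<min X X' + D}. (cnj (c X * a X y) * (c X' * a X' y)) * ee (ph X' Z - ph X Z))"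
    by (rule sum.cong[OF refl]) (simp only: cnj_ee_mult[symmetric] complex_cnj_mult mult_ac)
   finally show "(\<Sum>Z\<in>{0..<2*D}. cnj (?t X Z) * ?t X' Z) = (cnj (c X * a X y) * (c X' * a X' y)) * (\<Sum>Z\<in>{max X X'..<min X X' + D}. ee (ph X' Z - ph X Z))"
    by (simp only: sum_distrib_left)
  qed
  finally have E: "of_real (\<Sum>Z\<in>{0..<2*D}. (norm (T Z y))\<^sup>2) = (\<Sum>X\<in>S. \<Sum>X'\<in>S. (cnj (c X * a X y) * (c X' * a X' y)) * (\<Sum>Z\<in>{max X X'..<min X X' + D}. ee (ph X' Z - ph X Z)))"
   (is "_ = ?E") .
  have "(\<Sum>Z\<in>{0..<2*D}. (norm (T Z y))\<^sup>2) \<le> norm ?E"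
   unfolding E[symmetric] norm_of_real by (rule abs_ge_self)
  also have "\<dots> \<le> ?W"
  proof (rule order_trans[OF norm_sum], rule sum_mono, rule order_trans[OF norm_sum], rule sum_mono)
   fix X X'
   have ca: "norm (c X * a X y) \<le> 1" for X
    using mult_mono[OF c1[of X] ab(1)[of X y]] by (simp add: norm_mult)
   have "norm (cnj (c X * a X y) * (c X' * a X' y)) \<le> 1"
    using mult_mono[OF ca[of X] ca[of X']] unfolding norm_mult complex_mod_cnj by simp
   then show "norm ((cnj (c X * a X y) * (c X' * a X' y)) * (\<Sum>Z\<in>{max X X'..<min X X' + D}. ee (ph X' Z - ph X Z)))
    \<le> norm (\<Sum>Z\<in>{max X X'..<min X X' + D}. ee (ph X' Z - ph X Z))"
    unfolding norm_mult[of "cnj (c X * a X y) * (c X' * a X' y)"] by (intro mult_left_le_one_le) auto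
  qed
  finally show ?thesis .
 qed
 have "\<rho> * card S \<le> (\<Sum>X\<in>S. norm (?V X))"
  using sum_mono[of S "\<lambda>_. \<rho>" "\<lambda>X. norm (?V X)"] big by (simp add: mult.commute)
 also have "\<dots> = norm (\<Sum>X\<in>S. c X * ?V X)"
  unfolding cV of_real_sum[symmetric] norm_of_real by (simp add: sum_nonneg)
 also have "(\<Sum>X\<in>S. c X * ?V X) = avg Y (\<lambda>y. (1 / of_int D) * (\<Sum>Z\<in>{0..<2*D}. b Z y * T Z y))"
 proof -
  have "(\<Sum>X\<in>S. c X * ?V X) = (\<Sum>X\<in>S. avg Y (\<lambda>y. c X * avg {0..<D} (\<lambda>\<delta>. a X y * b (X + \<delta>) y * ee (l X * of_int \<delta> + be X * of_int (\<delta>\<^sup>2)))))"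
   by (rule sum.cong[OF refl], rule avg_cmult[symmetric])
  also have "\<dots> = avg Y (\<lambda>y. \<Sum>X\<in>S. c X * avg {0..<D} (\<lambda>\<delta>. a X y * b (X + \<delta>) y * ee (l X * of_int \<delta> + be X * of_int (\<delta>\<^sup>2))))"
   by (rule avg_sum[symmetric])
  also have "\<dots> = avg Y (\<lambda>y. (1 / of_int D) * (\<Sum>Z\<in>{0..<2*D}. b Z y * T Z y))"
   by (rule avg_cong, rule inner)
  finally show ?thesis .
 qed
 finally have "(\<rho> * card S)\<^sup>2 \<le> (norm (avg Y (\<lambda>y. (1 / of_int D) * (\<Sum>Z\<in>{0..<2*D}. b Z y * T Z y))))\<^sup>2"
  using \<rho> by (intro power_mono) auto
 also have "\<dots> \<le> avg Y (\<lambda>y. (norm ((1 / of_int D) * (\<Sum>Z\<in>{0..<2*D}. b Z y * T Z y)))\<^sup>2)"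
  by (rule avg_norm_square)
 also have "\<dots> \<le> (2 / D) * ?W"
 proof (rule avg_le)
  fix y
  have "norm (\<Sum>Z\<in>{0..<2*D}. b Z y * T Z y) \<le> (\<Sum>Z\<in>{0..<2*D}. norm (T Z y))"
   using ab(2) by (intro order_trans[OF norm_sum] sum_mono) (simp add: norm_mult mult_left_le_one_le)
  then have "(norm (\<Sum>Z\<in>{0..<2*D}. b Z y * T Z y))\<^sup>2 \<le> (\<Sum>Z\<in>{0..<2*D}. norm (T Z y))\<^sup>2"
   by (intro power_mono) auto
  also have "\<dots> \<le> (\<Sum>Z\<in>{0..<2*D}. (norm (T Z y))\<^sup>2) * card {0..<2*D}"
   by (rule sum_squared_le_sum_of_squares)
  also have "\<dots> \<le> ?W * (2 * D)"
   using Tsq[of y] D by (intro mult_mono) (auto intro!: sum_nonneg)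
  finally have "(norm (\<Sum>Z\<in>{0..<2*D}. b Z y * T Z y))\<^sup>2 / D\<^sup>2 \<le> ?W * (2 * D) / D\<^sup>2"
   by (intro divide_right_mono) auto
  then show "(norm ((1 / of_int D) * (\<Sum>Z\<in>{0..<2*D}. b Z y * T Z y)))\<^sup>2 \<le> (2 / D) * ?W"
   using D by (simp add: norm_mult norm_divide power_mult_distrib power_divide power2_eq_square field_simps)
 next
  show "0 \<le> (2 / D) * ?W" using D by (intro mult_nonneg_nonneg sum_nonneg) auto
 qed
 finally show ?thesis .
qed

text \<open>An average choice of the first element X, then popularity in the second: every pair sum
  is at most D, so the sums that are at least \<rho>^2 D/4 make up a proportion \<rho>^2/4 of
  S.\<close>

lemma weyl_large_pairs:
 fixes D :: int and a b :: "int \<Rightarrow> 'y \<Rightarrow> complex" and l be :: "int \<Rightarrow> real" and \<rho> :: real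
 defines "ph \<equiv> \<lambda>X Z. l X * of_int (Z - X) + be X * of_int ((Z - X)\<^sup>2)"
 assumes S: "S \<subseteq> {0..<D}" "S \<noteq> {}" and D: "0 < D" and \<rho>: "0 \<le> \<rho>"
  and ab: "\<And>X y. norm (a X y) \<le> 1" "\<And>Z y. norm (b Z y) \<le> 1"
  and big: "\<And>X. X \<in> S \<Longrightarrow> \<rho> \<le> norm (avg Y (\<lambda>y. avg {0..<D} (\<lambda>\<delta>. a X y * b (X + \<delta>) y * ee (l X * of_int \<delta> + be X * of_int (\<delta>\<^sup>2)))))"
 shows "\<exists>X\<in>S. \<rho>\<^sup>2 / 4 * card S \<le> card {X'\<in>S. \<rho>\<^sup>2 / 4 * D \<le> norm (\<Sum>Z\<in>{max X X'..<min X X' + D}. ee (ph X' Z - ph X Z))}"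
proof -
 let ?w = "\<lambda>X X'. norm (\<Sum>Z\<in>{max X X'..<min X X' + D}. ee (ph X' Z - ph X Z))"
 have finS: "finite S" using S finite_subset by blast
 have cS: "0 < real (card S)" using finS S by (simp add: card_gt_0_iff)
 have w: "?w X X' \<le> D" for X X'
 proof -
  have "?w X X' \<le> (\<Sum>Z\<in>{max X X'..<min X X' + D}. 1)" by (rule order_trans[OF norm_sum]) simp
  also have "\<dots> \<le> D" using D by simp
  finally show ?thesis .
 qed
 have "(\<rho> * card S)\<^sup>2 \<le> (2 / D) * (\<Sum>X\<in>S. \<Sum>X'\<in>S. ?w X X')"
  unfolding ph_def by (rule weyl_pairs[OF S(1) D \<rho> ab big])
 then have "\<rho>\<^sup>2 * D / 2 * card S * card S \<le> (\<Sum>X\<in>S. \<Sum>X'\<in>S. ?w X X')"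
  using D by (simp add: field_simps power2_eq_square)
 moreover have "(\<Sum>X\<in>S. \<Sum>X'\<in>S. ?w X X') = card S * avg S (\<lambda>X. \<Sum>X'\<in>S. ?w X X')"
  using cS by (simp add: avg_def)
 ultimately have "card S * (\<rho>\<^sup>2 * D / 2 * card S) \<le> card S * avg S (\<lambda>X. \<Sum>X'\<in>S. ?w X X')"
  by (simp only: mult_ac)
 then have "\<rho>\<^sup>2 * D / 2 * card S \<le> avg S (\<lambda>X. \<Sum>X'\<in>S. ?w X X')"
  using cS by (simp only: mult_le_cancel_left_pos)
 then obtain X where X: "X \<in> S" "\<rho>\<^sup>2 * D / 2 * card S \<le> (\<Sum>X'\<in>S. ?w X X')"
  using avg_exists_ge[OF finS S(2), of "\<lambda>X. \<Sum>X'\<in>S. ?w X X'"] order_trans by blast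
 let ?c = "\<rho>\<^sup>2 / 4 * D"
 have "(\<Sum>X'\<in>S. ?w X X') \<le> (\<Sum>X'\<in>S. (if ?c \<le> ?w X X' then real_of_int D else 0) + ?c)"
  using w D by (intro sum_mono) (auto intro: add_increasing2)
 also have "\<dots> = D * real (card {X'\<in>S. ?c \<le> ?w X X'}) + ?c * card S"
  using finS by (simp add: sum.distrib sum.If_cases Int_def)
 finally have "D * (\<rho>\<^sup>2 / 4 * card S) \<le> D * real (card {X'\<in>S. ?c \<le> ?w X X'})"
  using X(2) by (simp add: algebra_simps)
 then have "\<rho>\<^sup>2 / 4 * card S \<le> real (card {X'\<in>S. ?c \<le> ?w X X'})"
  using D by (subst (asm) mult_le_cancel_left_pos) auto
 then show ?thesis using X(1) by blast
qed

definition maj :: "real \<Rightarrow> real \<Rightarrow> real \<Rightarrow> bool" where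
 "maj Q \<kappa> z \<longleftrightarrow> (\<exists>q::int. (1::int) \<le> q \<and> of_int q \<le> Q \<and> near \<kappa> (of_int q * z))"

text \<open>The phases arise from \<open>\<zeta> (e + Q\<^sub>1 \<delta>)\<^sup>2\<close>. The quadratic Weyl sums pin down \<open>Q\<^sub>1\<^sup>2 \<zeta>\<close> up to rationals, hence on a dense
 subset up to a tiny error; the linear terms are then linked to the quadratic ones by \<open>Q\<^sub>1 l = 2 e be\<close>,
 which forces the common value itself to be close to a rational.\<close>

lemma local_major:
 fixes D Q1 e :: int and a b :: "int \<Rightarrow> 'y \<Rightarrow> complex" and \<zeta> :: "int \<Rightarrow> real" and \<rho> K3 :: real
 defines "l \<equiv> \<lambda>X. 2 * e * Q1 * \<zeta> X" and "be \<equiv> \<lambda>X. Q1\<^sup>2 * \<zeta> X"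
 assumes S: "S \<subseteq> {0..<D}" "\<rho> * D \<le> card S" and D: "0 < D" and \<rho>: "0 < \<rho>" "\<rho> \<le> 1" and Q1: "1 \<le> Q1"
  and ab: "\<And>X y. norm (a X y) \<le> 1" "\<And>Z y. norm (b Z y) \<le> 1"
  and K3: "16 * Q1 / \<rho>\<^sup>2 + \<bar>e\<bar> / D \<le> K3" and DK: "2 ^ 78 * K3 / \<rho> ^ 31 \<le> D"
  and big: "\<And>X. X \<in> S \<Longrightarrow> \<rho> \<le> norm (avg Y (\<lambda>y. avg {0..<D} (\<lambda>\<delta>. a X y * b (X + \<delta>) y * ee (l X * of_int \<delta> + be X * of_int (\<delta>\<^sup>2)))))"
 shows "\<exists>X\<in>S. maj (2 ^ 73 / \<rho> ^ 31) (2 ^ 148 * K3\<^sup>2 / (\<rho> ^ 62 * of_int (D\<^sup>2))) (of_int (Q1 ^ 3) * \<zeta> X)"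
proof -
 have finS: "finite S" using S finite_subset by blast
 have \<rho>p: "0 < \<rho> ^ k" "\<rho> ^ k \<le> 1" for k using \<rho> by (auto simp: power_le_one)
 have Sne: "S \<noteq> {}" using S(2) D \<rho> by (metis card.empty mult_pos_pos not_le of_int_0_less_iff of_nat_0)
 define r where "r = 1 / \<rho>"
 have r: "1 \<le> r" using \<rho> by (simp add: r_def)
 have rp: "1 \<le> r ^ k" for k using r by (rule one_le_power)
 have rr: "c / \<rho> ^ k = c * r ^ k" for c k by (simp add: r_def power_divide)
 have K16: "16 \<le> K3"
 proof -
  have "16 * 1 \<le> 16 * (Q1 / \<rho>\<^sup>2)" using Q1 \<rho>p[of 2] by (intro mult_left_mono) (auto simp: le_divide_eq)
  moreover have "0 \<le> \<bar>e\<bar> / real_of_int D" using D by simp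
  ultimately show ?thesis using K3 by simp
 qed
 let ?ph = "\<lambda>X Z. l X * of_int (Z - X) + be X * of_int ((Z - X)\<^sup>2)"
 let ?w = "\<lambda>X X'. norm (\<Sum>Z\<in>{max X X'..<min X X' + D}. ee (?ph X' Z - ?ph X Z))"
 obtain X0 where X0: "X0 \<in> S" "\<rho>\<^sup>2 / 4 * card S \<le> card {X'\<in>S. \<rho>\<^sup>2 / 4 * D \<le> ?w X0 X'}"
  using weyl_large_pairs[OF S(1) Sne D less_imp_le[OF \<rho>(1)] ab big] by blast
 define S1 where "S1 = {X'\<in>S. \<rho>\<^sup>2 / 4 * D \<le> ?w X0 X'}"
 have S1: "S1 \<subseteq> S" "finite S1" using finS by (auto simp: S1_def)
 have D22: "2 ^ 22 / \<rho> ^ 8 \<le> D"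
 proof -
  have "2 ^ 22 * r ^ 8 \<le> (2 ^ 78 * K3) * r ^ 31"
   using r K16 by (intro mult_mono power_increasing) auto
  then show ?thesis using DK by (simp only: rr)
 qed
 have "\<exists>(q::int) (m::int). (1::int) \<le> q \<and> q \<le> 1024 / \<rho> ^ 4 \<and> \<bar>q * (be X - be X0) - m\<bar> \<le> 2 ^ 36 / (\<rho> ^ 16 * of_int (D\<^sup>2))" if X: "X \<in> S1" for X
 proof -
  have Xr: "0 \<le> X" "X < D" "0 \<le> X0" "X0 < D" using X X0 S S1 by auto
  have eq: "?ph X Z - ?ph X0 Z = (be X - be X0) * of_int (Z\<^sup>2) + (l X - l X0 - 2 * be X * X + 2 * be X0 * X0) * Z
    + (- (l X * X) + be X * X\<^sup>2 + l X0 * X0 - be X0 * X0\<^sup>2)" for Z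
   by (simp add: power2_eq_square algebra_simps)
  have w: "\<rho>\<^sup>2 / 4 * D \<le> norm (\<Sum>Z\<in>{max X0 X..<min X0 X + D}. ee ((be X - be X0) * of_int (Z\<^sup>2) + (l X - l X0 - 2 * be X * X + 2 * be X0 * X0) * Z
    + (- (l X * X) + be X * X\<^sup>2 + l X0 * X0 - be X0 * X0\<^sup>2)))"
  proof -
   have "\<rho>\<^sup>2 / 4 * D \<le> ?w X0 X" using X unfolding S1_def by blast
   then show ?thesis unfolding eq .
  qed
  have w1: "max X0 X \<le> min X0 X + D" "min X0 X + D \<le> max X0 X + D" using Xr by auto
  have w2: "16384 / (\<rho>\<^sup>2 / 4) ^ 4 \<le> D" using D22 by (simp add: power_divide power_mult[symmetric])
  have w3: "0 < \<rho>\<^sup>2 / 4" "\<rho>\<^sup>2 / 4 \<le> 1" using \<rho>p[of 2] by auto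
  obtain q :: int where q: "1 \<le> q" "q \<le> 64 / (\<rho>\<^sup>2 / 4)\<^sup>2" "near (2 ^ 20 / ((\<rho>\<^sup>2 / 4) ^ 8 * of_int (D\<^sup>2))) (q * (be X - be X0))"
   using weyl[OF w1 w w3 w2] by auto
  have "2 ^ 20 / ((\<rho>\<^sup>2 / 4) ^ 8 * of_int (D\<^sup>2)) = 2 ^ 36 / (\<rho> ^ 16 * of_int (D\<^sup>2))"
   using D \<rho> by (simp add: power_divide power_mult[symmetric])
  then have "near (2 ^ 36 / (\<rho> ^ 16 * of_int (D\<^sup>2))) (q * (be X - be X0))" using q(3) by simp
  moreover have "q \<le> 1024 / \<rho> ^ 4" using q(2) by (simp add: power_divide power_mult[symmetric])
  ultimately have "\<exists>m::int. (1::int) \<le> q \<and> q \<le> 1024 / \<rho> ^ 4 \<and> \<bar>q * (be X - be X0) - m\<bar> \<le> 2 ^ 36 / (\<rho> ^ 16 * of_int (D\<^sup>2))"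
   using q(1) by (auto simp: near_def)
  then show ?thesis by blast
 qed
 then have "\<forall>X\<in>S1. \<exists>(q::int) (m::int). (1::int) \<le> q \<and> q \<le> 1024 / \<rho> ^ 4 \<and> \<bar>q * (be X - be X0) - m\<bar> \<le> 2 ^ 36 / (\<rho> ^ 16 * of_int (D\<^sup>2))" by blast
 from bchoice[OF this] obtain q :: "int \<Rightarrow> int" where "\<forall>X\<in>S1. \<exists>m::int. (1::int) \<le> q X \<and> q X \<le> 1024 / \<rho> ^ 4 \<and> \<bar>q X * (be X - be X0) - m\<bar> \<le> 2 ^ 36 / (\<rho> ^ 16 * of_int (D\<^sup>2))"
  by blast
 from bchoice[OF this] obtain m :: "int \<Rightarrow> int" where qm': "\<forall>X\<in>S1. (1::int) \<le> q X \<and> q X \<le> 1024 / \<rho> ^ 4 \<and> \<bar>q X * (be X - be X0) - m X\<bar> \<le> 2 ^ 36 / (\<rho> ^ 16 * of_int (D\<^sup>2))"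
  by blast
 then have qm: "1 \<le> q X" "q X \<le> 1024 / \<rho> ^ 4" "\<bar>q X * (be X - be X0) - m X\<bar> \<le> 2 ^ 36 / (\<rho> ^ 16 * of_int (D\<^sup>2))" if "X \<in> S1" for X
  using that by auto
 define \<theta> where "\<theta> X = q X * (be X - be X0) - of_int (m X)" for X
 \<comment> \<open>Chosen so that a quadratic coefficient within 1/(D^2 Nb) of an integer changes
   each exponential by at most 8/Nb = \<rho>^2/8, half the size \<rho>^2/4 of a large pair sum per
   term.\<close>
 define Nb where "Nb = 64 / \<rho>\<^sup>2"
 have Nb: "1 \<le> Nb" using \<rho>p[of 2] by (simp add: Nb_def le_divide_eq)
 \<comment> \<open>The fibres record the denominator, the residue of the numerator and the rounded
   error. If they agree for X and X', then q(be X - be X') is a multiple of q up to 1/(D^2 Nb), so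
   be X - be X' itself is nearly an integer and the denominator has disappeared.\<close>
 define f where "f X = (q X, m X mod q X, \<lfloor>\<theta> X * (D\<^sup>2 * Nb)\<rfloor>)" for X
 define Qw where "Qw = \<lfloor>1024 / \<rho> ^ 4\<rfloor>"
 define V where "V = \<lceil>2 ^ 42 / \<rho> ^ 18\<rceil>"
 let ?B = "{1..Qw} \<times> ({0..<Qw} \<times> {-V..V})"
 have fB: "f ` S1 \<subseteq> ?B"
 proof
  fix z assume "z \<in> f ` S1"
  then obtain X where X: "X \<in> S1" "z = f X" by auto
  have q1: "1 \<le> q X" "q X \<le> Qw" using qm[OF X(1)] by (auto simp: Qw_def le_floor_iff)
  have m1: "0 \<le> m X mod q X" "m X mod q X < q X" using q1 by auto
  have "\<bar>\<theta> X * (D\<^sup>2 * Nb)\<bar> \<le> 2 ^ 36 / (\<rho> ^ 16 * D\<^sup>2) * (D\<^sup>2 * Nb)"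
   unfolding abs_mult \<theta>_def using qm[OF X(1)] Nb by (intro mult_mono) auto
  also have "\<dots> = 2 ^ 42 / \<rho> ^ 18"
   using D \<rho> by (simp add: Nb_def field_simps flip: power_add)
  finally have "\<bar>\<theta> X * (D\<^sup>2 * Nb)\<bar> \<le> 2 ^ 42 / \<rho> ^ 18" .
  then have "- V \<le> \<lfloor>\<theta> X * (D\<^sup>2 * Nb)\<rfloor>" "\<lfloor>\<theta> X * (D\<^sup>2 * Nb)\<rfloor> \<le> V"
   unfolding V_def by linarith+
  then show "z \<in> ?B" using X q1 m1 by (auto simp: f_def)
 qed
 have S1ne: "S1 \<noteq> {}"
 proof
  assume "S1 = {}"
  then have "\<rho>\<^sup>2 / 4 * card S \<le> 0" using X0(2) unfolding S1_def[symmetric] by simp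
  then show False using \<rho>p[of 2] finS Sne by (simp add: mult_le_0_iff card_gt_0_iff)
 qed
 then have "?B \<noteq> {}" using fB by blast
 then obtain bb where bb: "bb \<in> ?B" "real (card S1) \<le> real (card ?B) * real (card {X\<in>S1. f X = bb})"
  using pigeonhole_fibre[OF S1(2) fB] by auto
 define S2 where "S2 = {X\<in>S1. f X = bb}"
 have S2: "S2 \<subseteq> S1" "finite S2" using S1 by (auto simp: S2_def)
 have cB: "real (card ?B) \<le> 2 ^ 65 * r ^ 26"
 proof -
  have Q: "0 \<le> Qw" "real_of_int Qw \<le> 1024 * r ^ 4"
   using \<rho>p[of 4] rr[of 1024 4] unfolding Qw_def by (auto simp: zero_le_floor)
  have "real_of_int V \<le> 2 ^ 42 * r ^ 18 + 1" unfolding V_def rr by linarith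
  moreover have "1 \<le> r ^ 18" by (rule rp)
  ultimately have V2: "2 * real_of_int V + 1 \<le> 2 ^ 44 * r ^ 18" by simp
  have "2 ^ 42 / \<rho> ^ 18 \<le> real_of_int V" unfolding V_def by (rule le_of_int_ceiling)
  moreover have "0 \<le> 2 ^ 42 / \<rho> ^ 18" using \<rho>p[of 18] by simp
  ultimately have "0 \<le> real_of_int V" by linarith
  then have V: "0 \<le> V" by simp
  have "real (card ?B) = real_of_int Qw * (real_of_int Qw * (2 * real_of_int V + 1))"
   using Q V by (simp add: card_cartesian_product)
  also have "\<dots> \<le> (1024 * r ^ 4) * ((1024 * r ^ 4) * (2 ^ 44 * r ^ 18))"
   using Q V V2 r by (intro mult_mono) auto
  also have "\<dots> = 2 ^ 64 * r ^ 26" by (simp flip: power_add)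
  also have "\<dots> \<le> 2 ^ 65 * r ^ 26" using r by (intro mult_right_mono) auto
  finally show ?thesis .
 qed
 have be2: "\<exists>n::int. \<bar>be X - be X' - n\<bar> \<le> 1 / (D\<^sup>2 * Nb)" if X: "X \<in> S2" "X' \<in> S2" for X X'
 proof -
  have ff: "f X = f X'" using X by (simp add: S2_def)
  then have q: "q X' = q X" and mm: "m X mod q X = m X' mod q X" and fl: "\<lfloor>\<theta> X * (D\<^sup>2 * Nb)\<rfloor> = \<lfloor>\<theta> X' * (D\<^sup>2 * Nb)\<rfloor>"
   by (auto simp: f_def)
  obtain k where k: "m X - m X' = q X * k" using mm by (metis mod_eq_dvd_iff dvdE)
  have q1: "1 \<le> q X" using qm X S2 by blast
  have "\<bar>\<theta> X * (D\<^sup>2 * Nb) - \<theta> X' * (D\<^sup>2 * Nb)\<bar> \<le> 1" using fl by linarith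
  moreover have "\<bar>\<theta> X - \<theta> X'\<bar> * \<bar>D\<^sup>2 * Nb\<bar> = \<bar>\<theta> X * (D\<^sup>2 * Nb) - \<theta> X' * (D\<^sup>2 * Nb)\<bar>"
   by (simp only: abs_mult[symmetric] left_diff_distrib)
  ultimately have "\<bar>\<theta> X - \<theta> X'\<bar> * (D\<^sup>2 * Nb) \<le> 1" using Nb by simp
  then have t: "\<bar>\<theta> X - \<theta> X'\<bar> \<le> 1 / (D\<^sup>2 * Nb)" using D Nb by (simp add: field_simps)
  have "q X * (be X - be X' - k) = \<theta> X - \<theta> X'"
  proof -
   have "real_of_int (m X) - of_int (m X') = of_int (q X) * of_int k" using arg_cong[OF k, of real_of_int] by simp
   then show ?thesis unfolding \<theta>_def q by (simp add: algebra_simps)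
  qed
  then have "\<bar>q X * (be X - be X' - k)\<bar> \<le> 1 / (D\<^sup>2 * Nb)" using t by simp
  moreover have "1 * \<bar>be X - be X' - k\<bar> \<le> \<bar>q X * (be X - be X' - k)\<bar>"
   unfolding abs_mult using q1 by (intro mult_right_mono) auto
  ultimately have "\<bar>be X - be X' - k\<bar> \<le> 1 / (D\<^sup>2 * Nb)" unfolding mult_1 by (rule order_trans[rotated])
  then show ?thesis by blast
 qed
 have cS2: "\<rho>\<^sup>2 / 4 * card S \<le> 2 ^ 65 * r ^ 26 * card S2"
 proof -
  have "\<rho>\<^sup>2 / 4 * card S \<le> card S1" using X0(2) by (simp only: S1_def)
  also have "\<dots> \<le> real (card ?B) * real (card S2)" using bb(2) by (simp only: S2_def)
  also have "\<dots> \<le> 2 ^ 65 * r ^ 26 * card S2" using cB by (intro mult_right_mono) auto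
  finally show ?thesis .
 qed
 have S2ne: "S2 \<noteq> {}"
 proof
  assume "S2 = {}"
  then have "\<rho>\<^sup>2 / 4 * card S \<le> 0" using cS2 by simp
  then show False using \<rho>p[of 2] finS Sne by (simp add: mult_le_0_iff card_gt_0_iff)
 qed
 have S2D: "S2 \<subseteq> {0..<D}" using S S1 S2 by blast
 \<comment> \<open>A second round inside one fibre. The quadratic parts now agree modulo 1 up to a
   negligible error, so large pair sums are essentially geometric and give information on the linear
   coefficients.\<close>
 obtain Y0 where Y0: "Y0 \<in> S2" "\<rho>\<^sup>2 / 4 * card S2 \<le> card {X'\<in>S2. \<rho>\<^sup>2 / 4 * D \<le> ?w Y0 X'}"
  using weyl_large_pairs[OF S2D S2ne D less_imp_le[OF \<rho>(1)] ab big] S1 S2 by blast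
 define S3 where "S3 = {X'\<in>S2. \<rho>\<^sup>2 / 4 * D \<le> ?w Y0 X'}"
 define \<sigma> where "\<sigma> = \<rho> ^ 31 / 2 ^ 69"
 have \<sigma>0: "0 < \<sigma>" "\<sigma> \<le> 1" using \<rho>p[of 31] by (auto simp: \<sigma>_def)
 have cS3: "\<sigma> * D \<le> card S3"
 proof -
  have "\<rho>\<^sup>2 / 4 * (\<rho>\<^sup>2 / 4 * (\<rho> * D)) \<le> \<rho>\<^sup>2 / 4 * (\<rho>\<^sup>2 / 4 * card S)"
   using S(2) \<rho>p[of 2] by (intro mult_left_mono) auto
  also have "\<dots> \<le> \<rho>\<^sup>2 / 4 * (2 ^ 65 * r ^ 26 * card S2)" using cS2 \<rho>p[of 2] by (intro mult_left_mono) auto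
  also have "\<dots> = 2 ^ 65 * r ^ 26 * (\<rho>\<^sup>2 / 4 * card S2)" by simp
  also have "\<dots> \<le> 2 ^ 65 * r ^ 26 * card S3" using Y0(2) r unfolding S3_def by (intro mult_left_mono) auto
  finally have "\<rho> ^ 26 * (\<rho>\<^sup>2 / 4 * (\<rho>\<^sup>2 / 4 * (\<rho> * D))) \<le> \<rho> ^ 26 * (2 ^ 65 * r ^ 26 * card S3)"
   using \<rho>p[of 26] by (intro mult_left_mono) auto
  also have "\<dots> = 2 ^ 65 * card S3" using \<rho> by (simp add: r_def power_divide)
  also have "\<rho> ^ 26 * (\<rho>\<^sup>2 / 4 * (\<rho>\<^sup>2 / 4 * (\<rho> * D))) = (\<rho> ^ 26 * (\<rho>\<^sup>2 * (\<rho>\<^sup>2 * \<rho>))) * D / 16" by simp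
  also have "\<rho> ^ 26 * (\<rho>\<^sup>2 * (\<rho>\<^sup>2 * \<rho>)) = \<rho> ^ 31"
   by (simp only: power_add[symmetric] power_Suc2[symmetric]) simp
  finally show ?thesis unfolding \<sigma>_def by simp
 qed
 \<comment> \<open>By Q1 l = 2 e be, multiplying the linear coefficient by Q1 leaves -(X -
   Y0)\<beta> up to near-integers. The condition is linear in X with a slope that involves be Y0
   itself rather than a difference, which is what Vinogradov's lemma needs to place be Y0 on a major
   arc.\<close>
 let ?\<beta> = "2 * Q1 * be Y0"
 have lin: "near (K3 / D) (X * ?\<beta> + (- (Y0 * ?\<beta>)))" if X: "X \<in> S3" for X
 proof -
  have XS: "X \<in> S2" "\<rho>\<^sup>2 / 4 * D \<le> ?w Y0 X" using X by (auto simp: S3_def)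
  have Xr: "0 \<le> X" "X < D" "0 \<le> Y0" "Y0 < D" using XS Y0 S2D by auto
  obtain n :: int where n: "\<bar>be X - be Y0 - n\<bar> \<le> 1 / (D\<^sup>2 * Nb)" using be2[OF XS(1) Y0(1)] by blast
  define \<epsilon> where "\<epsilon> = be X - be Y0 - n"
  let ?L = "l X - l Y0 - 2 * be Y0 * (X - Y0)"
  let ?\<mu> = "- (l X * X) + l Y0 * Y0 + be Y0 * (X\<^sup>2 - Y0\<^sup>2)"
  have pt: "norm (ee (?ph X Z - ?ph Y0 Z) - ee (?L * Z + ?\<mu>)) \<le> \<rho>\<^sup>2 / 8" if Z: "Z \<in> {max Y0 X..<min Y0 X + D}" for Z
  proof -
   have "?ph X Z - ?ph Y0 Z = (?L * Z + ?\<mu> + \<epsilon> * of_int ((Z - X)\<^sup>2)) + of_int (n * (Z - X)\<^sup>2)"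
    by (simp add: \<epsilon>_def power2_eq_square algebra_simps)
   then have "ee (?ph X Z - ?ph Y0 Z) = ee (?L * Z + ?\<mu> + \<epsilon> * of_int ((Z - X)\<^sup>2))" by (simp only: ee_add_int)
   then have "norm (ee (?ph X Z - ?ph Y0 Z) - ee (?L * Z + ?\<mu>)) \<le> 8 * \<bar>\<epsilon> * of_int ((Z - X)\<^sup>2)\<bar>"
    using ee_dist[of "?L * Z + ?\<mu> + \<epsilon> * of_int ((Z - X)\<^sup>2)" "?L * Z + ?\<mu>"] by simp
   also have "\<bar>\<epsilon> * of_int ((Z - X)\<^sup>2)\<bar> \<le> (1 / (D\<^sup>2 * Nb)) * of_int (D\<^sup>2)"
   proof -
    have "(Z - X)\<^sup>2 \<le> D\<^sup>2" using Z Xr by (intro power_mono) auto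
    then have "\<bar>real_of_int ((Z - X)\<^sup>2)\<bar> \<le> of_int (D\<^sup>2)" by (simp only: of_int_le_iff of_int_abs[symmetric] abs_power2)
    then show ?thesis unfolding abs_mult using n Nb by (intro mult_mono) (auto simp: \<epsilon>_def)
   qed
   also have "8 * ((1 / (D\<^sup>2 * Nb)) * of_int (D\<^sup>2)) = \<rho>\<^sup>2 / 8" using D \<rho> by (simp add: Nb_def field_simps)
   finally show ?thesis by simp
  qed
  have "norm ((\<Sum>Z\<in>{max Y0 X..<min Y0 X + D}. ee (?ph X Z - ?ph Y0 Z)) - (\<Sum>Z\<in>{max Y0 X..<min Y0 X + D}. ee (?L * Z + ?\<mu>)))
   \<le> (\<Sum>Z\<in>{max Y0 X..<min Y0 X + D}. \<rho>\<^sup>2 / 8)"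
   unfolding sum_subtractf[symmetric] using pt by (intro order_trans[OF norm_sum] sum_mono)
  also have "\<dots> \<le> D * (\<rho>\<^sup>2 / 8)"
  proof -
   have "real (card {max Y0 X..<min Y0 X + D}) \<le> D" using D by simp
   then have "real (card {max Y0 X..<min Y0 X + D}) * (\<rho>\<^sup>2 / 8) \<le> D * (\<rho>\<^sup>2 / 8)"
    using \<rho>p[of 2] by (intro mult_right_mono) auto
   then show ?thesis by (simp only: sum_constant)
  qed
  finally have "norm (\<Sum>Z\<in>{max Y0 X..<min Y0 X + D}. ee (?ph X Z - ?ph Y0 Z)) - norm (\<Sum>Z\<in>{max Y0 X..<min Y0 X + D}. ee (?L * Z + ?\<mu>)) \<le> D * (\<rho>\<^sup>2 / 8)"
   by (rule order_trans[OF norm_triangle_ineq2])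
  then have "\<rho>\<^sup>2 / 8 * D \<le> norm (\<Sum>Z\<in>{max Y0 X..<min Y0 X + D}. ee (?L * Z + ?\<mu>))"
   using XS(2) by (simp add: mult.commute)
  then have "near (2 / (\<rho>\<^sup>2 / 8 * D)) ?L" using \<rho>p[of 2] D by (intro geom_near) auto
  then have "near (of_int \<bar>Q1\<bar> * (2 / (\<rho>\<^sup>2 / 8 * D))) (Q1 * ?L)" by (rule near_mult)
  moreover have "near (of_int \<bar>2 * e\<bar> * (1 / (D\<^sup>2 * Nb))) (of_int (2 * e) * (be X - be Y0))"
   by (rule near_mult) (use n in \<open>auto simp: near_def\<close>)
  ultimately have n1: "near (of_int \<bar>2 * e\<bar> * (1 / (D\<^sup>2 * Nb)) + of_int \<bar>Q1\<bar> * (2 / (\<rho>\<^sup>2 / 8 * D))) (of_int (2 * e) * (be X - be Y0) - Q1 * ?L)"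
   by (intro near_diff)
  have n2: "of_int (2 * e) * (be X - be Y0) - Q1 * ?L = X * ?\<beta> + (- (Y0 * ?\<beta>))"
   by (simp add: l_def be_def power2_eq_square algebra_simps)
  have n3: "of_int \<bar>2 * e\<bar> * (1 / (D\<^sup>2 * Nb)) + of_int \<bar>Q1\<bar> * (2 / (\<rho>\<^sup>2 / 8 * D)) \<le> K3 / D"
  proof -
   have "2 * \<bar>e\<bar> / (D * Nb) \<le> \<bar>e\<bar> / D"
   proof -
    have "64 \<le> Nb" using \<rho>p[of 2] by (simp add: Nb_def le_divide_eq)
    then have "2 * \<bar>real_of_int e\<bar> \<le> \<bar>real_of_int e\<bar> * Nb" using mult_left_mono[of 2 Nb "\<bar>real_of_int e\<bar>"] by simp
    then show ?thesis using D Nb by (simp add: field_simps)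
   qed
   then have "16 * Q1 / \<rho>\<^sup>2 + 2 * \<bar>e\<bar> / (D * Nb) \<le> K3" using K3 by linarith
   then have "(16 * Q1 / \<rho>\<^sup>2 + 2 * \<bar>e\<bar> / (D * Nb)) / D \<le> K3 / D" using D by (intro divide_right_mono) auto
   moreover have "of_int \<bar>2 * e\<bar> * (1 / (D\<^sup>2 * Nb)) + of_int \<bar>Q1\<bar> * (2 / (\<rho>\<^sup>2 / 8 * D)) = (16 * Q1 / \<rho>\<^sup>2 + 2 * \<bar>e\<bar> / (D * Nb)) / D"
   proof -
    have "of_int \<bar>2 * e\<bar> * (1 / (D\<^sup>2 * Nb)) = 2 * \<bar>e\<bar> / (D * Nb) / D"
     by (simp add: power2_eq_square abs_mult)
    moreover have "of_int \<bar>Q1\<bar> * (2 / (\<rho>\<^sup>2 / 8 * D)) = 16 * Q1 / \<rho>\<^sup>2 / D" using Q1 by simp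
    ultimately show ?thesis by (simp only: add_divide_distrib add.commute)
   qed
   ultimately show ?thesis by simp
  qed
  show ?thesis using near_mono[OF n1 n3] unfolding n2 .
 qed
 define H' where "H' = \<lfloor>D / (8 * K3)\<rfloor>"
 have DK': "512 * K3 \<le> \<sigma> * D"
 proof -
  have "2 ^ 78 * K3 * r ^ 31 \<le> D" using DK by (simp only: rr)
  then have "\<rho> ^ 31 * (2 ^ 78 * K3 * r ^ 31) \<le> \<rho> ^ 31 * D" using \<rho>p[of 31] by (intro mult_left_mono) auto
  moreover have "\<rho> ^ 31 * (2 ^ 78 * K3 * r ^ 31) = 2 ^ 78 * K3" using \<rho> by (simp add: r_def power_divide)
  ultimately have "2 ^ 78 * K3 \<le> \<rho> ^ 31 * D" by linarith
  then show ?thesis unfolding \<sigma>_def by simp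
 qed
 have "\<sigma> * D \<le> 1 * real_of_int D" using \<sigma>0 D by (intro mult_right_mono) auto
 then have Dbig: "512 \<le> D / K3" using DK' K16 by (simp add: le_divide_eq)
 have H': "D / (16 * K3) \<le> H'" "H' \<le> D / (8 * K3)"
 proof -
  have "D / (8 * K3) = (D / K3) / 8" "D / (16 * K3) = (D / K3) / 16" by simp_all
  then show "D / (16 * K3) \<le> H'" "H' \<le> D / (8 * K3)" using Dbig unfolding H'_def by linarith+
 qed
 have "0 < D / (16 * K3)" using K16 D by simp
 then have "0 < real_of_int H'" using H'(1) by linarith
 then have H'0: "0 < H'" by simp
 have v1: "H' \<le> D"
 proof -
  have "D / (8 * K3) \<le> D / 1" using K16 D by (intro divide_left_mono) auto
  then show ?thesis using H' by linarith
 qed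
 have v2: "4 * (K3 / D) * H' < 1"
 proof -
  have "4 * (K3 / D) * H' \<le> 4 * (K3 / D) * (D / (8 * K3))" using H' K16 D by (intro mult_left_mono) auto
  also have "\<dots> < 1" using K16 D by simp
  finally show ?thesis .
 qed
 have v3: "32 \<le> \<sigma> * H'"
 proof -
  have "32 \<le> \<sigma> * (D / (16 * K3))" using DK' K16 by (simp add: field_simps)
  also have "\<dots> \<le> \<sigma> * H'" using H' \<sigma>0 by (intro mult_left_mono) auto
  finally show ?thesis .
 qed
 have S3D: "S3 \<subseteq> {0..<D}" using S2D by (auto simp: S3_def)
 obtain p :: int where p: "1 \<le> p" "p \<le> 8 / \<sigma>" "near (64 * (K3 / D) / (\<sigma>\<^sup>2 * H')) (p * ?\<beta>)"
  using vinogradov[OF S3D cS3 \<sigma>0 H'0 v1 v2 v3 _ lin] K16 D by auto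
 have "64 * (K3 / D) / (\<sigma>\<^sup>2 * H') \<le> 64 * (K3 / D) / (\<sigma>\<^sup>2 * (D / (16 * K3)))"
  using H' H'0 K16 D \<sigma>0 by (intro divide_left_mono mult_left_mono mult_pos_pos) auto
 also have "\<dots> = 2 ^ 148 * K3\<^sup>2 / (\<rho> ^ 62 * of_int (D\<^sup>2))"
 proof -
  have s2: "\<sigma>\<^sup>2 = \<rho> ^ 62 / 2 ^ 138" by (simp add: \<sigma>_def power_divide power_mult[symmetric])
  show ?thesis unfolding s2 using K16 D \<rho>p[of 62] by (simp add: field_simps power2_eq_square)
 qed
 finally have "near (2 ^ 148 * K3\<^sup>2 / (\<rho> ^ 62 * of_int (D\<^sup>2))) (p * ?\<beta>)" using p(3) near_mono by blast
 \<comment> \<open>Here be Y0 = Q1^2 \<zeta> Y0, and one more factor Q1 came from the linear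
   coefficients: the origin of the cube.\<close>
 moreover have "p * ?\<beta> = of_int (2 * p) * (of_int (Q1 ^ 3) * \<zeta> Y0)"
  by (simp add: be_def power2_eq_square power3_eq_cube)
 ultimately have "near (2 ^ 148 * K3\<^sup>2 / (\<rho> ^ 62 * of_int (D\<^sup>2))) (of_int (2 * p) * (of_int (Q1 ^ 3) * \<zeta> Y0))"
  by (simp only:)
 moreover have "of_int (2 * p) \<le> 2 ^ 73 / \<rho> ^ 31" using p(2) by (simp add: \<sigma>_def field_simps)
 moreover have "(1::int) \<le> 2 * p" using p(1) by simp
 ultimately have "maj (2 ^ 73 / \<rho> ^ 31) (2 ^ 148 * K3\<^sup>2 / (\<rho> ^ 62 * of_int (D\<^sup>2))) (of_int (Q1 ^ 3) * \<zeta> Y0)"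
  unfolding maj_def by blast
 then show ?thesis using Y0 S1 S2 by blast
qed

lemma avg_interval_shift:
 fixes \<phi> :: "int \<Rightarrow> complex"
 assumes b: "\<And>c. norm (\<phi> c) \<le> 1" and M: "0 < M" and s: "0 \<le> s" "s \<le> M"
 shows "norm (avg {0..<M} \<phi> - avg {0..<M} (\<lambda>c. \<phi> (c + s))) \<le> 2 * s / M"
proof -
 have a: "(\<Sum>c\<in>{0..<M}. \<phi> (c + s)) = (\<Sum>c\<in>{s..<M + s}. \<phi> c)"
  by (rule sum.reindex_bij_witness[of _ "\<lambda>c. c - s" "\<lambda>c. c + s"]) auto
 have "{0..<M} = {0..<s} \<union> {s..<M}" "{s..<M+s} = {s..<M} \<union> {M..<M+s}" using s by auto
 then have "(\<Sum>c\<in>{0..<M}. \<phi> c) - (\<Sum>c\<in>{s..<M+s}. \<phi> c) = (\<Sum>c\<in>{0..<s}. \<phi> c) - (\<Sum>c\<in>{M..<M+s}. \<phi> c)"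
  using sum.union_disjoint[of "{0..<s}" "{s..<M}" \<phi>] sum.union_disjoint[of "{s..<M}" "{M..<M+s}" \<phi>] by auto
 also have "norm \<dots> \<le> (\<Sum>c\<in>{0..<s}. 1) + (\<Sum>c\<in>{M..<M+s}. 1)"
  using b by (intro order_trans[OF norm_triangle_ineq4] add_mono order_trans[OF norm_sum] sum_mono)
 also have "\<dots> = 2 * s" using s by simp
 finally have n: "norm ((\<Sum>c\<in>{0..<M}. \<phi> c) - (\<Sum>c\<in>{s..<M+s}. \<phi> c)) \<le> 2 * s" .
 have "avg {0..<M} \<phi> - avg {0..<M} (\<lambda>c. \<phi> (c + s)) = (1 / real_of_int M) *\<^sub>R ((\<Sum>c\<in>{0..<M}. \<phi> c) - (\<Sum>c\<in>{s..<M+s}. \<phi> c))"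
  using M unfolding avg_def a by (simp add: scaleR_diff_right)
 then show ?thesis using n M by (simp add: divide_right_mono)
qed

lemma avg_complex_exists:
 fixes f :: "'a \<Rightarrow> complex"
 assumes "finite S" "c \<le> norm (avg S f)" "0 < c"
 shows "\<exists>s\<in>S. c \<le> norm (f s)"
proof -
 have ne: "S \<noteq> {}" using assms by (auto simp: avg_def)
 obtain s where "s \<in> S" "avg S (\<lambda>s. norm (f s)) \<le> norm (f s)" using avg_exists_ge[OF assms(1) ne] by blast
 then show ?thesis using norm_avg_le[of S f] assms(2) by (intro bexI[of _ s]) auto
qed

lemma norm_mult_le1:
 fixes a b :: complex
 assumes "norm a \<le> 1" "norm b \<le> c" shows "norm (a * b) \<le> c"
proof -
 have "norm a * norm b \<le> 1 * norm b" using assms(1) by (intro mult_right_mono) auto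
 then show ?thesis using assms(2) by (simp add: norm_mult)
qed

text \<open>The difference parameter is split as \<open>e + Q\<^sub>1 \<delta>\<close> with \<open>\<delta>\<close> small: then \<open>g\<close> is essentially independent of \<open>\<delta>\<close>
 and can be absorbed into \<open>f\<^sub>0\<close>.\<close>

lemma major_arc:
 fixes f0 f1 g :: "int \<Rightarrow> int \<Rightarrow> complex" and \<zeta> :: "int \<Rightarrow> real" and dv :: "'w \<Rightarrow> int" and Y :: "int set"
  and \<Omega> :: "'w set" and N M D Q1 \<gamma> :: int and \<rho> K3 :: real
 defines "U \<equiv> \<lambda>x. norm (avg \<Omega> (\<lambda>\<omega>. avg {0..<M} (\<lambda>c. avg Y (\<lambda>y.
   f0 x y * f1 (x + \<gamma> * (dv \<omega> + c)) y * ee (\<zeta> x * of_int ((dv \<omega> + c)\<^sup>2)) * g x (y + (dv \<omega> + c)\<^sup>2)))))"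
  and "\<rho>1 \<equiv> \<rho>\<^sup>2 / 4"
 assumes N: "0 < N" and M: "0 < M" and D: "0 < D" and Q1: "1 \<le> Q1" and \<rho>: "0 < \<rho>" "\<rho> \<le> 1" and fin: "finite \<Omega>"
  and p0: "per N f0" and p1: "per N f1" and pg: "per N g" and pz: "per N \<zeta>"
  and b0: "\<And>x y. norm (f0 x y) \<le> 1" and b1: "\<And>x y. norm (f1 x y) \<le> 1" and bg: "\<And>x y. norm (g x y) \<le> 1"
  and dv: "\<And>\<omega> c. \<omega> \<in> \<Omega> \<Longrightarrow> 0 \<le> c \<Longrightarrow> c < M \<Longrightarrow> \<bar>dv \<omega> + c\<bar> \<le> 3 * M"
  and slow: "\<And>x y j. \<bar>j\<bar> \<le> 7 * M * D \<Longrightarrow> norm (g x (y + Q1 * j) - g x y) \<le> \<rho>\<^sup>2 / 4"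
  and QD: "8 * (Q1 * D) \<le> \<rho>\<^sup>2 * M"
  and K3: "16 * Q1 / \<rho>1\<^sup>2 + 3 * M / D \<le> K3" and DK: "2 ^ 78 * K3 / \<rho>1 ^ 31 \<le> D"
 shows "card {x\<in>{0..<N}. \<rho> \<le> U x \<and> \<not> maj (2 ^ 73 / \<rho>1 ^ 31) (2 ^ 148 * K3\<^sup>2 / (\<rho>1 ^ 62 * of_int (D\<^sup>2))) (of_int (Q1 ^ 3) * \<zeta> x)} \<le> \<rho> * N"
proof (rule ccontr)
 let ?maj = "\<lambda>z. maj (2 ^ 73 / \<rho>1 ^ 31) (2 ^ 148 * K3\<^sup>2 / (\<rho>1 ^ 62 * of_int (D\<^sup>2))) (of_int (Q1 ^ 3) * z)"
 let ?V = "\<lambda>x. avg \<Omega> (\<lambda>\<omega>. avg {0..<M} (\<lambda>c. avg Y (\<lambda>y.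
   f0 x y * f1 (x + \<gamma> * (dv \<omega> + c)) y * ee (\<zeta> x * of_int ((dv \<omega> + c)\<^sup>2)) * g x (y + (dv \<omega> + c)\<^sup>2))))"
 \<comment> \<open>B marks the exceptional x. If there were too many, their correlations would add
   up, and \<open>local_major\<close> would find one of them whose frequency is major after
   all.\<close>
 define B where "B x \<longleftrightarrow> \<rho> \<le> norm (?V x) \<and> \<not> ?maj (\<zeta> x)" for x
 assume "\<not> ?thesis"
 then have big: "\<rho> * N < card {x\<in>{0..<N}. B x}" by (simp add: B_def U_def)
 define c where "c x = (if B x then cnj (sgn (?V x)) else 0)" for x
 have c1: "norm (c x) \<le> 1" for x by (simp add: c_def norm_sgn)
 have shx: "x + N + a = (x + a) + N" for x a :: int by simp
 have perV: "?V (x + N) = ?V x" for x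
  by (simp only: perD[OF p0] perD[OF pg] perD[OF pz] shx perD[OF p1])
 have perB: "B (x + N) = B x" for x unfolding B_def perV by (simp only: perD[OF pz])
 have perc: "c (x + N) = c x" for x unfolding c_def perV perB ..
 have cV: "c x * ?V x = of_real (if B x then norm (?V x) else 0)" for x
 proof (cases "B x \<and> ?V x \<noteq> 0")
  case True
  have "cnj (?V x) * ?V x = of_real ((norm (?V x))\<^sup>2)"
   by (subst complex_norm_square) (rule mult.commute)
  then show ?thesis using True by (simp add: c_def sgn_eq power2_eq_square)
 qed (auto simp: c_def)
 define e where "e \<omega> cc = dv \<omega> + cc" for \<omega> cc
 let ?G = "\<lambda>x d \<delta>. avg Y (\<lambda>y. f0 x y * f1 (x + \<gamma> * (d + Q1 * \<delta>)) y * ee (\<zeta> x * of_int ((d + Q1 * \<delta>)\<^sup>2)) * g x (y + d\<^sup>2))"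
 let ?H = "\<lambda>x d. avg Y (\<lambda>y. f0 x y * f1 (x + \<gamma> * d) y * ee (\<zeta> x * of_int (d\<^sup>2)) * g x (y + d\<^sup>2))"
 let ?V' = "\<lambda>x. avg \<Omega> (\<lambda>\<omega>. avg {0..<M} (\<lambda>cc. avg {0..<D} (\<lambda>\<delta>. ?G x (e \<omega> cc) \<delta>)))"
 have b3: "norm (f0 x y * f1 x' y * ee z) \<le> 1" for x x' y z
  by (intro norm_mult_le1 b0 b1) simp
 have b4: "norm (f0 x y * f1 x' y * ee z * g x y') \<le> 1" for x x' y y' z
  by (rule norm_mult_le1[OF b3 bg])
 have bH: "norm (?H x d) \<le> 1" for x d by (rule norm_avg_bound[OF b4]) simp
 have QDM: "Q1 * D \<le> M"
 proof -
  have "\<rho>\<^sup>2 * M \<le> 1 * real_of_int M" using \<rho> M by (intro mult_right_mono) (auto simp: power_le_one)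
  then have "real_of_int (8 * (Q1 * D)) \<le> real_of_int M" using QD by simp
  moreover have "0 \<le> Q1 * D" using Q1 D by simp
  ultimately show ?thesis by linarith
 qed
 \<comment> \<open>Translating c by Q1 \<delta> costs little because Q1 D is small against M. Since
   (e + Q1 \<delta>)^2 - e^2 is Q1 times an integer of size at most 7MD, g may be frozen at y + e^2
   by \<open>slow\<close>, while f1 and the quadratic phase keep their dependence on
   \<delta>.\<close>
 have VV: "norm (?V x - ?V' x) \<le> \<rho>\<^sup>2 / 2" for x
 proof -
  have "norm (avg {0..<M} (\<lambda>cc. ?H x (e \<omega> cc)) - avg {0..<M} (\<lambda>cc. avg {0..<D} (\<lambda>\<delta>. ?G x (e \<omega> cc) \<delta>))) \<le> \<rho>\<^sup>2 / 2" if \<omega>: "\<omega> \<in> \<Omega>" for \<omega>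
  proof -
   have eq1: "avg {0..<M} (\<lambda>cc. ?H x (e \<omega> cc)) = avg {0..<D} (\<lambda>\<delta>. avg {0..<M} (\<lambda>cc. ?H x (e \<omega> cc)))"
    using D by (simp add: avg_const)
   have eq2: "avg {0..<M} (\<lambda>cc. avg {0..<D} (\<lambda>\<delta>. ?G x (e \<omega> cc) \<delta>)) = avg {0..<D} (\<lambda>\<delta>. avg {0..<M} (\<lambda>cc. ?G x (e \<omega> cc) \<delta>))"
    by (rule avg_swap)
   have "norm (avg {0..<D} (\<lambda>\<delta>. avg {0..<M} (\<lambda>cc. ?H x (e \<omega> cc)) - avg {0..<M} (\<lambda>cc. ?G x (e \<omega> cc) \<delta>))) \<le> \<rho>\<^sup>2 / 2"
   proof (rule norm_avg_bound)
    fix \<delta> assume \<delta>: "\<delta> \<in> {0..<D}"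
    have s1: "0 \<le> Q1 * \<delta>" "Q1 * \<delta> \<le> Q1 * D" using \<delta> Q1 by (auto intro!: mult_left_mono)
    have "norm (avg {0..<M} (\<lambda>cc. ?H x (e \<omega> cc)) - avg {0..<M} (\<lambda>cc. ?H x (e \<omega> (cc + Q1 * \<delta>)))) \<le> 2 * of_int (Q1 * \<delta>) / M"
     using s1 QDM by (intro avg_interval_shift[OF bH M]) auto
    also have "\<dots> \<le> \<rho>\<^sup>2 / 4"
    proof -
     have "real_of_int (Q1 * \<delta>) \<le> real_of_int (Q1 * D)" using s1(2) by (simp only: of_int_le_iff)
     then have "8 * real_of_int (Q1 * \<delta>) \<le> \<rho>\<^sup>2 * M" using QD by simp
     then show ?thesis using M by (simp add: field_simps)
    qed
    finally have d1: "norm (avg {0..<M} (\<lambda>cc. ?H x (e \<omega> cc)) - avg {0..<M} (\<lambda>cc. ?H x (e \<omega> (cc + Q1 * \<delta>)))) \<le> \<rho>\<^sup>2 / 4" .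
    have d2: "norm (avg {0..<M} (\<lambda>cc. ?H x (e \<omega> (cc + Q1 * \<delta>)) - ?G x (e \<omega> cc) \<delta>)) \<le> \<rho>\<^sup>2 / 4"
    proof (rule norm_avg_bound)
     fix cc assume cc: "cc \<in> {0..<M}"
     let ?e = "e \<omega> cc"
     have ee3: "\<bar>?e\<bar> \<le> 3 * M" using dv[OF \<omega>, of cc] cc by (simp add: e_def)
     have e': "e \<omega> (cc + Q1 * \<delta>) = ?e + Q1 * \<delta>" by (simp add: e_def)
     let ?j = "2 * ?e * \<delta> + Q1 * \<delta>\<^sup>2"
     have "\<bar>?j\<bar> \<le> 2 * \<bar>?e\<bar> * \<bar>\<delta>\<bar> + \<bar>Q1 * \<delta>\<bar> * \<bar>\<delta>\<bar>"
      by (rule order_trans[OF abs_triangle_ineq]) (simp add: abs_mult power2_eq_square)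
     also have "\<dots> \<le> 2 * (3 * M) * D + M * D"
      using ee3 s1 QDM \<delta> M by (intro add_mono mult_mono) auto
     also have "\<dots> = 7 * M * D" by simp
     finally have j: "\<bar>?j\<bar> \<le> 7 * M * D" .
     have sq: "(?e + Q1 * \<delta>)\<^sup>2 = ?e\<^sup>2 + Q1 * ?j" by (simp add: power2_eq_square algebra_simps)
     have "?H x (?e + Q1 * \<delta>) - ?G x ?e \<delta> = avg Y (\<lambda>y. f0 x y * f1 (x + \<gamma> * (?e + Q1 * \<delta>)) y * ee (\<zeta> x * of_int ((?e + Q1 * \<delta>)\<^sup>2)) * (g x (y + (?e + Q1 * \<delta>)\<^sup>2) - g x (y + ?e\<^sup>2)))"
      by (simp only: right_diff_distrib avg_diff)
     also have "norm \<dots> \<le> \<rho>\<^sup>2 / 4"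
     proof (rule norm_avg_bound)
      fix y
      have "norm (g x (y + (?e + Q1 * \<delta>)\<^sup>2) - g x (y + ?e\<^sup>2)) \<le> \<rho>\<^sup>2 / 4"
       using slow[OF j, of x "y + ?e\<^sup>2"] unfolding sq by (simp add: add.assoc)
      then show "norm (f0 x y * f1 (x + \<gamma> * (?e + Q1 * \<delta>)) y * ee (\<zeta> x * of_int ((?e + Q1 * \<delta>)\<^sup>2)) * (g x (y + (?e + Q1 * \<delta>)\<^sup>2) - g x (y + ?e\<^sup>2))) \<le> \<rho>\<^sup>2 / 4"
       by (rule norm_mult_le1[OF b3])
     qed simp
     finally show "norm (?H x (e \<omega> (cc + Q1 * \<delta>)) - ?G x (e \<omega> cc) \<delta>) \<le> \<rho>\<^sup>2 / 4" unfolding e' .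
    qed simp
    show "norm (avg {0..<M} (\<lambda>cc. ?H x (e \<omega> cc)) - avg {0..<M} (\<lambda>cc. ?G x (e \<omega> cc) \<delta>)) \<le> \<rho>\<^sup>2 / 2"
     using norm_triangle_mono[OF d1 d2] unfolding avg_diff by simp
   qed simp
   then show ?thesis unfolding eq2 avg_diff eq1[symmetric] .
  qed
  then have "norm (avg \<Omega> (\<lambda>\<omega>. avg {0..<M} (\<lambda>cc. ?H x (e \<omega> cc)) - avg {0..<M} (\<lambda>cc. avg {0..<D} (\<lambda>\<delta>. ?G x (e \<omega> cc) \<delta>)))) \<le> \<rho>\<^sup>2 / 2"
   by (rule norm_avg_bound) simp_all
  then show ?thesis unfolding avg_diff e_def .
 qed
 have "\<rho>\<^sup>2 \<le> norm (avg {0..<N} (\<lambda>x. c x * ?V x))"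
 proof -
  have "\<rho> * (\<rho> * N) \<le> \<rho> * card {x\<in>{0..<N}. B x}" using big \<rho> by (intro mult_left_mono) auto
  also have "\<dots> = (\<Sum>x\<in>{0..<N}. if B x then \<rho> else 0)" by (simp add: sum.If_cases Int_def mult.commute)
  also have "\<dots> \<le> (\<Sum>x\<in>{0..<N}. if B x then norm (?V x) else 0)" by (intro sum_mono) (auto simp: B_def)
  finally have "\<rho>\<^sup>2 \<le> avg {0..<N} (\<lambda>x. if B x then norm (?V x) else 0)"
   using N by (simp add: avg_def field_simps power2_eq_square)
  then show ?thesis unfolding cV avg_of_real norm_of_real by linarith
 qed
 moreover have "norm (avg {0..<N} (\<lambda>x. c x * (?V x - ?V' x))) \<le> \<rho>\<^sup>2 / 2"
 proof (rule norm_avg_bound)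
  fix x show "norm (c x * (?V x - ?V' x)) \<le> \<rho>\<^sup>2 / 2"
   by (rule norm_mult_le1[OF c1 VV])
 qed simp
 ultimately have "\<rho>\<^sup>2 / 2 \<le> norm (avg {0..<N} (\<lambda>x. c x * ?V' x))"
  using norm_triangle_ineq2[of "avg {0..<N} (\<lambda>x. c x * ?V x)" "avg {0..<N} (\<lambda>x. c x * ?V x) - avg {0..<N} (\<lambda>x. c x * ?V' x)"]
  unfolding right_diff_distrib avg_diff by simp
 also have "avg {0..<N} (\<lambda>x. c x * ?V' x) = avg (\<Omega> \<times> {0..<M}) (\<lambda>p. avg {0..<N} (\<lambda>x. c x * avg {0..<D} (\<lambda>\<delta>. ?G x (e (fst p) (snd p)) \<delta>)))"
 proof -
  have "avg {0..<N} (\<lambda>x. c x * ?V' x) = avg {0..<N} (\<lambda>x. avg (\<Omega> \<times> {0..<M}) (\<lambda>p. c x * avg {0..<D} (\<lambda>\<delta>. ?G x (e (fst p) (snd p)) \<delta>)))"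
   by (simp only: avg_Times avg_cmult fst_conv snd_conv)
  also have "\<dots> = avg (\<Omega> \<times> {0..<M}) (\<lambda>p. avg {0..<N} (\<lambda>x. c x * avg {0..<D} (\<lambda>\<delta>. ?G x (e (fst p) (snd p)) \<delta>)))"
   by (rule avg_swap)
  finally show ?thesis .
 qed
 finally have X: "\<rho>\<^sup>2 / 2 \<le> norm (avg (\<Omega> \<times> {0..<M}) (\<lambda>p. avg {0..<N} (\<lambda>x. c x * avg {0..<D} (\<lambda>\<delta>. ?G x (e (fst p) (snd p)) \<delta>))))" .
 have fin': "finite (\<Omega> \<times> {0..<M})" using fin by simp
 have pos: "0 < \<rho>\<^sup>2 / 2" using \<rho>(1) by simp
 obtain p where p: "p \<in> \<Omega> \<times> {0..<M}" "\<rho>\<^sup>2 / 2 \<le> norm (avg {0..<N} (\<lambda>x. c x * avg {0..<D} (\<lambda>\<delta>. ?G x (e (fst p) (snd p)) \<delta>)))"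
  using avg_complex_exists[OF fin' X pos] by blast
 define d where "d = e (fst p) (snd p)"
 have d3: "\<bar>d\<bar> \<le> 3 * M" using dv[of "fst p" "snd p"] p(1) by (auto simp: d_def e_def)
 define \<Psi> where "\<Psi> x = c x * avg {0..<D} (\<lambda>\<delta>. ?G x d \<delta>)" for x
 have per\<Psi>: "per N \<Psi>"
  unfolding per_def \<Psi>_def by (intro allI) (simp only: perc perD[OF p0] perD[OF pg] perD[OF pz] shx perD[OF p1])
 \<comment> \<open>Averaging over x = u + \<gamma> Q1 X puts f1 at u + \<gamma>d + \<gamma> Q1 (X +
   \<delta>), a function of X + \<delta>; this is the shape of b in
   \<open>local_major\<close>.\<close>
 have "avg {0..<N} \<Psi> = avg {0..<D} (\<lambda>X. avg {0..<N} (\<lambda>u. \<Psi> (u + \<gamma> * Q1 * X)))"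
  using D by (simp add: avg_shift[OF per\<Psi>] avg_const)
 also have "\<dots> = avg {0..<N} (\<lambda>u. avg {0..<D} (\<lambda>X. \<Psi> (u + \<gamma> * Q1 * X)))" by (rule avg_swap)
 finally have "\<rho>\<^sup>2 / 2 \<le> norm (avg {0..<N} (\<lambda>u. avg {0..<D} (\<lambda>X. \<Psi> (u + \<gamma> * Q1 * X))))"
  using p(2) unfolding \<Psi>_def d_def[symmetric] by simp
 from avg_complex_exists[OF finite_atLeastLessThan_int this pos] obtain u where u: "\<rho>\<^sup>2 / 2 \<le> norm (avg {0..<D} (\<lambda>X. \<Psi> (u + \<gamma> * Q1 * X)))"
  by blast
 define xx where "xx X = u + \<gamma> * Q1 * X" for X
 have \<Psi>1: "norm (\<Psi> x) \<le> 1" for x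
 proof -
  have "norm (avg {0..<D} (\<lambda>\<delta>. ?G x d \<delta>)) \<le> 1" by (intro norm_avg_bound b4) auto
  then show ?thesis unfolding \<Psi>_def by (rule norm_mult_le1[OF c1])
 qed
 have "\<rho>\<^sup>2 / 2 \<le> avg {0..<D} (\<lambda>X. norm (\<Psi> (xx X)))"
  using u norm_avg_le[of "{0..<D}" "\<lambda>X. \<Psi> (xx X)"] unfolding xx_def by linarith
 then have "(\<rho>\<^sup>2 / 2 - \<rho>\<^sup>2 / 4) * real (card {0..<D}) \<le> real (card {X\<in>{0..<D}. \<rho>\<^sup>2 / 4 \<le> norm (\<Psi> (xx X))})"
  using D \<Psi>1 by (intro avg_large_card) auto
 then have cS: "\<rho>1 * D \<le> card {X\<in>{0..<D}. \<rho>1 \<le> norm (\<Psi> (xx X))}" using D by (simp add: \<rho>1_def)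
 let ?S = "{X\<in>{0..<D}. \<rho>1 \<le> norm (\<Psi> (xx X))}"
 let ?a = "\<lambda>X y. c (xx X) * f0 (xx X) y * g (xx X) (y + d\<^sup>2) * ee (\<zeta> (xx X) * of_int (d\<^sup>2))"
 let ?b = "\<lambda>Z y. f1 (u + \<gamma> * d + \<gamma> * Q1 * Z) y"
 have \<rho>1: "0 < \<rho>1" "\<rho>1 \<le> 1" using \<rho> power_le_one[of \<rho> 2] by (auto simp: \<rho>1_def)
 have sub: "?S \<subseteq> {0..<D}" by blast
 have Kd: "16 * Q1 / \<rho>1\<^sup>2 + \<bar>d\<bar> / D \<le> K3"
 proof -
  have "real_of_int \<bar>d\<bar> \<le> real_of_int (3 * M)" using d3 by (simp only: of_int_le_iff)
  then have "real_of_int \<bar>d\<bar> / D \<le> 3 * M / D" using D by (intro divide_right_mono) auto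
  then show ?thesis using K3 by linarith
 qed
 have na: "norm (?a X y) \<le> 1" for X y
  by (intro norm_mult_le1 c1 b0 bg) simp
 have nb: "norm (?b X y) \<le> 1" for X y by (rule b1)
 have bigX: "\<rho>1 \<le> norm (avg Y (\<lambda>y. avg {0..<D} (\<lambda>\<delta>. ?a X y * ?b (X + \<delta>) y * ee (2 * d * Q1 * \<zeta> (xx X) * of_int \<delta> + Q1\<^sup>2 * \<zeta> (xx X) * of_int (\<delta>\<^sup>2)))))"
  if "X \<in> ?S" for X
 proof -
  have "\<rho>1 \<le> norm (\<Psi> (xx X))" using that by simp
  also have "\<Psi> (xx X) = c (xx X) * avg Y (\<lambda>y. avg {0..<D} (\<lambda>\<delta>. f0 (xx X) y * f1 (xx X + \<gamma> * (d + Q1 * \<delta>)) y * ee (\<zeta> (xx X) * of_int ((d + Q1 * \<delta>)\<^sup>2)) * g (xx X) (y + d\<^sup>2)))"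
   unfolding \<Psi>_def by (rule arg_cong[OF avg_swap])
  also have "\<dots> = avg Y (\<lambda>y. avg {0..<D} (\<lambda>\<delta>. ?a X y * ?b (X + \<delta>) y * ee (2 * d * Q1 * \<zeta> (xx X) * of_int \<delta> + Q1\<^sup>2 * \<zeta> (xx X) * of_int (\<delta>\<^sup>2))))"
   unfolding avg_cmult[symmetric]
  proof (rule avg_cong, rule avg_cong)
   fix y \<delta>
   have "xx X + \<gamma> * (d + Q1 * \<delta>) = u + \<gamma> * d + \<gamma> * Q1 * (X + \<delta>)" by (simp add: xx_def algebra_simps)
   moreover have "\<zeta> (xx X) * of_int ((d + Q1 * \<delta>)\<^sup>2) = \<zeta> (xx X) * of_int (d\<^sup>2) + (2 * d * Q1 * \<zeta> (xx X) * of_int \<delta> + Q1\<^sup>2 * \<zeta> (xx X) * of_int (\<delta>\<^sup>2))"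
    by (simp add: power2_eq_square algebra_simps)
   ultimately show "c (xx X) * (f0 (xx X) y * f1 (xx X + \<gamma> * (d + Q1 * \<delta>)) y * ee (\<zeta> (xx X) * of_int ((d + Q1 * \<delta>)\<^sup>2)) * g (xx X) (y + d\<^sup>2))
    = ?a X y * ?b (X + \<delta>) y * ee (2 * d * Q1 * \<zeta> (xx X) * of_int \<delta> + Q1\<^sup>2 * \<zeta> (xx X) * of_int (\<delta>\<^sup>2))"
    by (simp only: ee_add[of "\<zeta> (xx X) * of_int (d\<^sup>2)"] mult_ac)
  qed
  finally show ?thesis .
 qed
 obtain X where X: "X \<in> ?S" "?maj (\<zeta> (xx X))"
  using local_major[where a = ?a and b = ?b and \<zeta> = "\<lambda>X. \<zeta> (xx X)", OF sub cS D \<rho>1 Q1 na nb Kd DK bigX] by blast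
 from X(1) have "\<Psi> (xx X) \<noteq> 0" using \<rho>1 by auto
 then have "B (xx X)" by (auto simp: \<Psi>_def c_def split: if_splits)
 then show False using X(2) by (simp add: B_def)
qed

section \<open>Control by a directional uniformity norm\<close>

definition avg2 :: "'a set \<Rightarrow> ('a \<Rightarrow> 'a \<Rightarrow> 'b::real_vector) \<Rightarrow> 'b" where
 "avg2 S f = avg S (\<lambda>a. avg S (f a))"

lemma avg2_cong: "(\<And>a a'. a \<in> S \<Longrightarrow> a' \<in> S \<Longrightarrow> f a a' = g a a') \<Longrightarrow> avg2 S f = avg2 S g"
 unfolding avg2_def by (intro avg_cong) auto

lemma avg2_mono: "(\<And>a a'. a \<in> S \<Longrightarrow> a' \<in> S \<Longrightarrow> f a a' \<le> (g a a' :: real)) \<Longrightarrow> avg2 S f \<le> avg2 S g"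
 unfolding avg2_def by (intro avg_mono) auto

lemma avg2_nonneg: "(\<And>a a'. a \<in> S \<Longrightarrow> a' \<in> S \<Longrightarrow> 0 \<le> (f a a' :: real)) \<Longrightarrow> 0 \<le> avg2 S f"
 unfolding avg2_def by (intro avg_nonneg) auto

lemma avg2_le: "(\<And>a a'. a \<in> S \<Longrightarrow> a' \<in> S \<Longrightarrow> f a a' \<le> (c :: real)) \<Longrightarrow> 0 \<le> c \<Longrightarrow> avg2 S f \<le> c"
 unfolding avg2_def by (intro avg_le) auto

lemma avg2_add: "avg2 S (\<lambda>a a'. f a a' + g a a') = avg2 S f + avg2 S g"
 by (simp add: avg2_def avg_add)

lemma avg2_cmult: "avg2 S (\<lambda>a a'. c * f a a') = c * avg2 S f" for c :: "'b::real_algebra"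
 by (simp add: avg2_def avg_cmult)

lemma avg2_sum: "avg2 S (\<lambda>a a'. \<Sum>x\<in>X. f a a' x) = (\<Sum>x\<in>X. avg2 S (\<lambda>a a'. f a a' x))"
 by (simp add: avg2_def avg_sum)

lemma avg_avg2_swap: "avg A (\<lambda>a. avg2 B (f a)) = avg2 B (\<lambda>b b'. avg A (\<lambda>a. f a b b'))"
proof -
 have "avg A (\<lambda>a. avg B (\<lambda>b. avg B (f a b))) = avg B (\<lambda>b. avg A (\<lambda>a. avg B (f a b)))"
  by (rule avg_swap)
 also have "\<dots> = avg B (\<lambda>b. avg B (\<lambda>b'. avg A (\<lambda>a. f a b b')))"
  by (rule avg_cong, rule avg_swap)
 finally show ?thesis by (simp only: avg2_def)
qed

lemma avg2_swap: "avg2 A (\<lambda>a a'. avg2 B (f a a')) = avg2 B (\<lambda>b b'. avg2 A (\<lambda>a a'. f a a' b b'))"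
 unfolding avg2_def[of A] by (simp only: avg_avg2_swap)

lemma avg2_const: "finite S \<Longrightarrow> S \<noteq> {} \<Longrightarrow> avg2 S (\<lambda>a a'. c) = c"
 by (simp add: avg2_def avg_const)

lemma avg2_exists_row:
 assumes "finite S" "S \<noteq> {}" "c \<le> avg2 S f" shows "\<exists>a\<in>S. (c::real) \<le> avg S (f a)"
 using avg_exists_ge[OF assms(1,2), of "\<lambda>a. avg S (f a)"] assms(3) unfolding avg2_def by force

lemma sum_mult_int:
 fixes f :: "int \<Rightarrow> 'b::comm_monoid_add"
 assumes "0 < b" "0 \<le> a"
 shows "(\<Sum>x\<in>{0..<a*b}. f x) = (\<Sum>i\<in>{0..<a}. \<Sum>j\<in>{0..<b}. f (i * b + j))"
proof -
 have lt: "i * b + j < a * b" if "i < a" "j < b" for i j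
 proof -
  have "(i + 1) * b \<le> a * b" using that assms by (intro mult_right_mono) auto
  then show ?thesis using that by (simp add: algebra_simps)
 qed
 have "(\<Sum>i\<in>{0..<a}. \<Sum>j\<in>{0..<b}. f (i * b + j)) = (\<Sum>p\<in>{0..<a} \<times> {0..<b}. f (fst p * b + snd p))"
  by (simp add: sum.cartesian_product case_prod_beta)
 also have "\<dots> = (\<Sum>x\<in>{0..<a*b}. f x)"
 proof (rule sum.reindex_bij_witness[of _ "\<lambda>x. (x div b, x mod b)" "\<lambda>p. fst p * b + snd p"])
  fix x assume x: "x \<in> {0..<a*b}"
  have "x div b < a"
  proof (rule ccontr)
   assume "\<not> x div b < a"
   then have "a * b \<le> (x div b) * b" using assms by (intro mult_right_mono) auto
   also have "\<dots> \<le> x" using div_mult_mod_eq[of x b] pos_mod_sign[OF assms(1), of x] by linarith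
   finally show False using x by simp
  qed
  then show "(x div b, x mod b) \<in> {0..<a} \<times> {0..<b}" using x assms by (simp add: pos_imp_zdiv_nonneg_iff)
 qed (use assms lt in auto)
 finally show ?thesis by simp
qed

lemma avg_mult_int:
 fixes f :: "int \<Rightarrow> 'b::real_vector"
 assumes "0 < b" "0 \<le> a"
 shows "avg {0..<a*b} f = avg {0..<a} (\<lambda>i. avg {0..<b} (\<lambda>j. f (i * b + j)))"
 unfolding avg_def sum_mult_int[OF assms] scaleR_sum_right[symmetric]
 using assms by (simp add: nat_mult_distrib mult.commute)

section \<open>Fourier weights and small denominators\<close>

lemma wt_minus: "wt n C (- z) = wt n C z"
proof -
 have "avg C (\<lambda>c. ch n (- z * c)) = cnj (avg C (\<lambda>c. ch n (z * c)))"
  by (simp add: avg_cnj[symmetric] cnj_ch)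
 then show ?thesis unfolding wt_def by simp
qed

text \<open>Write W = m v and c = i v + j. Then zmc = zWi + zmj, so the average splits into factors,
  and splitting i once more into blocks of length b leaves the average with step W and factors of
  modulus at most 1. In this way steps m that vary are replaced by a common multiple.\<close>

lemma wt_refine:
 assumes "m dvd W" "m \<noteq> 0" "0 < W" "0 < b"
 shows "wt n {0..<W * b} (z * m) \<le> wt n {0..<b} (z * W)"
proof -
 have pos: "wt n {0..<W * b} (z * m) \<le> wt n {0..<b} (z * W)" if m: "m dvd W" "0 < m" for m z
 proof -
  obtain v where v: "W = m * v" using m by auto
  have vp: "0 < v" using v m assms(3) by (simp add: zero_less_mult_iff)
  have e: "W * b = m * b * v" using v by simp
  have "avg {0..<W * b} (\<lambda>c. ch n (z * m * c)) = avg {0..<m * b} (\<lambda>i. avg {0..<v} (\<lambda>j. ch n (z * m * (i * v + j))))"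
   unfolding e using vp m assms by (intro avg_mult_int) auto
  also have "\<dots> = avg {0..<m * b} (\<lambda>i. ch n (z * W * i) * avg {0..<v} (\<lambda>j. ch n (z * m * j)))"
  proof (rule avg_cong, unfold avg_cmult[symmetric], rule avg_cong)
   fix i j
   have "z * m * (i * v + j) = z * W * i + z * m * j" by (simp add: v algebra_simps)
   then show "ch n (z * m * (i * v + j)) = ch n (z * W * i) * ch n (z * m * j)" by (simp only: ch_add)
  qed
  also have "\<dots> = avg {0..<m * b} (\<lambda>i. ch n (z * W * i)) * avg {0..<v} (\<lambda>j. ch n (z * m * j))"
   by (rule avg_multc)
  also have "avg {0..<m * b} (\<lambda>i. ch n (z * W * i)) = avg {0..<m} (\<lambda>r. avg {0..<b} (\<lambda>i. ch n (z * W * (r * b + i))))"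
   using m assms by (intro avg_mult_int) auto
  also have "\<dots> = avg {0..<m} (\<lambda>r. ch n (z * W * (r * b)) * avg {0..<b} (\<lambda>i. ch n (z * W * i)))"
   by (simp only: distrib_left ch_add avg_cmult)
  also have "\<dots> = avg {0..<m} (\<lambda>r. ch n (z * W * (r * b))) * avg {0..<b} (\<lambda>i. ch n (z * W * i))"
   by (rule avg_multc)
  finally have eq: "avg {0..<W * b} (\<lambda>c. ch n (z * m * c)) = avg {0..<m} (\<lambda>r. ch n (z * W * (r * b))) * (avg {0..<b} (\<lambda>i. ch n (z * W * i)) * avg {0..<v} (\<lambda>j. ch n (z * m * j)))"
   by (simp only: mult.assoc)
  have n12: "norm (avg {0..<m} (\<lambda>r. ch n (z * W * (r * b)))) \<le> 1" "norm (avg {0..<v} (\<lambda>j. ch n (z * m * j))) \<le> 1"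
   by (rule norm_avg_bound; simp)+
  from n12(2) have n3: "norm (avg {0..<b} (\<lambda>i. ch n (z * W * i)) * avg {0..<v} (\<lambda>j. ch n (z * m * j))) \<le> norm (avg {0..<b} (\<lambda>i. ch n (z * W * i)))"
   by (simp add: norm_mult mult_left_le)
  have "norm (avg {0..<W * b} (\<lambda>c. ch n (z * m * c))) \<le> norm (avg {0..<b} (\<lambda>i. ch n (z * W * i)))"
   unfolding eq by (rule norm_mult_le1[OF n12(1) n3])
  then show ?thesis unfolding wt_def by (intro power_mono) auto
 qed
 show ?thesis
 proof (cases "0 < m")
  case True then show ?thesis using pos assms by blast
 next
  case False
  then have "wt n {0..<W * b} (- z * - m) \<le> wt n {0..<b} (- z * W)" using assms by (intro pos) auto
  then show ?thesis using wt_minus[of n "{0..<b}" "z * W"] by simp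
 qed
qed

lemma wt_near:
 assumes "0 < M" "0 < \<rho>" "\<rho> \<le> wt n {0..<M} z"
 shows "near (2 / (\<rho> * M)) (z / n)"
proof -
 let ?a = "avg {0..<M} (\<lambda>c. ch n (z * c))"
 have a1: "norm ?a \<le> 1" by (rule norm_avg_bound) auto
 have "(norm ?a)\<^sup>2 \<le> norm ?a" using a1 by (simp add: power2_eq_square mult_left_le)
 then have "\<rho> \<le> norm ?a" using assms by (simp add: wt_def)
 moreover have "?a = (1 / real_of_int M) *\<^sub>R (\<Sum>c\<in>{0..<M}. ee ((z / n) * of_int c + 0))"
  using assms(1) by (simp add: avg_def ch_def)
 ultimately have "\<rho> * M \<le> norm (\<Sum>c\<in>{0..<M}. ee ((z / n) * of_int c + 0))"
  using assms(1) by (simp add: field_simps)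
 then show ?thesis using assms by (intro geom_near[where \<mu> = 0]) auto
qed

lemma avg_ge_card:
 assumes "finite S" "S \<noteq> {}" "\<And>s. s \<in> S \<Longrightarrow> (f s :: real) \<le> 1" "2 * c \<le> avg S f" "0 \<le> c"
 shows "c * card S \<le> card {s\<in>S. c \<le> f s}"
 using avg_large_card[OF assms(1,2,3,4), of c] assms(5) by simp

text \<open>For many h the weight is large, so (h + a)vz/n is within 4r/M of an integer.
  Vinogradov's lemma with H' about M/(32r) eliminates h and yields an error of order M^-2.\<close>

lemma wt_major:
 fixes H M v z a :: int and r :: real
 assumes big: "1 / r \<le> avg {0..<H} (\<lambda>h. wt n {0..<M} (z * (v * (h + a))))"
  and r: "1 \<le> r" and M: "4096 * r\<^sup>2 \<le> M" "M \<le> 32 * r * H" and H: "0 < H"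
 shows "\<exists>q::int. (1::int) \<le> q \<and> of_int q \<le> 16 * r \<and> near (2 ^ 16 * r ^ 4 / of_int (M\<^sup>2)) (of_int q * (of_int v * z / n))"
proof -
 let ?\<beta> = "of_int v * z / n" and ?\<rho> = "1 / (2 * r)" and ?\<kappa> = "4 * r / M"
 define S where "S = {h\<in>{0..<H}. ?\<rho> \<le> wt n {0..<M} (z * (v * (h + a)))}"
 define H' where "H' = \<lfloor>M / (32 * r)\<rfloor>"
 have "0 < 4096 * r\<^sup>2" using r by simp
 then have M0: "0 < M" using M(1) by linarith
 have "4096 * r * r \<le> M" using M(1) by (simp add: power2_eq_square)
 then have Mr: "128 * r \<le> M / (32 * r)" using r by (simp add: le_divide_eq mult_ac)
 have cS: "?\<rho> * H \<le> card S"
  using avg_ge_card[of "{0..<H}" "\<lambda>h. wt n {0..<M} (z * (v * (h + a)))" ?\<rho>] big r H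
  by (simp add: wt_le_1 S_def)
 have H'1: "H' \<le> M / (32 * r)" "M / (64 * r) \<le> H'" using Mr r unfolding H'_def by linarith+
 have H'r: "64 * r \<le> H'" using H'1(2) Mr by simp
 have nr: "near ?\<kappa> (h * ?\<beta> + a * ?\<beta>)" if "h \<in> S" for h :: int
 proof -
  have "near (2 / (?\<rho> * M)) (of_int (z * (v * (h + a))) / n)"
   using that r M0 by (intro wt_near) (auto simp: S_def)
  then show ?thesis using r by (simp add: algebra_simps add_divide_distrib)
 qed
 have v1: "?\<rho> \<le> 1" "0 < ?\<rho>" using r by auto
 have v2: "0 < H'" using H'r r by linarith
 have "M / (32 * r) \<le> H" using M(2) r by (simp add: divide_le_eq mult_ac)
 then have v3: "H' \<le> H" using H'1(1) by linarith
 have "4 * ?\<kappa> * H' \<le> 4 * ?\<kappa> * (M / (32 * r))" using H'1 r M0 by (intro mult_left_mono) auto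
 also have "\<dots> < 1" using r M0 by simp
 finally have v4: "4 * ?\<kappa> * H' < 1" .
 have v5: "32 \<le> ?\<rho> * H'" using H'r r by (simp add: field_simps)
 have v6: "0 \<le> ?\<kappa>" using r M0 by simp
 have v7: "S \<subseteq> {0..<H}" by (auto simp: S_def)
 obtain q :: int where q: "1 \<le> q" "q \<le> 8 / ?\<rho>" "near (64 * ?\<kappa> / (?\<rho>\<^sup>2 * H')) (q * ?\<beta>)"
  using vinogradov[OF v7 cS v1(2,1) v2 v3 v4 v5 v6 nr] by auto
 have "64 * ?\<kappa> / (?\<rho>\<^sup>2 * H') \<le> 64 * ?\<kappa> / (?\<rho>\<^sup>2 * (M / (64 * r)))"
  using H'1(2) v1 v2 v6 r M0 by (intro divide_left_mono mult_left_mono mult_pos_pos) auto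
 also have "\<dots> = 2 ^ 16 * r ^ 4 / of_int (M\<^sup>2)"
  using r M0 by (simp add: power2_eq_square eval_nat_numeral field_simps)
 finally have "near (2 ^ 16 * r ^ 4 / of_int (M\<^sup>2)) (q * ?\<beta>)" using q(3) near_mono by blast
 then show ?thesis using q(1,2) by (intro exI[of _ q]) auto
qed

section \<open>Derivative directions of PET and rarity of degenerate differences\<close>

lemma sum_inverse_squares:
 assumes "1 \<le> (G::int)" "G \<le> H"
 shows "(\<Sum>g\<in>{G<..H}. 1 / (real_of_int g)\<^sup>2) \<le> 1 / G - 1 / H"
 using assms(2)
proof (induction H rule: int_ge_induct)
 case (step i)
 have i: "0 < real_of_int i" using step assms by linarith
 have "{G<..i + 1} = insert (i + 1) {G<..i}" using step by auto
 then have "(\<Sum>g\<in>{G<..i + 1}. 1 / (real_of_int g)\<^sup>2) \<le> 1 / (real_of_int (i + 1))\<^sup>2 + (1 / G - 1 / i)"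
  using step by simp
 also have "1 / (real_of_int (i + 1))\<^sup>2 \<le> 1 / (i * (real_of_int (i + 1)))"
  using i unfolding power2_eq_square by (intro divide_left_mono mult_right_mono) auto
 also have "1 / (i * (real_of_int (i + 1))) = 1 / i - 1 / (i + 1)"
  using i by (simp add: field_simps)
 finally show ?case by simp
qed simp

lemma div_add_le: "0 < (l::int) \<Longrightarrow> (x + y) div l \<le> x div l + y div l + 1"
proof -
 assume l: "0 < l"
 let ?s = "x mod l + y mod l"
 have "?s div l * l \<le> ?s" using div_mult_mod_eq[of ?s l] pos_mod_sign[OF l, of ?s] by linarith
 also have "\<dots> < 2 * l" using pos_mod_bound[OF l, of x] pos_mod_bound[OF l, of y] by linarith
 finally have "?s div l < 2" using l by simp
 then show ?thesis using div_add1_eq[of x y l] by linarith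
qed

lemma card_multiples:
 fixes g H a :: int
 assumes "1 \<le> g" "g \<le> H"
 shows "real (card {i\<in>{a..<a+H}. g dvd i}) \<le> 3 * H / g"
proof -
 let ?S = "{i\<in>{a..<a+H}. g dvd i}"
 have g: "0 < g" using assms by simp
 have "(\<lambda>i. i div g) ` ?S \<subseteq> {a div g..(a + (H - 1)) div g}"
  using g by (auto intro!: zdiv_mono1)
 moreover have inj: "inj_on (\<lambda>i. i div g) ?S"
  by (rule inj_onI) (metis (no_types, lifting) dvd_div_mult_self mem_Collect_eq)
 ultimately have "card ?S \<le> card {a div g..(a + (H - 1)) div g}"
  using card_image[OF inj] card_mono[OF finite_atLeastAtMost_int] by metis
 also have "\<dots> \<le> card {a div g..a div g + (H - 1) div g + 1}"
  using div_add_le[OF g, of a "H - 1"] by (intro card_mono) auto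
 finally have "card ?S \<le> nat ((H - 1) div g + 2)" by simp
 moreover have "0 \<le> (H - 1) div g" using assms by (simp add: pos_imp_zdiv_nonneg_iff)
 ultimately have c: "real (card ?S) \<le> real_of_int ((H - 1) div g) + 2" by linarith
 have "(H - 1) div g * g \<le> H" using div_mult_mod_eq[of "H - 1" g] pos_mod_sign[OF g, of "H - 1"] by linarith
 then have "real_of_int ((H - 1) div g) * g \<le> H" by (simp only: of_int_le_iff flip: of_int_mult)
 then have "real_of_int ((H - 1) div g) \<le> H / g" using g by (simp add: le_divide_eq)
 moreover have "1 \<le> H / g" using assms g by (simp add: le_divide_eq)
 moreover have "3 * H / g = H / g + 2 * (H / g)" by simp
 ultimately show ?thesis using c by linarith
qed

text \<open>For one j0 there are two popular values m1, m2 of j' - j0. Linear combinations of the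
  two conditions show that h and k, each times 2(m1 - m2)\<xi>/n, are nearly integral, and
  \<open>near_gcd\<close> passes to their gcd. A small gcd keeps the denominator small; a large |h|
  makes the arc narrow, of width H^-2 rather than H^-1 when A is comparable to H.\<close>

lemma third_direction:
 fixes n A J H h k \<xi> G :: int and \<rho> K \<kappa> :: real
 defines "\<kappa> \<equiv> 4 / (\<rho> * A)"
 assumes big: "\<rho> \<le> avg2 {0..<J} (\<lambda>j j'. wt n {0..<A} (\<xi> * (2 * (h + k * (j' - j)))))"
  and \<rho>: "0 < \<rho>" and J: "2 < \<rho> * J" and A: "0 < A" and n: "0 < n" "\<bar>\<xi>\<bar> \<le> n"
  and hk: "\<bar>h\<bar> \<le> H" "\<bar>k\<bar> \<le> H" "gcd h k \<le> G" "1 / K \<le> \<bar>h\<bar>" "0 < K"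
  and wrap: "2 * H * (2 * J * \<kappa>) < 1"
 shows "\<xi> \<in> arcs n (4 * J * G) (G * (2 * J * \<kappa>) * K)"
proof -
 have J0: "0 < J" using J \<rho> by (metis less_trans of_int_0_less_iff zero_less_mult_pos zero_less_numeral)
 let ?f = "\<lambda>j j'. wt n {0..<A} (\<xi> * (2 * (h + k * (j' - j))))"
 obtain j0 where j0: "j0 \<in> {0..<J}" "\<rho> \<le> avg {0..<J} (?f j0)"
  using avg2_exists_row[OF _ _ big] J0 by auto
 define S where "S = {j'\<in>{0..<J}. \<rho> / 2 \<le> ?f j0 j'}"
 have "\<rho> / 2 * card {0..<J} \<le> card S"
  unfolding S_def using j0 J0 \<rho> by (intro avg_ge_card) (auto simp: wt_le_1)
 then have "1 < real (card S)" using J J0 by simp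
 then have "\<not> card S \<le> 1" by simp
 moreover have finS: "finite S" by (rule finite_subset[of _ "{0..<J}"]) (auto simp: S_def)
 ultimately obtain j1 j2 where j12: "j1 \<in> S" "j2 \<in> S" "j1 \<noteq> j2"
  using card_le_Suc0_iff_eq[OF finS] by auto
 let ?z = "real_of_int \<xi> / n"
 have nr: "near \<kappa> (of_int (2 * (h + k * (j - j0))) * ?z)" if "j \<in> S" for j
 proof -
  have "near (2 / (\<rho> / 2 * A)) (of_int (\<xi> * (2 * (h + k * (j - j0)))) / n)"
   using that A \<rho> by (intro wt_near) (auto simp: S_def)
  then show ?thesis by (simp add: \<kappa>_def mult_ac)
 qed
 define m1 m2 where "m1 = j1 - j0" and "m2 = j2 - j0"
 have m: "\<bar>m1\<bar> \<le> J" "\<bar>m2\<bar> \<le> J" "m1 \<noteq> m2" using j12 j0(1) by (auto simp: m1_def m2_def S_def)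
 have \<kappa>: "0 \<le> \<kappa>" using \<rho> A by (simp add: \<kappa>_def)
 define Dd where "Dd = 2 * (m1 - m2)"
 let ?\<beta> = "of_int Dd * ?z"
 have nk: "near (2 * J * \<kappa>) (k * ?\<beta>)"
 proof -
  have "near (\<kappa> + \<kappa>) (of_int (2 * (h + k * m1)) * ?z - of_int (2 * (h + k * m2)) * ?z)"
   unfolding m1_def m2_def by (intro near_diff nr j12)
  then have "near (\<kappa> + \<kappa>) (k * ?\<beta>)"
   by (simp add: Dd_def algebra_simps flip: add_divide_distrib diff_divide_distrib)
  moreover have "\<kappa> + \<kappa> \<le> 2 * J * \<kappa>" using \<kappa> J0 mult_right_mono[of 1 "real_of_int J" "2 * \<kappa>"] by simp
  ultimately show ?thesis by (rule near_mono)
 qed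
 have nh: "near (2 * J * \<kappa>) (h * ?\<beta>)"
 proof -
  have "near (of_int \<bar>m1\<bar> * \<kappa> + of_int \<bar>m2\<bar> * \<kappa>) (m1 * (of_int (2 * (h + k * m2)) * ?z) - m2 * (of_int (2 * (h + k * m1)) * ?z))"
   unfolding m1_def m2_def by (intro near_diff near_mult nr j12)
  then have "near (of_int \<bar>m1\<bar> * \<kappa> + of_int \<bar>m2\<bar> * \<kappa>) (h * ?\<beta>)"
   by (simp add: Dd_def algebra_simps flip: add_divide_distrib diff_divide_distrib)
  moreover have "of_int \<bar>m1\<bar> * \<kappa> + of_int \<bar>m2\<bar> * \<kappa> \<le> 2 * J * \<kappa>"
  proof -
   have "real_of_int (\<bar>m1\<bar> + \<bar>m2\<bar>) \<le> real_of_int (2 * J)" using m by (simp only: of_int_le_iff)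
   then have "real_of_int (\<bar>m1\<bar> + \<bar>m2\<bar>) * \<kappa> \<le> real_of_int (2 * J) * \<kappa>" using \<kappa> by (intro mult_right_mono)
   then show ?thesis by (simp add: distrib_right)
  qed
  ultimately show ?thesis by (rule near_mono)
 qed
 have h0: "h \<noteq> 0" using hk(4,5) by auto
 have ng: "near (gcd h k * (2 * J * \<kappa>) / \<bar>h\<bar>) (gcd h k * ?\<beta>)"
  using h0 hk(1,2) nh nk wrap by (intro near_gcd[where H = H]) auto
 have g0: "0 < gcd h k" using h0 by simp
 define q where "q = gcd h k * \<bar>Dd\<bar>"
 have D0: "1 \<le> \<bar>Dd\<bar>" "\<bar>Dd\<bar> \<le> 4 * J" using m by (auto simp: Dd_def)
 have q: "1 \<le> q" "q \<le> 4 * J * G"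
 proof -
  have "1 \<le> gcd h k" using g0 by linarith
  then have "1 * 1 \<le> gcd h k * \<bar>Dd\<bar>" using D0 by (intro mult_mono) linarith+
  then show "1 \<le> q" by (simp add: q_def)
  have "gcd h k * \<bar>Dd\<bar> \<le> G * (4 * J)" using hk(3) D0 g0 by (intro mult_mono) linarith+
  then show "q \<le> 4 * J * G" by (simp add: q_def mult_ac)
 qed
 have "near (gcd h k * (2 * J * \<kappa>) / \<bar>h\<bar>) (q * ?z)"
 proof (cases "0 \<le> Dd")
  case True then show ?thesis using ng by (simp add: q_def mult_ac)
 next
  case False then show ?thesis using near_minus[OF ng] by (simp add: q_def mult_ac)
 qed
 moreover have "gcd h k * (2 * J * \<kappa>) / \<bar>h\<bar> \<le> G * (2 * J * \<kappa>) * K"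
 proof -
  have a: "1 / \<bar>real_of_int h\<bar> \<le> K" using hk(4,5) h0 by (simp add: field_simps)
  have b: "real_of_int (gcd h k) * (2 * J * \<kappa>) \<le> real_of_int G * (2 * J * \<kappa>)" using hk(3) J0 \<kappa> by (intro mult_right_mono) auto
  have c: "0 \<le> real_of_int (gcd h k) * (2 * J * \<kappa>)" using J0 \<kappa> g0 by (intro mult_nonneg_nonneg) auto
  have "0 \<le> 1 / \<bar>real_of_int h\<bar>" by simp
  then have "gcd h k * (2 * J * \<kappa>) * (1 / \<bar>real_of_int h\<bar>) \<le> G * (2 * J * \<kappa>) * K"
   by (rule mult_mono[OF b a order_trans[OF c b]])
  then show ?thesis by simp
 qed
 ultimately have "near (G * (2 * J * \<kappa>) * K) (q * ?z)" by (rule near_mono)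
 then show ?thesis using n q unfolding arcs_def by (intro CollectI conjI exI[of _ q]) auto
qed

text \<open>A gcd equal to g requires g to divide both k and i' - i, which has density at most
  9/g^2; summing over g > G gives 9/G. The average over the dilation k provides one of the two
  factors 1/g, without which the sum over g would not be small.\<close>

lemma bad_pairs:
 fixes H G T :: int
 assumes H: "1 \<le> H" and G: "1 \<le> G" and T: "1 \<le> T" "T \<le> H"
 shows "avg {1..H} (\<lambda>k. avg2 {0..<H} (\<lambda>i i'. if \<bar>i' - i\<bar> < T \<or> G < gcd (i' - i) k then 1 else 0 :: real))
  \<le> 3 * T / H + 9 / G"
proof -
 have small: "avg {0..<H} (\<lambda>i'. if \<bar>i' - i\<bar> < T then 1 else 0 :: real) \<le> 3 * T / H" for i
 proof -
  have "(\<Sum>i'\<in>{0..<H}. if \<bar>i' - i\<bar> < T then 1 else 0 :: real) = card {i'\<in>{0..<H}. \<bar>i' - i\<bar> < T}"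
   by (simp add: sum.If_cases Int_def)
  also have "\<dots> \<le> card {i - T<..<i + T}" by (intro of_nat_mono card_mono) auto
  also have "\<dots> \<le> 3 * T" using T by simp
  finally show ?thesis using H by (simp add: avg_def divide_right_mono)
 qed
 have mult: "avg {0..<H} (\<lambda>i'. if g dvd i' - i then 1 else 0 :: real) \<le> 3 / g" if "1 \<le> g" "g \<le> H" for g i :: int
 proof -
  have "(\<Sum>i'\<in>{0..<H}. if g dvd i' - i then 1 else 0 :: real) = card {i'\<in>{0..<H}. g dvd i' - i}"
   by (simp add: sum.If_cases Int_def)
  also have "card {i'\<in>{0..<H}. g dvd i' - i} = card {i'\<in>{-i..<-i + H}. g dvd i'}"
   by (rule bij_betw_same_card[of "\<lambda>i'. i' - i"], rule bij_betwI[of _ _ _ "\<lambda>i'. i' + i"]) auto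
  also have "real \<dots> \<le> 3 * H / g" by (rule card_multiples[OF that])
  finally show ?thesis using H by (simp add: avg_def divide_right_mono divide_le_eq)
 qed
 have multk: "avg {1..H} (\<lambda>k. if g dvd k then 1 else 0 :: real) \<le> 3 / g" if "1 \<le> g" "g \<le> H" for g :: int
 proof -
  have "(\<Sum>k\<in>{1..H}. if g dvd k then 1 else 0 :: real) = card {k\<in>{1..H}. g dvd k}"
   by (simp add: sum.If_cases Int_def)
  also have "{k\<in>{1..H}. g dvd k} = {k\<in>{1..<1 + H}. g dvd k}" by auto
  also have "real (card \<dots>) \<le> 3 * H / g" by (rule card_multiples[OF that])
  finally show ?thesis using H by (simp add: avg_def divide_right_mono divide_le_eq)
 qed
 have "avg {1..H} (\<lambda>k. avg2 {0..<H} (\<lambda>i i'. if \<bar>i' - i\<bar> < T \<or> G < gcd (i' - i) k then 1 else 0 :: real))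
  \<le> avg {1..H} (\<lambda>k. avg2 {0..<H} (\<lambda>i i'. (if \<bar>i' - i\<bar> < T then 1 else 0) + (\<Sum>g\<in>{G<..H}. (if g dvd k then 1 else 0) * (if g dvd i' - i then 1 else 0))))"
 proof (intro avg_mono avg2_mono)
  fix k i i' assume k: "k \<in> {1..H}"
  let ?g = "gcd (i' - i) k"
  show "(if \<bar>i' - i\<bar> < T \<or> G < ?g then 1 else 0 :: real) \<le> (if \<bar>i' - i\<bar> < T then 1 else 0) + (\<Sum>g\<in>{G<..H}. (if g dvd k then 1 else 0) * (if g dvd i' - i then 1 else 0))"
  proof (cases "G < ?g")
   case True
   have gk: "?g \<le> k" using k by (intro zdvd_imp_le) auto
   have "?g \<le> H" by (rule order_trans[OF gk]) (use k in simp)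
   then have "?g \<in> {G<..H}" using True by simp
   then have "(\<Sum>g\<in>{?g}. (if g dvd k then 1 else 0) * (if g dvd i' - i then 1 else 0 :: real)) \<le> (\<Sum>g\<in>{G<..H}. (if g dvd k then 1 else 0) * (if g dvd i' - i then 1 else 0))"
    by (intro sum_mono2) auto
   then show ?thesis by auto
  qed (auto intro!: sum_nonneg add_nonneg_nonneg)
 qed
 also have "\<dots> = avg {1..H} (\<lambda>k. avg2 {0..<H} (\<lambda>i i'. (if \<bar>i' - i\<bar> < T then 1 else 0))) + (\<Sum>g\<in>{G<..H}. avg {1..H} (\<lambda>k. if g dvd k then 1 else 0) * avg2 {0..<H} (\<lambda>i i'. if g dvd i' - i then 1 else 0))"
  by (simp only: avg2_add avg2_sum avg2_cmult avg_add avg_sum avg_multc)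
 also have "\<dots> \<le> 3 * T / H + (\<Sum>g\<in>{G<..H}. 9 * (1 / (real_of_int g)\<^sup>2))"
 proof (intro add_mono sum_mono)
  show "avg {1..H} (\<lambda>k. avg2 {0..<H} (\<lambda>i i'. if \<bar>i' - i\<bar> < T then 1 else 0 :: real)) \<le> 3 * T / H"
   unfolding avg2_def by (rule avg_le, rule avg_le, rule small) (use H T in \<open>auto intro!: divide_nonneg_nonneg\<close>)
  fix g assume g: "g \<in> {G<..H}"
  have "avg2 {0..<H} (\<lambda>i i'. if g dvd i' - i then 1 else 0 :: real) \<le> 3 / g"
   unfolding avg2_def using g G by (intro avg_le mult) auto
  moreover have "avg {1..H} (\<lambda>k. if g dvd k then 1 else 0 :: real) \<le> 3 / g" using g G by (intro multk) auto
  moreover have "0 \<le> avg2 {0..<H} (\<lambda>i i'. if g dvd i' - i then 1 else 0 :: real)" by (intro avg2_nonneg) auto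
  moreover have "0 \<le> avg {1..H} (\<lambda>k. if g dvd k then 1 else 0 :: real)" by (intro avg_nonneg) auto
  ultimately have "avg {1..H} (\<lambda>k. if g dvd k then 1 else 0 :: real) * avg2 {0..<H} (\<lambda>i i'. if g dvd i' - i then 1 else 0) \<le> (3 / g) * (3 / g)"
   using g G by (intro mult_mono) auto
  then show "avg {1..H} (\<lambda>k. if g dvd k then 1 else 0 :: real) * avg2 {0..<H} (\<lambda>i i'. if g dvd i' - i then 1 else 0) \<le> 9 * (1 / (real_of_int g)\<^sup>2)"
   by (simp add: power2_eq_square)
 qed
 also have "(\<Sum>g\<in>{G<..H}. 9 * (1 / (real_of_int g)\<^sup>2)) \<le> 9 / G"
 proof (cases "G \<le> H")
  case True
  have "(\<Sum>g\<in>{G<..H}. 1 / (real_of_int g)\<^sup>2) \<le> 1 / G - 1 / H" by (rule sum_inverse_squares[OF G True])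
  also have "\<dots> \<le> 1 / G" using H by simp
  finally show ?thesis unfolding sum_distrib_left[symmetric] by simp
 qed (use G in auto)
 finally show ?thesis by simp
qed

text \<open>The largest squared Fourier coefficient plays the role of a U^2 norm in the y-direction;
  applied to derivatives it stands for a U^3 norm.\<close>

definition mx :: "int \<Rightarrow> (int \<Rightarrow> real) \<Rightarrow> real" where
 "mx n g = Max ((\<lambda>\<eta>. (norm (ft n g \<eta>))\<^sup>2) ` {0..<n})"

lemma mx_ge: "0 < n \<Longrightarrow> \<eta> \<in> {0..<n} \<Longrightarrow> (norm (ft n g \<eta>))\<^sup>2 \<le> mx n g"
 unfolding mx_def by (intro Max_ge) auto

lemma mx_attained: "0 < n \<Longrightarrow> \<exists>\<eta>\<in>{0..<n}. mx n g = (norm (ft n g \<eta>))\<^sup>2"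
proof -
 assume "0 < n"
 then have "mx n g \<in> (\<lambda>\<eta>. (norm (ft n g \<eta>))\<^sup>2) ` {0..<n}" unfolding mx_def by (intro Max_in) auto
 then show ?thesis by auto
qed

lemma mx_nonneg: "0 < n \<Longrightarrow> 0 \<le> mx n g"
 using mx_attained[of n g] by auto

text \<open>Bounds the right-hand side of the twisted correlation inequality when the weights concentrate on a small set.\<close>

lemma correlation_major:
 fixes w :: "int \<Rightarrow> real"
 assumes n: "0 < n" and g: "per n g" "\<And>y. \<bar>g y\<bar> \<le> 1"
  and w: "\<And>z. 0 \<le> w z" "\<And>z. w z \<le> 1" "\<And>z. \<bar>z\<bar> \<le> n \<Longrightarrow> \<rho> \<le> w z \<Longrightarrow> z \<in> \<A>" and fin: "finite \<A>" and \<rho>: "0 \<le> \<rho>"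
 shows "(\<Sum>\<eta>\<in>{0..<n}. (norm (ft n g \<eta>))\<^sup>2 * (\<Sum>\<theta>\<in>{0..<n}. (norm (ft n g \<theta>))\<^sup>2 * w (\<theta> - \<eta>))) \<le> \<rho> + card \<A> * mx n g"
proof -
 let ?p = "\<lambda>\<eta>. (norm (ft n g \<eta>))\<^sup>2"
 have P: "(\<Sum>\<eta>\<in>{0..<n}. ?p \<eta>) \<le> 1" by (rule parseval_le[OF n g])
 have C: "0 \<le> \<rho> + card \<A> * mx n g" using mx_nonneg[OF n, of g] \<rho> by simp
 have inner: "(\<Sum>\<theta>\<in>{0..<n}. ?p \<theta> * w (\<theta> - \<eta>)) \<le> \<rho> + card \<A> * mx n g" if \<eta>: "\<eta> \<in> {0..<n}" for \<eta>
 proof -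
  have "(\<Sum>\<theta>\<in>{0..<n}. ?p \<theta> * w (\<theta> - \<eta>)) \<le> (\<Sum>\<theta>\<in>{0..<n}. ?p \<theta> * \<rho> + (if \<theta> - \<eta> \<in> \<A> then ?p \<theta> else 0))"
  proof (rule sum_mono)
   fix \<theta> assume \<theta>: "\<theta> \<in> {0..<n}"
   show "?p \<theta> * w (\<theta> - \<eta>) \<le> ?p \<theta> * \<rho> + (if \<theta> - \<eta> \<in> \<A> then ?p \<theta> else 0)"
   proof (cases "\<theta> - \<eta> \<in> \<A>")
    case True
    have "?p \<theta> * w (\<theta> - \<eta>) \<le> ?p \<theta> * 1" using w(2) by (intro mult_left_mono) auto
    then show ?thesis using True \<rho> by (simp add: add_increasing)
   next
    case False
    moreover have "\<bar>\<theta> - \<eta>\<bar> \<le> n" using \<theta> \<eta> by auto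
    ultimately have "w (\<theta> - \<eta>) \<le> \<rho>" using w(3)[of "\<theta> - \<eta>"] linear by blast
    then show ?thesis using \<open>\<theta> - \<eta> \<notin> \<A>\<close> by (simp add: mult_left_mono)
   qed
  qed
  also have "\<dots> = (\<Sum>\<theta>\<in>{0..<n}. ?p \<theta>) * \<rho> + (\<Sum>\<theta>\<in>{\<theta>\<in>{0..<n}. \<theta> - \<eta> \<in> \<A>}. ?p \<theta>)"
   by (simp only: sum.distrib sum_distrib_right sum.inter_filter[OF finite_atLeastLessThan_int])
  also have "\<dots> \<le> 1 * \<rho> + (\<Sum>\<theta>\<in>{\<theta>\<in>{0..<n}. \<theta> - \<eta> \<in> \<A>}. mx n g)"
   using P \<rho> mx_ge[OF n] by (intro add_mono mult_right_mono sum_mono) auto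
  also have "\<dots> \<le> \<rho> + card \<A> * mx n g"
  proof -
   have "card {\<theta>\<in>{0..<n}. \<theta> - \<eta> \<in> \<A>} \<le> card \<A>"
    by (rule card_inj_on_le[of "\<lambda>\<theta>. \<theta> - \<eta>"]) (auto simp: inj_on_def fin)
   then show ?thesis using mx_nonneg[OF n, of g] by (simp add: mult_right_mono)
  qed
  finally show ?thesis .
 qed
 have "(\<Sum>\<eta>\<in>{0..<n}. ?p \<eta> * (\<Sum>\<theta>\<in>{0..<n}. ?p \<theta> * w (\<theta> - \<eta>))) \<le> (\<Sum>\<eta>\<in>{0..<n}. ?p \<eta> * (\<rho> + card \<A> * mx n g))"
  using inner by (intro sum_mono mult_left_mono) auto
 also have "\<dots> \<le> 1 * (\<rho> + card \<A> * mx n g)"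
  unfolding sum_distrib_right[symmetric] using P C by (intro mult_right_mono)
 finally show ?thesis by simp
qed

lemma power_absorb:
 fixes T c :: real
 assumes "1 \<le> T" "c \<le> T ^ a" "a + b \<le> d" shows "c * T ^ b \<le> T ^ d"
proof -
 have "c * T ^ b \<le> T ^ a * T ^ b" using assms by (intro mult_right_mono) auto
 also have "\<dots> = T ^ (a + b)" by (simp add: power_add)
 also have "\<dots> \<le> T ^ d" using assms by (intro power_increasing) auto
 finally show ?thesis .
qed

text \<open>Used with m = j' - j: the derivative step becomes a multiple of W and no longer depends
  on j and j', so these variables are free for \<open>third_direction\<close>.\<close>

lemma refine_direction:
 assumes "0 < n" "per n g" "m dvd W" "m \<noteq> 0" "0 < W" "0 < b"
 shows "avg2 {0..<W * b} (\<lambda>c c'. avg {0..<n} (dl (2 * (k * m) * (c' - c)) g))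
  \<le> avg2 {0..<b} (\<lambda>c c'. avg {0..<n} (dl (2 * W * k * (c' - c)) g))"
 unfolding avg2_def avg_dl_wt[OF assms(1,2)]
proof (intro sum_mono mult_left_mono)
 fix \<xi>
 show "wt n {0..<W * b} (\<xi> * (2 * (k * m))) \<le> wt n {0..<b} (\<xi> * (2 * W * k))"
  using wt_refine[OF assms(3-6), of n "\<xi> * 2 * k"] by (simp add: mult_ac)
qed simp

lemma avg2_dl_le1:
 assumes "\<And>y. \<bar>g y\<bar> \<le> 1" shows "avg {0..<n} (dl \<tau> g) \<le> 1"
 using dl_bound[OF assms] by (intro avg_le) (auto simp: abs_le_iff)

lemma avg2_dl_nonneg: "per n g \<Longrightarrow> 0 \<le> avg2 C (\<lambda>c c'. avg {0..<n} (dl (v * (c' - c)) g))"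
 unfolding avg2_def avg_dl_pos by (intro avg_nonneg) auto

lemma avg2_diag: "finite S \<Longrightarrow> S \<noteq> {} \<Longrightarrow> avg2 S (\<lambda>a a'. if a = a' then 1 else 0 :: real) = 1 / card S"
 by (simp add: avg2_def avg_def power2_eq_square)

text \<open>Of the three derivatives left by \<open>pet\<close>, the one along k(j' - j) is replaced
  by a common step 2Wk. The averages over the other two are Fourier weights, concentrated on major
  arc frequencies apart from degenerate differences and small thresholds. As n \<le> t^10 M^2 there
  are only polynomially many in t, so pigeonholing loses powers of t and one derivative with a large
  Fourier coefficient survives.\<close>

lemma u3_bound:
 fixes t W B1 N n \<gamma> H J A M :: int and f0 f1 R :: "int \<Rightarrow> int \<Rightarrow> real"
 defines "H \<equiv> W * B1" and "J \<equiv> t ^ 36" and "A \<equiv> t ^ 71 * H" and "M \<equiv> t ^ 74 * H"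
 assumes t: "2 ^ 20 \<le> t" and W: "0 < W" "\<And>m. 1 \<le> m \<Longrightarrow> m \<le> t ^ 36 \<Longrightarrow> m dvd W" and B1: "t ^ 1000 \<le> B1"
  and N: "0 < N" and n: "0 < n" "n \<le> t ^ 10 * M\<^sup>2"
  and b0: "\<And>x y. \<bar>f0 x y\<bar> \<le> 1" and b1: "\<And>x y. \<bar>f1 x y\<bar> \<le> 1" and b2: "\<And>x y. \<bar>R x y\<bar> \<le> 1"
  and p0: "per N f0" and p1: "per N f1" and p2: "per N R" and q2: "\<And>x. per n (R x)" and q1: "\<And>x. per n (f1 x)"
  and big: "1 / t \<le> avg {1..H} (\<lambda>k. avg {0..<M} (\<lambda>s. avg {0..<H} (\<lambda>i. avg {0..<J} (\<lambda>j. avg {0..<A} (\<lambda>a. avg {0..<H} (\<lambda>b. avg {0..<M} (\<lambda>c.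
   avg {0..<N} (\<lambda>x. avg {0..<n} (\<lambda>y.
    f0 x y * (f1 (x + \<gamma> * (i + k * j + (a + b + c + - s))) y * R x (y + (i + k * j + (a + b + c + - s))\<^sup>2)))))))))))"
 shows "1 / t ^ 2900 \<le> avg {1..H} (\<lambda>k. avg2 {0..<B1} (\<lambda>b b'. avg {0..<N} (\<lambda>x. mx n (dl (2 * W * k * (b' - b)) (R x)))))"
proof -
 define T where "T = real_of_int t"
 have T: "2 ^ 20 \<le> T" "1 \<le> T" "0 < T" using t unfolding T_def by simp_all
 have T1: "1 \<le> T ^ k" "0 < T ^ k" for k using T by auto
 have t0: "0 < t" using t by simp
 have B0: "1 \<le> B1" "0 < B1" using B1 t0 zero_less_power[OF t0, of 1000] by linarith+
 have H0: "0 < H" "1 \<le> H" using W(1) B0 by (auto simp: H_def simp flip: zero_less_mult_iff intro: mult_pos_pos) (metis mult_pos_pos zless_imp_add1_zle add_0)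
 have J0: "0 < J" using t0 by (simp add: J_def)
 have A0: "0 < A" using t0 H0 by (simp add: A_def)
 have M0: "0 < M" using t0 H0 by (simp add: M_def)
 have HB: "B1 \<le> H" using mult_right_mono[of 1 W B1] W(1) B0 by (simp add: H_def)
 have HT: "T ^ 1000 \<le> H"
 proof -
  have "real_of_int (t ^ 1000) \<le> H" using B1 HB by (simp only: of_int_le_iff)
  then show ?thesis by (simp add: T_def)
 qed
 have rJ: "real_of_int J = T ^ 36" by (simp add: J_def T_def)
 have rA: "real_of_int A = T ^ 71 * H" by (simp add: A_def T_def)
 have rM: "real_of_int M = T ^ 74 * H" by (simp add: M_def T_def)
 have nT: "real_of_int n \<le> T ^ 158 * (real_of_int H)\<^sup>2" 
 proof -
  have "real_of_int n \<le> real_of_int (t ^ 10 * M\<^sup>2)" using n by (simp only: of_int_le_iff)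
  also have "\<dots> = T ^ 158 * (real_of_int H)\<^sup>2" by (simp add: M_def T_def power_mult_distrib power_mult[symmetric] power_add[symmetric])
  finally show ?thesis .
 qed
 let ?X = "{0..<N}" and ?Y = "{0..<n}" and ?I = "{0..<H}" and ?J = "{0..<J}" and ?A = "{0..<A}" and ?C = "{0..<M}" and ?B = "{0..<B1}"
 \<comment> \<open>MA and MB contain the frequencies at which the weights along i' - i + k(j' - j)
   and along i' - i are large. Their parameters come from \<open>third_direction\<close> with G =
   t^36, K = T^36/H and from \<open>wt_major\<close> with r = T^410.\<close>
 define MA where "MA = arcs n (4 * t ^ 72) (8 * T ^ 71 / (real_of_int H)\<^sup>2)"
 define MB where "MB = arcs n (32 * t ^ 410) (2 ^ 16 * T ^ 1640 / (real_of_int M)\<^sup>2)"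
 define PA where "PA = MA \<inter> {0..<n}"
 define Tb where "Tb = \<lceil>H / T ^ 36\<rceil>"
 let ?bd = "\<lambda>k i i'. if \<bar>i' - i\<bar> < Tb \<or> t ^ 36 < gcd (i' - i) k then 1 else 0 :: real"
 let ?Z = "\<lambda>k. avg2 ?B (\<lambda>b b'. avg ?X (\<lambda>x. mx n (dl (2 * W * k * (b' - b)) (R x))))"
 let ?t1 = "\<lambda>i i' c c'. 2 * (i' - i) * (c' - c)"
 let ?t3 = "\<lambda>k i i' j j' a a'. 2 * (i' - i + k * (j' - j)) * (a' - a)"
 let ?E = "\<lambda>k. avg2 ?I (\<lambda>i i'. avg2 ?J (\<lambda>j j'. avg ?X (\<lambda>x. avg2 ?A (\<lambda>a a'. avg2 ?I (\<lambda>b b'. avg2 ?C (\<lambda>c c'.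
   avg ?Y (dl (?t1 i i' c c') (dl (2 * (k * (j' - j)) * (b' - b)) (dl (?t3 k i i' j j' a a') (R x))))))))))"
 let ?S = "\<lambda>k i i' x c c' b b'. (\<Sum>\<xi>\<in>PA. (norm (ft n (dl (?t1 i i' c c') (dl (2 * W * k * (b' - b)) (R x))) \<xi>))\<^sup>2)"
 have bdl: "\<bar>dl a (dl b (dl c (R x))) y\<bar> \<le> 1" for a b c x y by (intro dl_bound b2)
 have pdl: "per n (dl b (dl c (R x)))" for b c x by (intro per_dl q2)
 have Hne: "?I \<noteq> {}" "?J \<noteq> {}" "?X \<noteq> {}" "?A \<noteq> {}" "?C \<noteq> {}" "?B \<noteq> {}" using H0 J0 N A0 M0 B0 by auto
 have cJ: "real (card ?J) = T ^ 36" using J0 rJ by simp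
 have finM: "finite MA" "finite MB" "finite PA" by (auto simp: MA_def MB_def PA_def finite_arcs)
 have Tb: "1 \<le> Tb" "Tb \<le> H" "H / T ^ 36 \<le> Tb" "real_of_int Tb \<le> H / T ^ 36 + 1"
 proof -
  have "0 < H / T ^ 36" using H0 T1[of 36] by simp
  then show "1 \<le> Tb" unfolding Tb_def by linarith
  have "H / T ^ 36 \<le> H / 1" using H0 T1[of 36] by (intro divide_left_mono) auto
  then show "Tb \<le> H" unfolding Tb_def by (simp add: ceiling_le_iff)
  show "H / T ^ 36 \<le> Tb" "real_of_int Tb \<le> H / T ^ 36 + 1" unfolding Tb_def by linarith+
 qed
 \<comment> \<open>The diagonal j = j', where the direction degenerates, costs 1/J = 1/T^36; this is
   small against the main term 1/T^32 left by the 32nd power. Off the diagonal |j' - j| \<le> t^36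
   divides W.\<close>
 have step1: "?E k \<le> 1 / T ^ 36 + avg2 ?I (\<lambda>i i'. avg ?X (\<lambda>x. avg2 ?C (\<lambda>c c'. avg2 ?B (\<lambda>b b'. avg2 ?J (\<lambda>j j'. avg2 ?A (\<lambda>a a'.
   avg ?Y (dl (?t3 k i i' j j' a a') (dl (?t1 i i' c c') (dl (2 * W * k * (b' - b)) (R x))))))))))"
  (is "_ \<le> _ + ?E1") if k: "k \<in> {1..H}" for k
 proof -
  let ?G = "\<lambda>i i' j j' x a a' c c' b b'. avg ?Y (dl (?t3 k i i' j j' a a') (dl (?t1 i i' c c') (dl (2 * W * k * (b' - b)) (R x))))"
  have "?E k \<le> avg2 ?I (\<lambda>i i'. avg2 ?J (\<lambda>j j'. avg ?X (\<lambda>x. avg2 ?A (\<lambda>a a'. (if j = j' then 1 else 0) + avg2 ?C (\<lambda>c c'. avg2 ?B (\<lambda>b b'. ?G i i' j j' x a a' c c' b b'))))))"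
  proof (intro avg2_mono avg_mono)
   fix i i' j j' x a a' assume j: "j \<in> ?J" "j' \<in> ?J"
   let ?g = "\<lambda>c c'. dl (?t1 i i' c c') (dl (?t3 k i i' j j' a a') (R x))"
   have "avg2 ?I (\<lambda>b b'. avg2 ?C (\<lambda>c c'. avg ?Y (dl (?t1 i i' c c') (dl (2 * (k * (j' - j)) * (b' - b)) (dl (?t3 k i i' j j' a a') (R x))))))
    = avg2 ?I (\<lambda>b b'. avg2 ?C (\<lambda>c c'. avg ?Y (dl (2 * (k * (j' - j)) * (b' - b)) (?g c c'))))"
    by (simp only: dl_commute[of "?t1 i i' _ _"])
   also have "\<dots> = avg2 ?C (\<lambda>c c'. avg2 ?I (\<lambda>b b'. avg ?Y (dl (2 * (k * (j' - j)) * (b' - b)) (?g c c'))))"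
    by (rule avg2_swap)
   also have "\<dots> \<le> (if j = j' then 1 else 0) + avg2 ?C (\<lambda>c c'. avg2 ?B (\<lambda>b b'. avg ?Y (dl (2 * W * k * (b' - b)) (?g c c'))))"
   proof (cases "j = j'")
    case True
    have "avg2 ?C (\<lambda>c c'. avg2 ?I (\<lambda>b b'. avg ?Y (dl (2 * (k * (j' - j)) * (b' - b)) (?g c c')))) \<le> 1"
     by (intro avg2_le avg2_dl_le1 dl_bound b2) auto
    moreover have "0 \<le> avg2 ?C (\<lambda>c c'. avg2 ?B (\<lambda>b b'. avg ?Y (dl (2 * W * k * (b' - b)) (?g c c'))))"
     by (rule avg2_nonneg, rule avg2_dl_nonneg, rule pdl)
    ultimately show ?thesis using True by simp
   next
    case False
    define m where "m = j' - j"
    have "\<bar>m\<bar> \<le> t ^ 36" "m \<noteq> 0" using j False by (auto simp: m_def J_def)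
    then have "\<bar>m\<bar> dvd W" by (intro W(2)) auto
    then have m: "m dvd W" "m \<noteq> 0" using \<open>m \<noteq> 0\<close> by auto
    have "avg2 ?C (\<lambda>c c'. avg2 ?I (\<lambda>b b'. avg ?Y (dl (2 * (k * m) * (b' - b)) (?g c c')))) \<le> avg2 ?C (\<lambda>c c'. avg2 ?B (\<lambda>b b'. avg ?Y (dl (2 * W * k * (b' - b)) (?g c c'))))"
     unfolding H_def by (rule avg2_mono, rule refine_direction[OF n(1) pdl m W(1) B0(2)])
    then show ?thesis using False by (simp add: m_def)
   qed
   also have "avg2 ?C (\<lambda>c c'. avg2 ?B (\<lambda>b b'. avg ?Y (dl (2 * W * k * (b' - b)) (?g c c')))) = avg2 ?C (\<lambda>c c'. avg2 ?B (\<lambda>b b'. ?G i i' j j' x a a' c c' b b'))"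
    by (rule avg2_cong, rule avg2_cong) (metis dl_commute)
   finally show "avg2 ?I (\<lambda>b b'. avg2 ?C (\<lambda>c c'. avg ?Y (dl (?t1 i i' c c') (dl (2 * (k * (j' - j)) * (b' - b)) (dl (?t3 k i i' j j' a a') (R x))))))
    \<le> (if j = j' then 1 else 0) + avg2 ?C (\<lambda>c c'. avg2 ?B (\<lambda>b b'. ?G i i' j j' x a a' c c' b b'))" .
  qed
  also have "\<dots> = avg2 ?I (\<lambda>i i'. avg2 ?J (\<lambda>j j'. if j = j' then 1 else 0)) + avg2 ?I (\<lambda>i i'. avg2 ?J (\<lambda>j j'. avg ?X (\<lambda>x. avg2 ?A (\<lambda>a a'. avg2 ?C (\<lambda>c c'. avg2 ?B (\<lambda>b b'. ?G i i' j j' x a a' c c' b b'))))))"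
   by (simp only: avg2_add avg_add avg2_const[OF finite_atLeastLessThan_int Hne(4)] avg_const[OF finite_atLeastLessThan_int Hne(3)])
  also have "avg2 ?I (\<lambda>i i'. avg2 ?J (\<lambda>j j'. if j = j' then 1 else 0 :: real)) = 1 / T ^ 36"
   by (simp only: avg2_diag[OF finite_atLeastLessThan_int Hne(2)] avg2_const[OF finite_atLeastLessThan_int Hne(1)] cJ)
  also have "avg2 ?I (\<lambda>i i'. avg2 ?J (\<lambda>j j'. avg ?X (\<lambda>x. avg2 ?A (\<lambda>a a'. avg2 ?C (\<lambda>c c'. avg2 ?B (\<lambda>b b'. ?G i i' j j' x a a' c c' b b')))))) = ?E1"
  proof (rule avg2_cong)
   fix i i'
   have "avg2 ?J (\<lambda>j j'. avg ?X (\<lambda>x. avg2 ?A (\<lambda>a a'. avg2 ?C (\<lambda>c c'. avg2 ?B (\<lambda>b b'. ?G i i' j j' x a a' c c' b b')))))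
    = avg ?X (\<lambda>x. avg2 ?J (\<lambda>j j'. avg2 ?A (\<lambda>a a'. avg2 ?C (\<lambda>c c'. avg2 ?B (\<lambda>b b'. ?G i i' j j' x a a' c c' b b')))))"
    by (rule avg_avg2_swap[symmetric])
   also have "\<dots> = avg ?X (\<lambda>x. avg2 ?J (\<lambda>j j'. avg2 ?C (\<lambda>c c'. avg2 ?A (\<lambda>a a'. avg2 ?B (\<lambda>b b'. ?G i i' j j' x a a' c c' b b')))))"
    by (rule avg_cong, rule avg2_cong, rule avg2_swap)
   also have "\<dots> = avg ?X (\<lambda>x. avg2 ?J (\<lambda>j j'. avg2 ?C (\<lambda>c c'. avg2 ?B (\<lambda>b b'. avg2 ?A (\<lambda>a a'. ?G i i' j j' x a a' c c' b b')))))"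
    by (rule avg_cong, rule avg2_cong, rule avg2_cong, rule avg2_swap)
   also have "\<dots> = avg ?X (\<lambda>x. avg2 ?C (\<lambda>c c'. avg2 ?J (\<lambda>j j'. avg2 ?B (\<lambda>b b'. avg2 ?A (\<lambda>a a'. ?G i i' j j' x a a' c c' b b')))))"
    by (rule avg_cong, rule avg2_swap)
   also have "\<dots> = avg ?X (\<lambda>x. avg2 ?C (\<lambda>c c'. avg2 ?B (\<lambda>b b'. avg2 ?J (\<lambda>j j'. avg2 ?A (\<lambda>a a'. ?G i i' j j' x a a' c c' b b')))))"
    by (rule avg_cong, rule avg2_cong, rule avg2_swap)
   finally show "avg2 ?J (\<lambda>j j'. avg ?X (\<lambda>x. avg2 ?A (\<lambda>a a'. avg2 ?C (\<lambda>c c'. avg2 ?B (\<lambda>b b'. ?G i i' j j' x a a' c c' b b')))))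
    = avg ?X (\<lambda>x. avg2 ?C (\<lambda>c c'. avg2 ?B (\<lambda>b b'. avg2 ?J (\<lambda>j j'. avg2 ?A (\<lambda>a a'. ?G i i' j j' x a a' c c' b b')))))" .
  qed
  finally show ?thesis .
 qed
 \<comment> \<open>In Fourier space the average over j, j', a, a' is a weighted sum of |ft
   \<Phi>|^2. Outside MA the weight is at most 1/T^34 unless the triple i, i', k is
   degenerate.\<close>
 have step2: "avg2 ?J (\<lambda>j j'. avg2 ?A (\<lambda>a a'. avg ?Y (dl (?t3 k i i' j j' a a') \<Phi>))) \<le> (?bd k i i' + 1 / T ^ 34) + (\<Sum>\<xi>\<in>PA. (norm (ft n \<Phi> \<xi>))\<^sup>2)"
  if k: "k \<in> {1..H}" and i: "i \<in> ?I" "i' \<in> ?I" and \<Phi>: "per n \<Phi>" "\<And>y. \<bar>\<Phi> y\<bar> \<le> 1" for k i i' \<Phi>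
 proof -
  let ?p = "\<lambda>\<xi>. (norm (ft n \<Phi> \<xi>))\<^sup>2"
  let ?w = "\<lambda>\<xi>. avg2 ?J (\<lambda>j j'. wt n ?A (\<xi> * (2 * (i' - i + k * (j' - j)))))"
  have P: "(\<Sum>\<xi>\<in>{0..<n}. ?p \<xi>) \<le> 1" by (rule parseval_le[OF n(1) \<Phi>])
  have "avg2 ?J (\<lambda>j j'. avg2 ?A (\<lambda>a a'. avg ?Y (dl (?t3 k i i' j j' a a') \<Phi>))) = avg2 ?J (\<lambda>j j'. \<Sum>\<xi>\<in>{0..<n}. ?p \<xi> * wt n ?A (\<xi> * (2 * (i' - i + k * (j' - j)))))"
   unfolding avg2_def[of ?A] avg_dl_wt[OF n(1) \<Phi>(1)] ..
  also have "\<dots> = (\<Sum>\<xi>\<in>{0..<n}. ?p \<xi> * ?w \<xi>)" by (simp only: avg2_sum avg2_cmult)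
  also have "\<dots> \<le> (\<Sum>\<xi>\<in>{0..<n}. ?p \<xi> * (?bd k i i' + 1 / T ^ 34) + (if \<xi> \<in> MA then ?p \<xi> else 0))"
  proof (rule sum_mono)
   fix \<xi> assume \<xi>: "\<xi> \<in> {0..<n}"
   have w1: "?w \<xi> \<le> 1" by (intro avg2_le wt_le_1) auto
   show "?p \<xi> * ?w \<xi> \<le> ?p \<xi> * (?bd k i i' + 1 / T ^ 34) + (if \<xi> \<in> MA then ?p \<xi> else 0)"
   proof (cases "?bd k i i' = 1 \<or> \<xi> \<in> MA \<or> ?w \<xi> \<le> 1 / T ^ 34")
    case True
    have bd0: "0 \<le> ?bd k i i'" by simp
    have Tp: "0 \<le> 1 / T ^ 34" using T1[of 34] by simp
    show ?thesis
    proof (cases "\<xi> \<in> MA")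
     case True
     have "?p \<xi> * ?w \<xi> \<le> ?p \<xi> * 1" using w1 by (intro mult_left_mono) auto
     moreover have "0 \<le> ?p \<xi> * (?bd k i i' + 1 / T ^ 34)" using bd0 Tp by (intro mult_nonneg_nonneg add_nonneg_nonneg) auto
     ultimately have "?p \<xi> * ?w \<xi> \<le> ?p \<xi> * (?bd k i i' + 1 / T ^ 34) + ?p \<xi>" by linarith
     then show ?thesis by (simp only: True if_True)
    next
     case False
     then have "?w \<xi> \<le> ?bd k i i' + 1 / T ^ 34" using True w1 bd0 Tp by linarith
     then have "?p \<xi> * ?w \<xi> \<le> ?p \<xi> * (?bd k i i' + 1 / T ^ 34)" by (intro mult_left_mono) auto
     then show ?thesis by (simp only: False if_False add_0_right)
    qed
   next
    case False
    then have good: "Tb \<le> \<bar>i' - i\<bar>" "gcd (i' - i) k \<le> t ^ 36" and w: "1 / T ^ 34 \<le> ?w \<xi>" by (auto split: if_splits)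
    have "\<xi> \<in> arcs n (4 * J * t ^ 36) (t ^ 36 * (2 * J * (4 / (1 / T ^ 34 * A))) * (T ^ 36 / H))"
    proof (rule third_direction[where H = H and k = k, OF w])
     show "2 < 1 / T ^ 34 * J"
     proof -
      have "T ^ 36 = T ^ 34 * (T * T)" by (simp flip: power_add power2_eq_square)
      moreover have "2 ^ 20 * 1 \<le> T * T" using T by (intro mult_mono) auto
      ultimately show ?thesis unfolding rJ using T1[of 34] by (simp add: less_divide_eq)
     qed
     show "1 / (T ^ 36 / H) \<le> \<bar>i' - i\<bar>"
     proof -
      have "real_of_int Tb \<le> \<bar>i' - i\<bar>" using good(1) by (simp only: of_int_le_iff)
      then show ?thesis using Tb(3) by simp
     qed
     \<comment> \<open>This fixes the factor t^71 in A: it has to exceed T^36 from J times T^34 from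
       the threshold.\<close>
     show "2 * H * (2 * J * (4 / (1 / T ^ 34 * A))) < 1"
     proof -
      have "2 * H * (2 * J * (4 / (1 / T ^ 34 * A))) = 16 * (T ^ 36 * T ^ 34) / T ^ 71"
       using H0 T1[of 34] T1[of 71] by (simp add: rJ rA field_simps)
      also have "\<dots> = 16 / T" using T power_add[of T 70 1] by (simp flip: power_add)
      also have "\<dots> < 1" using T by simp
      finally show ?thesis .
     qed
    qed (use T1[of 34] T1[of 36] A0 H0 n i k \<xi> good in auto)
    moreover have "t ^ 36 * (2 * J * (4 / (1 / T ^ 34 * A))) * (T ^ 36 / H) = 8 * T ^ 71 / (real_of_int H)\<^sup>2"
    proof -
     have e: "T ^ 36 * T ^ 36 * T ^ 34 * T ^ 36 = T ^ 71 * T ^ 71" by (simp flip: power_add)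
     have "t ^ 36 * (2 * J * (4 / (1 / T ^ 34 * A))) * (T ^ 36 / H) = 8 * (T ^ 36 * T ^ 36 * T ^ 34 * T ^ 36) / (T ^ 71 * (real_of_int H)\<^sup>2)"
      using H0 T1[of 34] T1[of 71] by (simp add: rJ rA power2_eq_square field_simps flip: T_def)
     moreover have gen: "\<And>x h :: real. x \<noteq> 0 \<Longrightarrow> 8 * (x * x) / (x * h) = 8 * x / h" by simp
     have nz: "T ^ 71 \<noteq> 0" using T by simp
     ultimately show ?thesis unfolding e gen[OF nz] by simp
    qed
    moreover have "4 * J * t ^ 36 = 4 * t ^ 72" by (simp add: J_def flip: power_add)
    ultimately have "\<xi> \<in> MA" by (simp add: MA_def)
    then show ?thesis using False by blast
   qed
  qed
  also have "\<dots> = (\<Sum>\<xi>\<in>{0..<n}. ?p \<xi>) * (?bd k i i' + 1 / T ^ 34) + (\<Sum>\<xi>\<in>{\<xi>\<in>{0..<n}. \<xi> \<in> MA}. ?p \<xi>)"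
   by (simp only: sum.distrib sum_distrib_right sum.inter_filter[OF finite_atLeastLessThan_int])
  also have "{\<xi>\<in>{0..<n}. \<xi> \<in> MA} = PA" by (auto simp: PA_def)
  also have "(\<Sum>\<xi>\<in>{0..<n}. ?p \<xi>) * (?bd k i i' + 1 / T ^ 34) \<le> 1 * (?bd k i i' + 1 / T ^ 34)"
   using P T1[of 34] by (intro mult_right_mono) auto
  finally show ?thesis by simp
 qed
 \<comment> \<open>By \<open>twisted_correlation\<close> the average over i, i', c, c' is a
   self-correlation of |ft \<Psi>|^2 whose weights sit on differences in MB. The estimate holds for
   each \<xi>, so it can be summed over PA.\<close>
 have step3: "avg2 ?I (\<lambda>i i'. avg2 ?C (\<lambda>c c'. (norm (ft n (dl (?t1 i i' c c') \<Psi>) \<xi>))\<^sup>2)) \<le> 1 / T ^ 410 + card MB * mx n \<Psi>"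
  if \<Psi>: "per n \<Psi>" "\<And>y. \<bar>\<Psi> y\<bar> \<le> 1" for \<Psi> \<xi>
 proof -
  let ?p = "\<lambda>\<eta>. (norm (ft n \<Psi> \<eta>))\<^sup>2"
  let ?w = "\<lambda>z. avg2 ?I (\<lambda>i i'. wt n ?C (z * (2 * (i' - i))))"
  have "avg2 ?I (\<lambda>i i'. avg2 ?C (\<lambda>c c'. (norm (ft n (dl (?t1 i i' c c') \<Psi>) \<xi>))\<^sup>2))
   \<le> avg2 ?I (\<lambda>i i'. \<Sum>\<eta>\<in>{0..<n}. ?p \<eta> * (\<Sum>\<theta>\<in>{0..<n}. ?p \<theta> * wt n ?C ((\<theta> - \<eta>) * (2 * (i' - i)))))"
   unfolding avg2_def[of ?C] by (rule avg2_mono, rule twisted_correlation[OF n(1) \<Psi>(1)])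
  also have "\<dots> = (\<Sum>\<eta>\<in>{0..<n}. ?p \<eta> * (\<Sum>\<theta>\<in>{0..<n}. ?p \<theta> * ?w (\<theta> - \<eta>)))"
   by (simp only: avg2_sum avg2_cmult)
  also have "\<dots> \<le> 1 / T ^ 410 + card MB * mx n \<Psi>"
  proof (rule correlation_major[OF n(1) \<Psi>])
   fix z :: int assume z: "\<bar>z\<bar> \<le> n" and w: "1 / T ^ 410 \<le> ?w z"
   obtain i where i: "i \<in> ?I" "1 / T ^ 410 \<le> avg ?I (\<lambda>i'. wt n ?C (z * (2 * (i' - i))))"
    using avg2_exists_row[OF finite_atLeastLessThan_int Hne(1) w] by blast
   then have i2: "1 / T ^ 410 \<le> avg ?I (\<lambda>i'. wt n ?C (z * (2 * (i' + - i))))" by simp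
   have m1: "4096 * (T ^ 410)\<^sup>2 \<le> M"
   proof -
    have "4096 * T ^ 820 \<le> T ^ 1000" using T by (intro power_absorb[where a = 1]) auto
    also have "\<dots> \<le> T ^ 74 * H" using HT T1[of 74] mult_mono[of 1 "T ^ 74" "T ^ 1000" "real_of_int H"] by simp
    finally show ?thesis unfolding rM by (simp flip: power_mult)
   qed
   have m2: "M \<le> 32 * T ^ 410 * H"
   proof -
    have "T ^ 74 \<le> T ^ 410" using T by (intro power_increasing) auto
    then have "T ^ 74 * H \<le> (32 * T ^ 410) * H" using H0 T1[of 410] by (intro mult_right_mono) auto
    then show ?thesis unfolding rM .
   qed
   obtain q :: int where q: "(1::int) \<le> q" "of_int q \<le> 16 * T ^ 410" "near (2 ^ 16 * (T ^ 410) ^ 4 / of_int (M\<^sup>2)) (of_int q * (of_int 2 * z / n))"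
    using wt_major[OF i2 T1(1) m1 m2 H0(1)] by blast
   have "near (2 ^ 16 * T ^ 1640 / (real_of_int M)\<^sup>2) (of_int (2 * q) * (z / n))"
    using q(3) by (simp flip: power_mult add: mult_ac)
   moreover have "2 * q \<le> 32 * t ^ 410"
   proof -
    have "real_of_int (2 * q) \<le> real_of_int (32 * t ^ 410)" using q(2) by (simp add: T_def)
    then show ?thesis by (simp only: of_int_le_iff)
   qed
   ultimately show "z \<in> MB" unfolding MB_def arcs_def using z q(1) by (intro CollectI conjI exI[of _ "2 * q"]) auto
  qed (use T1[of 410] finM in \<open>auto intro!: avg2_nonneg avg2_le simp: wt_nonneg wt_le_1\<close>)
  finally show ?thesis .
 qed
 have step4: "?E k \<le> 1 / T ^ 36 + (avg2 ?I (?bd k) + 1 / T ^ 34) + card MA * (1 / T ^ 410 + card MB * ?Z k)" if k: "k \<in> {1..H}" for k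
 proof -
  let ?\<Psi> = "\<lambda>x b b'. dl (2 * W * k * (b' - b)) (R x)"
  have p\<Psi>: "per n (?\<Psi> x b b')" and b\<Psi>: "\<bar>?\<Psi> x b b' y\<bar> \<le> 1" for x b b' y by (intro per_dl q2, intro dl_bound b2)
  have "avg2 ?I (\<lambda>i i'. avg ?X (\<lambda>x. avg2 ?C (\<lambda>c c'. avg2 ?B (\<lambda>b b'. avg2 ?J (\<lambda>j j'. avg2 ?A (\<lambda>a a'.
   avg ?Y (dl (?t3 k i i' j j' a a') (dl (?t1 i i' c c') (?\<Psi> x b b')))))))))
   \<le> avg2 ?I (\<lambda>i i'. avg ?X (\<lambda>x. avg2 ?C (\<lambda>c c'. avg2 ?B (\<lambda>b b'. (?bd k i i' + 1 / T ^ 34) + ?S k i i' x c c' b b'))))"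
   by (intro avg2_mono avg_mono step2 k per_dl dl_bound p\<Psi> b\<Psi>)
  also have "\<dots> = (avg2 ?I (?bd k) + 1 / T ^ 34) + avg2 ?I (\<lambda>i i'. avg ?X (\<lambda>x. avg2 ?C (\<lambda>c c'. avg2 ?B (\<lambda>b b'. ?S k i i' x c c' b b'))))"
   by (simp only: avg2_add avg_add avg2_const[OF finite_atLeastLessThan_int Hne(6)] avg2_const[OF finite_atLeastLessThan_int Hne(5)]
    avg2_const[OF finite_atLeastLessThan_int Hne(1)] avg_const[OF finite_atLeastLessThan_int Hne(3)])
  also have "avg2 ?I (\<lambda>i i'. avg ?X (\<lambda>x. avg2 ?C (\<lambda>c c'. avg2 ?B (\<lambda>b b'. ?S k i i' x c c' b b'))))
   = avg ?X (\<lambda>x. avg2 ?I (\<lambda>i i'. avg2 ?C (\<lambda>c c'. avg2 ?B (\<lambda>b b'. ?S k i i' x c c' b b'))))"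
   by (rule avg_avg2_swap[symmetric])
  also have "\<dots> = avg ?X (\<lambda>x. avg2 ?I (\<lambda>i i'. avg2 ?B (\<lambda>b b'. avg2 ?C (\<lambda>c c'. ?S k i i' x c c' b b'))))"
   by (rule avg_cong, rule avg2_cong, rule avg2_swap)
  also have "\<dots> = avg ?X (\<lambda>x. avg2 ?B (\<lambda>b b'. avg2 ?I (\<lambda>i i'. avg2 ?C (\<lambda>c c'. ?S k i i' x c c' b b'))))"
   by (rule avg_cong, rule avg2_swap)
  also have "\<dots> \<le> avg ?X (\<lambda>x. avg2 ?B (\<lambda>b b'. card MA * (1 / T ^ 410 + card MB * mx n (?\<Psi> x b b'))))"
  proof (intro avg_mono avg2_mono)
   fix x b b'
   have "avg2 ?I (\<lambda>i i'. avg2 ?C (\<lambda>c c'. ?S k i i' x c c' b b')) = (\<Sum>\<xi>\<in>PA. avg2 ?I (\<lambda>i i'. avg2 ?C (\<lambda>c c'. (norm (ft n (dl (?t1 i i' c c') (?\<Psi> x b b')) \<xi>))\<^sup>2)))"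
    by (simp only: avg2_sum)
   also have "\<dots> \<le> (\<Sum>\<xi>\<in>PA. 1 / T ^ 410 + card MB * mx n (?\<Psi> x b b'))"
    by (intro sum_mono step3 p\<Psi> b\<Psi>)
   also have "\<dots> = real (card PA) * (1 / T ^ 410 + card MB * mx n (?\<Psi> x b b'))" by (simp only: sum_constant)
   also have "\<dots> \<le> card MA * (1 / T ^ 410 + card MB * mx n (?\<Psi> x b b'))"
    using T1[of 410] mx_nonneg[OF n(1)] finM by (intro mult_right_mono add_nonneg_nonneg mult_nonneg_nonneg) (auto simp: PA_def intro: card_mono)
   finally show "avg2 ?I (\<lambda>i i'. avg2 ?C (\<lambda>c c'. ?S k i i' x c c' b b')) \<le> card MA * (1 / T ^ 410 + card MB * mx n (?\<Psi> x b b'))" .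
  qed
  also have "\<dots> = card MA * (1 / T ^ 410 + card MB * avg ?X (\<lambda>x. avg2 ?B (\<lambda>b b'. mx n (?\<Psi> x b b'))))"
   by (simp only: avg2_add avg_add avg2_cmult avg_cmult avg2_const[OF finite_atLeastLessThan_int Hne(6)] avg_const[OF finite_atLeastLessThan_int Hne(3)])
  also have "avg ?X (\<lambda>x. avg2 ?B (\<lambda>b b'. mx n (?\<Psi> x b b'))) = ?Z k" by (rule avg_avg2_swap)
  finally show ?thesis using step1[OF k] by linarith
 qed
 let ?L = "\<lambda>k s. avg ?I (\<lambda>i. avg ?J (\<lambda>j. avg ?A (\<lambda>a. avg ?I (\<lambda>b. avg ?C (\<lambda>c. avg ?X (\<lambda>x. avg ?Y (\<lambda>y.
    f0 x y * (f1 (x + \<gamma> * (i + k * j + (a + b + c + - s))) y * R x (y + (i + k * j + (a + b + c + - s))\<^sup>2)))))))))"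
 have pow32: "(avg S f) ^ 32 \<le> avg S (\<lambda>s. (f s :: real) ^ 32)" for S :: "int set" and f
 proof -
  have "(avg S f) ^ 32 = ((avg S f) ^ 4) ^ 8" by simp
  also have "\<dots> \<le> (avg S (\<lambda>s. (f s) ^ 4)) ^ 8" by (rule power_mono[OF avg_pow4]) simp
  also have "\<dots> \<le> avg S (\<lambda>s. ((f s) ^ 4) ^ 8)" by (rule avg_pow8)
  finally show ?thesis by simp
 qed
 have "(1 / T) ^ 32 \<le> (avg {1..H} (\<lambda>k. avg ?C (\<lambda>s. ?L k s))) ^ 32"
  using big T by (intro power_mono) (auto simp: T_def)
 also have "\<dots> \<le> avg {1..H} (\<lambda>k. (avg ?C (\<lambda>s. ?L k s)) ^ 32)" by (rule pow32)
 also have "\<dots> \<le> avg {1..H} (\<lambda>k. avg ?C (\<lambda>s. (?L k s) ^ 32))" by (rule avg_mono, rule pow32)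
 also have "\<dots> \<le> avg {1..H} (\<lambda>k. avg ?C (\<lambda>s. ?E k))"
 proof (intro avg_mono)
  fix k s assume "k \<in> {1..H}"
  then have k: "1 \<le> k" by simp
  show "(?L k s) ^ 32 \<le> ?E k"
   unfolding avg2_def by (rule pet[OF b0 b1 b2 p0 p1 p2 q2 q1 k])
 qed
 also have "\<dots> = avg {1..H} ?E" by (simp only: avg_const[OF finite_atLeastLessThan_int Hne(5)])
 also have "\<dots> \<le> avg {1..H} (\<lambda>k. 1 / T ^ 36 + (avg2 ?I (?bd k) + 1 / T ^ 34) + card MA * (1 / T ^ 410 + card MB * ?Z k))"
  by (rule avg_mono, rule step4)
 also have "\<dots> = 1 / T ^ 36 + (avg {1..H} (\<lambda>k. avg2 ?I (?bd k)) + 1 / T ^ 34) + card MA * (1 / T ^ 410 + card MB * avg {1..H} ?Z)"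
 proof -
  have ne: "{1..H} \<noteq> {}" using H0 by simp
  show ?thesis by (simp only: avg_add avg_cmult avg_const[OF finite_atLeastAtMost_int ne])
 qed
 finally have main: "(1 / T) ^ 32 \<le> 1 / T ^ 36 + (avg {1..H} (\<lambda>k. avg2 ?I (?bd k)) + 1 / T ^ 34) + card MA * (1 / T ^ 410 + card MB * avg {1..H} ?Z)" .
 have bad: "avg {1..H} (\<lambda>k. avg2 ?I (?bd k)) \<le> 15 / T ^ 36"
 proof -
  have "avg {1..H} (\<lambda>k. avg2 ?I (?bd k)) \<le> 3 * Tb / H + 9 / (t ^ 36)"
   using t0 by (intro bad_pairs H0 Tb) auto
  also have "3 * Tb / H \<le> 3 * (H / T ^ 36 + 1) / H" using Tb(4) H0 by (intro divide_right_mono) auto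
  also have "\<dots> = 3 / T ^ 36 + 3 / H" using H0 by (simp add: add_divide_distrib)
  also have "3 / H \<le> 3 / T ^ 36"
  proof -
   have "T ^ 36 \<le> T ^ 1000" using T by (intro power_increasing) auto
   then show ?thesis using HT H0 T1[of 36] by (intro divide_left_mono) auto
  qed
  finally show ?thesis by (simp add: T_def)
 qed
 \<comment> \<open>The threshold 1/T^410 used for MB is this bound times a further T^36, so that the
   discarded mass, summed over MA, is again 1/T^36.\<close>
 have cMA: "real (card MA) \<le> T ^ 374"
 proof -
  let ?\<kappa> = "8 * T ^ 71 / (real_of_int H)\<^sup>2"
  have H2: "T ^ 1000 \<le> (real_of_int H)\<^sup>2" using HT T1(1)[of 1000] mult_mono[of 1 "real_of_int H" "T ^ 1000" "real_of_int H"] by (simp add: power2_eq_square)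
  have "8 * T ^ 71 \<le> T ^ 1000" using T by (intro power_absorb[where a = 1]) auto
  then have k1: "?\<kappa> \<le> 1" using H2 H0 by (simp add: divide_le_eq)
  have "?\<kappa> * n \<le> ?\<kappa> * (T ^ 158 * (real_of_int H)\<^sup>2)" using nT T1[of 71] by (intro mult_left_mono) auto
  also have "\<dots> = 8 * T ^ 229" using H0 by (simp flip: power_add)
  finally have k2: "2 * ?\<kappa> * n + 1 \<le> 17 * T ^ 229" using T1(1)[of 229] by simp
  have "1 \<le> t" using t0 by linarith
  from one_le_power[OF this, of 72] have q1: "1 \<le> 4 * t ^ 72" by linarith
  have e3: "real_of_int (2 * (4 * t ^ 72) + 3) \<le> 11 * T ^ 72" using T1(1)[of 72] by (simp flip: T_def)
  have k0: "0 \<le> ?\<kappa>" using T1[of 71] by simp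
  have "real (card MA) \<le> real_of_int (4 * t ^ 72) * real_of_int (2 * (4 * t ^ 72) + 3) * (2 * ?\<kappa> * n + 1)"
   unfolding MA_def using card_arcs[OF n(1) q1 k0 k1] by (simp only: of_int_mult of_int_add of_int_numeral of_int_power)
  also have "\<dots> \<le> (4 * T ^ 72) * (11 * T ^ 72) * (17 * T ^ 229)"
   using k2 e3 T1[of 72] T1[of 71] n by (intro mult_mono) (auto simp flip: T_def)
  also have "\<dots> = 748 * T ^ 373" by (simp flip: power_add)
  also have "\<dots> \<le> T ^ 374" using T by (intro power_absorb[where a = 1]) auto
  finally show ?thesis .
 qed
 have cMB: "real (card MB) \<le> T ^ 2472"
 proof -
  let ?\<kappa> = "2 ^ 16 * T ^ 1640 / (real_of_int M)\<^sup>2"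
  have M2: "T ^ 2000 \<le> (real_of_int M)\<^sup>2"
  proof -
   have "T ^ 1000 \<le> real_of_int M" unfolding rM using HT T1[of 74] mult_mono[of 1 "T ^ 74" "T ^ 1000" "real_of_int H"] by simp
   then have "(T ^ 1000)\<^sup>2 \<le> (real_of_int M)\<^sup>2" using T1 by (intro power_mono) (auto intro: less_imp_le)
   then show ?thesis by (simp flip: power_mult)
  qed
  have "2 ^ 16 * T ^ 1640 \<le> T ^ 2000" using T by (intro power_absorb[where a = 1]) auto
  then have k1: "?\<kappa> \<le> 1" using M2 M0 by (simp add: divide_le_eq)
  have "real_of_int n \<le> T ^ 10 * (real_of_int M)\<^sup>2"
  proof -
   have "real_of_int n \<le> real_of_int (t ^ 10 * M\<^sup>2)" using n by (simp only: of_int_le_iff)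
   then show ?thesis by (simp add: T_def)
  qed
  then have "?\<kappa> * n \<le> ?\<kappa> * (T ^ 10 * (real_of_int M)\<^sup>2)" using T1[of 1640] by (intro mult_left_mono) auto
  also have "\<dots> = 2 ^ 16 * T ^ 1650" using M0 by (simp flip: power_add)
  finally have k2: "2 * ?\<kappa> * n + 1 \<le> 2 ^ 18 * T ^ 1650" using T1(1)[of 1650] by simp
  have "1 \<le> t" using t0 by linarith
  from one_le_power[OF this, of 410] have q1: "1 \<le> 32 * t ^ 410" by linarith
  have e3: "real_of_int (2 * (32 * t ^ 410) + 3) \<le> 67 * T ^ 410" using T1(1)[of 410] by (simp flip: T_def)
  have k0: "0 \<le> ?\<kappa>" using T1[of 1640] by simp
  have "real (card MB) \<le> real_of_int (32 * t ^ 410) * real_of_int (2 * (32 * t ^ 410) + 3) * (2 * ?\<kappa> * n + 1)"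
   unfolding MB_def using card_arcs[OF n(1) q1 k0 k1] by (simp only: of_int_mult of_int_add of_int_numeral of_int_power)
  also have "\<dots> \<le> (32 * T ^ 410) * (67 * T ^ 410) * (2 ^ 18 * T ^ 1650)"
   using k2 e3 T1[of 410] T1[of 1640] n by (intro mult_mono) (auto simp flip: T_def)
  also have "\<dots> = (32 * 67 * 2 ^ 18) * T ^ 2470" by (simp flip: power_add)
  also have "\<dots> \<le> T ^ 2472"
  proof (rule power_absorb[where a = 2])
   have "(2 ^ 20) ^ 2 \<le> T ^ 2" using T by (intro power_mono) auto
   then show "32 * 67 * 2 ^ 18 \<le> T ^ 2" by simp
  qed (use T in auto)
  finally show ?thesis .
 qed
 let ?c = "avg {1..H} ?Z"
 have c0: "0 \<le> ?c" by (intro avg_nonneg avg2_nonneg mx_nonneg n)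
 have "card MA * (1 / T ^ 410 + card MB * ?c) \<le> T ^ 374 * (1 / T ^ 410 + T ^ 2472 * ?c)"
  using cMA cMB c0 T1[of 374] T1[of 410] by (intro mult_mono add_mono mult_right_mono add_nonneg_nonneg) auto
 also have "\<dots> = 1 / T ^ 36 + T ^ 2846 * ?c"
 proof -
  have "T ^ 410 = T ^ 374 * T ^ 36" by (simp flip: power_add)
  moreover have gen: "\<And>x y :: real. x \<noteq> 0 \<Longrightarrow> x * (1 / (x * y)) = 1 / y" by simp
  have nz: "T ^ 374 \<noteq> 0" using T by simp
  ultimately have "T ^ 374 * (1 / T ^ 410) = 1 / T ^ 36" by (simp only: gen[OF nz])
  then show ?thesis by (simp add: distrib_left flip: power_add)
 qed
 finally have "1 / T ^ 32 \<le> 17 / T ^ 36 + 1 / T ^ 34 + T ^ 2846 * ?c"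
  using main bad by (simp add: power_one_over)
 moreover have "17 / T ^ 36 + 1 / T ^ 34 \<le> (1 / 2) * (1 / T ^ 32)"
 proof -
  have e: "T ^ 36 = T ^ 32 * T ^ 4" "T ^ 34 = T ^ 32 * T\<^sup>2" by (simp_all flip: power_add)
  have "(2 ^ 20) ^ 4 \<le> T ^ 4" "(2 ^ 20) ^ 2 \<le> T ^ 2" using power_mono[OF T(1), of 4] power_mono[OF T(1), of 2] by simp_all
  then have "17 / T ^ 4 \<le> 1 / 4" "1 / T ^ 2 \<le> 1 / 4" using T1 by (auto simp: divide_le_eq)
  then have "17 / T ^ 4 + 1 / T ^ 2 \<le> 1 / 2" by linarith
  then have "(17 / T ^ 4 + 1 / T ^ 2) / T ^ 32 \<le> (1 / 2) / T ^ 32" using T1(2)[of 32] by (rule divide_right_mono[OF _ less_imp_le])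
  then show ?thesis unfolding e by (simp add: add_divide_distrib mult.commute)
 qed
 \<comment> \<open>The total loss is T^(32 + 374 + 2472) = T^2878 up to a factor 2, and 2900 leaves
   room for it.\<close>
 ultimately have "1 / T ^ 32 \<le> 2 * T ^ 2846 * ?c" by linarith
 then have "1 \<le> (2 * T ^ 2846 * ?c) * T ^ 32" using T1[of 32] by (simp add: divide_le_eq)
 also have "\<dots> = (2 * T ^ 2878) * ?c" by (simp flip: power_add)
 also have "\<dots> \<le> T ^ 2900 * ?c" using c0 T by (intro mult_right_mono power_absorb[where a = 1]) auto
 finally have "1 / T ^ 2900 \<le> ?c" using T1[of 2900] by (simp add: divide_le_eq mult.commute)
 then show ?thesis by (simp add: T_def)
qed

section \<open>Structure on major arcs\<close>

text \<open>The largest Fourier mass around a single centre \<zeta>, in the sense of the weight w.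
  This is what remains of the family of large derivatives when their frequencies cluster.\<close>

definition vx :: "int \<Rightarrow> (int \<Rightarrow> real) \<Rightarrow> (int \<Rightarrow> real) \<Rightarrow> real" where
 "vx n w g = Max ((\<lambda>\<zeta>. \<Sum>\<theta>\<in>{0..<n}. (norm (ft n g \<theta>))\<^sup>2 * w (\<theta> - \<zeta>)) ` {0..<n})"

lemma vx_ge: "\<zeta> \<in> {0..<n} \<Longrightarrow> (\<Sum>\<theta>\<in>{0..<n}. (norm (ft n g \<theta>))\<^sup>2 * w (\<theta> - \<zeta>)) \<le> vx n w g"
 unfolding vx_def by (intro Max_ge) auto

lemma vx_attained: "0 < n \<Longrightarrow> \<exists>\<zeta>\<in>{0..<n}. vx n w g = (\<Sum>\<theta>\<in>{0..<n}. (norm (ft n g \<theta>))\<^sup>2 * w (\<theta> - \<zeta>))"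
proof -
 assume n: "0 < n"
 have "vx n w g \<in> (\<lambda>\<zeta>. \<Sum>\<theta>\<in>{0..<n}. (norm (ft n g \<theta>))\<^sup>2 * w (\<theta> - \<zeta>)) ` {0..<n}"
  unfolding vx_def using n by (intro Max_in) auto
 then show ?thesis by auto
qed

text \<open>The dual function in window coordinates: \<gamma> acts only in x, since the factor
  \<gamma>^2 in y is already part of the window. The displacement is dv \<omega> + c, with c uniform
  on an interval so that it can be translated as in \<open>major_arc\<close>.\<close>

definition conf :: "'w set \<Rightarrow> ('w \<Rightarrow> int) \<Rightarrow> int \<Rightarrow> int \<Rightarrow> (int \<Rightarrow> int \<Rightarrow> real) \<Rightarrow> (int \<Rightarrow> int \<Rightarrow> real) \<Rightarrow> int \<Rightarrow> int \<Rightarrow> real" where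
 "conf \<Omega> dv M \<gamma> f0 f1 x y = avg \<Omega> (\<lambda>\<omega>. avg {0..<M} (\<lambda>c.
  f0 x (y - (dv \<omega> + c)\<^sup>2) * f1 (x + \<gamma> * (dv \<omega> + c)) (y - (dv \<omega> + c)\<^sup>2)))"

lemma conf_dual:
 fixes h :: "int \<Rightarrow> complex"
 assumes "\<And>x. per n (f0 x)" "\<And>x. per n (f1 x)" "per n h"
 shows "avg {0..<n} (\<lambda>y. h y * of_real (conf \<Omega> dv M \<gamma> f0 f1 x (y + s)))
  = avg \<Omega> (\<lambda>\<omega>. avg {0..<M} (\<lambda>c. avg {0..<n} (\<lambda>y. h (y + (dv \<omega> + c)\<^sup>2) * of_real (f0 x (y + s) * f1 (x + \<gamma> * (dv \<omega> + c)) (y + s)))))"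
proof -
 have "avg {0..<n} (\<lambda>y. h y * of_real (conf \<Omega> dv M \<gamma> f0 f1 x (y + s)))
  = avg {0..<n} (\<lambda>y. avg \<Omega> (\<lambda>\<omega>. avg {0..<M} (\<lambda>c. h y * of_real (f0 x (y + s - (dv \<omega> + c)\<^sup>2) * f1 (x + \<gamma> * (dv \<omega> + c)) (y + s - (dv \<omega> + c)\<^sup>2)))))"
  unfolding conf_def by (simp only: avg_of_real[symmetric] avg_cmult)
 also have "\<dots> = avg \<Omega> (\<lambda>\<omega>. avg {0..<n} (\<lambda>y. avg {0..<M} (\<lambda>c. h y * of_real (f0 x (y + s - (dv \<omega> + c)\<^sup>2) * f1 (x + \<gamma> * (dv \<omega> + c)) (y + s - (dv \<omega> + c)\<^sup>2)))))"
  by (rule avg_swap)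
 also have "\<dots> = avg \<Omega> (\<lambda>\<omega>. avg {0..<M} (\<lambda>c. avg {0..<n} (\<lambda>y. h y * of_real (f0 x (y + s - (dv \<omega> + c)\<^sup>2) * f1 (x + \<gamma> * (dv \<omega> + c)) (y + s - (dv \<omega> + c)\<^sup>2)))))"
  by (rule avg_cong, rule avg_swap)
 also have "\<dots> = avg \<Omega> (\<lambda>\<omega>. avg {0..<M} (\<lambda>c. avg {0..<n} (\<lambda>y. h (y + (dv \<omega> + c)\<^sup>2) * of_real (f0 x (y + s) * f1 (x + \<gamma> * (dv \<omega> + c)) (y + s)))))"
 proof (rule avg_cong, rule avg_cong)
  fix \<omega> c
  let ?d = "(dv \<omega> + c)\<^sup>2"
  let ?k = "\<lambda>y. h (y + ?d) * of_real (f0 x (y + s) * f1 (x + \<gamma> * (dv \<omega> + c)) (y + s))"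
  have sh: "y + n + a = (y + a) + n" for y a :: int by simp
  have "per n ?k"
   unfolding per_def sh by (simp only: perD[OF assms(1)] perD[OF assms(2)] perD[OF assms(3)] simp_thms)
  from avg_shift[OF this, of "- ?d"] show "avg {0..<n} (\<lambda>y. h y * of_real (f0 x (y + s - ?d) * f1 (x + \<gamma> * (dv \<omega> + c)) (y + s - ?d)))
   = avg {0..<n} ?k" by (simp add: algebra_simps)
 qed
 finally show ?thesis .
qed

lemma conf_bound: "(\<And>x y. \<bar>f0 x y\<bar> \<le> 1) \<Longrightarrow> (\<And>x y. \<bar>f1 x y\<bar> \<le> 1) \<Longrightarrow> \<bar>conf \<Omega> dv M \<gamma> f0 f1 x y\<bar> \<le> 1"
 unfolding conf_def by (intro abs_avg_bound abs_mult_le1) auto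

lemma conf_per: "per N f0 \<Longrightarrow> per N f1 \<Longrightarrow> conf \<Omega> dv M \<gamma> f0 f1 (x + N) y = conf \<Omega> dv M \<gamma> f0 f1 x y"
proof -
 assume p: "per N f0" "per N f1"
 have sh: "x + N + a = (x + a) + N" for a by simp
 show ?thesis unfolding conf_def sh by (simp only: perD[OF p(1)] perD[OF p(2)])
qed

lemma conf_per_n: "(\<And>x. per n (f0 x)) \<Longrightarrow> (\<And>x. per n (f1 x)) \<Longrightarrow> per n (conf \<Omega> dv M \<gamma> f0 f1 x)"
proof -
 assume p: "\<And>x. per n (f0 x)" "\<And>x. per n (f1 x)"
 have sh: "y + n - a = (y - a) + n" for a y by simp
 show ?thesis unfolding conf_def per_def sh by (simp only: perD[OF p(1)] perD[OF p(2)] simp_thms)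
qed

text \<open>The half difference combines translates of G with total weight at most 1, so it cannot
  correlate with a more than the best translate does. This allows one copy of R to be replaced by a
  shifted F.\<close>

lemma half_diff_witness:
 fixes a :: "'z \<Rightarrow> complex" and G :: "'z \<Rightarrow> int \<Rightarrow> real"
 assumes S: "finite S" "S \<noteq> {}"
  and big: "c \<le> norm (avg Z (\<lambda>z. a z * of_real ((G z 0 - avg2 S (\<lambda>l l'. G z (v * (l' - l)))) / 2)))"
 shows "\<exists>w. c \<le> norm (avg Z (\<lambda>z. a z * of_real (G z w)))"
proof (rule ccontr)
 let ?\<Phi> = "\<lambda>w. avg Z (\<lambda>z. a z * of_real (G z w))"
 assume "\<not> ?thesis"
 then have lt: "norm (?\<Phi> w) < c" for w by (auto simp: not_le)
 then have c: "0 < c" using order_le_less_trans[OF norm_ge_zero] by blast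
 have e: "avg2 S (\<lambda>l l'. a z * of_real (G z (v * (l' - l)))) = a z * of_real (avg2 S (\<lambda>l l'. G z (v * (l' - l))))" for z
  unfolding avg2_def avg_cmult avg_of_real ..
 have "avg Z (\<lambda>z. a z * of_real ((G z 0 - avg2 S (\<lambda>l l'. G z (v * (l' - l)))) / 2))
  = avg Z (\<lambda>z. (1 / 2) * (a z * of_real (G z 0) - avg2 S (\<lambda>l l'. a z * of_real (G z (v * (l' - l))))))"
  unfolding e by (rule avg_cong) (simp add: right_diff_distrib)
 also have "\<dots> = (1 / 2) * (?\<Phi> 0 - avg2 S (\<lambda>l l'. ?\<Phi> (v * (l' - l))))"
  by (simp only: avg_cmult avg_diff avg_avg2_swap)
 also have "norm \<dots> = (1 / 2) * norm (?\<Phi> 0 - avg2 S (\<lambda>l l'. ?\<Phi> (v * (l' - l))))"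
  by (simp add: norm_mult)
 also have "\<dots> \<le> (1 / 2) * (norm (?\<Phi> 0) + norm (avg2 S (\<lambda>l l'. ?\<Phi> (v * (l' - l)))))"
  by (intro mult_left_mono norm_triangle_ineq4) simp
 also have "norm (avg2 S (\<lambda>l l'. ?\<Phi> (v * (l' - l)))) \<le> c"
  unfolding avg2_def by (rule norm_avg_bound, rule norm_avg_bound) (use lt c in \<open>auto intro: less_imp_le\<close>)
 also have "(1 / 2) * (norm (?\<Phi> 0) + c) < c" using lt[of 0] by simp
 finally show False using big by simp
qed

lemma norm_avg_sq: "of_real ((norm (avg P f))\<^sup>2) = avg P (\<lambda>p. avg P (\<lambda>p'. f p * cnj (f p')))"
 by (simp only: complex_norm_square avg_cnj[symmetric] avg_mult_avg)

lemma avg_cs_bounded: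
 fixes b :: "'p \<Rightarrow> 'z \<Rightarrow> complex"
 assumes r: "\<And>z. norm (r z) \<le> 1"
 shows "(norm (avg Z (\<lambda>z. r z * avg P (\<lambda>p. b p z))))\<^sup>2 \<le> avg P (\<lambda>p. avg P (\<lambda>p'. norm (avg Z (\<lambda>z. b p z * cnj (b p' z)))))"
proof -
 have "(norm (avg Z (\<lambda>z. r z * avg P (\<lambda>p. b p z))))\<^sup>2 \<le> avg Z (\<lambda>z. (norm (r z * avg P (\<lambda>p. b p z)))\<^sup>2)"
  by (rule avg_norm_square)
 also have "\<dots> \<le> avg Z (\<lambda>z. (norm (avg P (\<lambda>p. b p z)))\<^sup>2)"
 proof (intro avg_mono power_mono)
  fix z show "norm (r z * avg P (\<lambda>p. b p z)) \<le> norm (avg P (\<lambda>p. b p z))"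
   unfolding norm_mult using r mult_right_mono[of "norm (r z)" 1] by auto
 qed simp
 also have "\<dots> = norm (of_real (avg Z (\<lambda>z. (norm (avg P (\<lambda>p. b p z)))\<^sup>2)) :: complex)"
  by (simp add: abs_of_nonneg avg_nonneg)
 also have "of_real (avg Z (\<lambda>z. (norm (avg P (\<lambda>p. b p z)))\<^sup>2)) = avg Z (\<lambda>z. avg P (\<lambda>p. avg P (\<lambda>p'. b p z * cnj (b p' z))))"
  unfolding avg_of_real[symmetric] norm_avg_sq ..
 also have "\<dots> = avg P (\<lambda>p. avg Z (\<lambda>z. avg P (\<lambda>p'. b p z * cnj (b p' z))))" by (rule avg_swap)
 also have "\<dots> = avg P (\<lambda>p. avg P (\<lambda>p'. avg Z (\<lambda>z. b p z * cnj (b p' z))))" by (rule avg_cong, rule avg_swap)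
 also have "norm \<dots> \<le> avg P (\<lambda>p. norm (avg P (\<lambda>p'. avg Z (\<lambda>z. b p z * cnj (b p' z)))))" by (rule norm_avg_le)
 also have "\<dots> \<le> avg P (\<lambda>p. avg P (\<lambda>p'. norm (avg Z (\<lambda>z. b p z * cnj (b p' z)))))" by (rule avg_mono, rule norm_avg_le)
 finally show ?thesis .
qed

text \<open>The points with U < \<rho> and the few exceptional points contribute at most \<rho>
  each; on the remaining points B holds.\<close>

lemma exceptional_split:
 fixes U T :: "int \<Rightarrow> real" and \<rho> :: real
 assumes N: "0 < N" and U: "\<And>x. 0 \<le> U x" "\<And>x. U x \<le> 1" and T: "\<And>x. 0 \<le> T x" "\<And>x. T x \<le> 1" and \<rho>: "0 \<le> \<rho>"
  and card: "card {x\<in>{0..<N}. \<rho> \<le> U x \<and> \<not> B x} \<le> \<rho> * N"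
 shows "avg {0..<N} (\<lambda>x. T x * U x) \<le> 2 * \<rho> + avg {0..<N} (\<lambda>x. if B x then T x else 0)"
proof -
 have "avg {0..<N} (\<lambda>x. T x * U x) \<le> avg {0..<N} (\<lambda>x. \<rho> + ((if \<rho> \<le> U x \<and> \<not> B x then 1 else 0) + (if B x then T x else 0)))"
 proof (rule avg_mono)
  fix x
  have 1: "T x * U x \<le> T x * 1" "T x * U x \<le> 1 * U x" using U T by (intro mult_left_mono mult_right_mono; simp)+
  show "T x * U x \<le> \<rho> + ((if \<rho> \<le> U x \<and> \<not> B x then 1 else 0) + (if B x then T x else 0))"
   using 1 T[of x] \<rho> by (auto simp: not_le)
 qed
 also have "\<dots> = \<rho> + (avg {0..<N} (\<lambda>x. if \<rho> \<le> U x \<and> \<not> B x then 1 else 0) + avg {0..<N} (\<lambda>x. if B x then T x else 0))"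
  using N by (simp add: avg_add avg_const)
 also have "avg {0..<N} (\<lambda>x. if \<rho> \<le> U x \<and> \<not> B x then 1 else 0) = card {x\<in>{0..<N}. \<rho> \<le> U x \<and> \<not> B x} / real_of_int N"
  using N by (simp add: avg_def sum.If_cases Int_def)
 also have "\<dots> \<le> \<rho>" using card N by (simp add: divide_le_eq)
 finally show ?thesis by simp
qed

text \<open>If the frequency chosen for a derivative lies in \<xi> + \<A>, its energy is one of the
  card \<A> energies at the fixed frequencies \<xi> + \<theta>. For a fixed frequency
  \<open>twisted_correlation\<close> bounds the average over all derivatives by the Fourier mass of
  g near one centre.\<close>

lemma cluster_weight:
 assumes n: "0 < n" and g: "per n g" "\<And>y. \<bar>g y\<bar> \<le> 1" and fin: "finite \<A>"
 shows "avg {1..H} (\<lambda>k. avg2 {0..<B} (\<lambda>b b'. if \<phi> k b b' - \<xi> \<in> \<A> then (norm (ft n (dl (u * k * (b' - b)) g) (\<phi> k b b')))\<^sup>2 else 0))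
  \<le> card \<A> * vx n (\<lambda>z. avg {1..H} (\<lambda>k. wt n {0..<B} (z * (u * k)))) g"
proof -
 let ?w = "\<lambda>z. avg {1..H} (\<lambda>k. wt n {0..<B} (z * (u * k)))"
 let ?p = "\<lambda>\<eta>. (norm (ft n g \<eta>))\<^sup>2"
 have "avg {1..H} (\<lambda>k. avg2 {0..<B} (\<lambda>b b'. if \<phi> k b b' - \<xi> \<in> \<A> then (norm (ft n (dl (u * k * (b' - b)) g) (\<phi> k b b')))\<^sup>2 else 0))
  \<le> avg {1..H} (\<lambda>k. avg2 {0..<B} (\<lambda>b b'. \<Sum>\<theta>\<in>\<A>. (norm (ft n (dl (u * k * (b' - b)) g) (\<xi> + \<theta>)))\<^sup>2))"
 proof (intro avg_mono avg2_mono)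
  fix k b b'
  let ?q = "\<lambda>\<theta>. (norm (ft n (dl (u * k * (b' - b)) g) (\<xi> + \<theta>)))\<^sup>2"
  show "(if \<phi> k b b' - \<xi> \<in> \<A> then (norm (ft n (dl (u * k * (b' - b)) g) (\<phi> k b b')))\<^sup>2 else 0) \<le> (\<Sum>\<theta>\<in>\<A>. ?q \<theta>)"
  proof (cases "\<phi> k b b' - \<xi> \<in> \<A>")
   case True
   then have "?q (\<phi> k b b' - \<xi>) \<le> (\<Sum>\<theta>\<in>\<A>. ?q \<theta>)" using fin by (intro member_le_sum) auto
   then show ?thesis using True by simp
  qed (simp add: sum_nonneg)
 qed
 also have "\<dots> = (\<Sum>\<theta>\<in>\<A>. avg {1..H} (\<lambda>k. avg2 {0..<B} (\<lambda>b b'. (norm (ft n (dl (u * k * (b' - b)) g) (\<xi> + \<theta>)))\<^sup>2)))"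
  by (simp only: avg2_sum avg_sum)
 also have "\<dots> \<le> (\<Sum>\<theta>\<in>\<A>. vx n ?w g)"
 proof (rule sum_mono)
  fix \<theta>
  have "avg {1..H} (\<lambda>k. avg2 {0..<B} (\<lambda>b b'. (norm (ft n (dl (u * k * (b' - b)) g) (\<xi> + \<theta>)))\<^sup>2))
   \<le> avg {1..H} (\<lambda>k. \<Sum>\<eta>\<in>{0..<n}. ?p \<eta> * (\<Sum>\<theta>\<in>{0..<n}. ?p \<theta> * wt n {0..<B} ((\<theta> - \<eta>) * (u * k))))"
   unfolding avg2_def by (rule avg_mono, rule twisted_correlation[OF n g(1)])
  also have "\<dots> = (\<Sum>\<eta>\<in>{0..<n}. ?p \<eta> * (\<Sum>\<theta>\<in>{0..<n}. ?p \<theta> * ?w (\<theta> - \<eta>)))"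
   by (simp only: avg_sum avg_cmult)
  also have "\<dots> \<le> (\<Sum>\<eta>\<in>{0..<n}. ?p \<eta> * vx n ?w g)"
   by (intro sum_mono mult_left_mono vx_ge) auto
  also have "\<dots> = (\<Sum>\<eta>\<in>{0..<n}. ?p \<eta>) * vx n ?w g" by (simp only: sum_distrib_right)
  also have "\<dots> \<le> 1 * vx n ?w g"
  proof (rule mult_right_mono[OF parseval_le[OF n g]])
   have "0 \<le> (\<Sum>\<theta>\<in>{0..<n}. ?p \<theta> * ?w (\<theta> - 0))"
    by (intro sum_nonneg mult_nonneg_nonneg avg_nonneg wt_nonneg) auto
   also have "\<dots> \<le> vx n ?w g" using n by (intro vx_ge) auto
   finally show "0 \<le> vx n ?w g" .
  qed
  finally show "avg {1..H} (\<lambda>k. avg2 {0..<B} (\<lambda>b b'. (norm (ft n (dl (u * k * (b' - b)) g) (\<xi> + \<theta>)))\<^sup>2)) \<le> vx n ?w g" by simp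
 qed
 finally show ?thesis by simp
qed

text \<open>The large coefficient of a derivative of R is a correlation of R with a shifted R and a
  character. The shifted copy is expanded through F, the other is discarded by Cauchy-Schwarz over
  (x, \<omega>, c, y), which pairs two derivatives p, p'. Their characters combine into a quadratic
  exponential in the displacement with frequency -(\<phi> x p - \<phi> x p')/n, and
  \<open>major_arc\<close> shows that this is major up to few x.\<close>

lemma phase_clustering:
 fixes \<Omega> :: "'w set" and dv :: "'w \<Rightarrow> int" and N M n \<gamma> v :: int and f0 f1 R :: "int \<Rightarrow> int \<Rightarrow> real" and P :: "'p set" and n1 :: "'p \<Rightarrow> int"
  and c \<rho> e :: real
 defines "\<rho> \<equiv> c\<^sup>2 / 8" and "e \<equiv> 4 / \<rho>\<^sup>2"
 assumes N: "0 < N" and n: "0 < n" and M: "2 ^ 86 * e ^ 34 \<le> M" and fin: "finite \<Omega>" "finite S" "S \<noteq> {}"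
  and p0: "per N f0" and p1: "per N f1" and pR: "per N R"
  and q0: "\<And>x. per n (f0 x)" and q1: "\<And>x. per n (f1 x)" and qR: "\<And>x. per n (R x)"
  and b0: "\<And>x y. \<bar>f0 x y\<bar> \<le> 1" and b1: "\<And>x y. \<bar>f1 x y\<bar> \<le> 1" and bR: "\<And>x y. \<bar>R x y\<bar> \<le> 1"
  and dv: "\<And>\<omega> c. \<omega> \<in> \<Omega> \<Longrightarrow> 0 \<le> c \<Longrightarrow> c < M \<Longrightarrow> \<bar>dv \<omega> + c\<bar> \<le> 3 * M"
  and R: "\<And>x y. R x y = (conf \<Omega> dv M \<gamma> f0 f1 x y - avg2 S (\<lambda>l l'. conf \<Omega> dv M \<gamma> f0 f1 x (y + v * (l' - l)))) / 2"
  and c: "0 < c" "c \<le> 1" and big: "c \<le> avg P (\<lambda>p. avg {0..<N} (\<lambda>x. mx n (dl (n1 p) (R x))))"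
 shows "\<exists>\<phi>. (\<forall>x p. \<phi> x p \<in> {0..<n}) \<and> c ^ 4 / 8 \<le> avg P (\<lambda>p'. avg P (\<lambda>p. avg {0..<N} (\<lambda>x.
   if \<phi> x p - \<phi> x p' \<in> arcs n \<lfloor>2 ^ 73 * e ^ 31\<rfloor> (2 ^ 164 * e ^ 68 / (real_of_int M)\<^sup>2) then (norm (ft n (dl (n1 p) (R x)) (\<phi> x p)))\<^sup>2 else 0)))"
proof -
 let ?F = "conf \<Omega> dv M \<gamma> f0 f1"
 let ?X = "{0..<N}" and ?Y = "{0..<n}" and ?C = "{0..<M}"
 let ?arc = "arcs n \<lfloor>2 ^ 73 * e ^ 31\<rfloor> (2 ^ 164 * e ^ 68 / (real_of_int M)\<^sup>2)"
 have \<rho>: "0 < \<rho>" "\<rho> \<le> 1" "\<rho> \<le> c\<^sup>2 / 8" using c power_le_one[of c 2] by (auto simp: \<rho>_def)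
 have e1: "\<rho>\<^sup>2 = 4 / e" using \<rho>(1) by (simp add: e_def)
 have e4: "4 \<le> e" using \<rho> power_le_one[of \<rho> 2] by (simp add: e_def le_divide_eq)
 define \<phi> where "\<phi> x p = (SOME \<eta>. \<eta> \<in> ?Y \<and> mx n (dl (n1 p) (R x)) = (norm (ft n (dl (n1 p) (R x)) \<eta>))\<^sup>2)" for x p
 have \<phi>: "\<phi> x p \<in> ?Y" "mx n (dl (n1 p) (R x)) = (norm (ft n (dl (n1 p) (R x)) (\<phi> x p)))\<^sup>2" for x p
  using someI_ex[of "\<lambda>\<eta>. \<eta> \<in> ?Y \<and> mx n (dl (n1 p) (R x)) = (norm (ft n (dl (n1 p) (R x)) \<eta>))\<^sup>2"] mx_attained[OF n, of "dl (n1 p) (R x)"]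
  unfolding \<phi>_def by blast+
 have p\<phi>: "\<phi> (x + N) p = \<phi> x p" for x p unfolding \<phi>_def perD[OF pR] ..
 define T where "T x p = ft n (dl (n1 p) (R x)) (\<phi> x p)" for x p
 have pT: "T (x + N) p = T x p" for x p unfolding T_def p\<phi> perD[OF pR] ..
 have T1: "norm (T x p) \<le> 1" for x p
  unfolding T_def ft_def using dl_bound[OF bR] by (intro norm_avg_bound) (auto simp: norm_mult)
 define a where "a = (\<lambda>(p, x, y). cnj (T x p) * of_real (R x y) * ch n (- (\<phi> x p * y)))"
 \<comment> \<open>One of the two factors T in |T|^2 is opened; the other stays as a bounded
   coefficient inside a.\<close>
 have "c \<le> norm (avg (P \<times> (?X \<times> ?Y)) (\<lambda>z. a z * of_real ((case z of (p, x, y) \<Rightarrow> R x (y + n1 p)))))"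
 proof -
  have "avg P (\<lambda>p. avg ?X (\<lambda>x. mx n (dl (n1 p) (R x)))) = norm (of_real (avg P (\<lambda>p. avg ?X (\<lambda>x. (norm (T x p))\<^sup>2))) :: complex)"
   unfolding \<phi>(2) T_def by (simp add: avg_nonneg)
  also have "of_real (avg P (\<lambda>p. avg ?X (\<lambda>x. (norm (T x p))\<^sup>2))) = avg P (\<lambda>p. avg ?X (\<lambda>x. cnj (T x p) * T x p))"
   unfolding avg_of_real[symmetric] complex_norm_square by (simp only: mult.commute)
  also have "\<dots> = avg P (\<lambda>p. avg ?X (\<lambda>x. avg ?Y (\<lambda>y. a (p, x, y) * of_real (R x (y + n1 p)))))"
  proof (rule avg_cong, rule avg_cong)
   fix p x
   have "cnj (T x p) * T x p = avg ?Y (\<lambda>y. cnj (T x p) * (of_real (dl (n1 p) (R x) y) * ch n (- (\<phi> x p * y))))"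
    unfolding T_def ft_def avg_cmult ..
   also have "\<dots> = avg ?Y (\<lambda>y. a (p, x, y) * of_real (R x (y + n1 p)))"
    by (rule avg_cong) (simp add: a_def dl_def)
   finally show "cnj (T x p) * T x p = avg ?Y (\<lambda>y. a (p, x, y) * of_real (R x (y + n1 p)))" .
  qed
  also have "\<dots> = avg (P \<times> (?X \<times> ?Y)) (\<lambda>z. a z * of_real ((case z of (p, x, y) \<Rightarrow> R x (y + n1 p))))"
   by (simp only: avg_Times prod.case)
  finally show ?thesis using big by simp
 qed
 also have "(\<lambda>z. a z * of_real ((case z of (p, x, y) \<Rightarrow> R x (y + n1 p))))
  = (\<lambda>z. a z * of_real (((case z of (p, x, y) \<Rightarrow> (\<lambda>w. ?F x (y + n1 p + w))) 0 - avg2 S (\<lambda>l l'. (case z of (p, x, y) \<Rightarrow> (\<lambda>w. ?F x (y + n1 p + w))) (v * (l' - l)))) / 2))"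
  by (auto simp: R fun_eq_iff)
 finally obtain w where "c \<le> norm (avg (P \<times> (?X \<times> ?Y)) (\<lambda>z. a z * of_real ((case z of (p, x, y) \<Rightarrow> (\<lambda>w. ?F x (y + n1 p + w))) w)))"
  using half_diff_witness[OF fin(2,3), where G = "\<lambda>z. case z of (p, x, y) \<Rightarrow> (\<lambda>w. ?F x (y + n1 p + w))"] by blast
 then have cw: "c \<le> norm (avg P (\<lambda>p. avg ?X (\<lambda>x. avg ?Y (\<lambda>y. a (p, x, y) * of_real (?F x (y + (n1 p + w)))))))"
  by (simp only: avg_Times prod.case add.assoc)
 define s where "s p = n1 p + w" for p
 define b where "b p = (\<lambda>(x, \<omega>, cc, y). cnj (T x p) * ch n (- (\<phi> x p * (y + (dv \<omega> + cc)\<^sup>2))) * of_real (f0 x (y + s p) * f1 (x + \<gamma> * (dv \<omega> + cc)) (y + s p)))" for p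
 define r where "r = (\<lambda>(x, \<omega>, cc, y). of_real (R x (y + (dv \<omega> + cc)\<^sup>2)) :: complex)"
 let ?Z = "?X \<times> (\<Omega> \<times> (?C \<times> ?Y))"
 have "avg P (\<lambda>p. avg ?X (\<lambda>x. avg ?Y (\<lambda>y. a (p, x, y) * of_real (?F x (y + (n1 p + w))))))
  = avg P (\<lambda>p. avg ?Z (\<lambda>z. r z * b p z))"
 proof (rule avg_cong)
  fix p
  have "avg ?X (\<lambda>x. avg ?Y (\<lambda>y. a (p, x, y) * of_real (?F x (y + (n1 p + w)))))
   = avg ?X (\<lambda>x. avg \<Omega> (\<lambda>\<omega>. avg ?C (\<lambda>cc. avg ?Y (\<lambda>y. a (p, x, y + (dv \<omega> + cc)\<^sup>2) * of_real (f0 x (y + (n1 p + w)) * f1 (x + \<gamma> * (dv \<omega> + cc)) (y + (n1 p + w)))))))"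
  proof (rule avg_cong)
   fix x
   have "- (\<phi> x p * (y + n)) = - (\<phi> x p * y) + n * (- \<phi> x p)" for y by (simp add: algebra_simps)
   then have "ch n (- (\<phi> x p * (y + n))) = ch n (- (\<phi> x p * y))" for y by (simp only: ch_period[OF n])
   then have "per n (\<lambda>y. a (p, x, y))" unfolding per_def a_def prod.case by (simp only: perD[OF qR] simp_thms)
   from conf_dual[OF q0 q1 this, where s = "n1 p + w"]
   show "avg ?Y (\<lambda>y. a (p, x, y) * of_real (?F x (y + (n1 p + w)))) = avg \<Omega> (\<lambda>\<omega>. avg ?C (\<lambda>cc. avg ?Y (\<lambda>y. a (p, x, y + (dv \<omega> + cc)\<^sup>2) * of_real (f0 x (y + (n1 p + w)) * f1 (x + \<gamma> * (dv \<omega> + cc)) (y + (n1 p + w))))))" .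
  qed
  also have "\<dots> = avg ?Z (\<lambda>z. r z * b p z)"
   unfolding avg_Times by (rule avg_cong, rule avg_cong, rule avg_cong, rule avg_cong) (simp add: a_def r_def b_def s_def mult_ac)
  finally show "avg ?X (\<lambda>x. avg ?Y (\<lambda>y. a (p, x, y) * of_real (?F x (y + (n1 p + w))))) = avg ?Z (\<lambda>z. r z * b p z)" .
 qed
 also have "\<dots> = avg ?Z (\<lambda>z. r z * avg P (\<lambda>p. b p z))" by (subst avg_swap) (simp only: avg_cmult)
 finally have "c \<le> norm (avg ?Z (\<lambda>z. r z * avg P (\<lambda>p. b p z)))" using cw by simp
 then have "c\<^sup>2 \<le> (norm (avg ?Z (\<lambda>z. r z * avg P (\<lambda>p. b p z))))\<^sup>2" using c by (intro power_mono) auto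
 also have "\<dots> \<le> avg P (\<lambda>p. avg P (\<lambda>p'. norm (avg ?Z (\<lambda>z. b p z * cnj (b p' z)))))"
  using bR by (intro avg_cs_bounded) (auto simp: r_def)
 also have "\<dots> \<le> avg P (\<lambda>p. avg P (\<lambda>p'. (c\<^sup>2 / 2) + (4 / c\<^sup>2) * avg ?X (\<lambda>x. if \<phi> x p - \<phi> x p' \<in> ?arc then (norm (T x p))\<^sup>2 else 0)))"
 proof (rule avg_mono, rule avg_mono)
  fix p p'
  define \<zeta> where "\<zeta> x = - (real_of_int (\<phi> x p - \<phi> x p') / n)" for x
  define h0 where "h0 x y = ch n (- ((\<phi> x p - \<phi> x p') * y)) * of_real (f0 x (y + s p) * f0 x (y + s p'))" for x y
  define h1 where "h1 x y = (of_real (f1 x (y + s p) * f1 x (y + s p')) :: complex)" for x y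
  \<comment> \<open>A constant g satisfies \<open>slow\<close> trivially, so
    \<open>major_arc\<close> applies with Q1 = 1 and gives information on the difference of
    frequencies itself.\<close>
  define g where "g x y = (1 :: complex)" for x y :: int
  let ?U = "\<lambda>x. norm (avg \<Omega> (\<lambda>\<omega>. avg ?C (\<lambda>cc. avg ?Y (\<lambda>y.
   h0 x y * h1 (x + \<gamma> * (dv \<omega> + cc)) y * ee (\<zeta> x * of_int ((dv \<omega> + cc)\<^sup>2)) * g x (y + (dv \<omega> + cc)\<^sup>2)))))"
  have nh: "norm (h0 x y) \<le> 1" "norm (h1 x y) \<le> 1" for x y
   unfolding h0_def h1_def norm_mult norm_ch norm_of_real by (simp_all add: b0 b1 mult_le_one abs_mult)
  have inner: "b p (x, \<omega>, cc, y) * cnj (b p' (x, \<omega>, cc, y)) = (cnj (T x p) * T x p') * (h0 x y * h1 (x + \<gamma> * (dv \<omega> + cc)) y * ee (\<zeta> x * of_int ((dv \<omega> + cc)\<^sup>2)) * g x (y + (dv \<omega> + cc)\<^sup>2))"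
   for x \<omega> cc y
  proof -
   have "ch n (- (\<phi> x p * (y + (dv \<omega> + cc)\<^sup>2))) * cnj (ch n (- (\<phi> x p' * (y + (dv \<omega> + cc)\<^sup>2)))) = ch n (- ((\<phi> x p - \<phi> x p') * y) + (- ((\<phi> x p - \<phi> x p') * (dv \<omega> + cc)\<^sup>2)))"
    unfolding cnj_ch ch_add[symmetric] by (rule arg_cong[of _ _ "ch n"]) (simp add: algebra_simps)
   also have "\<dots> = ch n (- ((\<phi> x p - \<phi> x p') * y)) * ee (\<zeta> x * of_int ((dv \<omega> + cc)\<^sup>2))"
    unfolding ch_add by (simp add: ch_def \<zeta>_def)
   finally have eq: "ch n (- (\<phi> x p * (y + (dv \<omega> + cc)\<^sup>2))) * cnj (ch n (- (\<phi> x p' * (y + (dv \<omega> + cc)\<^sup>2)))) = ch n (- ((\<phi> x p - \<phi> x p') * y)) * ee (\<zeta> x * of_int ((dv \<omega> + cc)\<^sup>2))" .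
   have "b p (x, \<omega>, cc, y) * cnj (b p' (x, \<omega>, cc, y)) = (cnj (T x p) * T x p') * (ch n (- (\<phi> x p * (y + (dv \<omega> + cc)\<^sup>2))) * cnj (ch n (- (\<phi> x p' * (y + (dv \<omega> + cc)\<^sup>2)))))
    * (of_real (f0 x (y + s p) * f1 (x + \<gamma> * (dv \<omega> + cc)) (y + s p)) * of_real (f0 x (y + s p') * f1 (x + \<gamma> * (dv \<omega> + cc)) (y + s p')))"
    unfolding b_def prod.case complex_cnj_mult complex_cnj_cnj complex_cnj_complex_of_real by (simp only: mult_ac)
   also have "\<dots> = (cnj (T x p) * T x p') * (h0 x y * h1 (x + \<gamma> * (dv \<omega> + cc)) y * ee (\<zeta> x * of_int ((dv \<omega> + cc)\<^sup>2)) * g x (y + (dv \<omega> + cc)\<^sup>2))"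
    unfolding eq h0_def h1_def g_def of_real_mult by (simp only: mult_ac mult_1_right mult_1_left)
   finally show ?thesis .
  qed
  have eqZ: "avg ?Z (\<lambda>z. b p z * cnj (b p' z)) = avg ?X (\<lambda>x. (cnj (T x p) * T x p') * avg \<Omega> (\<lambda>\<omega>. avg ?C (\<lambda>cc. avg ?Y (\<lambda>y.
    h0 x y * h1 (x + \<gamma> * (dv \<omega> + cc)) y * ee (\<zeta> x * of_int ((dv \<omega> + cc)\<^sup>2)) * g x (y + (dv \<omega> + cc)\<^sup>2)))))"
   unfolding avg_Times inner avg_cmult ..
  have drop: "norm ((cnj (T x p) * T x p') * Q) \<le> norm (T x p) * norm Q" for x Q
  proof -
   have "norm (T x p) * norm (T x p') \<le> norm (T x p) * 1" using T1 by (intro mult_left_mono) auto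
   then show ?thesis unfolding norm_mult complex_mod_cnj by (intro mult_right_mono) auto
  qed
  have "norm (avg ?Z (\<lambda>z. b p z * cnj (b p' z))) \<le> avg ?X (\<lambda>x. norm (T x p) * ?U x)"
   unfolding eqZ by (rule order_trans[OF norm_avg_le], rule avg_mono, rule drop)
  also have "\<dots> \<le> 2 * \<rho> + avg ?X (\<lambda>x. if \<phi> x p - \<phi> x p' \<in> ?arc then norm (T x p) else 0)"
  proof (rule exceptional_split[OF N])
   show "?U x \<le> 1" for x
    by (rule norm_avg_bound, rule norm_avg_bound, rule norm_avg_bound) (simp_all add: norm_mult g_def nh mult_le_one)
   \<comment> \<open>Up to rounding, the largest length allowed by 8D \<le> \<rho>^2 M, as \<rho>^2
     = 4/e. A long D gives narrow arcs.\<close>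
   define D where "D = \<lfloor>M / (2 * e)\<rfloor>"
   have eM: "2 ^ 85 * e ^ 33 \<le> M / (2 * e)"
   proof -
    have "2 ^ 85 * e ^ 33 * (2 * e) = 2 ^ 86 * e ^ 34" by (simp flip: power_Suc2)
    then show ?thesis using M e4 by (simp add: le_divide_eq)
   qed
   have e33: "1 \<le> e ^ 33" using e4 by (intro one_le_power) auto
   have D: "D \<le> M / (2 * e)" "M / (4 * e) \<le> D" "0 < D"
   proof -
    have "2 * 1 \<le> (2::real) ^ 85 * e ^ 33" using e33 by (intro mult_mono) auto
    then have "2 \<le> M / (2 * e)" using eM by linarith
    moreover have "M / (4 * e) = M / (2 * e) / 2" by simp
    ultimately show "D \<le> M / (2 * e)" "M / (4 * e) \<le> D" "0 < D" unfolding D_def by linarith+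
   qed
   have M0: "0 < M" using D e4 by (smt (verit) divide_nonpos_pos of_int_0_less_iff of_int_le_0_iff mult_pos_pos)
   have r1: "\<rho>\<^sup>2 / 4 = 1 / e" using e1 by simp
   have "card {x\<in>?X. \<rho> \<le> ?U x \<and> \<not> maj (2 ^ 73 / (\<rho>\<^sup>2 / 4) ^ 31) (2 ^ 148 * (64 * e\<^sup>2)\<^sup>2 / ((\<rho>\<^sup>2 / 4) ^ 62 * of_int (D\<^sup>2))) (of_int (1 ^ 3) * \<zeta> x)} \<le> \<rho> * N"
   proof (rule major_arc[OF N M0 D(3) _ \<rho>(1,2) fin(1)])
    show "per N h0" "per N h1" "per N g" "per N \<zeta>"
     unfolding per_def h0_def h1_def g_def \<zeta>_def by (simp_all only: p\<phi> perD[OF p0] perD[OF p1] simp_thms)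
    have "8 * D \<le> 8 * (M / (2 * e))" using D(1) by simp
    then show "real_of_int (8 * (1 * D)) \<le> \<rho>\<^sup>2 * real_of_int M" unfolding e1 by simp
    have "3 * M / D \<le> 12 * e"
    proof -
     have "M \<le> 4 * e * D" using D(2) e4 by (simp add: divide_le_eq mult_ac)
     then show ?thesis using D(3) by (simp add: divide_le_eq)
    qed
    moreover have "12 * e \<le> 48 * (e * e)" using e4 mult_mono[of 1 e e e] by simp
    moreover have "real_of_int (16 * 1) / (\<rho>\<^sup>2 / 4)\<^sup>2 = 16 * (e * e)" unfolding r1 by (simp add: power_one_over power2_eq_square)
    moreover have "real_of_int (3 * M) = 3 * real_of_int M" "64 * e\<^sup>2 = 64 * (e * e)" by (simp_all add: power2_eq_square)
    ultimately show "real_of_int (16 * 1) / (\<rho>\<^sup>2 / 4)\<^sup>2 + real_of_int (3 * M) / real_of_int D \<le> 64 * e\<^sup>2"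
     by linarith
    have "2 ^ 78 * (64 * e\<^sup>2) * e ^ 31 = 2 ^ 85 * e ^ 33 / 2" by (simp flip: power_add)
    also have "\<dots> \<le> M / (2 * e) / 2" using eM by simp
    also have "\<dots> \<le> D" using D(2) by simp
    finally show "2 ^ 78 * (64 * e\<^sup>2) / (\<rho>\<^sup>2 / 4) ^ 31 \<le> real_of_int D" unfolding r1 by (simp add: power_one_over)
   qed (use nh dv \<rho> in \<open>auto simp: g_def\<close>)
   moreover have "\<phi> x p - \<phi> x p' \<in> ?arc" if mj: "maj (2 ^ 73 / (\<rho>\<^sup>2 / 4) ^ 31) (2 ^ 148 * (64 * e\<^sup>2)\<^sup>2 / ((\<rho>\<^sup>2 / 4) ^ 62 * of_int (D\<^sup>2))) (of_int (1 ^ 3) * \<zeta> x)" for x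
   proof -
    obtain q :: int where q: "(1::int) \<le> q" "of_int q \<le> 2 ^ 73 / (\<rho>\<^sup>2 / 4) ^ 31" "near (2 ^ 148 * (64 * e\<^sup>2)\<^sup>2 / ((\<rho>\<^sup>2 / 4) ^ 62 * of_int (D\<^sup>2))) (of_int q * (of_int (1 ^ 3) * \<zeta> x))"
     using mj[unfolded maj_def] by blast
    have "near (2 ^ 148 * (64 * e\<^sup>2)\<^sup>2 / ((\<rho>\<^sup>2 / 4) ^ 62 * of_int (D\<^sup>2))) (q * (real_of_int (\<phi> x p - \<phi> x p') / n))"
     using near_minus[OF q(3)] by (simp add: \<zeta>_def)
    moreover have "2 ^ 148 * (64 * e\<^sup>2)\<^sup>2 / ((\<rho>\<^sup>2 / 4) ^ 62 * of_int (D\<^sup>2)) \<le> 2 ^ 164 * e ^ 68 / (real_of_int M)\<^sup>2"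
    proof -
     have "(M / (4 * e))\<^sup>2 \<le> (real_of_int D)\<^sup>2" using D(2) M0 e4 by (intro power_mono) auto
     then have "2 ^ 160 * e ^ 66 / (real_of_int D)\<^sup>2 \<le> 2 ^ 160 * e ^ 66 / (M / (4 * e))\<^sup>2"
      using e4 M0 D(3) by (intro divide_left_mono) auto
     also have "\<dots> = 2 ^ 164 * (e ^ 66 * e\<^sup>2) / (real_of_int M)\<^sup>2" by (simp add: power_divide power_mult_distrib)
     also have "\<dots> = 2 ^ 164 * e ^ 68 / (real_of_int M)\<^sup>2" by (simp flip: power_add)
     finally have "2 ^ 160 * e ^ 66 / (real_of_int D)\<^sup>2 \<le> 2 ^ 164 * e ^ 68 / (real_of_int M)\<^sup>2" .
     moreover have "2 ^ 148 * (64 * e\<^sup>2)\<^sup>2 / ((\<rho>\<^sup>2 / 4) ^ 62 * of_int (D\<^sup>2)) = 2 ^ 160 * (e ^ 4 * e ^ 62) / (real_of_int D)\<^sup>2"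
      unfolding r1 by (simp add: power_one_over power_mult_distrib flip: power_mult)
     ultimately show ?thesis by (simp flip: power_add)
    qed
    ultimately have "near (2 ^ 164 * e ^ 68 / (real_of_int M)\<^sup>2) (q * (real_of_int (\<phi> x p - \<phi> x p') / n))" by (rule near_mono)
    moreover have "q \<le> \<lfloor>2 ^ 73 * e ^ 31\<rfloor>" using q(2) unfolding r1 by (simp add: power_one_over le_floor_iff)
    moreover have "\<bar>\<phi> x p - \<phi> x p'\<bar> \<le> n" using \<phi>(1)[of x p] \<phi>(1)[of x p'] by auto
    ultimately show ?thesis using q(1) unfolding arcs_def by (intro CollectI conjI exI[of _ q]) auto
   qed
   then have sub: "{x\<in>?X. \<rho> \<le> ?U x \<and> \<phi> x p - \<phi> x p' \<notin> ?arc} \<subseteq> {x\<in>?X. \<rho> \<le> ?U x \<and> \<not> maj (2 ^ 73 / (\<rho>\<^sup>2 / 4) ^ 31) (2 ^ 148 * (64 * e\<^sup>2)\<^sup>2 / ((\<rho>\<^sup>2 / 4) ^ 62 * of_int (D\<^sup>2))) (of_int (1 ^ 3) * \<zeta> x)}"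
    by blast
   have finS: "finite {x\<in>?X. Pq x}" for Pq :: "int \<Rightarrow> bool" by (rule finite_subset[of _ ?X]) auto
   have "card {x\<in>?X. \<rho> \<le> ?U x \<and> \<phi> x p - \<phi> x p' \<notin> ?arc} \<le> card {x\<in>?X. \<rho> \<le> ?U x \<and> \<not> maj (2 ^ 73 / (\<rho>\<^sup>2 / 4) ^ 31) (2 ^ 148 * (64 * e\<^sup>2)\<^sup>2 / ((\<rho>\<^sup>2 / 4) ^ 62 * of_int (D\<^sup>2))) (of_int (1 ^ 3) * \<zeta> x)}"
    by (rule card_mono[OF finS sub])
   ultimately show "real (card {x\<in>?X. \<rho> \<le> ?U x \<and> \<phi> x p - \<phi> x p' \<notin> ?arc}) \<le> \<rho> * N" by linarith
  qed (use T1 \<rho> in auto)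
  also have "\<dots> \<le> 2 * \<rho> + avg ?X (\<lambda>x. c\<^sup>2 / 4 + (4 / c\<^sup>2) * (if \<phi> x p - \<phi> x p' \<in> ?arc then (norm (T x p))\<^sup>2 else 0))"
  proof (intro add_left_mono avg_mono)
   fix x
   \<comment> \<open>Passing from the modulus to its square, at the cost of c^2/4: the square is the
     Fourier energy that \<open>cluster_weight\<close> can bound.\<close>
   have "norm (T x p) \<le> c\<^sup>2 / 4 + (4 / c\<^sup>2) * (norm (T x p))\<^sup>2"
   proof (cases "norm (T x p) \<le> c\<^sup>2 / 4")
    case False
    then have "c\<^sup>2 / 4 * norm (T x p) \<le> (norm (T x p))\<^sup>2" unfolding power2_eq_square[of "norm _"] by (intro mult_right_mono) auto
    then have "norm (T x p) \<le> (4 / c\<^sup>2) * (norm (T x p))\<^sup>2" using c by (simp add: field_simps)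
    moreover have "0 \<le> c\<^sup>2 / 4" by simp
    ultimately show ?thesis by linarith
   qed (simp add: add_increasing2)
   then show "(if \<phi> x p - \<phi> x p' \<in> ?arc then norm (T x p) else 0) \<le> c\<^sup>2 / 4 + (4 / c\<^sup>2) * (if \<phi> x p - \<phi> x p' \<in> ?arc then (norm (T x p))\<^sup>2 else 0)"
    by simp
  qed
  also have "\<dots> = 2 * \<rho> + (c\<^sup>2 / 4 + (4 / c\<^sup>2) * avg ?X (\<lambda>x. if \<phi> x p - \<phi> x p' \<in> ?arc then (norm (T x p))\<^sup>2 else 0))"
   using N by (simp only: avg_add avg_cmult) (simp add: avg_const)
  finally show "norm (avg ?Z (\<lambda>z. b p z * cnj (b p' z))) \<le> (c\<^sup>2 / 2) + (4 / c\<^sup>2) * avg ?X (\<lambda>x. if \<phi> x p - \<phi> x p' \<in> ?arc then (norm (T x p))\<^sup>2 else 0)"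
   using \<rho>(3) by linarith
 qed
 also have "\<dots> \<le> c\<^sup>2 / 2 + (4 / c\<^sup>2) * avg P (\<lambda>p. avg P (\<lambda>p'. avg ?X (\<lambda>x. if \<phi> x p - \<phi> x p' \<in> ?arc then (norm (T x p))\<^sup>2 else 0)))"
 proof -
  have "avg P (\<lambda>p. avg P (\<lambda>p'. c\<^sup>2 / 2)) \<le> c\<^sup>2 / 2" by (rule avg_le, rule avg_le) auto
  then show ?thesis by (simp only: avg_add avg_cmult)
 qed
 finally have "c\<^sup>2 / 2 \<le> (4 / c\<^sup>2) * avg P (\<lambda>p. avg P (\<lambda>p'. avg ?X (\<lambda>x. if \<phi> x p - \<phi> x p' \<in> ?arc then (norm (T x p))\<^sup>2 else 0)))"
  (is "_ \<le> _ * ?V") by simp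
 then have "c\<^sup>2 * (c\<^sup>2 / 8) \<le> ?V" using c by (simp add: field_simps)
 moreover have "c\<^sup>2 * (c\<^sup>2 / 8) = c ^ 4 / 8" by (simp flip: power_add)
 moreover have "?V = avg P (\<lambda>p'. avg P (\<lambda>p. avg ?X (\<lambda>x. if \<phi> x p - \<phi> x p' \<in> ?arc then (norm (T x p))\<^sup>2 else 0)))"
  by (rule avg_swap)
 ultimately have "c ^ 4 / 8 \<le> avg P (\<lambda>p'. avg P (\<lambda>p. avg ?X (\<lambda>x. if \<phi> x p - \<phi> x p' \<in> ?arc then (norm (T x p))\<^sup>2 else 0)))" by simp
 then show ?thesis unfolding T_def using \<phi>(1) by (intro exI[of _ \<phi>]) blast
qed

text \<open>For each fixed p' the frequency \<phi> x p' is a centre depending on x alone, and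
  \<open>cluster_weight\<close> applies on the arcs around it. Since n \<le> r M^2 there are at most
  2^1355 r^521 of them. Together with the fourth power of c = 1/r this gives r^525, and r \<ge>
  2^1400 absorbs the numerical constants.\<close>

lemma weighted_bound:
 fixes \<Omega> :: "'w set" and dv :: "'w \<Rightarrow> int" and N M n \<gamma> v H B u :: int and f0 f1 R :: "int \<Rightarrow> int \<Rightarrow> real" and r :: real
 assumes r: "2 ^ 1400 \<le> r" and N: "0 < N" and n: "0 < n" "n \<le> r * M\<^sup>2" and M: "r ^ 140 \<le> M" and fin: "finite \<Omega>" "finite S" "S \<noteq> {}"
  and p0: "per N f0" and p1: "per N f1" and pR: "per N R"
  and q0: "\<And>x. per n (f0 x)" and q1: "\<And>x. per n (f1 x)" and qR: "\<And>x. per n (R x)"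
  and b0: "\<And>x y. \<bar>f0 x y\<bar> \<le> 1" and b1: "\<And>x y. \<bar>f1 x y\<bar> \<le> 1" and bR: "\<And>x y. \<bar>R x y\<bar> \<le> 1"
  and dv: "\<And>\<omega> c. \<omega> \<in> \<Omega> \<Longrightarrow> 0 \<le> c \<Longrightarrow> c < M \<Longrightarrow> \<bar>dv \<omega> + c\<bar> \<le> 3 * M"
  and R: "\<And>x y. R x y = (conf \<Omega> dv M \<gamma> f0 f1 x y - avg2 S (\<lambda>l l'. conf \<Omega> dv M \<gamma> f0 f1 x (y + v * (l' - l)))) / 2"
  and big: "1 / r \<le> avg {1..H} (\<lambda>k. avg2 {0..<B} (\<lambda>b b'. avg {0..<N} (\<lambda>x. mx n (dl (u * k * (b' - b)) (R x)))))"
 shows "1 / r ^ 530 \<le> avg {0..<N} (\<lambda>x. vx n (\<lambda>z. avg {1..H} (\<lambda>k. wt n {0..<B} (z * (u * k)))) (R x))"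
proof -
 define P where "P = {1..H} \<times> ({0..<B} \<times> {0..<B})"
 define n1 where "n1 = (\<lambda>(k, b, b'). u * k * (b' - b))"
 define c where "c = 1 / r"
 define e where "e = 256 * r ^ 4"
 have r1: "1 \<le> r" "0 < r" using r by simp_all
 have c: "0 < c" "c \<le> 1" using r1 by (auto simp: c_def)
 have e: "4 / (c\<^sup>2 / 8)\<^sup>2 = e" using r1 by (simp add: c_def e_def power_one_over flip: power_mult)
 have e1: "1 \<le> e" using one_le_power[OF r1(1), of 4] by (simp add: e_def)
 have big': "c \<le> avg P (\<lambda>p. avg {0..<N} (\<lambda>x. mx n (dl (n1 p) (R x))))"
  using big by (simp add: P_def n1_def c_def avg_Times avg2_def)
 have Me: "2 ^ 86 * e ^ 34 \<le> M"
 proof -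
  have "2 ^ 86 * e ^ 34 = 2 ^ 358 * r ^ 136" by (simp add: e_def power_mult_distrib flip: power_mult)
  also have "\<dots> \<le> r * r ^ 136" using r r1 by (intro mult_right_mono) auto
  also have "\<dots> \<le> r ^ 140" unfolding power_Suc[symmetric] using r1 by (intro power_increasing) auto
  finally show ?thesis using M by linarith
 qed
 let ?K = "arcs n \<lfloor>2 ^ 73 * e ^ 31\<rfloor> (2 ^ 164 * e ^ 68 / (real_of_int M)\<^sup>2)"
 obtain \<phi> where \<phi>: "c ^ 4 / 8 \<le> avg P (\<lambda>p'. avg P (\<lambda>p. avg {0..<N} (\<lambda>x.
   if \<phi> x p - \<phi> x p' \<in> ?K then (norm (ft n (dl (n1 p) (R x)) (\<phi> x p)))\<^sup>2 else 0)))"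
  using phase_clustering[OF N n(1) _ fin p0 p1 pR q0 q1 qR b0 b1 bR dv R c big', unfolded e, OF Me] by blast
 let ?V = "\<lambda>x. vx n (\<lambda>z. avg {1..H} (\<lambda>k. wt n {0..<B} (z * (u * k)))) (R x)"
 have fK: "finite ?K" by (rule finite_arcs)
 have "c ^ 4 / 8 \<le> avg P (\<lambda>p'. avg {0..<N} (\<lambda>x. card ?K * ?V x))"
 proof (rule order_trans[OF \<phi>], rule avg_mono)
  fix p'
  have "avg P (\<lambda>p. avg {0..<N} (\<lambda>x. if \<phi> x p - \<phi> x p' \<in> ?K then (norm (ft n (dl (n1 p) (R x)) (\<phi> x p)))\<^sup>2 else 0))
   = avg {0..<N} (\<lambda>x. avg P (\<lambda>p. if \<phi> x p - \<phi> x p' \<in> ?K then (norm (ft n (dl (n1 p) (R x)) (\<phi> x p)))\<^sup>2 else 0))"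
   by (rule avg_swap)
  also have "\<dots> \<le> avg {0..<N} (\<lambda>x. card ?K * ?V x)"
  proof (rule avg_mono)
   fix x
   show "avg P (\<lambda>p. if \<phi> x p - \<phi> x p' \<in> ?K then (norm (ft n (dl (n1 p) (R x)) (\<phi> x p)))\<^sup>2 else 0) \<le> card ?K * ?V x"
    unfolding P_def n1_def avg_Times prod.case avg2_def[symmetric] by (rule cluster_weight[OF n(1) qR bR fK])
  qed
  finally show "avg P (\<lambda>p. avg {0..<N} (\<lambda>x. if \<phi> x p - \<phi> x p' \<in> ?K then (norm (ft n (dl (n1 p) (R x)) (\<phi> x p)))\<^sup>2 else 0))
   \<le> avg {0..<N} (\<lambda>x. card ?K * ?V x)" .
 qed
 also have "\<dots> \<le> card ?K * avg {0..<N} ?V"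
 proof (rule avg_le)
  show "avg {0..<N} (\<lambda>x. card ?K * ?V x) \<le> card ?K * avg {0..<N} ?V" by (simp only: avg_cmult order_refl)
 next
  have "0 \<le> ?V x" for x
  proof -
   have "0 \<le> (\<Sum>\<theta>\<in>{0..<n}. (norm (ft n (R x) \<theta>))\<^sup>2 * avg {1..H} (\<lambda>k. wt n {0..<B} ((\<theta> - 0) * (u * k))))"
    by (intro sum_nonneg mult_nonneg_nonneg avg_nonneg wt_nonneg) auto
   also have "\<dots> \<le> ?V x" using n by (intro vx_ge) auto
   finally show ?thesis .
  qed
  then show "0 \<le> card ?K * avg {0..<N} ?V" by (intro mult_nonneg_nonneg avg_nonneg) auto
 qed
 finally have fin1: "c ^ 4 / 8 \<le> card ?K * avg {0..<N} ?V" .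
 have cK: "real (card ?K) \<le> 2 ^ 1355 * r ^ 521"
 proof -
  let ?Q = "\<lfloor>2 ^ 73 * e ^ 31\<rfloor>" and ?\<kappa> = "2 ^ 164 * e ^ 68 / (real_of_int M)\<^sup>2"
  have e31: "1 \<le> e ^ 31" "1 \<le> e ^ 68" using e1 by (intro one_le_power, simp)+
  have Qle: "?Q \<le> 2 ^ 73 * e ^ 31" by linarith
  have "1 \<le> 2 ^ 73 * e ^ 31" using e31 by simp
  then have Q1: "1 \<le> ?Q" by linarith
  have Q0: "0 \<le> 2 * real_of_int ?Q + 3" using Q1 by linarith
  have M0: "0 < M" using M r1 by (metis less_le_trans of_int_0_less_iff zero_less_power)
  have "2 ^ 164 * e ^ 68 \<le> (2 ^ 86 * e ^ 34)\<^sup>2" using e31 by (simp add: power_mult_distrib flip: power_mult)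
  also have "\<dots> \<le> (real_of_int M)\<^sup>2" using Me e1 by (intro power_mono) auto
  finally have k1: "?\<kappa> \<le> 1" using M0 by (simp add: divide_le_eq)
  have k0: "0 \<le> ?\<kappa>" using e31 by simp
  have "?\<kappa> * n \<le> ?\<kappa> * (r * (real_of_int M)\<^sup>2)" using n k0 by (intro mult_left_mono) auto
  also have "\<dots> = 2 ^ 164 * e ^ 68 * r" using M0 by simp
  finally have "2 * ?\<kappa> * n + 1 \<le> 2 * (2 ^ 164 * e ^ 68 * r) + 1" by simp
  moreover have "1 * 1 \<le> e ^ 68 * r" using e31 r1 by (intro mult_mono) auto
  ultimately have k2: "2 * ?\<kappa> * n + 1 \<le> 2 ^ 166 * (e ^ 68 * r)" by simp
  have "real (card ?K) \<le> real_of_int ?Q * real_of_int (2 * ?Q + 3) * (2 * ?\<kappa> * n + 1)"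
   using card_arcs[OF n(1) Q1 k0 k1] by (simp only: of_int_mult of_int_add of_int_numeral)
  also have "\<dots> \<le> (2 ^ 73 * e ^ 31) * (5 * (2 ^ 73 * e ^ 31)) * (2 ^ 166 * (e ^ 68 * r))"
  proof (intro mult_mono k2)
   show "real_of_int (2 * ?Q + 3) \<le> 5 * (2 ^ 73 * e ^ 31)"
   proof -
    have "real_of_int (2 * ?Q + 3) \<le> real_of_int (5 * ?Q)" using Q1 by (simp only: of_int_le_iff)
    also have "\<dots> = 5 * real_of_int ?Q" by (simp only: of_int_mult of_int_numeral)
    also have "\<dots> \<le> 5 * (2 ^ 73 * e ^ 31)" using Qle by (intro mult_left_mono) auto
    finally show ?thesis .
   qed
  qed (use Qle Q1 Q0 e1 e31 k0 n in auto)
  also have "\<dots> = 5 * 2 ^ 312 * r * (e ^ 31 * e ^ 31 * e ^ 68)" by simp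
  also have "e ^ 31 * e ^ 31 * e ^ 68 = 2 ^ 1040 * r ^ 520" by (simp add: e_def power_mult_distrib flip: power_mult power_add)
  also have "5 * 2 ^ 312 * r * (2 ^ 1040 * r ^ 520) = 5 * 2 ^ 1352 * r ^ 521" by (simp flip: power_Suc)
  also have "\<dots> \<le> 2 ^ 1355 * r ^ 521" using r1 by (intro mult_right_mono) auto
  finally show ?thesis .
 qed
 let ?A = "avg {0..<N} ?V"
 have "0 < c ^ 4 / 8" using c by simp
 then have c4: "0 < real (card ?K) * ?A" using fin1 by (rule less_le_trans)
 have A0: "0 < ?A"
 proof (rule ccontr)
  assume "\<not> 0 < ?A"
  then have "real (card ?K) * ?A \<le> 0" by (intro mult_nonneg_nonpos) auto
  then show False using c4 by linarith
 qed
 have "c ^ 4 / 8 \<le> (2 ^ 1355 * r ^ 521) * ?A" by (rule order_trans[OF fin1 mult_right_mono[OF cK less_imp_le[OF A0]]])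
 then have "1 \<le> 8 * r ^ 4 * ((2 ^ 1355 * r ^ 521) * ?A)" using r1 by (simp add: c_def power_one_over divide_le_eq mult_ac)
 also have "\<dots> = 2 ^ 1358 * r ^ 525 * ?A" by (simp flip: power_add)
 also have "\<dots> \<le> r ^ 530 * ?A"
 proof (rule mult_right_mono)
  have "2 ^ 1358 * r ^ 525 \<le> r * r ^ 525" using r r1 by (intro mult_right_mono) auto
  also have "\<dots> \<le> r ^ 530" unfolding power_Suc[symmetric] using r1 by (intro power_increasing) auto
  finally show "2 ^ 1358 * r ^ 525 \<le> r ^ 530" .
 qed (use A0 in simp)
 finally show ?thesis using r1 by (simp add: divide_le_eq mult.commute)
qed

section \<open>Smoothing as a Fourier multiplier\<close>

lemma ft_shift:
 assumes "0 < n" "per n u"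
 shows "ft n (\<lambda>y. u (y + a)) \<xi> = ch n (\<xi> * a) * ft n u \<xi>"
proof -
 let ?k = "\<lambda>y. of_real (u y) * ch n (- (\<xi> * (y - a)))"
 have "- (\<xi> * (y + n - a)) = - (\<xi> * (y - a)) + n * (- \<xi>)" for y by (simp add: algebra_simps)
 then have "ch n (- (\<xi> * (y + n - a))) = ch n (- (\<xi> * (y - a)))" for y by (simp only: ch_period[OF assms(1)])
 then have "per n ?k" unfolding per_def by (simp only: perD[OF assms(2)] simp_thms)
 from avg_shift[OF this, of a] have "ft n (\<lambda>y. u (y + a)) \<xi> = avg {0..<n} ?k" by (simp add: ft_def)
 also have "\<dots> = avg {0..<n} (\<lambda>y. ch n (\<xi> * a) * (of_real (u y) * ch n (- (\<xi> * y))))"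
 proof (rule avg_cong)
  fix y
  have "- (\<xi> * (y - a)) = \<xi> * a + - (\<xi> * y)" by (simp add: algebra_simps)
  then have "ch n (- (\<xi> * (y - a))) = ch n (\<xi> * a) * ch n (- (\<xi> * y))" by (simp only: ch_add)
  then show "?k y = ch n (\<xi> * a) * (of_real (u y) * ch n (- (\<xi> * y)))" by simp
 qed
 finally show ?thesis unfolding avg_cmult ft_def .
qed

lemma ft_avg2_shift:
 assumes "0 < n" "per n u"
 shows "ft n (\<lambda>y. avg2 S (\<lambda>l l'. u (y + v * (l' - l)))) \<xi> = of_real (wt n S (\<xi> * v)) * ft n u \<xi>"
proof -
 have "ft n (\<lambda>y. avg2 S (\<lambda>l l'. u (y + v * (l' - l)))) \<xi>
  = avg {0..<n} (\<lambda>y. avg2 S (\<lambda>l l'. of_real (u (y + v * (l' - l))) * ch n (- (\<xi> * y))))"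
  unfolding ft_def avg2_def avg_of_real[symmetric] avg_multc ..
 also have "\<dots> = avg2 S (\<lambda>l l'. ft n (\<lambda>y. u (y + v * (l' - l))) \<xi>)"
  unfolding ft_def by (rule avg_avg2_swap)
 also have "\<dots> = avg2 S (\<lambda>l l'. ch n (\<xi> * v * (l' - l))) * ft n u \<xi>"
  unfolding ft_shift[OF assms] avg2_def avg_multc by (simp only: mult.assoc)
 finally show ?thesis unfolding wt_conv avg2_def .
qed

lemma ft_half_diff:
 assumes "0 < n" "per n F" "\<And>y. R y = (F y - avg2 S (\<lambda>l l'. F (y + v * (l' - l)))) / 2"
 shows "ft n R \<xi> = of_real ((1 - wt n S (\<xi> * v)) / 2) * ft n F \<xi>"
proof -
 have "ft n R \<xi> = avg {0..<n} (\<lambda>y. (1 / 2) * (of_real (F y) * ch n (- (\<xi> * y)) - of_real (avg2 S (\<lambda>l l'. F (y + v * (l' - l)))) * ch n (- (\<xi> * y))))"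
  unfolding ft_def assms(3) by (rule avg_cong) (simp add: left_diff_distrib)
 also have "\<dots> = (1 / 2) * (ft n F \<xi> - ft n (\<lambda>y. avg2 S (\<lambda>l l'. F (y + v * (l' - l)))) \<xi>)"
  unfolding avg_cmult avg_diff ft_def ..
 finally show ?thesis unfolding ft_avg2_shift[OF assms(1,2)] by (simp add: algebra_simps)
qed

text \<open>With multiplier a in [0, 1] the coefficients of R are (1 - a)/2 times those of F. In
  Fourier space the claim reads (1 - a)^2/2 \<le> (1 - a)/2. Hence a large half difference
  correlates with F itself.\<close>

lemma half_diff_energy:
 fixes F R :: "int \<Rightarrow> real"
 assumes n: "0 < n" and F: "per n F" and R: "\<And>y. R y = (F y - avg2 S (\<lambda>l l'. F (y + v * (l' - l)))) / 2"
 shows "2 * avg {0..<n} (\<lambda>y. (R y)\<^sup>2) \<le> avg {0..<n} (\<lambda>y. F y * R y)"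
proof -
 let ?p = "\<lambda>\<xi>. (norm (ft n F \<xi>))\<^sup>2" and ?a = "\<lambda>\<xi>. wt n S (\<xi> * v)"
 have sh: "y + n + a = (y + a) + n" for y a :: int by simp
 have pR: "per n R" unfolding per_def R sh perD[OF F] by simp
 have e0: "avg2 S (\<lambda>l l'. dl (v * (l' - l)) F y) = F y * avg2 S (\<lambda>l l'. F (y + v * (l' - l)))" for y
  unfolding dl_def avg2_def avg_cmult ..
 have "avg {0..<n} (\<lambda>y. F y * R y) = avg {0..<n} (\<lambda>y. (1 / 2) * ((F y)\<^sup>2 - avg2 S (\<lambda>l l'. dl (v * (l' - l)) F y)))"
  unfolding R e0 by (rule avg_cong) (simp add: right_diff_distrib power2_eq_square)
 also have "\<dots> = (1 / 2) * (avg {0..<n} (\<lambda>y. (F y)\<^sup>2) - avg2 S (\<lambda>l l'. avg {0..<n} (dl (v * (l' - l)) F)))"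
  by (simp only: avg_cmult avg_diff avg_avg2_swap)
 also have "avg2 S (\<lambda>l l'. avg {0..<n} (dl (v * (l' - l)) F)) = (\<Sum>\<xi>\<in>{0..<n}. ?p \<xi> * ?a \<xi>)"
  unfolding avg2_def by (rule avg_dl_wt[OF n F])
 also have "(1 / 2) * (avg {0..<n} (\<lambda>y. (F y)\<^sup>2) - (\<Sum>\<xi>\<in>{0..<n}. ?p \<xi> * ?a \<xi>)) = (\<Sum>\<xi>\<in>{0..<n}. ?p \<xi> * ((1 - ?a \<xi>) / 2))"
  unfolding parseval[OF n F, symmetric] by (simp add: sum_subtractf algebra_simps diff_divide_distrib flip: sum_divide_distrib)
 finally have e: "avg {0..<n} (\<lambda>y. F y * R y) = (\<Sum>\<xi>\<in>{0..<n}. ?p \<xi> * ((1 - ?a \<xi>) / 2))" .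
 have "2 * avg {0..<n} (\<lambda>y. (R y)\<^sup>2) = (\<Sum>\<xi>\<in>{0..<n}. 2 * (norm (ft n R \<xi>))\<^sup>2)"
  unfolding parseval[OF n pR, symmetric] by (simp only: sum_distrib_left)
 also have "\<dots> \<le> (\<Sum>\<xi>\<in>{0..<n}. ?p \<xi> * ((1 - ?a \<xi>) / 2))"
 proof (rule sum_mono)
  fix \<xi>
  let ?b = "1 - ?a \<xi>"
  have b: "0 \<le> ?b" "?b \<le> 1" using wt_nonneg[of n S "\<xi> * v"] wt_le_1[of n S "\<xi> * v"] by auto
  have "2 * (norm (ft n R \<xi>))\<^sup>2 = ?p \<xi> * (?b * ?b / 2)"
   unfolding ft_half_diff[OF n F R] norm_mult norm_of_real by (simp add: power_mult_distrib power2_eq_square)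
  also have "\<dots> \<le> ?p \<xi> * (?b / 2)"
   using b mult_left_mono[of ?b 1 ?b] by (intro mult_left_mono) auto
  finally show "2 * (norm (ft n R \<xi>))\<^sup>2 \<le> ?p \<xi> * (?b / 2)" .
 qed
 finally show ?thesis using e by simp
qed

text \<open>The Fourier mass near \<zeta> is written as a pairing of g with the smoothing of its
  modulation by \<zeta> along the step Q. This smoothing varies slowly along multiples of Q, so it
  can serve as the function g in \<open>major_arc\<close>.\<close>

lemma weighted_energy:
 fixes g :: "int \<Rightarrow> real"
 assumes n: "0 < n" and g: "per n g"
 shows "of_real (\<Sum>\<theta>\<in>{0..<n}. (norm (ft n g \<theta>))\<^sup>2 * wt n C ((\<theta> - \<zeta>) * Q))
  = avg {0..<n} (\<lambda>y. ch n (\<zeta> * y) * avg2 C (\<lambda>l l'. of_real (g (y + Q * (l' - l))) * ch n (- (\<zeta> * (y + Q * (l' - l))))) * of_real (g y))"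
proof -
 let ?p = "\<lambda>\<theta>. of_real ((norm (ft n g \<theta>))\<^sup>2) :: complex"
 have "avg {0..<n} (\<lambda>y. ch n (\<zeta> * y) * avg2 C (\<lambda>l l'. of_real (g (y + Q * (l' - l))) * ch n (- (\<zeta> * (y + Q * (l' - l))))) * of_real (g y))
  = avg {0..<n} (\<lambda>y. avg2 C (\<lambda>l l'. ch n (- (\<zeta> * Q * (l' - l))) * of_real (dl (Q * (l' - l)) g y)))"
 proof (rule avg_cong)
  fix y
  have "ch n (\<zeta> * y) * (of_real (g (y + Q * (l' - l))) * ch n (- (\<zeta> * (y + Q * (l' - l))))) * of_real (g y)
   = ch n (- (\<zeta> * Q * (l' - l))) * of_real (dl (Q * (l' - l)) g y)" for l l'
  proof -
   have "\<zeta> * y + - (\<zeta> * (y + Q * (l' - l))) = - (\<zeta> * Q * (l' - l))" by (simp add: algebra_simps)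
   then have "ch n (\<zeta> * y) * ch n (- (\<zeta> * (y + Q * (l' - l)))) = ch n (- (\<zeta> * Q * (l' - l)))" by (simp only: ch_add[symmetric])
   then show ?thesis by (simp add: dl_def mult_ac)
  qed
  then show "ch n (\<zeta> * y) * avg2 C (\<lambda>l l'. of_real (g (y + Q * (l' - l))) * ch n (- (\<zeta> * (y + Q * (l' - l))))) * of_real (g y)
   = avg2 C (\<lambda>l l'. ch n (- (\<zeta> * Q * (l' - l))) * of_real (dl (Q * (l' - l)) g y))"
   unfolding avg2_def avg_cmult[symmetric] avg_multc[symmetric] by simp
 qed
 also have "\<dots> = avg2 C (\<lambda>l l'. avg {0..<n} (\<lambda>y. ch n (- (\<zeta> * Q * (l' - l))) * of_real (dl (Q * (l' - l)) g y)))"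
  by (rule avg_avg2_swap)
 also have "\<dots> = avg2 C (\<lambda>l l'. \<Sum>\<theta>\<in>{0..<n}. ?p \<theta> * ch n ((\<theta> - \<zeta>) * Q * (l' - l)))"
 proof (rule avg2_cong)
  fix l l'
  have "avg {0..<n} (\<lambda>y. ch n (- (\<zeta> * Q * (l' - l))) * of_real (dl (Q * (l' - l)) g y)) = ch n (- (\<zeta> * Q * (l' - l))) * (\<Sum>\<theta>\<in>{0..<n}. ?p \<theta> * ch n (\<theta> * (Q * (l' - l))))"
   unfolding avg_cmult avg_of_real ft_dl[OF n g] ..
  also have "\<dots> = (\<Sum>\<theta>\<in>{0..<n}. ?p \<theta> * (ch n (- (\<zeta> * Q * (l' - l))) * ch n (\<theta> * (Q * (l' - l)))))"
   unfolding sum_distrib_left by (simp only: mult.left_commute)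
  also have "\<dots> = (\<Sum>\<theta>\<in>{0..<n}. ?p \<theta> * ch n ((\<theta> - \<zeta>) * Q * (l' - l)))"
  proof (rule sum.cong[OF refl])
   fix \<theta>
   have "- (\<zeta> * Q * (l' - l)) + \<theta> * (Q * (l' - l)) = (\<theta> - \<zeta>) * Q * (l' - l)" by (simp add: algebra_simps)
   then show "?p \<theta> * (ch n (- (\<zeta> * Q * (l' - l))) * ch n (\<theta> * (Q * (l' - l)))) = ?p \<theta> * ch n ((\<theta> - \<zeta>) * Q * (l' - l))"
    by (simp only: ch_add[symmetric])
  qed
  finally show "avg {0..<n} (\<lambda>y. ch n (- (\<zeta> * Q * (l' - l))) * of_real (dl (Q * (l' - l)) g y)) = (\<Sum>\<theta>\<in>{0..<n}. ?p \<theta> * ch n ((\<theta> - \<zeta>) * Q * (l' - l)))" .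
 qed
 also have "\<dots> = (\<Sum>\<theta>\<in>{0..<n}. ?p \<theta> * of_real (wt n C ((\<theta> - \<zeta>) * Q)))"
  unfolding wt_conv by (simp only: avg2_sum avg2_cmult avg2_def[symmetric])
 also have "\<dots> = of_real (\<Sum>\<theta>\<in>{0..<n}. (norm (ft n g \<theta>))\<^sup>2 * wt n C ((\<theta> - \<zeta>) * Q))" by simp
 finally show ?thesis by simp
qed

lemma wt_lower:
 assumes "0 < L" "near \<kappa> (z / n)"
 shows "1 - 16 * L * \<kappa> \<le> wt n {0..<L} z"
proof -
 obtain m :: int where m: "\<bar>z / n - of_int m\<bar> \<le> \<kappa>" using assms(2) by (auto simp: near_def)
 let ?a = "avg {0..<L} (\<lambda>c. ch n (z * c))"
 have \<kappa>: "0 \<le> \<kappa>" using m by linarith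
 have "?a - 1 = avg {0..<L} (\<lambda>c. ch n (z * c) - 1)"
  using assms(1) by (simp add: avg_diff avg_const)
 also have "norm \<dots> \<le> 8 * L * \<kappa>"
 proof (rule norm_avg_bound)
  fix c assume c: "c \<in> {0..<L}"
  have "ch n (z * c) = ee (of_int c * (z / n - of_int m) + of_int (c * m))"
   unfolding ch_def by (rule arg_cong[of _ _ ee]) (simp add: algebra_simps)
  then have "ch n (z * c) = ee (of_int c * (z / n - of_int m))" by (simp only: ee_add_int)
  then have "norm (ch n (z * c) - 1) \<le> 8 * \<bar>of_int c * (z / n - of_int m)\<bar>" by (simp only: ee_upper)
  also have "\<dots> = 8 * (of_int c * \<bar>z / n - of_int m\<bar>)" using c by (simp add: abs_mult)
  also have "\<dots> \<le> 8 * (L * \<kappa>)" using c m \<kappa> by (intro mult_left_mono mult_mono) auto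
  finally show "norm (ch n (z * c) - 1) \<le> 8 * L * \<kappa>" by simp
 qed (use assms(1) \<kappa> in auto)
 finally have d: "norm (?a - 1) \<le> 8 * L * \<kappa>" .
 have "norm (1 - (1 - ?a)) \<ge> norm (1 :: complex) - norm (1 - ?a)" by (rule norm_triangle_ineq2)
 then have l: "1 - 8 * L * \<kappa> \<le> norm ?a" using d by (simp add: norm_minus_commute)
 show ?thesis
 proof (cases "8 * L * \<kappa> \<le> 1")
  case True
  have "1 - 16 * L * \<kappa> \<le> (1 - 8 * L * \<kappa>)\<^sup>2" by (simp add: power2_diff)
  also have "\<dots> \<le> (norm ?a)\<^sup>2" using l True by (intro power_mono) auto
  finally show ?thesis by (simp add: wt_def)
 next
  case False
  then show ?thesis using wt_nonneg[of n "{0..<L}" z] by linarith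
 qed
qed

lemma avg2_slow:
 fixes u :: "int \<Rightarrow> complex"
 assumes u: "\<And>y. norm (u y) \<le> 1" and L: "0 < L" "\<bar>j\<bar> \<le> L"
 shows "norm (avg2 {0..<L} (\<lambda>l l'. u (y + Q * j + Q * (l' - l))) - avg2 {0..<L} (\<lambda>l l'. u (y + Q * (l' - l)))) \<le> 2 * real_of_int \<bar>j\<bar> / real_of_int L"
proof -
 have pos: "norm (avg2 {0..<L} (\<lambda>l l'. u (y + Q * j + Q * (l' - l))) - avg2 {0..<L} (\<lambda>l l'. u (y + Q * (l' - l)))) \<le> 2 * real_of_int j / real_of_int L"
  if j: "0 \<le> j" "j \<le> L" for j y
 proof -
  have "avg2 {0..<L} (\<lambda>l l'. u (y + Q * j + Q * (l' - l))) - avg2 {0..<L} (\<lambda>l l'. u (y + Q * (l' - l)))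
   = avg {0..<L} (\<lambda>l. avg {0..<L} (\<lambda>l'. u (y + Q * (l' + j - l))) - avg {0..<L} (\<lambda>l'. u (y + Q * (l' - l))))"
   unfolding avg2_def avg_diff[symmetric] by (simp add: algebra_simps)
  also have "norm \<dots> \<le> 2 * real_of_int j / real_of_int L"
  proof (rule norm_avg_bound)
   fix l
   show "norm (avg {0..<L} (\<lambda>l'. u (y + Q * (l' + j - l))) - avg {0..<L} (\<lambda>l'. u (y + Q * (l' - l)))) \<le> 2 * real_of_int j / real_of_int L"
    using avg_interval_shift[OF u L(1) j, of "\<lambda>l'. y + Q * (l' - l)"] by (simp add: norm_minus_commute)
  qed (use j L in simp)
  finally show ?thesis .
 qed
 show ?thesis
 proof (cases "0 \<le> j")
  case True then show ?thesis using pos[of j y] L by simp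
 next
  case False then show ?thesis using pos[of "- j" "y + Q * j"] L by (simp add: norm_minus_commute)
 qed
qed

text \<open>If the average over k is not small, \<open>wt_major\<close> gives a q dividing W with
  2qWz/n nearly integral. Then 2W^2 z/n is nearly integral too and the weight in this one direction
  is at least 1/2. The average over k is thus replaced by one smoothing, the form that
  \<open>weighted_energy\<close> handles.\<close>

lemma weight_compare:
 fixes W L B H n :: int and s :: real
 assumes s: "1 \<le> s" and W: "0 < W" "\<And>m. 1 \<le> m \<Longrightarrow> m \<le> 32 * s \<Longrightarrow> m dvd W" and H: "0 < H"
  and B: "16384 * s\<^sup>2 \<le> B" "B \<le> 64 * s * H" and L: "0 < L" "16 * L * (W * (2 ^ 20 * s ^ 4 / (real_of_int B)\<^sup>2)) \<le> 1 / 2"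
 shows "avg {1..H} (\<lambda>k. wt n {0..<B} (z * (2 * W * k))) \<le> 1 / (2 * s) + 2 * wt n {0..<L} (z * (2 * W * W))"
proof (cases "1 / (2 * s) \<le> avg {1..H} (\<lambda>k. wt n {0..<B} (z * (2 * W * k)))")
 case True
 have "{1..H} = (\<lambda>h. h + 1) ` {0..<H}"
  by (auto simp: image_iff intro!: bexI[of _ "_ - 1"])
 then have "avg {1..H} (\<lambda>k. wt n {0..<B} (z * (2 * W * k))) = avg {0..<H} (\<lambda>h. wt n {0..<B} (z * (2 * W * (h + 1))))"
  by (simp only: avg_reindex[OF inj_onI, of "{0..<H}" "\<lambda>h. h + 1"] add_right_cancel)
 with True have w: "1 / (2 * s) \<le> avg {0..<H} (\<lambda>h. wt n {0..<B} (z * (2 * W * (h + 1))))" by simp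
 obtain q :: int where q: "(1::int) \<le> q" "of_int q \<le> 16 * (2 * s)" "near (2 ^ 16 * (2 * s) ^ 4 / of_int (B\<^sup>2)) (of_int q * (of_int (2 * W) * z / n))"
  using wt_major[OF w _ _ _ H] s B by (auto simp: power_mult_distrib)
 then have "q dvd W" by (intro W(2)) auto
 then obtain m where m: "W = q * m" by (elim dvdE)
 have m0: "0 < m" using W(1) q(1) m by (metis zero_less_mult_pos less_le_trans zero_less_one)
 have mW: "m \<le> W" using m0 q(1) mult_right_mono[of 1 q m] unfolding m by simp
 let ?\<kappa> = "2 ^ 20 * s ^ 4 / (real_of_int B)\<^sup>2"
 have nr: "near (of_int \<bar>m\<bar> * ?\<kappa>) (of_int m * (of_int q * (of_int (2 * W) * z / n)))"
  using q(3) by (intro near_mult) (simp add: power_mult_distrib)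
 have eqn: "of_int m * (of_int q * (of_int (2 * W) * z / n)) = of_int (z * (2 * W * W)) / n"
  by (subst (3) m) (simp add: mult_ac)
 have "near (of_int \<bar>m\<bar> * ?\<kappa>) (of_int (z * (2 * W * W)) / n)" using nr unfolding eqn .
 moreover have "of_int \<bar>m\<bar> * ?\<kappa> \<le> W * ?\<kappa>" using m0 mW s by (intro mult_right_mono) auto
 ultimately have "near (W * ?\<kappa>) (of_int (z * (2 * W * W)) / n)" by (rule near_mono)
 from wt_lower[OF L(1) this] have "1 / 2 \<le> wt n {0..<L} (z * (2 * W * W))" using L(2) by linarith
 moreover have "avg {1..H} (\<lambda>k. wt n {0..<B} (z * (2 * W * k))) \<le> 1" by (intro avg_le wt_le_1) auto
 moreover have "0 \<le> 1 / (2 * s)" using s by simp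
 ultimately show ?thesis by linarith
next
 case False
 then show ?thesis using wt_nonneg[of n "{0..<L}" "z * (2 * W * W)"] by linarith
qed

text \<open>Let \<zeta> x be the best centre of R x. If it is major, every frequency with a
  substantial weight near it becomes nearly integral after multiplication by (4W^4)^2; smoothing
  acts there almost as the identity and R has little mass. For the other x the mass is a correlation
  of F with a slowly varying function and a character, and \<open>major_arc\<close> permits this for
  few x only.\<close>

lemma weighted_bound_contradiction:
 fixes \<Omega> :: "'w set" and dv :: "'w \<Rightarrow> int" and N M n \<gamma> H B W D L \<mu> Q1 :: int and f0 f1 R :: "int \<Rightarrow> int \<Rightarrow> real" and s :: real
 defines "Q1 \<equiv> 2 * W * W" and "B \<equiv> W ^ 4 * D" and "M \<equiv> \<mu> * (W ^ 5 * D)"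
 assumes s: "2 ^ 1400 \<le> s" and W: "s ^ 200 \<le> W" "\<And>m. 1 \<le> m \<Longrightarrow> m \<le> s ^ 200 \<Longrightarrow> m dvd W"
  and D: "W ^ 16 \<le> D" and \<mu>: "1 \<le> \<mu>" "\<mu> \<le> s" and L: "0 < L" "L * W ^ 17 \<le> D\<^sup>2" and H: "W * B \<le> H"
  and N: "0 < N" and n: "0 < n" and fin: "finite \<Omega>"
  and p0: "per N f0" and p1: "per N f1" and pR: "per N R"
  and q0: "\<And>x. per n (f0 x)" and q1: "\<And>x. per n (f1 x)" and qR: "\<And>x. per n (R x)"
  and b0: "\<And>x y. \<bar>f0 x y\<bar> \<le> 1" and b1: "\<And>x y. \<bar>f1 x y\<bar> \<le> 1" and bR: "\<And>x y. \<bar>R x y\<bar> \<le> 1"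
  and dv: "\<And>\<omega> c. \<omega> \<in> \<Omega> \<Longrightarrow> 0 \<le> c \<Longrightarrow> c < M \<Longrightarrow> \<bar>dv \<omega> + c\<bar> \<le> 3 * M"
  and R: "\<And>x y. R x y = (conf \<Omega> dv M \<gamma> f0 f1 x y - avg2 {0..<L} (\<lambda>l l'. conf \<Omega> dv M \<gamma> f0 f1 x (y + (4 * W ^ 4)\<^sup>2 * (l' - l)))) / 2"
  and big: "1 / s \<le> avg {0..<N} (\<lambda>x. vx n (\<lambda>z. avg {1..H} (\<lambda>k. wt n {0..<B} (z * (2 * W * k)))) (R x))"
 shows False
proof -
 let ?F = "conf \<Omega> dv M \<gamma> f0 f1"
 let ?X = "{0..<N}" and ?Y = "{0..<n}" and ?C = "{0..<M}"
 define w where "w = real_of_int W"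
 define dd where "dd = real_of_int D"
 have s1: "1 \<le> s" "0 < s" using s by simp_all
 have sp: "1 \<le> s ^ k" "0 < s ^ k" for k using s1 by auto
 have absorb: "c * s ^ k \<le> s ^ m" if "c \<le> 2 ^ 1400" "k + 1 \<le> m" for c k m
 proof -
  have "c * s ^ k \<le> s * s ^ k" using that(1) s sp(2)[of k] by (intro mult_right_mono) auto
  also have "\<dots> \<le> s ^ m" unfolding power_Suc[symmetric] using s1 that(2) by (intro power_increasing) auto
  finally show ?thesis .
 qed
 have sw: "s ^ 200 \<le> w" using W(1) by (simp add: w_def)
 have cw: "c * s ^ k \<le> w" if "c \<le> 2 ^ 1400" "k + 1 \<le> 200" for c k
  using absorb[OF that] sw by linarith
 have w1: "1 \<le> w" "0 < w" using sw sp(1)[of 200] by linarith+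
 have wp: "1 \<le> w ^ k" "0 < w ^ k" for k using w1 by auto
 have W0: "0 < W" using w1 by (simp add: w_def)
 have Dw: "w ^ 16 \<le> dd"
 proof -
  have "real_of_int (W ^ 16) \<le> D" using D by (simp only: of_int_le_iff)
  then show ?thesis by (simp add: w_def dd_def)
 qed
 have d1: "1 \<le> dd" "0 < dd" using Dw wp(1)[of 16] by linarith+
 have D0: "0 < D" using d1 by (simp add: dd_def)
 have rB: "real_of_int B = w ^ 4 * dd" by (simp add: B_def w_def dd_def)
 have rM: "real_of_int M = \<mu> * (w ^ 5 * dd)" by (simp add: M_def w_def dd_def)
 have rQ: "real_of_int Q1 = 2 * w\<^sup>2" by (simp add: Q1_def w_def power2_eq_square)
 have M0: "0 < M" using \<mu> W0 D0 by (auto simp: M_def intro!: mult_pos_pos)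
 have "Q1 = 2 * (W * W)" by (simp add: Q1_def)
 then have Q0: "1 \<le> Q1" "0 < Q1" using mult_pos_pos[OF W0 W0] by linarith+
 \<comment> \<open>Long enough for smoothing over L1 steps to be insensitive to shifts by 7MD steps,
   the factor W paying for powers of s, and short enough for \<open>weight_compare\<close>.\<close>
 define L1 where "L1 = W * (M * D)"
 have rL1: "real_of_int L1 = \<mu> * (w ^ 6 * dd\<^sup>2)" by (simp add: L1_def rM flip: w_def dd_def) (simp add: power2_eq_square eval_nat_numeral)
 have L10: "0 < L1" using W0 M0 D0 by (simp add: L1_def)
 have \<mu>r: "1 \<le> real_of_int \<mu>" "real_of_int \<mu> \<le> s" using \<mu> by auto
 let ?w1 = "\<lambda>z. avg {1..H} (\<lambda>k. wt n {0..<B} (z * (2 * W * k)))"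
 let ?ws = "\<lambda>z. wt n {0..<L1} (z * Q1)"
 have B0: "0 < B" using W0 D0 by (simp add: B_def)
 have H0: "0 < H" using H mult_pos_pos[OF W0 B0] by linarith
 have wc: "?w1 z \<le> 1 / (2 * s) + 2 * ?ws z" for z
  unfolding Q1_def
 proof (rule weight_compare[OF s1(1) W0 _ H0 _ _ L10])
  fix m :: int assume m: "1 \<le> m" "m \<le> 32 * s"
  have "32 * s ^ 1 \<le> s ^ 200" by (rule absorb) auto
  then show "m dvd W" using m by (intro W(2)) auto
 next
  have "16384 * s\<^sup>2 \<le> w" by (rule cw) auto
  also have "\<dots> \<le> w ^ 4 * dd" using mult_mono[of w "w ^ 4" 1 dd] w1 d1 power_increasing[of 1 4 w] by simp
  finally show "16384 * s\<^sup>2 \<le> B" by (simp only: rB)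
  have "1 * B \<le> W * B" using W0 B0 by (intro mult_right_mono) auto
  then have "B \<le> H" using H by linarith
  then have "real_of_int B \<le> real_of_int H" by (simp only: of_int_le_iff)
  moreover have "1 * real_of_int H \<le> 64 * s * H" using s1 H0 by (intro mult_right_mono) auto
  ultimately show "real_of_int B \<le> 64 * s * H" by simp
  have "2 ^ 25 * \<mu> * s ^ 4 \<le> 2 ^ 25 * s * s ^ 4" using \<mu>r s1 by (intro mult_right_mono mult_left_mono) auto
  also have "\<dots> = 2 ^ 25 * s ^ 5" by (simp flip: power_Suc)
  also have "\<dots> \<le> w" by (rule cw) auto
  finally have k: "2 ^ 25 * \<mu> * s ^ 4 \<le> w" .
  have w7: "w ^ 7 = w ^ 6 * w" using power_Suc2[of w 6] by simp
  have "16 * L1 * (W * (2 ^ 20 * s ^ 4 / (real_of_int B)\<^sup>2)) = (2 ^ 24 * \<mu> * s ^ 4) * (w ^ 7 * dd\<^sup>2) / (w ^ 8 * dd\<^sup>2)"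
   using w1 d1 by (simp add: rL1 rB power_mult_distrib w7 mult_ac flip: w_def power_mult)
  also have "\<dots> = (2 ^ 24 * \<mu> * s ^ 4) / w"
  proof -
   have "w ^ 8 * dd\<^sup>2 = w * (w ^ 7 * dd\<^sup>2)" by (simp flip: power_Suc)
   moreover have "w ^ 7 * dd\<^sup>2 \<noteq> 0" using w1 d1 by simp
   ultimately show ?thesis by simp
  qed
  also have "\<dots> \<le> 1 / 2" using k w1 by (simp add: divide_le_eq)
  finally show "16 * L1 * (W * (2 ^ 20 * s ^ 4 / (real_of_int B)\<^sup>2)) \<le> 1 / 2" .
 qed
 define \<zeta> where "\<zeta> x = (SOME z. z \<in> ?Y \<and> vx n ?w1 (R x) = (\<Sum>\<theta>\<in>{0..<n}. (norm (ft n (R x) \<theta>))\<^sup>2 * ?w1 (\<theta> - z)))" for x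
 have \<zeta>: "\<zeta> x \<in> ?Y" "vx n ?w1 (R x) = (\<Sum>\<theta>\<in>{0..<n}. (norm (ft n (R x) \<theta>))\<^sup>2 * ?w1 (\<theta> - \<zeta> x))" for x
  using someI_ex[of "\<lambda>z. z \<in> ?Y \<and> vx n ?w1 (R x) = (\<Sum>\<theta>\<in>{0..<n}. (norm (ft n (R x) \<theta>))\<^sup>2 * ?w1 (\<theta> - z))"] vx_attained[OF n, of ?w1 "R x"]
  unfolding \<zeta>_def by blast+
 have p\<zeta>: "\<zeta> (x + N) = \<zeta> x" for x unfolding \<zeta>_def perD[OF pR] ..
 define Vs where "Vs x = (\<Sum>\<theta>\<in>{0..<n}. (norm (ft n (R x) \<theta>))\<^sup>2 * ?ws (\<theta> - \<zeta> x))" for x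
 have Vs0: "0 \<le> Vs x" for x unfolding Vs_def by (intro sum_nonneg mult_nonneg_nonneg wt_nonneg) auto
 have "1 / s \<le> avg ?X (\<lambda>x. 1 / (2 * s) + 2 * Vs x)"
 proof (rule order_trans[OF big], rule avg_mono)
  fix x
  have "vx n ?w1 (R x) \<le> (\<Sum>\<theta>\<in>{0..<n}. (norm (ft n (R x) \<theta>))\<^sup>2 * (1 / (2 * s) + 2 * ?ws (\<theta> - \<zeta> x)))"
   unfolding \<zeta>(2) by (intro sum_mono mult_left_mono wc) auto
  also have "\<dots> = (\<Sum>\<theta>\<in>{0..<n}. (norm (ft n (R x) \<theta>))\<^sup>2) * (1 / (2 * s)) + 2 * Vs x"
   unfolding Vs_def by (simp add: distrib_left sum.distrib sum_distrib_left sum_divide_distrib mult_ac)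
  also have "\<dots> \<le> 1 * (1 / (2 * s)) + 2 * Vs x"
   using s1 by (intro add_right_mono mult_right_mono parseval_le n qR bR) auto
  finally show "vx n ?w1 (R x) \<le> 1 / (2 * s) + 2 * Vs x" by simp
 qed
 also have "\<dots> = 1 / (2 * s) + 2 * avg ?X Vs" using N by (simp only: avg_add avg_cmult) (simp add: avg_const)
 finally have V1: "1 / (4 * s) \<le> avg ?X Vs" by (simp add: field_simps)
 define \<rho> where "\<rho> = 1 / (32 * s)"
 have \<rho>: "0 < \<rho>" "\<rho> \<le> 1" using s1 by (auto simp: \<rho>_def)
 have r1: "\<rho>\<^sup>2 / 4 = 1 / (2 ^ 12 * s\<^sup>2)" by (simp add: \<rho>_def power_divide power_mult_distrib)
 define Q4 where "Q4 = 2 ^ 73 / (\<rho>\<^sup>2 / 4) ^ 31"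
 define \<kappa>4 where "\<kappa>4 = 2 ^ 148 * (w ^ 6)\<^sup>2 / ((\<rho>\<^sup>2 / 4) ^ 62 * of_int (D\<^sup>2))"
 define Bx where "Bx x \<longleftrightarrow> maj Q4 \<kappa>4 (of_int (Q1 ^ 3) * (real_of_int (\<zeta> x) / n))" for x
 have Q4: "Q4 \<le> s ^ 63"
 proof -
  have "Q4 = 2 ^ 445 * s ^ 62" unfolding Q4_def r1 by (simp add: power_one_over power_mult_distrib flip: power_mult)
  also have "\<dots> \<le> s ^ 63" by (rule absorb) auto
  finally show ?thesis .
 qed
 have \<kappa>4: "\<kappa>4 \<le> w ^ 13 / dd\<^sup>2" "0 \<le> \<kappa>4"
 proof -
  have "\<kappa>4 = (2 ^ 892 * s ^ 124) * w ^ 12 / dd\<^sup>2"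
   unfolding \<kappa>4_def r1 by (simp add: power_one_over power_mult_distrib dd_def flip: power_mult)
  also have "\<dots> \<le> w * w ^ 12 / dd\<^sup>2"
   using w1 by (intro divide_right_mono mult_right_mono cw) auto
  also have "\<dots> = w ^ 13 / dd\<^sup>2" by (simp flip: power_Suc)
  finally show "\<kappa>4 \<le> w ^ 13 / dd\<^sup>2" .
  show "0 \<le> \<kappa>4" unfolding \<kappa>4_def using w1 by (intro divide_nonneg_nonneg mult_nonneg_nonneg) auto
 qed
 \<comment> \<open>The weight around \<zeta> x selects \<theta> with (\<theta> - \<zeta> x)Q1/n
   nearly integral; adding the major arc condition on Q1^3 \<zeta> x transfers it to
   \<theta>.\<close>
 have majx: "Vs x \<le> 1 / (16 * s)" if bx: "Bx x" for x
 proof -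
  obtain q :: int where q: "(1::int) \<le> q" "of_int q \<le> Q4" "near \<kappa>4 (of_int q * (of_int (Q1 ^ 3) * (real_of_int (\<zeta> x) / n)))"
   using bx[unfolded Bx_def maj_def] by blast
  have "s ^ 63 \<le> s ^ 200" using s1 by (intro power_increasing) auto
  then have "q dvd W" using q Q4 by (intro W(2)) auto
  then obtain m where m: "W = q * m" by (elim dvdE)
  have m0: "0 < m" using W0 q(1) m by (metis zero_less_mult_pos less_le_trans zero_less_one)
  let ?p = "\<lambda>\<theta>. (norm (ft n (?F x) \<theta>))\<^sup>2"
  have qF: "per n (?F x)" by (rule conf_per_n[OF q0 q1])
  have bF: "\<bar>?F x y\<bar> \<le> 1" for y by (rule conf_bound[OF b0 b1])
  have "Vs x \<le> (\<Sum>\<theta>\<in>{0..<n}. ?p \<theta> * (1 / (16 * s)))"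
   unfolding Vs_def
  proof (rule sum_mono)
   fix \<theta>
   let ?a = "wt n {0..<L} (\<theta> * (4 * W ^ 4)\<^sup>2)"
   let ?z = "real_of_int \<theta> / n"
   have a: "0 \<le> 1 - ?a" "1 - ?a \<le> 1" using wt_nonneg wt_le_1 by (simp_all add: algebra_simps)
   have ws: "0 \<le> ?ws (\<theta> - \<zeta> x)" "?ws (\<theta> - \<zeta> x) \<le> 1" by (simp_all add: wt_nonneg wt_le_1)
   have "(norm (ft n (R x) \<theta>))\<^sup>2 * ?ws (\<theta> - \<zeta> x) = ?p \<theta> * ((1 - ?a)\<^sup>2 / 4 * ?ws (\<theta> - \<zeta> x))"
    unfolding ft_half_diff[OF n qF R] norm_mult norm_of_real by (simp add: power_mult_distrib power_divide)
   also have "\<dots> \<le> ?p \<theta> * (1 / (16 * s))"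
   proof (rule mult_left_mono)
    show "(1 - ?a)\<^sup>2 / 4 * ?ws (\<theta> - \<zeta> x) \<le> 1 / (16 * s)"
    proof (cases "1 / (4 * s) \<le> ?ws (\<theta> - \<zeta> x)")
     case False
     have "(1 - ?a)\<^sup>2 \<le> 1" using a by (simp add: power_le_one)
     then have "(1 - ?a)\<^sup>2 / 4 * ?ws (\<theta> - \<zeta> x) \<le> 1 / 4 * (1 / (4 * s))" using False ws by (intro mult_mono) auto
     then show ?thesis by simp
    next
     case True
     have "near (2 / (1 / (4 * s) * L1)) (of_int ((\<theta> - \<zeta> x) * Q1) / n)"
      using s1 by (intro wt_near[OF L10 _ True]) auto
     then have "near (of_int \<bar>q * Q1\<^sup>2\<bar> * (8 * s / L1)) (of_int (q * Q1\<^sup>2) * (of_int ((\<theta> - \<zeta> x) * Q1) / n))"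
      by (intro near_mult) simp
     from near_add[OF this q(3)]
     have "near (of_int \<bar>q * Q1\<^sup>2\<bar> * (8 * s / L1) + \<kappa>4) (of_int (q * Q1 ^ 3) * ?z)"
     proof (rule back_subst[of "near _"])
      show "of_int (q * Q1\<^sup>2) * (of_int ((\<theta> - \<zeta> x) * Q1) / n) + of_int q * (of_int (Q1 ^ 3) * (real_of_int (\<zeta> x) / n)) = of_int (q * Q1 ^ 3) * ?z"
       by (simp add: algebra_simps power2_eq_square power3_eq_cube flip: add_divide_distrib)
     qed
     from near_mult[OF this, of "2 * m * W"]
     have "near (of_int \<bar>2 * m * W\<bar> * (of_int \<bar>q * Q1\<^sup>2\<bar> * (8 * s / L1) + \<kappa>4)) (of_int (\<theta> * (4 * W ^ 4)\<^sup>2) / n)"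
      proof (rule back_subst[of "near _"])
      \<comment> \<open>Origin of the smoothing step: with q m = W and Q1 = 2W^2 the product is 2
        W^2 times 8 W^6, that is (4W^4)^2.\<close>
      have "2 * m * W * (q * Q1 ^ 3) = 2 * (q * m) * W * Q1 ^ 3" by simp
      also have "\<dots> = (4 * W ^ 4)\<^sup>2" unfolding m[symmetric] Q1_def by (simp add: power_mult_distrib flip: power_mult power_add power_Suc power_Suc2)
      finally have e: "2 * m * W * (q * Q1 ^ 3) = (4 * W ^ 4)\<^sup>2" .
      show "of_int (2 * m * W) * (of_int (q * Q1 ^ 3) * ?z) = of_int (\<theta> * (4 * W ^ 4)\<^sup>2) / n"
       unfolding e[symmetric] by simp
     qed
     moreover have "of_int \<bar>2 * m * W\<bar> * (of_int \<bar>q * Q1\<^sup>2\<bar> * (8 * s / L1) + \<kappa>4) \<le> 4 * w ^ 15 / dd\<^sup>2"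
     proof -
      have qm: "real_of_int q * real_of_int m = w" using m by (simp add: w_def)
      have mw: "real_of_int m \<le> w" using qm q(1) m0 mult_right_mono[of 1 "real_of_int q" "real_of_int m"] by simp
      have e: "of_int \<bar>2 * m * W\<bar> * (of_int \<bar>q * Q1\<^sup>2\<bar> * (8 * s / L1) + \<kappa>4)
       = w * (2 * (real_of_int q * real_of_int m) * ((real_of_int Q1)\<^sup>2 * (8 * s / L1)) + 2 * m * \<kappa>4)"
       using m0 q(1) W0 by (simp add: abs_mult w_def algebra_simps)
      have "(real_of_int Q1)\<^sup>2 * (8 * s / L1) = 32 * s * w ^ 4 / (\<mu> * (w ^ 6 * dd\<^sup>2))"
       unfolding rQ rL1 by (simp add: power_mult_distrib flip: power_mult)
      also have "\<dots> \<le> 32 * s * w ^ 4 / (1 * (w ^ 4 * dd\<^sup>2))"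
       using \<mu>r s1 w1 d1 wp(2) power_increasing[of 4 6 w] by (intro divide_left_mono mult_mono mult_pos_pos) (auto intro!: mult_nonneg_nonneg)
      also have "\<dots> = 32 * s / dd\<^sup>2" using w1 by simp
      also have "\<dots> \<le> w ^ 13 / dd\<^sup>2"
      proof (rule divide_right_mono)
       have "32 * s ^ 1 \<le> w" by (rule cw) auto
       also have "w \<le> w ^ 13" using power_increasing[of 1 13 w] w1 by simp
       finally show "32 * s \<le> w ^ 13" by simp
      qed simp
      finally have i: "(real_of_int Q1)\<^sup>2 * (8 * s / L1) \<le> w ^ 13 / dd\<^sup>2" .
      have "2 * w * ((real_of_int Q1)\<^sup>2 * (8 * s / L1)) \<le> 2 * w * (w ^ 13 / dd\<^sup>2)" using i w1 by (intro mult_left_mono) auto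
      moreover have "2 * m * \<kappa>4 \<le> 2 * w * (w ^ 13 / dd\<^sup>2)" using mw \<kappa>4 w1 by (intro mult_mono) auto
      moreover have "2 * w * (w ^ 13 / dd\<^sup>2) = 2 * w ^ 14 / dd\<^sup>2" by (simp flip: power_Suc)
      ultimately have "2 * w * ((real_of_int Q1)\<^sup>2 * (8 * s / L1)) + 2 * m * \<kappa>4 \<le> 4 * w ^ 14 / dd\<^sup>2" by linarith
      then have "w * (2 * w * ((real_of_int Q1)\<^sup>2 * (8 * s / L1)) + 2 * m * \<kappa>4) \<le> w * (4 * w ^ 14 / dd\<^sup>2)" using w1 by (intro mult_left_mono) auto
      also have "\<dots> = 4 * w ^ 15 / dd\<^sup>2" by (simp flip: power_Suc)
      finally show ?thesis unfolding e qm .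
     qed
     ultimately have "near (4 * w ^ 15 / dd\<^sup>2) (of_int (\<theta> * (4 * W ^ 4)\<^sup>2) / n)" by (rule near_mono)
     from wt_lower[OF L(1) this]
     have a1: "1 - ?a \<le> 16 * L * (4 * w ^ 15 / dd\<^sup>2)" by linarith
     have "16 * L * (4 * w ^ 15 / dd\<^sup>2) * w\<^sup>2 = 64 * (L * w ^ 17 / dd\<^sup>2)" by (simp flip: power_add)
     also have "\<dots> \<le> 64 * 1"
     proof -
      have "real_of_int (L * W ^ 17) \<le> real_of_int (D\<^sup>2)" using L(2) by (simp only: of_int_le_iff)
      then show ?thesis using d1 by (simp add: w_def dd_def divide_le_eq)
     qed
     finally have "16 * L * (4 * w ^ 15 / dd\<^sup>2) \<le> 64 / w\<^sup>2" using w1 by (simp add: le_divide_eq)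
     also have "\<dots> \<le> 64 / w" using w1 power_increasing[of 1 2 w] by (intro divide_left_mono) auto
     also have "\<dots> \<le> 1 / (4 * s)"
     proof -
      have "256 * s ^ 1 \<le> w" by (rule cw) auto
      then show ?thesis using w1 s1 by (simp add: field_simps)
     qed
     finally have a2: "1 - ?a \<le> 1 / (4 * s)" using a1 by linarith
     have "(1 - ?a)\<^sup>2 \<le> 1 - ?a" unfolding power2_eq_square using a mult_left_mono[of "1 - ?a" 1 "1 - ?a"] by simp
     then have "(1 - ?a)\<^sup>2 / 4 * ?ws (\<theta> - \<zeta> x) \<le> (1 / (4 * s)) / 4 * 1" using a2 ws s1 by (intro mult_mono divide_right_mono) auto
     then show ?thesis by simp
    qed
   qed simp
   finally show "(norm (ft n (R x) \<theta>))\<^sup>2 * ?ws (\<theta> - \<zeta> x) \<le> ?p \<theta> * (1 / (16 * s))" .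
  qed
  also have "\<dots> = (\<Sum>\<theta>\<in>{0..<n}. ?p \<theta>) * (1 / (16 * s))" by (simp only: sum_distrib_right)
  also have "\<dots> \<le> 1 * (1 / (16 * s))" using s1 by (intro mult_right_mono parseval_le[OF n qF bF]) auto
  finally show ?thesis by simp
 qed
 define T where "T x = (if Bx x then 0 else 1 :: real)" for x
 have "avg ?X Vs \<le> avg ?X (\<lambda>x. 1 / (16 * s) + T x * Vs x)"
  using majx Vs0 s1 by (intro avg_mono) (auto simp: T_def)
 also have "\<dots> = 1 / (16 * s) + avg ?X (\<lambda>x. T x * Vs x)" using N by (simp add: avg_add avg_const)
 finally have V2: "3 / (16 * s) \<le> avg ?X (\<lambda>x. T x * Vs x)"
 proof -
  assume "avg ?X Vs \<le> 1 / (16 * s) + avg ?X (\<lambda>x. T x * Vs x)"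
  moreover have "1 / (4 * s) = 1 / (16 * s) + 3 / (16 * s)" using s1 by (simp add: field_simps)
  ultimately show ?thesis using V1 by linarith
 qed
 define g where "g x y = avg2 {0..<L1} (\<lambda>l l'. of_real (R x (y + Q1 * (l' - l))) * ch n (- (\<zeta> x * (y + Q1 * (l' - l)))))" for x y
 define a where "a = (\<lambda>(x, y). of_real (T x) * (ch n (\<zeta> x * y) * g x y))"
 have "norm (avg (?X \<times> ?Y) (\<lambda>z. a z * of_real (case z of (x, y) \<Rightarrow> R x y))) = avg ?X (\<lambda>x. T x * Vs x)"
 proof -
  have "avg (?X \<times> ?Y) (\<lambda>z. a z * of_real (case z of (x, y) \<Rightarrow> R x y))
   = avg ?X (\<lambda>x. of_real (T x) * avg ?Y (\<lambda>y. ch n (\<zeta> x * y) * g x y * of_real (R x y)))"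
   by (simp only: avg_Times a_def prod.case avg_cmult[symmetric] mult.assoc)
  also have "\<dots> = avg ?X (\<lambda>x. of_real (T x) * of_real (Vs x))"
   unfolding g_def Vs_def weighted_energy[OF n qR] ..
  also have "\<dots> = of_real (avg ?X (\<lambda>x. T x * Vs x))" by (simp only: of_real_mult[symmetric] avg_of_real)
  also have "norm \<dots> = avg ?X (\<lambda>x. T x * Vs x)"
   using Vs0 by (simp add: abs_of_nonneg avg_nonneg T_def)
  finally show ?thesis .
 qed
 then have "3 / (16 * s) \<le> norm (avg (?X \<times> ?Y) (\<lambda>z. a z * of_real (case z of (x, y) \<Rightarrow> R x y)))" using V2 by simp
 also have "(\<lambda>z. a z * of_real (case z of (x, y) \<Rightarrow> R x y))
  = (\<lambda>z. a z * of_real (((case z of (x, y) \<Rightarrow> (\<lambda>w. ?F x (y + w))) 0 - avg2 {0..<L} (\<lambda>l l'. (case z of (x, y) \<Rightarrow> (\<lambda>w. ?F x (y + w))) ((4 * W ^ 4)\<^sup>2 * (l' - l)))) / 2))"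
  by (auto simp: R fun_eq_iff)
 finally obtain v where "3 / (16 * s) \<le> norm (avg (?X \<times> ?Y) (\<lambda>z. a z * of_real ((case z of (x, y) \<Rightarrow> (\<lambda>w. ?F x (y + w))) v)))"
  using half_diff_witness[where G = "\<lambda>z. case z of (x, y) \<Rightarrow> (\<lambda>w. ?F x (y + w))" and S = "{0..<L}"] L(1) by fastforce
 then have cv: "3 / (16 * s) \<le> norm (avg ?X (\<lambda>x. avg ?Y (\<lambda>y. a (x, y) * of_real (?F x (y + v)))))"
  by (simp only: avg_Times prod.case)
 define h0 where "h0 x y = ch n (\<zeta> x * y) * of_real (f0 x (y + v))" for x y
 define h1 where "h1 x y = (of_real (f1 x (y + v)) :: complex)" for x y
 define z' where "z' x = real_of_int (\<zeta> x) / n" for x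
 let ?U = "\<lambda>x. norm (avg \<Omega> (\<lambda>\<omega>. avg ?C (\<lambda>cc. avg ?Y (\<lambda>y.
  h0 x y * h1 (x + \<gamma> * (dv \<omega> + cc)) y * ee (z' x * of_int ((dv \<omega> + cc)\<^sup>2)) * g x (y + (dv \<omega> + cc)\<^sup>2)))))"
 have ng: "norm (g x y) \<le> 1" for x y
  unfolding g_def avg2_def by (rule norm_avg_bound, rule norm_avg_bound) (use bR in \<open>simp_all add: norm_mult\<close>)
 have nh: "norm (h0 x y) \<le> 1" "norm (h1 x y) \<le> 1" for x y
  unfolding h0_def h1_def norm_mult norm_ch norm_of_real by (simp_all add: b0 b1)
 have eqU: "avg ?X (\<lambda>x. avg ?Y (\<lambda>y. a (x, y) * of_real (?F x (y + v))))
  = avg ?X (\<lambda>x. of_real (T x) * avg \<Omega> (\<lambda>\<omega>. avg ?C (\<lambda>cc. avg ?Y (\<lambda>y.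
   h0 x y * h1 (x + \<gamma> * (dv \<omega> + cc)) y * ee (z' x * of_int ((dv \<omega> + cc)\<^sup>2)) * g x (y + (dv \<omega> + cc)\<^sup>2)))))"
 proof (rule avg_cong)
  fix x
  have chp: "ch n (\<zeta> x * (y + n)) = ch n (\<zeta> x * y)" for y
  proof -
   have "\<zeta> x * (y + n) = \<zeta> x * y + n * \<zeta> x" by (simp add: algebra_simps)
   then show ?thesis by (simp only: ch_period[OF n])
  qed
  have chm: "ch n (- (\<zeta> x * (y + n))) = ch n (- (\<zeta> x * y))" for y
  proof -
   have "- (\<zeta> x * (y + n)) = - (\<zeta> x * y) + n * (- \<zeta> x)" by (simp add: algebra_simps)
   then show ?thesis by (simp only: ch_period[OF n])
  qed
  have sh: "y + n + b = (y + b) + n" for y b :: int by simp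
  have gp: "g x (y + n) = g x y" for y unfolding g_def sh by (simp only: perD[OF qR] chm)
  have "per n (\<lambda>y. a (x, y))" unfolding per_def a_def prod.case by (simp only: gp chp simp_thms)
  from conf_dual[OF q0 q1 this, where s = v]
  have "avg ?Y (\<lambda>y. a (x, y) * of_real (?F x (y + v))) = avg \<Omega> (\<lambda>\<omega>. avg ?C (\<lambda>cc. avg ?Y (\<lambda>y. a (x, y + (dv \<omega> + cc)\<^sup>2) * of_real (f0 x (y + v) * f1 (x + \<gamma> * (dv \<omega> + cc)) (y + v)))))" .
  also have "\<dots> = avg \<Omega> (\<lambda>\<omega>. avg ?C (\<lambda>cc. avg ?Y (\<lambda>y. of_real (T x) *
   (h0 x y * h1 (x + \<gamma> * (dv \<omega> + cc)) y * ee (z' x * of_int ((dv \<omega> + cc)\<^sup>2)) * g x (y + (dv \<omega> + cc)\<^sup>2)))))"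
  proof (rule avg_cong, rule avg_cong, rule avg_cong)
   fix \<omega> cc y
   have "ch n (\<zeta> x * (y + (dv \<omega> + cc)\<^sup>2)) = ch n (\<zeta> x * y) * ee (z' x * of_int ((dv \<omega> + cc)\<^sup>2))"
    unfolding distrib_left ch_add by (simp add: ch_def z'_def)
   then show "a (x, y + (dv \<omega> + cc)\<^sup>2) * of_real (f0 x (y + v) * f1 (x + \<gamma> * (dv \<omega> + cc)) (y + v)) = of_real (T x) *
    (h0 x y * h1 (x + \<gamma> * (dv \<omega> + cc)) y * ee (z' x * of_int ((dv \<omega> + cc)\<^sup>2)) * g x (y + (dv \<omega> + cc)\<^sup>2))"
    unfolding a_def prod.case h0_def h1_def of_real_mult by (simp only: mult_ac)
  qed
  finally show "avg ?Y (\<lambda>y. a (x, y) * of_real (?F x (y + v))) = of_real (T x) * avg \<Omega> (\<lambda>\<omega>. avg ?C (\<lambda>cc. avg ?Y (\<lambda>y.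
   h0 x y * h1 (x + \<gamma> * (dv \<omega> + cc)) y * ee (z' x * of_int ((dv \<omega> + cc)\<^sup>2)) * g x (y + (dv \<omega> + cc)\<^sup>2))))"
   by (simp only: avg_cmult)
 qed
 have drop: "norm (of_real (T x) * Q :: complex) \<le> T x * norm Q" for x Q by (simp add: norm_mult T_def)
 have "norm (avg ?X (\<lambda>x. avg ?Y (\<lambda>y. a (x, y) * of_real (?F x (y + v))))) \<le> avg ?X (\<lambda>x. T x * ?U x)"
  unfolding eqU by (rule order_trans[OF norm_avg_le], rule avg_mono, rule drop)
 also have "\<dots> \<le> 2 * \<rho> + avg ?X (\<lambda>x. if Bx x then T x else 0)"
 proof (rule exceptional_split[OF N])
  show "?U x \<le> 1" for x
   by (rule norm_avg_bound, rule norm_avg_bound, rule norm_avg_bound) (simp_all add: norm_mult ng nh mult_le_one)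
  show "real (card {x\<in>?X. \<rho> \<le> ?U x \<and> \<not> Bx x}) \<le> \<rho> * N"
   unfolding Bx_def Q4_def \<kappa>4_def z'_def[symmetric]
  proof (rule major_arc[OF N M0 D0 Q0(1) \<rho> fin])
   show "per N h0" "per N h1" "per N g" "per N z'"
    unfolding per_def h0_def h1_def g_def z'_def by (simp_all only: p\<zeta> perD[OF p0] perD[OF p1] perD[OF pR] simp_thms)
  next
   fix x y j :: int assume j: "\<bar>j\<bar> \<le> 7 * M * D"
   have w7: "7 \<le> W"
   proof -
    have "7 * s ^ 0 \<le> w" by (rule cw) auto
    then show ?thesis by (simp add: w_def)
   qed
   have jL: "\<bar>j\<bar> \<le> L1"
   proof -
    have "7 * (M * D) \<le> W * (M * D)" using w7 M0 D0 by (intro mult_right_mono) auto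
    then show ?thesis using j by (simp add: L1_def)
   qed
   have "norm (g x (y + Q1 * j) - g x y) \<le> 2 * real_of_int \<bar>j\<bar> / real_of_int L1"
    unfolding g_def by (rule avg2_slow[OF _ L10 jL, of "\<lambda>y. of_real (R x y) * ch n (- (\<zeta> x * y))"]) (simp add: norm_mult bR)
   also have "\<dots> \<le> \<rho>\<^sup>2 / 4"
   proof -
    have k: "57344 * s\<^sup>2 \<le> w" by (rule cw) auto
    have "2 * real_of_int \<bar>j\<bar> \<le> 2 * real_of_int (7 * M * D)" using j by (simp only: of_int_le_iff mult_le_cancel_left_pos zero_less_numeral)
    then have "2 * real_of_int \<bar>j\<bar> * (2 ^ 12 * s\<^sup>2) \<le> 14 * real_of_int (M * D) * (2 ^ 12 * s\<^sup>2)" by (intro mult_right_mono) auto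
    also have "\<dots> = 57344 * s\<^sup>2 * real_of_int (M * D)" by simp
    also have "\<dots> \<le> w * real_of_int (M * D)" using k M0 D0 by (intro mult_right_mono) auto
    also have "\<dots> = L1" by (simp add: L1_def w_def)
    finally have "2 * real_of_int \<bar>j\<bar> * (2 ^ 12 * s\<^sup>2) \<le> L1" .
    then show ?thesis unfolding r1 using s1 L10 by (simp add: field_simps)
   qed
   finally show "norm (g x (y + Q1 * j) - g x y) \<le> \<rho>\<^sup>2 / 4" .
  next
   have k: "2 ^ 14 * s\<^sup>2 \<le> w" by (rule cw) auto
   have "(16 * (w\<^sup>2 * dd)) * (2 ^ 10 * s\<^sup>2) = (2 ^ 14 * s\<^sup>2) * (w\<^sup>2 * dd)" by simp
   also have "\<dots> \<le> w * (w\<^sup>2 * dd)" using k w1 d1 by (intro mult_right_mono) auto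
   also have "\<dots> = w ^ 3 * dd" by (simp add: power2_eq_square power3_eq_cube)
   also have "\<dots> \<le> 1 * (w ^ 5 * dd)" using power_increasing[of 3 5 w] w1 d1 by simp
   also have "\<dots> \<le> \<mu> * (w ^ 5 * dd)" using \<mu>r w1 d1 by (intro mult_right_mono) auto
   also have "\<dots> = M" by (simp only: rM)
   finally have A: "(16 * (w\<^sup>2 * dd)) * (2 ^ 10 * s\<^sup>2) \<le> M" .
   have e1: "real_of_int (8 * (Q1 * D)) = 16 * (w\<^sup>2 * dd)" by (simp add: rQ dd_def)
   have e2: "\<rho>\<^sup>2 = 1 / (2 ^ 10 * s\<^sup>2)" by (simp add: \<rho>_def power_divide power_mult_distrib)
   have "16 * (w\<^sup>2 * dd) \<le> M / (2 ^ 10 * s\<^sup>2)" by (rule pos_le_divide_eq[THEN iffD2, OF _ A]) (use s1 in simp)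
   then show "real_of_int (8 * (Q1 * D)) \<le> \<rho>\<^sup>2 * real_of_int M" unfolding e1 e2 by simp
  next
   have "16 * real_of_int Q1 / (\<rho>\<^sup>2 / 4)\<^sup>2 = (2 ^ 29 * s ^ 4) * w\<^sup>2"
    unfolding r1 rQ by (simp add: power_one_over power_mult_distrib flip: power_mult)
   also have "\<dots> \<le> w * w\<^sup>2" using w1 by (intro mult_right_mono cw) auto
   also have "\<dots> = w ^ 3" by (simp add: power2_eq_square power3_eq_cube)
   also have "\<dots> \<le> w ^ 5" using w1 by (intro power_increasing) auto
   finally have A: "16 * real_of_int Q1 / (\<rho>\<^sup>2 / 4)\<^sup>2 \<le> w ^ 5" .
   have "3 * real_of_int M / real_of_int D = 3 * \<mu> * w ^ 5" unfolding rM dd_def[symmetric] using d1 by simp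
   moreover have "3 * \<mu> * w ^ 5 + w ^ 5 \<le> w * w ^ 5"
   proof -
    have "4 * s ^ 1 \<le> w" by (rule cw) auto
    then have "3 * \<mu> + 1 \<le> w" using \<mu>r by simp
    then have "(3 * \<mu> + 1) * w ^ 5 \<le> w * w ^ 5" using w1 by (intro mult_right_mono) auto
    then show ?thesis by (simp add: distrib_right)
   qed
   moreover have "w * w ^ 5 = w ^ 6" by (simp flip: power_Suc)
   moreover have "real_of_int (16 * Q1) = 16 * real_of_int Q1" "real_of_int (3 * M) = 3 * real_of_int M" by simp_all
   ultimately show "real_of_int (16 * Q1) / (\<rho>\<^sup>2 / 4)\<^sup>2 + real_of_int (3 * M) / real_of_int D \<le> w ^ 6" using A by simp
  next
   have "2 ^ 78 * w ^ 6 / (\<rho>\<^sup>2 / 4) ^ 31 = (2 ^ 450 * s ^ 62) * w ^ 6"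
    unfolding r1 by (simp add: power_one_over power_mult_distrib flip: power_mult)
   also have "\<dots> \<le> w * w ^ 6" using w1 by (intro mult_right_mono cw) auto
   also have "\<dots> = w ^ 7" by (simp flip: power_Suc)
   also have "\<dots> \<le> w ^ 16" using w1 by (intro power_increasing) auto
   also have "\<dots> \<le> D" using Dw by (simp add: dd_def)
   finally show "2 ^ 78 * w ^ 6 / (\<rho>\<^sup>2 / 4) ^ 31 \<le> D" .
  qed (use ng nh dv in auto)
 qed (use \<rho> in \<open>auto simp: T_def\<close>)
 \<comment> \<open>T vanishes where Bx holds, so only the exceptional cost 2\<rho> = 1/(16s) is
   left, against a correlation of at least 3/(16s).\<close>
 also have "avg ?X (\<lambda>x. if Bx x then T x else 0) = 0"
  by (simp add: T_def if_distrib cong: if_cong)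
 finally have "3 / (16 * s) \<le> 2 * \<rho>" using cv by linarith
 then show False using s1 by (simp add: \<rho>_def field_simps)
qed

section \<open>The parameter space of the displacements\<close>

definition msize :: "int \<Rightarrow> int \<Rightarrow> int \<Rightarrow> int" where
 "msize t W D = t ^ 74 * (W * (W ^ 4 * D))"

text \<open>The coordinates (k, \<sigma>, i, j, a, b) match the averages in \<open>u3_bound\<close>:
  i and j are used up by \<open>pet1\<close>, the layers a and b together with the interval variable
  c by \<open>lin3\<close>. The dilation k serves \<open>bad_pairs\<close>, and \<sigma>, as long as
  c, serves the lower bound for the count.\<close>

definition params :: "int \<Rightarrow> int \<Rightarrow> int \<Rightarrow> (int \<times> int \<times> int \<times> int \<times> int \<times> int) set" where
 "params t W D = (let H = W * (W ^ 4 * D) in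
  {1..H} \<times> ({0..<msize t W D} \<times> ({0..<H} \<times> ({0..<t ^ 36} \<times> ({0..<t ^ 71 * H} \<times> {0..<H})))))"

definition disp :: "int \<times> int \<times> int \<times> int \<times> int \<times> int \<Rightarrow> int" where
 "disp = (\<lambda>(k, \<sigma>, i, j, a, b). i + k * j + (a + b) - \<sigma>)"

text \<open>All terms except -\<sigma> add up to at most 4t^71 H, and t times this is at most t^74
  H. This explains the exponent 74: the layers other than \<sigma> and c move the displacement by at
  most a fraction 1/t of its range.\<close>

lemma disp_bound:
 assumes t: "2 ^ 20 \<le> t" and W: "0 < W" and D: "0 < D" and \<omega>: "\<omega> \<in> params t W D"
 obtains k \<sigma> e where "disp \<omega> = e - \<sigma>" "0 \<le> \<sigma>" "\<sigma> < msize t W D" "0 \<le> e" "t * e \<le> msize t W D"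
proof -
 define H where "H = W * (W ^ 4 * D)"
 have H: "0 < H" using W D by (simp add: H_def)
 have M: "msize t W D = t ^ 74 * H" by (simp add: msize_def H_def)
 obtain k \<sigma> i j a b where w: "\<omega> = (k, \<sigma>, i, j, a, b)" by (metis prod.exhaust)
 have r: "1 \<le> k" "k \<le> H" "0 \<le> \<sigma>" "\<sigma> < msize t W D" "0 \<le> i" "i < H" "0 \<le> j" "j < t ^ 36" "0 \<le> a" "a < t ^ 71 * H" "0 \<le> b" "b < H"
  using \<omega> unfolding w params_def Let_def H_def[symmetric] by auto
 have kj: "k * j \<le> H * t ^ 36" using r by (intro mult_mono) auto
 have tp: "t ^ 36 \<le> t ^ 71" "1 \<le> t ^ 71" "4 * t ^ 72 \<le> t ^ 74"
 proof -
  show "t ^ 36 \<le> t ^ 71" "1 \<le> t ^ 71" using t by (auto intro!: power_increasing one_le_power)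
  have "4 \<le> t\<^sup>2" using t mult_mono[of 2 t 2 t] by (simp add: power2_eq_square)
  then have "4 * t ^ 72 \<le> t\<^sup>2 * t ^ 72" using t by (intro mult_right_mono) auto
  then show "4 * t ^ 72 \<le> t ^ 74" by (simp flip: power_add)
 qed
 have "H * t ^ 36 \<le> H * t ^ 71" using tp H by (intro mult_left_mono) auto
 moreover have "H \<le> H * t ^ 71" using tp H mult_left_mono[of 1 "t ^ 71" H] by simp
 moreover have "t ^ 71 * H = H * t ^ 71" by simp
 ultimately have e4: "i + k * j + (a + b) \<le> 4 * (t ^ 71 * H)" using kj r by linarith
 have "t * (i + k * j + (a + b)) \<le> t * (4 * (t ^ 71 * H))" using e4 t by (intro mult_left_mono) auto
 also have "\<dots> = 4 * t ^ 72 * H" by (simp flip: power_Suc add: mult.assoc[symmetric])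
 also have "\<dots> \<le> t ^ 74 * H" using tp H by (intro mult_right_mono) auto
 finally have "t * (i + k * j + (a + b)) \<le> msize t W D" by (simp add: M)
 moreover have "0 \<le> k * j" using r by simp
 ultimately show ?thesis using r by (intro that[of "i + k * j + (a + b)" \<sigma>]) (auto simp: w disp_def)
qed

lemma disp_bound3:
 assumes "2 ^ 20 \<le> t" "0 < W" "0 < D" "\<omega> \<in> params t W D" "0 \<le> c" "c < msize t W D"
 shows "\<bar>disp \<omega> + c\<bar> \<le> 3 * msize t W D"
proof -
 obtain \<sigma> e where d: "disp \<omega> = e - \<sigma>" "0 \<le> \<sigma>" "\<sigma> < msize t W D" "0 \<le> e" "t * e \<le> msize t W D"
  using disp_bound[OF assms(1-4)] by metis
 have "1 * e \<le> t * e" using assms(1) d by (intro mult_right_mono) auto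
 then show ?thesis using d assms by auto
qed

lemma finite_params: "finite (params t W D)"
 by (simp add: params_def Let_def)

lemma params_nonempty: "0 < t \<Longrightarrow> 0 < W \<Longrightarrow> 0 < D \<Longrightarrow> params t W D \<noteq> {}"
 by (auto simp: params_def Let_def msize_def) (smt (verit) mult_pos_pos zero_less_power)+

text \<open>If the claim fails, \<open>half_diff_energy\<close> makes R correlate with F by 1/t.
  Then \<open>u3_bound\<close> loses the power 2900, so r = t^2900, \<open>weighted_bound\<close>
  the power 530, so s = r^530, and \<open>weighted_bound_contradiction\<close> needs W to exceed
  s^200 and to be divisible by all smaller integers. This is the tower of exponents in the
  hypotheses on W.\<close>

lemma local_structure:
 fixes t W D L N n \<gamma> :: int and f0 f1 :: "int \<Rightarrow> int \<Rightarrow> real"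
 defines "F \<equiv> conf (params t W D) disp (msize t W D) \<gamma> f0 f1"
 assumes t: "2 ^ 20 \<le> t" and W: "((t ^ 2900) ^ 530) ^ 200 \<le> W" "\<And>m. 1 \<le> m \<Longrightarrow> m \<le> ((t ^ 2900) ^ 530) ^ 200 \<Longrightarrow> m dvd W"
  and D: "W ^ 16 \<le> D" and L: "0 < L" "L * W ^ 17 \<le> D\<^sup>2" and N: "0 < N" and n: "0 < n" "n \<le> t ^ 10 * (msize t W D)\<^sup>2"
  and p0: "per N f0" and p1: "per N f1" and q0: "\<And>x. per n (f0 x)" and q1: "\<And>x. per n (f1 x)"
  and b0: "\<And>x y. \<bar>f0 x y\<bar> \<le> 1" and b1: "\<And>x y. \<bar>f1 x y\<bar> \<le> 1"
 shows "avg {0..<N} (\<lambda>x. avg {0..<n} (\<lambda>y. (F x y - avg2 {0..<L} (\<lambda>l l'. F x (y + (4 * W ^ 4)\<^sup>2 * (l' - l))))\<^sup>2)) \<le> 2 / t"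
proof (rule ccontr)
 let ?X = "{0..<N}" and ?Y = "{0..<n}"
 let ?M = "msize t W D" and ?\<Omega> = "params t W D" and ?B = "W ^ 4 * D" and ?v = "(4 * W ^ 4)\<^sup>2"
 let ?H = "W * ?B"
 define r where "r = real_of_int (t ^ 2900)"
 define R where "R x y = (F x y - avg2 {0..<L} (\<lambda>l l'. F x (y + ?v * (l' - l)))) / 2" for x y
 have t0: "1 \<le> t" "0 < t" using t by simp_all
 have tp: "1 \<le> t ^ k" "0 < t ^ k" for k using t0 by auto
 have W1: "1 \<le> W"
 proof -
  have "1 \<le> ((t ^ 2900) ^ 530) ^ 200" by (intro one_le_power tp)
  then show ?thesis using W(1) by linarith
 qed
 have Wp: "1 \<le> W ^ k" for k using W1 by (intro one_le_power)
 have WD: "W \<le> D" "1 \<le> D"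
 proof -
  have "W ^ 1 \<le> W ^ 16" using W1 by (intro power_increasing) auto
  then show "W \<le> D" using D by simp
  then show "1 \<le> D" using W1 by simp
 qed
 have WB: "W \<le> ?B" using mult_mono[OF Wp[of 4] WD(1)] W1 by simp
 have B0: "0 < ?B" "0 < ?H" using W1 WB by (auto intro!: mult_pos_pos)
 have Meq: "?M = t ^ 74 * (W ^ 5 * D)" "?M = t ^ 74 * ?H" by (simp_all add: msize_def flip: mult.assoc power_Suc)
 have BM: "?B \<le> ?M"
 proof -
  have "1 * (1 * ?B) \<le> t ^ 74 * (W * ?B)" using tp W1 B0 WD by (intro mult_mono) auto
  then show ?thesis by (simp add: msize_def)
 qed
 have M0: "0 < ?M" using BM B0 by linarith
 have pF: "F (x + N) y = F x y" for x y unfolding F_def by (rule conf_per[OF p0 p1])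
 have pF': "F (x + N) = F x" for x using pF by (rule ext)
 have qF: "per n (F x)" for x unfolding F_def by (rule conf_per_n[OF q0 q1])
 have bF: "\<bar>F x y\<bar> \<le> 1" for x y unfolding F_def by (rule conf_bound[OF b0 b1])
 have pR: "per N R" unfolding per_def fun_eq_iff R_def pF by simp
 have sh: "y + n + a = (y + a) + n" for y a :: int by simp
 have qR: "per n (R x)" for x unfolding per_def R_def sh perD[OF qF] by simp
 have bR: "\<bar>R x y\<bar> \<le> 1" for x y
 proof -
  have "\<bar>avg2 {0..<L} (\<lambda>l l'. F x (y + ?v * (l' - l)))\<bar> \<le> 1"
   unfolding avg2_def by (rule abs_avg_bound, rule abs_avg_bound) (auto simp: bF)
  then have "\<bar>F x y - avg2 {0..<L} (\<lambda>l l'. F x (y + ?v * (l' - l)))\<bar> \<le> 2" using bF[of x y] by linarith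
  then show ?thesis by (simp add: R_def abs_divide)
 qed
 assume "\<not> ?thesis"
 then have "2 / t < avg ?X (\<lambda>x. avg ?Y (\<lambda>y. 4 * (R x y)\<^sup>2))"
  by (simp add: R_def power_divide not_le)
 then have "2 / t < 2 * avg ?X (\<lambda>x. 2 * avg ?Y (\<lambda>y. (R x y)\<^sup>2))" by (simp only: avg_cmult)
 also have "avg ?X (\<lambda>x. 2 * avg ?Y (\<lambda>y. (R x y)\<^sup>2)) \<le> avg ?X (\<lambda>x. avg ?Y (\<lambda>y. F x y * R x y))"
  by (rule avg_mono, rule half_diff_energy[OF n(1) qF]) (simp add: R_def)
 finally have big0: "1 / t \<le> avg ?X (\<lambda>x. avg ?Y (\<lambda>y. F x y * R x y))" by simp
 have dual: "avg ?Y (\<lambda>y. F x y * R x y) = avg ?\<Omega> (\<lambda>\<omega>. avg {0..<?M} (\<lambda>c. avg ?Y (\<lambda>y. f0 x y * (f1 (x + \<gamma> * (disp \<omega> + c)) y * R x (y + (disp \<omega> + c)\<^sup>2)))))" for x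
 proof -
  have "per n (\<lambda>y. of_real (R x y) :: complex)" using qR unfolding per_def by simp
  from conf_dual[OF q0 q1 this, where s = 0 and \<Omega> = ?\<Omega> and dv = disp and M = ?M and \<gamma> = \<gamma>]
  have "(of_real (avg ?Y (\<lambda>y. R x y * F x y)) :: complex) = of_real (avg ?\<Omega> (\<lambda>\<omega>. avg {0..<?M} (\<lambda>c. avg ?Y (\<lambda>y. R x (y + (disp \<omega> + c)\<^sup>2) * (f0 x y * f1 (x + \<gamma> * (disp \<omega> + c)) y)))))"
   unfolding F_def avg_of_real[symmetric] of_real_mult add_0_right .
  then have "avg ?Y (\<lambda>y. R x y * F x y) = avg ?\<Omega> (\<lambda>\<omega>. avg {0..<?M} (\<lambda>c. avg ?Y (\<lambda>y. R x (y + (disp \<omega> + c)\<^sup>2) * (f0 x y * f1 (x + \<gamma> * (disp \<omega> + c)) y))))"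
   by (rule of_real_eq_iff[THEN iffD1])
  then show ?thesis by (simp only: mult_ac)
 qed
 let ?T = "\<lambda>x \<omega> c. avg ?Y (\<lambda>y. f0 x y * (f1 (x + \<gamma> * (disp \<omega> + c)) y * R x (y + (disp \<omega> + c)\<^sup>2)))"
 have "avg ?X (\<lambda>x. avg ?\<Omega> (\<lambda>\<omega>. avg {0..<?M} (\<lambda>c. ?T x \<omega> c))) = avg ?\<Omega> (\<lambda>\<omega>. avg ?X (\<lambda>x. avg {0..<?M} (\<lambda>c. ?T x \<omega> c)))"
  by (rule avg_swap)
 also have "\<dots> = avg ?\<Omega> (\<lambda>\<omega>. avg {0..<?M} (\<lambda>c. avg ?X (\<lambda>x. ?T x \<omega> c)))" by (rule avg_cong, rule avg_swap)
 also have "\<dots> = avg {1..?H} (\<lambda>k. avg {0..<?M} (\<lambda>\<sigma>. avg {0..<?H} (\<lambda>i. avg {0..<t ^ 36} (\<lambda>j. avg {0..<t ^ 71 * ?H} (\<lambda>a. avg {0..<?H} (\<lambda>b. avg {0..<?M} (\<lambda>c. avg ?X (\<lambda>x. ?T x (k, \<sigma>, i, j, a, b) c))))))))"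
  unfolding params_def Let_def avg_Times ..
 finally have e1: "avg ?X (\<lambda>x. avg ?Y (\<lambda>y. F x y * R x y)) = avg {1..?H} (\<lambda>k. avg {0..<?M} (\<lambda>\<sigma>. avg {0..<?H} (\<lambda>i. avg {0..<t ^ 36} (\<lambda>j. avg {0..<t ^ 71 * ?H} (\<lambda>a. avg {0..<?H} (\<lambda>b. avg {0..<?M} (\<lambda>c. avg ?X (\<lambda>x. ?T x (k, \<sigma>, i, j, a, b) c))))))))"
  unfolding dual .
 have de: "disp (k, \<sigma>, i, j, a, b) + c = i + k * j + (a + b + c + - \<sigma>)" for k \<sigma> i j a b c by (simp add: disp_def)
 have small: "t ^ k \<le> ((t ^ 2900) ^ 530) ^ 200" if "k \<le> 2900 * 530 * 200" for k
  using that t0 by (simp flip: power_mult add: power_increasing)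
 have u3: "1 / t ^ 2900 \<le> avg {1..?H} (\<lambda>k. avg2 {0..<?B} (\<lambda>b b'. avg ?X (\<lambda>x. mx n (dl (2 * W * k * (b' - b)) (R x)))))"
 proof (rule u3_bound[OF t _ _ _ N n(1) _ b0 b1 bR p0 p1 pR qR q1, where \<gamma> = \<gamma>])
  show "0 < W" using W1 by simp
  show "m dvd W" if "1 \<le> m" "m \<le> t ^ 36" for m
  proof -
   have "t ^ 36 \<le> ((t ^ 2900) ^ 530) ^ 200" by (rule small) simp
   then show ?thesis using that W(2)[of m] by linarith
  qed
  have "t ^ 1000 \<le> ((t ^ 2900) ^ 530) ^ 200" by (rule small) simp
  then show "t ^ 1000 \<le> ?B" using W(1) WB by linarith
  show "n \<le> t ^ 10 * (t ^ 74 * (W * (W ^ 4 * D)))\<^sup>2" using n(2) by (simp only: msize_def)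
  show "1 / real_of_int t \<le> avg {1..?H} (\<lambda>k. avg {0..<t ^ 74 * ?H} (\<lambda>s. avg {0..<?H} (\<lambda>i. avg {0..<t ^ 36} (\<lambda>j. avg {0..<t ^ 71 * ?H} (\<lambda>a. avg {0..<?H} (\<lambda>b. avg {0..<t ^ 74 * ?H} (\<lambda>c.
   avg ?X (\<lambda>x. avg ?Y (\<lambda>y. f0 x y * (f1 (x + \<gamma> * (i + k * j + (a + b + c + - s))) y * R x (y + (i + k * j + (a + b + c + - s))\<^sup>2)))))))))))"
   using big0 unfolding e1 de msize_def .
 qed
 have r1: "2 ^ 1400 \<le> r"
 proof -
  have "(2::real) ^ 1400 \<le> real_of_int t ^ 1400" using t by (intro power_mono) auto
  also have "\<dots> \<le> real_of_int t ^ 2900" using t0 by (intro power_increasing) auto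
  finally show ?thesis by (simp only: r_def of_int_power)
 qed
 have r0: "1 \<le> r" using r1 by (rule order_trans[rotated]) simp
 have rs: "real_of_int (((t ^ 2900) ^ 530) ^ 200) = (r ^ 530) ^ 200" by (simp add: r_def)
 have sW: "(r ^ 530) ^ 200 \<le> W" using W(1) unfolding rs[symmetric] by (simp only: of_int_le_iff)
 have n2: "real_of_int n \<le> r * real_of_int (?M\<^sup>2)"
 proof -
  have "t ^ 10 * ?M\<^sup>2 \<le> t ^ 2900 * ?M\<^sup>2" using t0 by (intro mult_right_mono power_increasing) auto
  then have "real_of_int n \<le> real_of_int (t ^ 2900 * ?M\<^sup>2)" using n(2) by (simp only: of_int_le_iff)
  then show ?thesis by (simp add: r_def)
 qed
 have M140: "r ^ 140 \<le> ?M"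
 proof -
  have "r ^ 140 \<le> r ^ (530 * 200)" using r0 by (intro power_increasing) auto
  also have "\<dots> \<le> W" using sW by (simp only: power_mult)
  also have "\<dots> \<le> ?M" using WB BM by simp
  finally show ?thesis .
 qed
 have dv: "\<bar>disp \<omega> + c\<bar> \<le> 3 * ?M" if "\<omega> \<in> ?\<Omega>" "0 \<le> c" "c < ?M" for \<omega> c
  using W1 WD that by (intro disp_bound3[OF t]) auto
 have Rd: "R x y = (conf ?\<Omega> disp ?M \<gamma> f0 f1 x y - avg2 {0..<L} (\<lambda>l l'. conf ?\<Omega> disp ?M \<gamma> f0 f1 x (y + ?v * (l' - l)))) / 2" for x y
  by (simp add: R_def F_def)
 have Lne: "{0..<L} \<noteq> {}" using L by simp
 have u3': "1 / r \<le> avg {1..?H} (\<lambda>k. avg2 {0..<?B} (\<lambda>b b'. avg ?X (\<lambda>x. mx n (dl (2 * W * k * (b' - b)) (R x)))))"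
  using u3 by (simp add: r_def)
 have V: "1 / r ^ 530 \<le> avg ?X (\<lambda>x. vx n (\<lambda>z. avg {1..?H} (\<lambda>k. wt n {0..<?B} (z * (2 * W * k)))) (R x))"
  by (rule weighted_bound[OF r1 N n(1) n2 M140 finite_params finite_atLeastLessThan_int Lne p0 p1 pR q0 q1 qR b0 b1 bR dv Rd u3'])
 show False
 proof (rule weighted_bound_contradiction[where s = "r ^ 530" and \<mu> = "t ^ 74", OF _ sW _ D _ _ L _ N n(1) finite_params p0 p1 pR q0 q1 qR b0 b1 bR _ _ V])
  have "r ^ 1 \<le> r ^ 530" using r0 by (intro power_increasing) auto
  then show "2 ^ 1400 \<le> r ^ 530" using r1 by simp
  show "m dvd W" if "1 \<le> m" "of_int m \<le> (r ^ 530) ^ 200" for m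
   using that unfolding rs[symmetric] by (intro W(2)) (simp_all only: of_int_le_iff)
  show "1 \<le> t ^ 74" by (rule tp)
  have "t ^ 74 \<le> t ^ 2900" using t0 by (intro power_increasing) auto
  then have "real_of_int (t ^ 74) \<le> r" unfolding r_def by (simp only: of_int_le_iff)
  moreover have "r ^ 1 \<le> r ^ 530" using r0 by (intro power_increasing) auto
  ultimately show "real_of_int (t ^ 74) \<le> r ^ 530" by simp
  show "\<bar>disp \<omega> + c\<bar> \<le> 3 * (t ^ 74 * (W ^ 5 * D))" if "\<omega> \<in> ?\<Omega>" "0 \<le> c" "c < t ^ 74 * (W ^ 5 * D)" for \<omega> c
   using that dv unfolding Meq(1)[symmetric] by blast
  show "R x y = (conf ?\<Omega> disp (t ^ 74 * (W ^ 5 * D)) \<gamma> f0 f1 x y - avg2 {0..<L} (\<lambda>l l'. conf ?\<Omega> disp (t ^ 74 * (W ^ 5 * D)) \<gamma> f0 f1 x (y + ?v * (l' - l)))) / 2" for x y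
   unfolding Meq(1)[symmetric] by (rule Rd)
 qed simp
qed

section \<open>Smoothing operators and the energy increment\<close>

text \<open>Smoothing along the step g with the autocorrelation of an interval as kernel. It is
  \<open>cv\<close>, the average over one interval, composed with its adjoint; hence it is
  self-adjoint and its quadratic form is the energy of \<open>cv\<close>, the quantity that is
  incremented.\<close>

definition sm :: "int \<Rightarrow> int \<Rightarrow> (int \<Rightarrow> real) \<Rightarrow> int \<Rightarrow> real" where
 "sm g L u y = avg2 {0..<L} (\<lambda>l l'. u (y + g * (l' - l)))"

definition cv :: "int \<Rightarrow> int \<Rightarrow> (int \<Rightarrow> real) \<Rightarrow> int \<Rightarrow> real" where
 "cv g L u y = avg {0..<L} (\<lambda>l. u (y + g * l))"

lemma per_sm: "per N u \<Longrightarrow> per N (sm g L u)"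
proof -
 assume u: "per N u"
 have sh: "y + N + a = (y + a) + N" for y a :: int by simp
 show ?thesis unfolding per_def sm_def sh by (simp only: perD[OF u] simp_thms)
qed

lemma per_cv: "per N u \<Longrightarrow> per N (cv g L u)"
proof -
 assume u: "per N u"
 have sh: "y + N + a = (y + a) + N" for y a :: int by simp
 show ?thesis unfolding per_def cv_def sh by (simp only: perD[OF u] simp_thms)
qed

lemma sm_nonneg: "(\<And>y. 0 \<le> u y) \<Longrightarrow> 0 \<le> sm g L u y"
 unfolding sm_def by (rule avg2_nonneg) auto

lemma sm_eq: "sm g L u y = avg {0..<L} (\<lambda>l. cv g L u (y - g * l))"
 unfolding sm_def avg2_def cv_def by (rule avg_cong, rule avg_cong) (simp add: algebra_simps)

lemma sm_dual:
 assumes u: "per N u" and w: "per N w"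
 shows "avg {0..<N} (\<lambda>y. sm g L u y * w y) = avg {0..<N} (\<lambda>y. u y * sm g L w y)"
proof -
 have "avg {0..<N} (\<lambda>y. sm g L u y * w y) = avg {0..<N} (\<lambda>y. avg2 {0..<L} (\<lambda>l l'. u (y + g * (l' - l)) * w y))"
  unfolding sm_def avg2_def avg_multc ..
 also have "\<dots> = avg2 {0..<L} (\<lambda>l l'. avg {0..<N} (\<lambda>y. u (y + g * (l' - l)) * w y))" by (rule avg_avg2_swap)
 also have "\<dots> = avg2 {0..<L} (\<lambda>l l'. avg {0..<N} (\<lambda>y. u y * w (y + g * (l - l'))))"
 proof (rule avg2_cong)
  fix l l'
  have "per N (\<lambda>y. u y * w (y + g * (l - l')))" by (intro per_mult u per_comp_add w)
  from avg_shift[OF this, of "g * (l' - l)"]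
  show "avg {0..<N} (\<lambda>y. u (y + g * (l' - l)) * w y) = avg {0..<N} (\<lambda>y. u y * w (y + g * (l - l')))"
   by (simp add: algebra_simps)
 qed
 also have "\<dots> = avg2 {0..<L} (\<lambda>l l'. avg {0..<N} (\<lambda>y. u y * w (y + g * (l' - l))))"
  unfolding avg2_def by (rule avg_swap)
 also have "\<dots> = avg {0..<N} (\<lambda>y. avg2 {0..<L} (\<lambda>l l'. u y * w (y + g * (l' - l))))" by (rule avg_avg2_swap[symmetric])
 also have "\<dots> = avg {0..<N} (\<lambda>y. u y * sm g L w y)"
  unfolding sm_def avg2_def avg_cmult ..
 finally show ?thesis .
qed

lemma sm_energy:
 assumes u: "per N u"
 shows "avg {0..<N} (\<lambda>y. u y * sm g L u y) = avg {0..<N} (\<lambda>y. (cv g L u y)\<^sup>2)"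
proof -
 have "avg {0..<N} (\<lambda>y. u y * sm g L u y) = avg {0..<N} (\<lambda>y. avg2 {0..<L} (\<lambda>l l'. dl (g * (l' - l)) u y))"
  unfolding sm_def avg2_def avg_cmult[symmetric] dl_def ..
 also have "\<dots> = avg2 {0..<L} (\<lambda>l l'. avg {0..<N} (dl (g * (l' - l)) u))" by (rule avg_avg2_swap)
 finally show ?thesis unfolding avg2_def avg_dl_pos[OF u] cv_def .
qed

lemma sm_contract:
 assumes u: "per N u"
 shows "avg {0..<N} (\<lambda>y. (sm g L u y)\<^sup>2) \<le> avg {0..<N} (\<lambda>y. (cv g L u y)\<^sup>2)"
proof -
 have "avg {0..<N} (\<lambda>y. (sm g L u y)\<^sup>2) \<le> avg {0..<N} (\<lambda>y. avg {0..<L} (\<lambda>l. (cv g L u (y - g * l))\<^sup>2))"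
  unfolding sm_eq by (rule avg_mono, rule avg_square)
 also have "\<dots> = avg {0..<L} (\<lambda>l. avg {0..<N} (\<lambda>y. (cv g L u (y - g * l))\<^sup>2))" by (rule avg_swap)
 also have "\<dots> = avg {0..<L} (\<lambda>l. avg {0..<N} (\<lambda>y. (cv g L u y)\<^sup>2))"
 proof (rule avg_cong)
  fix l
  have "per N (\<lambda>y. (cv g L u y)\<^sup>2)" using per_cv[OF u] unfolding per_def by simp
  from avg_shift[OF this, of "- (g * l)"] show "avg {0..<N} (\<lambda>y. (cv g L u (y - g * l))\<^sup>2) = avg {0..<N} (\<lambda>y. (cv g L u y)\<^sup>2)" by simp
 qed
 also have "\<dots> \<le> avg {0..<N} (\<lambda>y. (cv g L u y)\<^sup>2)" by (rule avg_le) (auto intro: avg_nonneg)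
 finally show ?thesis .
qed

lemma avg2_shift_slow:
 fixes u :: "int \<Rightarrow> real"
 assumes u: "\<And>y. \<bar>u y\<bar> \<le> 1" and L: "0 < L" "\<bar>j\<bar> \<le> L"
 shows "\<bar>sm g L u (y + g * j) - sm g L u y\<bar> \<le> 2 * real_of_int \<bar>j\<bar> / real_of_int L"
proof -
 have pos: "\<bar>sm g L u (y + g * j) - sm g L u y\<bar> \<le> 2 * real_of_int j / real_of_int L" if j: "0 \<le> j" "j \<le> L" for j y
 proof -
  have "sm g L u (y + g * j) - sm g L u y
   = avg {0..<L} (\<lambda>l. avg {0..<L} (\<lambda>l'. u (y + g * (l' + j - l))) - avg {0..<L} (\<lambda>l'. u (y + g * (l' - l))))"
   unfolding sm_def avg2_def avg_diff[symmetric] by (simp add: algebra_simps)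
  also have "\<bar>\<dots>\<bar> \<le> 2 * real_of_int j / real_of_int L"
  proof (rule abs_avg_bound)
   fix l
   have "norm (avg {0..<L} (\<lambda>l'. of_real (u (y + g * (l' - l))) :: complex) - avg {0..<L} (\<lambda>l'. of_real (u (y + g * (l' + j - l))))) \<le> 2 * real_of_int j / real_of_int L"
    by (rule avg_interval_shift[OF _ L(1) j]) (simp add: u)
   then show "\<bar>avg {0..<L} (\<lambda>l'. u (y + g * (l' + j - l))) - avg {0..<L} (\<lambda>l'. u (y + g * (l' - l)))\<bar> \<le> 2 * real_of_int j / real_of_int L"
    unfolding avg_of_real of_real_diff[symmetric] norm_of_real by (simp add: abs_minus_commute)
  qed (use j L in simp)
  finally show ?thesis .
 qed
 show ?thesis
 proof (cases "0 \<le> j")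
  case True then show ?thesis using pos[of j y] L by simp
 next
  case False then show ?thesis using pos[of "- j" "y + g * j"] L by (simp add: abs_minus_commute)
 qed
qed

text \<open>Expand the square. The two diagonal terms are at most the energies of \<open>cv\<close>
  by \<open>sm_contract\<close>. The mixed term is, by self-adjointness, the pairing of u with the
  coarse smoothing of its finer smoothing, which is nearly its coarse smoothing alone, so it
  contributes the coarse energy twice.\<close>

lemma sm_increment:
 fixes u :: "int \<Rightarrow> real" and v :: int
 assumes u: "per N u" "\<And>y. \<bar>u y\<bar> \<le> 1" and L: "0 < L1" "0 < L2" "0 < v" "v * L2 \<le> L1"
 shows "avg {0..<N} (\<lambda>y. (sm (g * v) L2 u y - sm g L1 u y)\<^sup>2)
  \<le> avg {0..<N} (\<lambda>y. (cv (g * v) L2 u y)\<^sup>2) - avg {0..<N} (\<lambda>y. (cv g L1 u y)\<^sup>2) + 4 * real_of_int (v * L2) / real_of_int L1"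
proof -
 let ?Y = "{0..<N}" and ?s1 = "sm g L1 u" and ?s2 = "sm (g * v) L2 u"
 let ?h = "2 * real_of_int (v * L2) / L1"
 have h0: "0 \<le> ?h" using L by simp
 \<comment> \<open>The finer smoothing averages shifts by g times at most v L2, short compared with
   the length L1 of the coarse one.\<close>
 have close: "\<bar>sm g L1 ?s2 y - ?s1 y\<bar> \<le> ?h" for y
 proof -
  have e1: "sm g L1 ?s2 y = avg2 {0..<L2} (\<lambda>m m'. ?s1 (y + g * (v * (m' - m))))"
   unfolding sm_def[of g L1] sm_def[of "g * v"] by (subst avg2_swap) (simp add: algebra_simps)
  have e2: "sm g L1 ?s2 y - ?s1 y = avg2 {0..<L2} (\<lambda>m m'. ?s1 (y + g * (v * (m' - m))) - ?s1 y)"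
   unfolding e1 using L by (simp add: avg2_def avg_diff avg_const)
  show ?thesis
   unfolding e2 avg2_def
  proof (rule abs_avg_bound, rule abs_avg_bound)
   fix m m' assume m: "m \<in> {0..<L2}" "m' \<in> {0..<L2}"
   have "\<bar>v * (m' - m)\<bar> = v * \<bar>m' - m\<bar>" using L by (simp add: abs_mult)
   also have "\<dots> \<le> v * L2" using m L by (intro mult_left_mono) auto
   finally have b: "\<bar>v * (m' - m)\<bar> \<le> v * L2" .
   then have "\<bar>v * (m' - m)\<bar> \<le> L1" using L by simp
   from avg2_shift_slow[OF u(2) L(1) this]
   have "\<bar>?s1 (y + g * (v * (m' - m))) - ?s1 y\<bar> \<le> 2 * real_of_int \<bar>v * (m' - m)\<bar> / real_of_int L1" .
   also have "\<dots> \<le> ?h"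
   proof (rule divide_right_mono)
    show "2 * real_of_int \<bar>v * (m' - m)\<bar> \<le> 2 * real_of_int (v * L2)" using b by linarith
   qed (use L in simp)
   finally show "\<bar>?s1 (y + g * (v * (m' - m))) - ?s1 y\<bar> \<le> ?h" .
  qed (use h0 in simp_all)
 qed
 have "avg ?Y (\<lambda>y. (?s2 y - ?s1 y)\<^sup>2) = avg ?Y (\<lambda>y. (?s2 y)\<^sup>2) - 2 * avg ?Y (\<lambda>y. ?s1 y * ?s2 y) + avg ?Y (\<lambda>y. (?s1 y)\<^sup>2)"
  unfolding avg_cmult[symmetric] avg_diff[symmetric] avg_add[symmetric] by (rule avg_cong) (simp add: power2_diff mult_ac)
 moreover have "avg ?Y (\<lambda>y. (cv g L1 u y)\<^sup>2) - ?h \<le> avg ?Y (\<lambda>y. ?s1 y * ?s2 y)"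
 proof -
  have "avg ?Y (\<lambda>y. ?s1 y * ?s2 y) = avg ?Y (\<lambda>y. u y * sm g L1 ?s2 y)" by (rule sm_dual[OF u(1) per_sm[OF u(1)]])
  moreover have "avg ?Y (\<lambda>y. u y * ?s1 y - ?h) \<le> avg ?Y (\<lambda>y. u y * sm g L1 ?s2 y)"
  proof (rule avg_mono)
   fix y
   have "\<bar>u y * (sm g L1 ?s2 y - ?s1 y)\<bar> \<le> 1 * ?h" unfolding abs_mult by (intro mult_mono u close) auto
   then show "u y * ?s1 y - ?h \<le> u y * sm g L1 ?s2 y" unfolding right_diff_distrib by linarith
  qed
  moreover have "avg ?Y (\<lambda>y. ?h) \<le> ?h" by (rule avg_le) (use h0 in auto)
  ultimately show ?thesis unfolding sm_energy[OF u(1), symmetric] avg_diff by linarith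
 qed
 moreover have "2 * ?h = 4 * real_of_int (v * L2) / real_of_int L1" by simp
 ultimately show ?thesis using sm_contract[OF u(1), of "g * v" L2] sm_contract[OF u(1), of g L1] by linarith
qed

text \<open>The weighted bipartite inequality for paths with three edges. With w = sqrt(r k), the
  bounds 2w \<le> r + k and w (w - m)^2 (w + 2m) \<ge> 0 give m^2 (3 - m/k - m/r) \<le> r k
  pointwise. Multiplying by \<phi> and averaging yields m^3, because the averages of \<phi>/k and
  \<phi>/r are at most 1; they fall short of 1 only through rows or columns of mean zero, where the
  quotient is 0.\<close>

lemma path_ineq:
 fixes \<phi> :: "'a \<Rightarrow> 'b \<Rightarrow> real"
 assumes fin: "finite S" "finite T" and pos: "\<And>s l. 0 \<le> \<phi> s l"
 shows "(avg S (\<lambda>s. avg T (\<phi> s))) ^ 3 \<le> avg S (\<lambda>s. avg T (\<lambda>l. \<phi> s l * avg S (\<lambda>c. \<phi> c l) * avg T (\<phi> s)))"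
proof -
 define m where "m = avg S (\<lambda>s. avg T (\<phi> s))"
 define r where "r l = avg S (\<lambda>c. \<phi> c l)" for l
 define k where "k s = avg T (\<phi> s)" for s
 have m0: "0 \<le> m" unfolding m_def by (intro avg_nonneg pos)
 have r0: "0 \<le> r l" and k0: "0 \<le> k s" for l s unfolding r_def k_def by (intro avg_nonneg pos)+
 have key: "m\<^sup>2 * (3 * \<phi> s l - m * (\<phi> s l / k s) - m * (\<phi> s l / r l)) \<le> \<phi> s l * r l * k s" if "s \<in> S" "l \<in> T" for s l
 proof (cases "\<phi> s l = 0")
  case False
  then have p: "0 < \<phi> s l" using pos[of s l] by linarith
  have posavg: "0 < avg X f" if "finite X" "x \<in> X" "\<And>z. 0 \<le> (f z :: real)" "0 < f x" for X :: "'z set" and x f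
  proof -
   have "0 < sum f X" using that by (intro sum_pos2) auto
   moreover have "0 < real (card X)" using that by (auto simp: card_gt_0_iff)
   ultimately show ?thesis by (simp add: avg_def)
  qed
  have rp: "0 < r l" unfolding r_def by (rule posavg[OF fin(1) that(1), of "\<lambda>c. \<phi> c l"]) (use p pos in auto)
  have kp: "0 < k s" unfolding k_def by (rule posavg[OF fin(2) that(2), of "\<phi> s"]) (use p pos in auto)
  define w where "w = sqrt (r l * k s)"
  have w: "w\<^sup>2 = r l * k s" "0 < w" using rp kp by (simp_all add: w_def)
  have "2 * w \<le> r l + k s"
   using arith_geo_mean_sqrt[of "r l" "k s"] rp kp by (simp add: w_def)
  then have "m ^ 3 * (2 * w) \<le> m ^ 3 * (r l + k s)" using m0 by (intro mult_left_mono) auto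
  moreover have "0 \<le> w * (w - m)\<^sup>2 * (w + 2 * m)" using w m0 by simp
  moreover have "w * (w - m)\<^sup>2 * (w + 2 * m) = (w\<^sup>2)\<^sup>2 + m ^ 3 * (2 * w) - 3 * m\<^sup>2 * w\<^sup>2"
   by (simp add: power2_eq_square power3_eq_cube algebra_simps)
  ultimately have "3 * m\<^sup>2 * (r l * k s) - m ^ 3 * (r l + k s) \<le> (r l * k s) * (r l * k s)"
   unfolding w(1) power2_eq_square[of "r l * k s"] by linarith
  then have "(3 * m\<^sup>2 * (r l * k s) - m ^ 3 * (r l + k s)) / (r l * k s) \<le> r l * k s"
   using rp kp by (simp add: divide_le_eq)
  moreover have "(3 * m\<^sup>2 * (r l * k s) - m ^ 3 * (r l + k s)) / (r l * k s) = m\<^sup>2 * (3 - m / k s - m / r l)"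
   using rp kp by (simp add: field_simps power2_eq_square power3_eq_cube)
  ultimately have "\<phi> s l * (m\<^sup>2 * (3 - m / k s - m / r l)) \<le> \<phi> s l * (r l * k s)" using p by (intro mult_left_mono) auto
  then show ?thesis by (simp add: algebra_simps)
 qed simp
 have "avg S (\<lambda>s. avg T (\<lambda>l. m\<^sup>2 * (3 * \<phi> s l - m * (\<phi> s l / k s) - m * (\<phi> s l / r l))))
  \<le> avg S (\<lambda>s. avg T (\<lambda>l. \<phi> s l * r l * k s))"
  using key by (intro avg_mono) auto
 moreover have "avg S (\<lambda>s. avg T (\<lambda>l. m\<^sup>2 * (3 * \<phi> s l - m * (\<phi> s l / k s) - m * (\<phi> s l / r l))))
  = m\<^sup>2 * (3 * m - m * avg S (\<lambda>s. avg T (\<lambda>l. \<phi> s l / k s)) - m * avg S (\<lambda>s. avg T (\<lambda>l. \<phi> s l / r l)))"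
  unfolding m_def by (simp only: avg_cmult avg_diff)
 moreover have "avg S (\<lambda>s. avg T (\<lambda>l. \<phi> s l / k s)) \<le> 1"
 proof (rule avg_le)
  fix s
  have "avg T (\<lambda>l. \<phi> s l / k s) = k s / k s" unfolding k_def divide_inverse avg_multc ..
  then show "avg T (\<lambda>l. \<phi> s l / k s) \<le> 1" by simp
 qed simp
 moreover have "avg S (\<lambda>s. avg T (\<lambda>l. \<phi> s l / r l)) \<le> 1"
 proof (subst avg_swap, rule avg_le)
  fix l
  have "avg S (\<lambda>s. \<phi> s l / r l) = r l / r l" unfolding r_def divide_inverse avg_multc ..
  then show "avg S (\<lambda>s. \<phi> s l / r l) \<le> 1" by simp
 qed simp
 moreover have "m\<^sup>2 * (3 * m - m * 1 - m * 1) \<le> m\<^sup>2 * (3 * m - m * avg S (\<lambda>s. avg T (\<lambda>l. \<phi> s l / k s)) - m * avg S (\<lambda>s. avg T (\<lambda>l. \<phi> s l / r l)))"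
  using calculation(3,4) m0 by (intro mult_left_mono diff_mono order_refl) auto
 moreover have "m\<^sup>2 * (3 * m - m * 1 - m * 1) = m ^ 3" by (simp add: power2_eq_square power3_eq_cube)
 ultimately show ?thesis unfolding m_def r_def k_def by linarith
qed

lemma cube_jensen:
 assumes "finite Z" "Z \<noteq> {}" "\<And>z. 0 \<le> (m z :: real)"
 shows "(avg Z m) ^ 3 \<le> avg Z (\<lambda>z. (m z) ^ 3)"
proof -
 define \<mu> where "\<mu> = avg Z m"
 have \<mu>: "0 \<le> \<mu>" unfolding \<mu>_def by (intro avg_nonneg assms)
 have "3 * \<mu>\<^sup>2 * m z - 2 * \<mu> ^ 3 \<le> (m z) ^ 3" for z
 proof -
  have "0 \<le> (m z - \<mu>)\<^sup>2 * (m z + 2 * \<mu>)" using \<mu> assms(3)[of z] by simp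
  also have "\<dots> = (m z) ^ 3 - (3 * \<mu>\<^sup>2 * m z - 2 * \<mu> ^ 3)" by (simp add: power2_eq_square power3_eq_cube algebra_simps)
  finally show ?thesis by simp
 qed
 then have "avg Z (\<lambda>z. 3 * \<mu>\<^sup>2 * m z - 2 * \<mu> ^ 3) \<le> avg Z (\<lambda>z. (m z) ^ 3)" by (intro avg_mono)
 moreover have "avg Z (\<lambda>z. 3 * \<mu>\<^sup>2 * m z - 2 * \<mu> ^ 3) = 3 * \<mu>\<^sup>2 * \<mu> - 2 * \<mu> ^ 3"
  unfolding avg_diff avg_cmult avg_const[OF assms(1,2)] \<mu>_def ..
 moreover have "3 * \<mu>\<^sup>2 * \<mu> - 2 * \<mu> ^ 3 = \<mu> ^ 3" by (simp add: power2_eq_square power3_eq_cube)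
 ultimately show ?thesis by (simp add: \<mu>_def)
qed

text \<open>The graph is the grid f (x + \<gamma>s) (y + g l) around a random point (x, y). A path
  uses (s, l), (c, l) and (s, l'); shifting y by g l leaves the points (s, 0), (c, 0) and (s, l' -
  l), and the average over l, l' becomes the smoothing. Jensen for the cube passes from local
  densities to the global one.\<close>

lemma grid_lower_bound:
 fixes f :: "int \<Rightarrow> int \<Rightarrow> real"
 assumes N: "0 < N" and f: "per N f" "\<And>x. per N (f x)" "\<And>x y. 0 \<le> f x y" and ml: "0 < M" "0 < L"
 shows "(avg {0..<N} (\<lambda>x. avg {0..<N} (f x))) ^ 3
  \<le> avg {0..<N} (\<lambda>x. avg {0..<N} (\<lambda>y. avg {0..<M} (\<lambda>s. f (x + \<gamma> * s) y * sm g L (f (x + \<gamma> * s)) y) * avg {0..<M} (\<lambda>c. f (x + \<gamma> * c) y)))"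
proof -
 let ?X = "{0..<N}" and ?S = "{0..<M}" and ?L = "{0..<L}"
 let ?\<phi> = "\<lambda>x y s l. f (x + \<gamma> * s) (y + g * l)"
 let ?m = "\<lambda>x y. avg ?S (\<lambda>s. avg ?L (?\<phi> x y s))"
 have sh: "avg ?X (\<lambda>y. f x (y + a)) = avg ?X (f x)" for x a by (rule avg_shift[OF f(2)])
 have "avg ?X (\<lambda>x. avg ?X (\<lambda>y. ?m x y)) = avg ?S (\<lambda>s. avg ?L (\<lambda>l. avg ?X (\<lambda>x. avg ?X (\<lambda>y. ?\<phi> x y s l))))"
 proof -
  have "avg ?X (\<lambda>x. avg ?X (\<lambda>y. ?m x y)) = avg ?X (\<lambda>x. avg ?S (\<lambda>s. avg ?X (\<lambda>y. avg ?L (?\<phi> x y s))))"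
   by (rule avg_cong, rule avg_swap)
  also have "\<dots> = avg ?X (\<lambda>x. avg ?S (\<lambda>s. avg ?L (\<lambda>l. avg ?X (\<lambda>y. ?\<phi> x y s l))))"
   by (rule avg_cong, rule avg_cong, rule avg_swap)
  also have "\<dots> = avg ?S (\<lambda>s. avg ?X (\<lambda>x. avg ?L (\<lambda>l. avg ?X (\<lambda>y. ?\<phi> x y s l))))" by (rule avg_swap)
  also have "\<dots> = avg ?S (\<lambda>s. avg ?L (\<lambda>l. avg ?X (\<lambda>x. avg ?X (\<lambda>y. ?\<phi> x y s l))))" by (rule avg_cong, rule avg_swap)
  finally show ?thesis .
 qed
 also have "\<dots> = avg ?S (\<lambda>s. avg ?L (\<lambda>l. avg ?X (\<lambda>x. avg ?X (f x))))"
 proof (rule avg_cong, rule avg_cong)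
  fix s l
  have "per N (\<lambda>x. avg ?X (f x))" unfolding per_def perD[OF f(1)] by simp
  from avg_shift[OF this, of "\<gamma> * s"] show "avg ?X (\<lambda>x. avg ?X (\<lambda>y. ?\<phi> x y s l)) = avg ?X (\<lambda>x. avg ?X (f x))"
   by (simp only: sh)
 qed
 also have "\<dots> = avg ?X (\<lambda>x. avg ?X (f x))" using ml by (simp add: avg_const)
 finally have mean: "avg ?X (\<lambda>x. avg ?X (\<lambda>y. ?m x y)) = avg ?X (\<lambda>x. avg ?X (f x))" .
 have Xne: "finite ?X" "?X \<noteq> {}" using N by auto
 have "(avg ?X (\<lambda>x. avg ?X (f x))) ^ 3 \<le> avg ?X (\<lambda>x. (avg ?X (\<lambda>y. ?m x y)) ^ 3)"
  unfolding mean[symmetric] by (intro cube_jensen Xne avg_nonneg f(3))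
 also have "\<dots> \<le> avg ?X (\<lambda>x. avg ?X (\<lambda>y. (?m x y) ^ 3))"
  by (rule avg_mono, rule cube_jensen) (use N f(3) in \<open>auto intro!: avg_nonneg\<close>)
 also have "\<dots> \<le> avg ?X (\<lambda>x. avg ?X (\<lambda>y. avg ?S (\<lambda>s. avg ?L (\<lambda>l. ?\<phi> x y s l * avg ?S (\<lambda>c. ?\<phi> x y c l) * avg ?L (?\<phi> x y s)))))"
  by (rule avg_mono, rule avg_mono, rule path_ineq) (auto simp: f(3))
 also have "\<dots> = avg ?X (\<lambda>x. avg ?X (\<lambda>y. avg ?S (\<lambda>s. f (x + \<gamma> * s) y * sm g L (f (x + \<gamma> * s)) y) * avg ?S (\<lambda>c. f (x + \<gamma> * c) y)))"
 proof (rule avg_cong)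
  fix x
  let ?P = "\<lambda>y s l l'. f (x + \<gamma> * s) y * avg ?S (\<lambda>c. f (x + \<gamma> * c) y) * f (x + \<gamma> * s) (y + g * (l' - l))"
  have "avg ?X (\<lambda>y. avg ?S (\<lambda>s. avg ?L (\<lambda>l. ?\<phi> x y s l * avg ?S (\<lambda>c. ?\<phi> x y c l) * avg ?L (?\<phi> x y s))))
   = avg ?X (\<lambda>y. avg ?S (\<lambda>s. avg ?L (\<lambda>l. avg ?L (\<lambda>l'. ?\<phi> x y s l * avg ?S (\<lambda>c. ?\<phi> x y c l) * ?\<phi> x y s l'))))"
   by (simp only: avg_cmult)
  also have "\<dots> = avg ?S (\<lambda>s. avg ?X (\<lambda>y. avg ?L (\<lambda>l. avg ?L (\<lambda>l'. ?\<phi> x y s l * avg ?S (\<lambda>c. ?\<phi> x y c l) * ?\<phi> x y s l'))))"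
   by (rule avg_swap)
  also have "\<dots> = avg ?S (\<lambda>s. avg ?L (\<lambda>l. avg ?X (\<lambda>y. avg ?L (\<lambda>l'. ?\<phi> x y s l * avg ?S (\<lambda>c. ?\<phi> x y c l) * ?\<phi> x y s l'))))"
   by (rule avg_cong, rule avg_swap)
  also have "\<dots> = avg ?S (\<lambda>s. avg ?L (\<lambda>l. avg ?X (\<lambda>y. avg ?L (\<lambda>l'. ?P y s l l'))))"
  proof (rule avg_cong, rule avg_cong)
   fix s l
   have p: "per N (\<lambda>y. avg ?L (\<lambda>l'. ?P y s l l'))"
   proof -
    have s: "y + N + a = (y + a) + N" for y a :: int by simp
    show ?thesis unfolding per_def s by (simp only: perD[OF f(2)] simp_thms)
   qed
   have e: "y + g * l + g * (l' - l) = y + g * l'" for y l' by (simp add: algebra_simps)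
   show "avg ?X (\<lambda>y. avg ?L (\<lambda>l'. ?\<phi> x y s l * avg ?S (\<lambda>c. ?\<phi> x y c l) * ?\<phi> x y s l')) = avg ?X (\<lambda>y. avg ?L (\<lambda>l'. ?P y s l l'))"
    using avg_shift[OF p, of "g * l"] unfolding e .
  qed
  also have "\<dots> = avg ?S (\<lambda>s. avg ?X (\<lambda>y. avg ?L (\<lambda>l. avg ?L (\<lambda>l'. ?P y s l l'))))"
   by (rule avg_cong, rule avg_swap)
  also have "\<dots> = avg ?X (\<lambda>y. avg ?S (\<lambda>s. avg ?L (\<lambda>l. avg ?L (\<lambda>l'. ?P y s l l'))))" by (rule avg_swap)
  also have "\<dots> = avg ?X (\<lambda>y. avg ?S (\<lambda>s. f (x + \<gamma> * s) y * sm g L (f (x + \<gamma> * s)) y) * avg ?S (\<lambda>c. f (x + \<gamma> * c) y))"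
  proof (rule avg_cong)
   fix y
   have inner: "avg ?L (\<lambda>l. avg ?L (\<lambda>l'. ?P y s l l')) = (f (x + \<gamma> * s) y * sm g L (f (x + \<gamma> * s)) y) * avg ?S (\<lambda>c. f (x + \<gamma> * c) y)" for s
    unfolding sm_def avg2_def avg_cmult by (simp only: mult_ac)
   show "avg ?S (\<lambda>s. avg ?L (\<lambda>l. avg ?L (\<lambda>l'. ?P y s l l'))) = avg ?S (\<lambda>s. f (x + \<gamma> * s) y * sm g L (f (x + \<gamma> * s)) y) * avg ?S (\<lambda>c. f (x + \<gamma> * c) y)"
    unfolding inner avg_multc ..
  qed
  finally show "avg ?X (\<lambda>y. avg ?S (\<lambda>s. avg ?L (\<lambda>l. ?\<phi> x y s l * avg ?S (\<lambda>c. ?\<phi> x y c l) * avg ?L (?\<phi> x y s))))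
   = avg ?X (\<lambda>y. avg ?S (\<lambda>s. f (x + \<gamma> * s) y * sm g L (f (x + \<gamma> * s)) y) * avg ?S (\<lambda>c. f (x + \<gamma> * c) y))" .
 qed
 finally show ?thesis .
qed

section \<open>Localisation to windows and the count at one level\<close>

lemma avg_window:
 fixes h :: "int \<Rightarrow> real"
 assumes h: "per N h" and n: "0 < n"
 shows "avg {0..<N} h = avg {0..<N} (\<lambda>b. avg {0..<n} (\<lambda>y. h (b + g * y)))"
proof -
 have "avg {0..<N} (\<lambda>b. avg {0..<n} (\<lambda>y. h (b + g * y))) = avg {0..<n} (\<lambda>y. avg {0..<N} (\<lambda>b. h (b + g * y)))"
  by (rule avg_swap)
 also have "\<dots> = avg {0..<n} (\<lambda>y. avg {0..<N} h)" by (simp only: avg_shift[OF h])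
 also have "\<dots> = avg {0..<N} h" using n by (intro avg_const) auto
 finally show ?thesis by simp
qed

lemma l2_small:
 fixes u w :: "int \<Rightarrow> int \<Rightarrow> real"
 assumes "0 \<le> \<eta>" "avg X (\<lambda>x. avg Y (\<lambda>y. (u x y)\<^sup>2)) \<le> \<eta>\<^sup>2" "\<And>x y. \<bar>w x y\<bar> \<le> 1"
 shows "\<bar>avg X (\<lambda>x. avg Y (\<lambda>y. u x y * w x y))\<bar> \<le> \<eta>"
proof -
 have "(avg X (\<lambda>x. avg Y (\<lambda>y. u x y * w x y)))\<^sup>2 \<le> avg X (\<lambda>x. (avg Y (\<lambda>y. u x y * w x y))\<^sup>2)" by (rule avg_square)
 also have "\<dots> \<le> avg X (\<lambda>x. avg Y (\<lambda>y. (u x y * w x y)\<^sup>2))" by (rule avg_mono, rule avg_square)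
 also have "\<dots> \<le> avg X (\<lambda>x. avg Y (\<lambda>y. (u x y)\<^sup>2))"
 proof (rule avg_mono, rule avg_mono)
  fix x y
  have "(w x y)\<^sup>2 \<le> 1" using assms(3)[of x y] by (simp add: abs_square_le_1)
  then have "(u x y)\<^sup>2 * (w x y)\<^sup>2 \<le> (u x y)\<^sup>2 * 1" by (intro mult_left_mono) auto
  then show "(u x y * w x y)\<^sup>2 \<le> (u x y)\<^sup>2" by (simp add: power_mult_distrib)
 qed
 finally have "(avg X (\<lambda>x. avg Y (\<lambda>y. u x y * w x y)))\<^sup>2 \<le> \<eta>\<^sup>2" using assms(2) by linarith
 then have "\<bar>avg X (\<lambda>x. avg Y (\<lambda>y. u x y * w x y))\<bar>\<^sup>2 \<le> \<eta>\<^sup>2" unfolding power2_abs .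
 then show ?thesis by (rule power2_le_imp_le[OF _ assms(1)])
qed

text \<open>\<open>conf\<close> in the original coordinates with both functions equal to f. Along y
  = b + \<gamma>^2 y' the shift (\<gamma>d)^2 becomes the shift d^2 of y', which recovers
  \<open>conf\<close>.\<close>

definition oconf :: "'w set \<Rightarrow> ('w \<Rightarrow> int) \<Rightarrow> int \<Rightarrow> int \<Rightarrow> (int \<Rightarrow> int \<Rightarrow> real) \<Rightarrow> int \<Rightarrow> int \<Rightarrow> real" where
 "oconf \<Omega> dv M \<gamma> f x y = avg \<Omega> (\<lambda>\<omega>. avg {0..<M} (\<lambda>c.
  f x (y - (\<gamma> * (dv \<omega> + c))\<^sup>2) * f (x + \<gamma> * (dv \<omega> + c)) (y - (\<gamma> * (dv \<omega> + c))\<^sup>2)))"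

lemma oconf_range:
 assumes "\<And>x y. 0 \<le> f x y" "\<And>x y. f x y \<le> 1"
 shows "0 \<le> oconf \<Omega> dv M \<gamma> f x y" "oconf \<Omega> dv M \<gamma> f x y \<le> 1"
 unfolding oconf_def using assms by (auto intro!: avg_nonneg avg_le mult_le_one)

lemma oconf_per_n: "(\<And>x. per n (f x)) \<Longrightarrow> per n (oconf \<Omega> dv M \<gamma> f x)"
proof -
 assume p: "\<And>x. per n (f x)"
 have sh: "y + n - a = (y - a) + n" for a y by simp
 show ?thesis unfolding oconf_def per_def sh by (simp only: perD[OF p] simp_thms)
qed

lemma oconf_dual:
 assumes f: "\<And>x. per N (f x)" and w: "\<And>x. per N (w x)"
 shows "avg X (\<lambda>x. avg {0..<N} (\<lambda>y. oconf \<Omega> dv M \<gamma> f x y * w x y))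
  = avg \<Omega> (\<lambda>\<omega>. avg {0..<M} (\<lambda>c. avg X (\<lambda>x. avg {0..<N} (\<lambda>y. f x y * f (x + \<gamma> * (dv \<omega> + c)) y * w x (y + (\<gamma> * (dv \<omega> + c))\<^sup>2)))))"
proof -
 let ?Y = "{0..<N}" and ?C = "{0..<M}"
 let ?h = "\<lambda>x y \<omega> c. f x (y - (\<gamma> * (dv \<omega> + c))\<^sup>2) * f (x + \<gamma> * (dv \<omega> + c)) (y - (\<gamma> * (dv \<omega> + c))\<^sup>2) * w x y"
 have "avg X (\<lambda>x. avg ?Y (\<lambda>y. oconf \<Omega> dv M \<gamma> f x y * w x y)) = avg X (\<lambda>x. avg ?Y (\<lambda>y. avg \<Omega> (\<lambda>\<omega>. avg ?C (\<lambda>c. ?h x y \<omega> c))))"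
  unfolding oconf_def avg_multc ..
 also have "\<dots> = avg X (\<lambda>x. avg \<Omega> (\<lambda>\<omega>. avg ?Y (\<lambda>y. avg ?C (\<lambda>c. ?h x y \<omega> c))))" by (rule avg_cong, rule avg_swap)
 also have "\<dots> = avg X (\<lambda>x. avg \<Omega> (\<lambda>\<omega>. avg ?C (\<lambda>c. avg ?Y (\<lambda>y. ?h x y \<omega> c))))" by (rule avg_cong, rule avg_cong, rule avg_swap)
 also have "\<dots> = avg \<Omega> (\<lambda>\<omega>. avg X (\<lambda>x. avg ?C (\<lambda>c. avg ?Y (\<lambda>y. ?h x y \<omega> c))))" by (rule avg_swap)
 also have "\<dots> = avg \<Omega> (\<lambda>\<omega>. avg ?C (\<lambda>c. avg X (\<lambda>x. avg ?Y (\<lambda>y. ?h x y \<omega> c))))" by (rule avg_cong, rule avg_swap)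
 also have "\<dots> = avg \<Omega> (\<lambda>\<omega>. avg ?C (\<lambda>c. avg X (\<lambda>x. avg ?Y (\<lambda>y. f x y * f (x + \<gamma> * (dv \<omega> + c)) y * w x (y + (\<gamma> * (dv \<omega> + c))\<^sup>2)))))"
 proof (rule avg_cong, rule avg_cong, rule avg_cong)
  fix \<omega> c x
  let ?k = "\<lambda>y. ?h x y \<omega> c" and ?a = "(\<gamma> * (dv \<omega> + c))\<^sup>2"
  have sh: "y + N - a = (y - a) + N" for a y by simp
  have "per N ?k" unfolding per_def sh by (simp only: perD[OF f] perD[OF w] simp_thms)
  from avg_shift[OF this, of ?a] show "avg ?Y ?k = avg ?Y (\<lambda>y. f x y * f (x + \<gamma> * (dv \<omega> + c)) y * w x (y + ?a))"
   by (simp only: add_diff_cancel_right')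
 qed
 finally show ?thesis .
qed

text \<open>The torus average is an average over windows b + \<gamma>^2 y with 0 \<le> y < n. In
  each window f is cut off and repeated with period n, which changes the dual function only near the
  ends, and \<open>local_structure\<close> applies to the periodic copy.\<close>

lemma window_bound:
 fixes t W D L N \<gamma> :: int and f :: "int \<Rightarrow> int \<Rightarrow> real"
 defines "F \<equiv> oconf (params t W D) disp (msize t W D) \<gamma> f"
 assumes t: "2 ^ 20 \<le> t" and W: "((t ^ 2900) ^ 530) ^ 200 \<le> W" "\<And>m. 1 \<le> m \<Longrightarrow> m \<le> ((t ^ 2900) ^ 530) ^ 200 \<Longrightarrow> m dvd W"
  and D: "W ^ 16 \<le> D" and L: "0 < L" "L * W ^ 17 \<le> D\<^sup>2" and N: "0 < N"
  and p: "per N f" "\<And>x. per N (f x)" and f: "\<And>x y. 0 \<le> f x y" "\<And>x y. f x y \<le> 1"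
 shows "avg {0..<N} (\<lambda>x. avg {0..<N} (\<lambda>y. (F x y - sm (\<gamma>\<^sup>2 * (4 * W ^ 4)\<^sup>2) L (F x) y)\<^sup>2)) \<le> 3 / t"
proof -
 let ?M = "msize t W D" and ?v = "(4 * W ^ 4)\<^sup>2" and ?X = "{0..<N}"
 define n where "n = t ^ 10 * ?M\<^sup>2"
 \<comment> \<open>9M^2 covers the squared displacements, at most (3M)^2, and M^2 the reach (4W^4)^2
   L of the smoothing. The two ends make up a proportion 20/t^10 of the window.\<close>
 define K where "K = 10 * ?M\<^sup>2"
 have t0: "1 \<le> t" "0 < t" using t by simp_all
 have W1: "1 \<le> W"
 proof -
  have "1 \<le> ((t ^ 2900) ^ 530) ^ 200" by (intro one_le_power t0)
  then show ?thesis using W(1) by linarith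
 qed
 have W16: "16 \<le> W"
 proof -
  have "t ^ 1 \<le> t ^ (2900 * 530 * 200)" using t0 by (intro power_increasing) auto
  then have "t \<le> ((t ^ 2900) ^ 530) ^ 200" by (simp flip: power_mult)
  moreover have "16 \<le> t" using t by simp
  ultimately show ?thesis using W(1) by linarith
 qed
 have D1: "1 \<le> D" using D one_le_power[OF W1, of 16] by linarith
 have DM: "D \<le> ?M"
 proof -
  have "1 * (1 * (1 * D)) \<le> t ^ 74 * (W * (W ^ 4 * D))" using t0 W1 D1 by (intro mult_mono one_le_power) auto
  then show ?thesis by (simp add: msize_def)
 qed
 have M0: "0 < ?M" using DM D1 by linarith
 have n0: "0 < n" using t0 M0 by (simp add: n_def)
 have vL: "?v * L \<le> ?M\<^sup>2"
 proof -
  have "?v * L = 16 * W ^ 8 * L" by (simp add: power_mult_distrib flip: power_mult)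
  also have "\<dots> \<le> W * W ^ 8 * L" using W16 W1 L by (intro mult_right_mono) auto
  also have "\<dots> = W ^ 9 * L" by (simp flip: power_Suc)
  also have "\<dots> \<le> W ^ 17 * L" using W1 L by (intro mult_right_mono power_increasing) auto
  also have "\<dots> \<le> D\<^sup>2" using L(2) by (simp add: mult.commute)
  also have "\<dots> \<le> ?M\<^sup>2" using DM D1 by (intro power_mono) auto
  finally show ?thesis .
 qed
 define G where "G x y = F x y - sm (\<gamma>\<^sup>2 * ?v) L (F x) y" for x y
 have F01: "0 \<le> F x y" "F x y \<le> 1" for x y unfolding F_def by (rule oconf_range[OF f])+
 have pF: "per N (F x)" for x unfolding F_def by (rule oconf_per_n[OF p(2)])
 have pG: "per N (\<lambda>y. (G x y)\<^sup>2)" for x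
  unfolding per_def G_def perD[OF pF] perD[OF per_sm[OF pF]] by simp
 have G1: "(G x y)\<^sup>2 \<le> 1" for x y
 proof -
  have "0 \<le> sm (\<gamma>\<^sup>2 * ?v) L (F x) y" by (rule sm_nonneg) (rule F01)
  moreover have "sm (\<gamma>\<^sup>2 * ?v) L (F x) y \<le> 1" unfolding sm_def by (rule avg2_le) (auto simp: F01)
  ultimately have "\<bar>G x y\<bar> \<le> 1" using F01[of x y] unfolding G_def by linarith
  then show ?thesis by (simp add: abs_square_le_1)
 qed
 let ?e = "\<lambda>y. if K \<le> y \<and> y < n - K then 0 else 1 :: real"
 have edge: "avg {0..<n} ?e \<le> 1 / t"
 proof -
  have ind: "(\<Sum>y\<in>{0..<n}. if y \<in> Bs then 1 else 0 :: real) = card ({0..<n} \<inter> Bs)" for Bs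
   by (simp add: sum.If_cases)
  have "(\<Sum>y\<in>{0..<n}. ?e y) \<le> (\<Sum>y\<in>{0..<n}. (if y \<in> {0..<K} then 1 else 0) + (if y \<in> {n - K..<n} then 1 else 0))"
   by (rule sum_mono) auto
  also have "\<dots> = real (card ({0..<n} \<inter> {0..<K})) + real (card ({0..<n} \<inter> {n - K..<n}))"
   unfolding sum.distrib ind ..
  also have "\<dots> \<le> real (card {0..<K}) + real (card {n - K..<n})" by (intro add_mono of_nat_mono card_mono) auto
  also have "\<dots> = 2 * real_of_int K" using M0 by (simp add: K_def)
  finally have "avg {0..<n} ?e \<le> 2 * real_of_int K / n" using n0 by (simp add: avg_def divide_right_mono)
  also have "\<dots> = 20 / real_of_int t ^ 10" using M0 t0 by (simp add: K_def n_def)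
  also have "\<dots> \<le> 1 / t"
  proof -
   have "20 * real_of_int t ^ 1 \<le> real_of_int t * real_of_int t ^ 1" using t by (intro mult_right_mono) auto
   also have "\<dots> = real_of_int t ^ 2" by (simp add: power2_eq_square)
   also have "\<dots> \<le> real_of_int t ^ 10" using t0 by (intro power_increasing) auto
   finally show ?thesis using t0 by (simp add: divide_le_eq le_divide_eq)
  qed
  finally show ?thesis .
 qed
 have window: "avg ?X (\<lambda>x. avg {0..<n} (\<lambda>y. (G x (b + \<gamma>\<^sup>2 * y))\<^sup>2)) \<le> 3 / t" for b
 proof -
  define fb where "fb x y = f x (b + \<gamma>\<^sup>2 * (y mod n))" for x y
  let ?Fb = "conf (params t W D) disp ?M \<gamma> fb fb"
  let ?H = "\<lambda>x y. (?Fb x y - avg2 {0..<L} (\<lambda>l l'. ?Fb x (y + ?v * (l' - l))))\<^sup>2"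
  have pb: "per N fb" unfolding per_def fun_eq_iff fb_def by (simp only: perD[OF p(1)] simp_thms)
  have qb: "per n (fb x)" for x unfolding per_def fb_def by simp
  have bb: "\<bar>fb x y\<bar> \<le> 1" for x y unfolding fb_def using f by (simp add: abs_le_iff)
  have nle: "n \<le> t ^ 10 * ?M\<^sup>2" unfolding n_def by (rule order_refl)
  have loc: "avg ?X (\<lambda>x. avg {0..<n} (\<lambda>y. ?H x y)) \<le> 2 / t"
   by (rule local_structure[OF t W D L N n0 nle pb pb qb qb bb bb])
  have eqF: "?Fb x y = F x (b + \<gamma>\<^sup>2 * y)" if y: "9 * ?M\<^sup>2 \<le> y" "y < n" for x y
   unfolding conf_def F_def oconf_def
  proof (rule avg_cong, rule avg_cong)
   fix \<omega> c assume "\<omega> \<in> params t W D" "c \<in> {0..<?M}"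
   then have "\<bar>disp \<omega> + c\<bar> \<le> 3 * ?M" using W1 D1 by (intro disp_bound3[OF t]) auto
   then have "\<bar>disp \<omega> + c\<bar>\<^sup>2 \<le> (3 * ?M)\<^sup>2" by (intro power_mono) auto
   then have "(disp \<omega> + c)\<^sup>2 \<le> (3 * ?M)\<^sup>2" by (simp only: power2_abs)
   then have "(disp \<omega> + c)\<^sup>2 \<le> y" using y(1) by (simp add: power_mult_distrib)
   moreover have "0 \<le> (disp \<omega> + c)\<^sup>2" by simp
   ultimately have "(y - (disp \<omega> + c)\<^sup>2) mod n = y - (disp \<omega> + c)\<^sup>2" using y(2) by (intro mod_pos_pos_trivial) linarith+
   then show "fb x (y - (disp \<omega> + c)\<^sup>2) * fb (x + \<gamma> * (disp \<omega> + c)) (y - (disp \<omega> + c)\<^sup>2)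
    = f x (b + \<gamma>\<^sup>2 * y - (\<gamma> * (disp \<omega> + c))\<^sup>2) * f (x + \<gamma> * (disp \<omega> + c)) (b + \<gamma>\<^sup>2 * y - (\<gamma> * (disp \<omega> + c))\<^sup>2)"
    unfolding fb_def by (simp add: right_diff_distrib power_mult_distrib add_diff_eq)
  qed
  have "avg ?X (\<lambda>x. avg {0..<n} (\<lambda>y. (G x (b + \<gamma>\<^sup>2 * y))\<^sup>2)) \<le> avg ?X (\<lambda>x. avg {0..<n} (\<lambda>y. ?H x y + ?e y))"
  proof (rule avg_mono, rule avg_mono)
   fix x y assume "y \<in> {0..<n}"
   show "(G x (b + \<gamma>\<^sup>2 * y))\<^sup>2 \<le> ?H x y + ?e y"
   proof (cases "K \<le> y \<and> y < n - K")
    case True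
    have inner: "?Fb x (y + ?v * (l' - l)) = F x (b + \<gamma>\<^sup>2 * y + \<gamma>\<^sup>2 * ?v * (l' - l))" if "l \<in> {0..<L}" "l' \<in> {0..<L}" for l l'
    proof -
     have "\<bar>?v * (l' - l)\<bar> = ?v * \<bar>l' - l\<bar>" by (simp add: abs_mult)
     also have "\<dots> \<le> ?v * L" using that by (intro mult_left_mono) auto
     finally have "\<bar>?v * (l' - l)\<bar> \<le> ?M\<^sup>2" using vL by linarith
     then have "9 * ?M\<^sup>2 \<le> y + ?v * (l' - l)" "y + ?v * (l' - l) < n" using True M0 unfolding K_def by linarith+
     from eqF[OF this] show ?thesis by (simp add: algebra_simps)
    qed
    have "0 \<le> ?M\<^sup>2" by simp
    then have "9 * ?M\<^sup>2 \<le> y" "y < n" using True unfolding K_def by linarith+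
    from eqF[OF this] have "G x (b + \<gamma>\<^sup>2 * y) = ?Fb x y - avg2 {0..<L} (\<lambda>l l'. ?Fb x (y + ?v * (l' - l)))"
     unfolding G_def sm_def by (simp only: avg2_cong[OF inner])
    then show ?thesis using True by simp
   next
    case False
    then have e1: "?e y = 1" by (simp only: if_False)
    have "0 \<le> ?H x y" by (rule zero_le_power2)
    then show ?thesis using G1[of x "b + \<gamma>\<^sup>2 * y"] unfolding e1 by linarith
   qed
  qed
  also have "\<dots> = avg ?X (\<lambda>x. avg {0..<n} (\<lambda>y. ?H x y)) + avg {0..<n} ?e" using N by (simp add: avg_add avg_const)
  also have "\<dots> \<le> 2 / t + 1 / t" using loc edge by linarith
  finally show ?thesis by simp
 qed
 have "avg ?X (\<lambda>x. avg ?X (\<lambda>y. (G x y)\<^sup>2)) = avg ?X (\<lambda>x. avg ?X (\<lambda>b. avg {0..<n} (\<lambda>y. (G x (b + \<gamma>\<^sup>2 * y))\<^sup>2)))"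
  by (rule avg_cong, rule avg_window[OF pG n0])
 also have "\<dots> = avg ?X (\<lambda>b. avg ?X (\<lambda>x. avg {0..<n} (\<lambda>y. (G x (b + \<gamma>\<^sup>2 * y))\<^sup>2)))" by (rule avg_swap)
 also have "\<dots> \<le> 3 / t" by (rule avg_le[OF window]) (use t0 in simp)
 finally show ?thesis unfolding G_def .
qed

lemma avg_interval_shift_real:
 fixes \<phi> :: "int \<Rightarrow> real"
 assumes "\<And>c. \<bar>\<phi> c\<bar> \<le> 1" "0 < M" "0 \<le> s" "s \<le> M"
 shows "\<bar>avg {0..<M} \<phi> - avg {0..<M} (\<lambda>c. \<phi> (c + s))\<bar> \<le> 2 * real_of_int s / real_of_int M"
proof -
 have "norm (avg {0..<M} (\<lambda>c. of_real (\<phi> c) :: complex) - avg {0..<M} (\<lambda>c. of_real (\<phi> (c + s)))) \<le> 2 * real_of_int s / real_of_int M"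
  using avg_interval_shift[of "\<lambda>c. of_real (\<phi> c)", OF _ assms(2-4)] assms(1) by simp
 then show ?thesis unfolding avg_of_real of_real_diff[symmetric] norm_of_real .
qed

text \<open>The displacement is e - \<sigma> + c. Shifting x by \<gamma>\<sigma> puts the two points
  at \<gamma>\<sigma> and \<gamma>(c + e), and dropping e \<le> M/t costs 2/t. For fixed values of
  the remaining layers this is the configuration of \<open>grid_lower_bound\<close>.\<close>

lemma pattern_lower_bound:
 fixes t W D L N \<gamma> g :: int and f :: "int \<Rightarrow> int \<Rightarrow> real"
 assumes t: "2 ^ 20 \<le> t" and W: "0 < W" and D: "0 < D" and L: "0 < L" and N: "0 < N"
  and p: "per N f" "\<And>x. per N (f x)" and f: "\<And>x y. 0 \<le> f x y" "\<And>x y. f x y \<le> 1"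
 shows "(avg {0..<N} (\<lambda>x. avg {0..<N} (f x))) ^ 3 - 2 / t \<le> avg (params t W D) (\<lambda>\<omega>. avg {0..<msize t W D} (\<lambda>c.
  avg {0..<N} (\<lambda>x. avg {0..<N} (\<lambda>y. f x y * f (x + \<gamma> * (disp \<omega> + c)) y * sm g L (f x) y))))"
proof -
 let ?M = "msize t W D" and ?X = "{0..<N}"
 let ?\<mu> = "avg ?X (\<lambda>x. avg ?X (f x))"
 have t0: "1 \<le> t" "0 < t" using t by simp_all
 have M0: "0 < ?M" using t0 W D by (simp add: msize_def)
 define S where "S d = avg ?X (\<lambda>x. avg ?X (\<lambda>y. f x y * f (x + \<gamma> * d) y * sm g L (f x) y))" for d
 have key: "?\<mu> ^ 3 - 2 / t \<le> avg {0..<?M} (\<lambda>\<sigma>. avg {0..<?M} (\<lambda>c. S (e - \<sigma> + c)))" if e: "0 \<le> e" "t * e \<le> ?M" for e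
 proof -
  have eM: "e \<le> ?M" using mult_right_mono[of 1 t e] t0 e by simp
  let ?a = "\<lambda>x y. avg {0..<?M} (\<lambda>\<sigma>. f (x + \<gamma> * \<sigma>) y * sm g L (f (x + \<gamma> * \<sigma>)) y)"
  have a01: "0 \<le> ?a x y" "?a x y \<le> 1" for x y
  proof -
   have s01: "0 \<le> sm g L (f x) y" "sm g L (f x) y \<le> 1" for x y
    unfolding sm_def by (rule avg2_nonneg, rule f) (rule avg2_le, auto simp: f)
   show "0 \<le> ?a x y" "?a x y \<le> 1" using s01 f by (auto intro!: avg_nonneg avg_le mult_le_one)
  qed
  have "?\<mu> ^ 3 - 2 / t \<le> avg ?X (\<lambda>x. avg ?X (\<lambda>y. ?a x y * avg {0..<?M} (\<lambda>c. f (x + \<gamma> * c) y))) - 2 / t"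
   using grid_lower_bound[OF N p f(1) M0 L, of \<gamma> g] by simp
  also have "\<dots> = avg ?X (\<lambda>x. avg ?X (\<lambda>y. ?a x y * avg {0..<?M} (\<lambda>c. f (x + \<gamma> * c) y) - 2 / t))"
   using N by (simp add: avg_diff avg_const)
  also have "\<dots> \<le> avg ?X (\<lambda>x. avg ?X (\<lambda>y. ?a x y * avg {0..<?M} (\<lambda>c. f (x + \<gamma> * (c + e)) y)))"
  proof (rule avg_mono, rule avg_mono)
   fix x y
   have "\<bar>avg {0..<?M} (\<lambda>c. f (x + \<gamma> * c) y) - avg {0..<?M} (\<lambda>c. f (x + \<gamma> * (c + e)) y)\<bar> \<le> 2 * real_of_int e / real_of_int ?M"
    by (rule avg_interval_shift_real[OF _ M0 e(1) eM]) (use f in auto)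
   also have "\<dots> \<le> 2 / t"
   proof -
    have "real_of_int (t * e) \<le> ?M" using e(2) by (simp only: of_int_le_iff)
    then show ?thesis using t0 M0 by (simp add: field_simps)
   qed
   finally have d: "\<bar>avg {0..<?M} (\<lambda>c. f (x + \<gamma> * c) y) - avg {0..<?M} (\<lambda>c. f (x + \<gamma> * (c + e)) y)\<bar> \<le> 2 / t" .
   have "\<bar>?a x y * (avg {0..<?M} (\<lambda>c. f (x + \<gamma> * c) y) - avg {0..<?M} (\<lambda>c. f (x + \<gamma> * (c + e)) y))\<bar> \<le> 1 * (2 / t)"
    unfolding abs_mult using a01[of x y] by (intro mult_mono d) auto
   then show "?a x y * avg {0..<?M} (\<lambda>c. f (x + \<gamma> * c) y) - 2 / t \<le> ?a x y * avg {0..<?M} (\<lambda>c. f (x + \<gamma> * (c + e)) y)"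
    unfolding right_diff_distrib by linarith
  qed
  also have "\<dots> = avg {0..<?M} (\<lambda>\<sigma>. avg {0..<?M} (\<lambda>c. S (e - \<sigma> + c)))"
  proof -
   let ?h = "\<lambda>x y \<sigma> c. f (x + \<gamma> * \<sigma>) y * sm g L (f (x + \<gamma> * \<sigma>)) y * f (x + \<gamma> * (c + e)) y"
   have "avg ?X (\<lambda>x. avg ?X (\<lambda>y. ?a x y * avg {0..<?M} (\<lambda>c. f (x + \<gamma> * (c + e)) y)))
    = avg ?X (\<lambda>x. avg ?X (\<lambda>y. avg {0..<?M} (\<lambda>\<sigma>. avg {0..<?M} (\<lambda>c. ?h x y \<sigma> c))))"
    by (simp only: avg_mult_avg)
   also have "\<dots> = avg ?X (\<lambda>x. avg {0..<?M} (\<lambda>\<sigma>. avg ?X (\<lambda>y. avg {0..<?M} (\<lambda>c. ?h x y \<sigma> c))))" by (rule avg_cong, rule avg_swap)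
   also have "\<dots> = avg ?X (\<lambda>x. avg {0..<?M} (\<lambda>\<sigma>. avg {0..<?M} (\<lambda>c. avg ?X (\<lambda>y. ?h x y \<sigma> c))))" by (rule avg_cong, rule avg_cong, rule avg_swap)
   also have "\<dots> = avg {0..<?M} (\<lambda>\<sigma>. avg ?X (\<lambda>x. avg {0..<?M} (\<lambda>c. avg ?X (\<lambda>y. ?h x y \<sigma> c))))" by (rule avg_swap)
   also have "\<dots> = avg {0..<?M} (\<lambda>\<sigma>. avg {0..<?M} (\<lambda>c. avg ?X (\<lambda>x. avg ?X (\<lambda>y. ?h x y \<sigma> c))))" by (rule avg_cong, rule avg_swap)
   also have "\<dots> = avg {0..<?M} (\<lambda>\<sigma>. avg {0..<?M} (\<lambda>c. S (e - \<sigma> + c)))"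
   proof (rule avg_cong, rule avg_cong)
    fix \<sigma> c
    let ?k = "\<lambda>x. avg ?X (\<lambda>y. f x y * f (x + \<gamma> * (e - \<sigma> + c)) y * sm g L (f x) y)"
    have sh: "x + N + a = (x + a) + N" for x a :: int by simp
    have "per N ?k" unfolding per_def sh by (simp only: perD[OF p(1)] simp_thms)
    from avg_shift[OF this, of "\<gamma> * \<sigma>"] have "S (e - \<sigma> + c) = avg ?X (\<lambda>x. ?k (x + \<gamma> * \<sigma>))" by (simp add: S_def)
    moreover have "x + \<gamma> * \<sigma> + \<gamma> * (e - \<sigma> + c) = x + \<gamma> * (c + e)" for x by (simp add: algebra_simps)
    ultimately show "avg ?X (\<lambda>x. avg ?X (\<lambda>y. ?h x y \<sigma> c)) = S (e - \<sigma> + c)" by (simp only: mult_ac)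
   qed
   finally show ?thesis .
  qed
  finally show ?thesis .
 qed
 define H where "H = W * (W ^ 4 * D)"
 let ?A = "\<lambda>k i j a b. avg {0..<?M} (\<lambda>\<sigma>. avg {0..<?M} (\<lambda>c. S (disp (k, \<sigma>, i, j, a, b) + c)))"
 have H0: "0 < H" using W D by (simp add: H_def)
 have ne: "{1..H} \<noteq> {}" "{0..<H} \<noteq> {}" "{0..<t ^ 36} \<noteq> {}" "{0..<t ^ 71 * H} \<noteq> {}" "{0..<?M} \<noteq> {}" using H0 M0 t0 by auto
 have low: "?\<mu> ^ 3 - 2 / t \<le> ?A k i j a b" if "k \<in> {1..H}" "i \<in> {0..<H}" "j \<in> {0..<t ^ 36}" "a \<in> {0..<t ^ 71 * H}" "b \<in> {0..<H}" for k i j a b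
 proof -
  have "(k, 0, i, j, a, b) \<in> params t W D" using that M0 by (simp add: params_def Let_def H_def)
  from disp_bound[OF t W D this] obtain \<sigma> e where d: "disp (k, 0, i, j, a, b) = e - \<sigma>" "0 \<le> \<sigma>" "\<sigma> < ?M" "0 \<le> e" "t * e \<le> ?M" by metis
  \<comment> \<open>\<open>disp_bound\<close> only asserts some representation e - \<sigma>. The
    explicit e' is nonnegative and at most e, so it inherits the bound.\<close>
  define e' where "e' = i + k * j + (a + b)"
  have "e' = e - \<sigma>" using d(1) by (simp add: disp_def e'_def)
  moreover have "0 \<le> k * j" using that by simp
  ultimately have "0 \<le> e'" "e' \<le> e" using that d(2) unfolding atLeastLessThan_iff atLeastAtMost_iff e'_def by linarith+
  moreover have "t * e' \<le> t * e" using calculation t0 by (intro mult_left_mono) auto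
  ultimately have "?\<mu> ^ 3 - 2 / t \<le> avg {0..<?M} (\<lambda>\<sigma>. avg {0..<?M} (\<lambda>c. S (e' - \<sigma> + c)))" using d by (intro key) auto
  moreover have "disp (k, \<sigma>, i, j, a, b) = e' - \<sigma>" for \<sigma> by (simp add: disp_def e'_def)
  ultimately show ?thesis by (simp only:)
 qed
 have "?\<mu> ^ 3 - 2 / t \<le> avg {1..H} (\<lambda>k. avg {0..<H} (\<lambda>i. avg {0..<t ^ 36} (\<lambda>j. avg {0..<t ^ 71 * H} (\<lambda>a. avg {0..<H} (\<lambda>b. ?A k i j a b)))))"
  by (rule avg_ge[OF _ ne(1)], simp, rule avg_ge[OF _ ne(2)], simp, rule avg_ge[OF _ ne(3)], simp, rule avg_ge[OF _ ne(4)], simp, rule avg_ge[OF _ ne(2)], simp, rule low)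
 also have "\<dots> = avg {1..H} (\<lambda>k. avg {0..<?M} (\<lambda>\<sigma>. avg {0..<H} (\<lambda>i. avg {0..<t ^ 36} (\<lambda>j. avg {0..<t ^ 71 * H} (\<lambda>a. avg {0..<H} (\<lambda>b. avg {0..<?M} (\<lambda>c. S (disp (k, \<sigma>, i, j, a, b) + c))))))))"
 proof (rule avg_cong)
  fix k
  let ?T = "\<lambda>\<sigma> i j a b. avg {0..<?M} (\<lambda>c. S (disp (k, \<sigma>, i, j, a, b) + c))"
  let ?S = "{0..<?M}" and ?I = "{0..<H}" and ?J = "{0..<t ^ 36}" and ?B = "{0..<t ^ 71 * H}"
  have "avg ?I (\<lambda>i. avg ?J (\<lambda>j. avg ?B (\<lambda>a. avg ?I (\<lambda>b. avg ?S (\<lambda>\<sigma>. ?T \<sigma> i j a b)))))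
   = avg ?I (\<lambda>i. avg ?J (\<lambda>j. avg ?B (\<lambda>a. avg ?S (\<lambda>\<sigma>. avg ?I (\<lambda>b. ?T \<sigma> i j a b)))))"
   by (rule avg_cong, rule avg_cong, rule avg_cong, rule avg_swap)
  also have "\<dots> = avg ?I (\<lambda>i. avg ?J (\<lambda>j. avg ?S (\<lambda>\<sigma>. avg ?B (\<lambda>a. avg ?I (\<lambda>b. ?T \<sigma> i j a b)))))"
   by (rule avg_cong, rule avg_cong, rule avg_swap)
  also have "\<dots> = avg ?I (\<lambda>i. avg ?S (\<lambda>\<sigma>. avg ?J (\<lambda>j. avg ?B (\<lambda>a. avg ?I (\<lambda>b. ?T \<sigma> i j a b)))))"
   by (rule avg_cong, rule avg_swap)
  also have "\<dots> = avg ?S (\<lambda>\<sigma>. avg ?I (\<lambda>i. avg ?J (\<lambda>j. avg ?B (\<lambda>a. avg ?I (\<lambda>b. ?T \<sigma> i j a b)))))"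
   by (rule avg_swap)
  finally show "avg ?I (\<lambda>i. avg ?J (\<lambda>j. avg ?B (\<lambda>a. avg ?I (\<lambda>b. avg ?S (\<lambda>\<sigma>. ?T \<sigma> i j a b)))))
   = avg ?S (\<lambda>\<sigma>. avg ?I (\<lambda>i. avg ?J (\<lambda>j. avg ?B (\<lambda>a. avg ?I (\<lambda>b. ?T \<sigma> i j a b)))))" .
 qed
 also have "\<dots> = avg (params t W D) (\<lambda>\<omega>. avg {0..<?M} (\<lambda>c. S (disp \<omega> + c)))"
  unfolding params_def Let_def H_def avg_Times ..
 finally show ?thesis unfolding S_def .
qed

text \<open>Three replacements in the count, which is the pairing of the dual function with f:
  \<open>window_bound\<close> and self-adjointness put the smoothing of the next level on f,
  \<open>inc\<close> exchanges it for the smoothing of this level, and its length L' makes it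
  insensitive to the shift by the squared displacement. Then \<open>pattern_lower_bound\<close>
  applies. The costs are \<eta>, \<eta>, 1/t and 2/t.\<close>

lemma level_bound:
 fixes t W D L L' N \<gamma> :: int and f :: "int \<Rightarrow> int \<Rightarrow> real" and \<eta> :: real
 assumes t: "2 ^ 20 \<le> t" and W: "((t ^ 2900) ^ 530) ^ 200 \<le> W" "\<And>m. 1 \<le> m \<Longrightarrow> m \<le> ((t ^ 2900) ^ 530) ^ 200 \<Longrightarrow> m dvd W"
  and D: "W ^ 16 \<le> D" and L: "0 < L" "L * W ^ 17 \<le> D\<^sup>2" and N: "0 < N"
  and p: "per N f" "\<And>x. per N (f x)" and f: "\<And>x y. 0 \<le> f x y" "\<And>x y. f x y \<le> 1"
  and L': "18 * t * (msize t W D)\<^sup>2 \<le> L'" and \<eta>: "0 \<le> \<eta>" "4 / t \<le> \<eta>\<^sup>2"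
  and inc: "avg {0..<N} (\<lambda>x. avg {0..<N} (\<lambda>y. (sm (\<gamma>\<^sup>2 * (4 * W ^ 4)\<^sup>2) L (f x) y - sm (\<gamma>\<^sup>2) L' (f x) y)\<^sup>2)) \<le> \<eta>\<^sup>2"
 shows "(avg {0..<N} (\<lambda>x. avg {0..<N} (f x))) ^ 3 - 2 * \<eta> - 3 / t \<le> avg (params t W D) (\<lambda>\<omega>. avg {0..<msize t W D} (\<lambda>c.
  avg {0..<N} (\<lambda>x. avg {0..<N} (\<lambda>y. f x y * f (x + \<gamma> * (disp \<omega> + c)) y * f x (y + (\<gamma> * (disp \<omega> + c))\<^sup>2)))))"
proof -
 let ?M = "msize t W D" and ?X = "{0..<N}" and ?\<Omega> = "params t W D" and ?g2 = "\<gamma>\<^sup>2 * (4 * W ^ 4)\<^sup>2"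
 let ?F = "oconf ?\<Omega> disp ?M \<gamma> f"
 let ?s2 = "\<lambda>x. sm ?g2 L (f x)" and ?s1 = "\<lambda>x. sm (\<gamma>\<^sup>2) L' (f x)"
 have t0: "1 \<le> t" "0 < t" using t by simp_all
 have W1: "1 \<le> W"
 proof -
  have "1 \<le> ((t ^ 2900) ^ 530) ^ 200" by (intro one_le_power t0)
  then show ?thesis using W(1) by linarith
 qed
 have D1: "1 \<le> D" using D one_le_power[OF W1, of 16] by linarith
 have M0: "0 < ?M" using t0 W1 D1 by (auto simp: msize_def intro!: mult_pos_pos)
 have L'0: "9 * ?M\<^sup>2 \<le> L'" "0 < L'"
 proof -
  have "9 * ?M\<^sup>2 \<le> 18 * t * ?M\<^sup>2" using t0 by (intro mult_right_mono) auto
  then show a: "9 * ?M\<^sup>2 \<le> L'" using L' by linarith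
  have "0 < ?M\<^sup>2" using M0 by simp
  then show "0 < L'" using a by linarith
 qed
 have absf: "\<bar>f x y\<bar> \<le> 1" for x y using f(1)[of x y] f(2)[of x y] by simp
 have F01: "0 \<le> ?F x y" "?F x y \<le> 1" for x y by (rule oconf_range[OF f])+
 have absF: "\<bar>?F x y\<bar> \<le> 1" for x y using F01[of x y] by simp
 have pF: "per N (?F x)" for x by (rule oconf_per_n[OF p(2)])
 have "avg ?X (\<lambda>x. avg ?X (\<lambda>y. (?F x y - sm ?g2 L (?F x) y)\<^sup>2)) \<le> 3 / t"
  by (rule window_bound[OF t W D L N p f])
 also have "3 / real_of_int t \<le> \<eta>\<^sup>2" using \<eta>(2) t0 divide_right_mono[of 3 4 "real_of_int t"] by linarith
 finally have e1: "\<bar>avg ?X (\<lambda>x. avg ?X (\<lambda>y. (?F x y - sm ?g2 L (?F x) y) * f x y))\<bar> \<le> \<eta>"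
  by (intro l2_small \<eta> absf)
 have e2: "\<bar>avg ?X (\<lambda>x. avg ?X (\<lambda>y. (?s2 x y - ?s1 x y) * ?F x y))\<bar> \<le> \<eta>"
  by (intro l2_small \<eta> absF inc)
 have d1: "avg ?X (\<lambda>x. avg ?X (\<lambda>y. (?F x y - sm ?g2 L (?F x) y) * f x y)) = avg ?X (\<lambda>x. avg ?X (\<lambda>y. ?F x y * f x y)) - avg ?X (\<lambda>x. avg ?X (\<lambda>y. ?F x y * ?s2 x y))"
  unfolding left_diff_distrib avg_diff by (simp only: sm_dual[OF pF p(2)])
 have d2: "avg ?X (\<lambda>x. avg ?X (\<lambda>y. (?s2 x y - ?s1 x y) * ?F x y)) = avg ?X (\<lambda>x. avg ?X (\<lambda>y. ?F x y * ?s2 x y)) - avg ?X (\<lambda>x. avg ?X (\<lambda>y. ?F x y * ?s1 x y))"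
  unfolding left_diff_distrib avg_diff by (simp only: mult.commute)
 have "avg ?\<Omega> (\<lambda>\<omega>. avg {0..<?M} (\<lambda>c. avg ?X (\<lambda>x. avg ?X (\<lambda>y. f x y * f (x + \<gamma> * (disp \<omega> + c)) y * ?s1 x y)))) - 1 / t
  \<le> avg ?\<Omega> (\<lambda>\<omega>. avg {0..<?M} (\<lambda>c. avg ?X (\<lambda>x. avg ?X (\<lambda>y. f x y * f (x + \<gamma> * (disp \<omega> + c)) y * ?s1 x y - 1 / t))))"
 proof -
  have "avg ?\<Omega> (\<lambda>\<omega>. avg {0..<?M} (\<lambda>c. avg ?X (\<lambda>x. avg ?X (\<lambda>y. 1 / real_of_int t)))) \<le> 1 / t"
   by (rule avg_le, rule avg_le, rule avg_le, rule avg_le) (use t0 in auto)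
  then show ?thesis unfolding avg_diff by linarith
 qed
 also have "\<dots> \<le> avg ?\<Omega> (\<lambda>\<omega>. avg {0..<?M} (\<lambda>c. avg ?X (\<lambda>x. avg ?X (\<lambda>y. f x y * f (x + \<gamma> * (disp \<omega> + c)) y * ?s1 x (y + (\<gamma> * (disp \<omega> + c))\<^sup>2)))))"
 proof (rule avg_mono, rule avg_mono, rule avg_mono, rule avg_mono)
  fix \<omega> c x y assume "\<omega> \<in> ?\<Omega>" "c \<in> {0..<?M}"
  let ?d = "disp \<omega> + c"
  have "\<bar>?d\<bar> \<le> 3 * ?M" using W1 D1 \<open>\<omega> \<in> ?\<Omega>\<close> \<open>c \<in> {0..<?M}\<close> by (intro disp_bound3[OF t]) auto
  then have "\<bar>?d\<bar>\<^sup>2 \<le> (3 * ?M)\<^sup>2" by (intro power_mono) auto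
  then have "?d\<^sup>2 \<le> (3 * ?M)\<^sup>2" by (simp only: power2_abs)
  then have d9: "?d\<^sup>2 \<le> 9 * ?M\<^sup>2" by (simp add: power_mult_distrib)
  then have "\<bar>?d\<^sup>2\<bar> \<le> L'" using L'0 by simp
  from avg2_shift_slow[where u = "f x" and y = y and g = "\<gamma>\<^sup>2", OF absf L'0(2) this]
  have "\<bar>?s1 x (y + \<gamma>\<^sup>2 * ?d\<^sup>2) - ?s1 x y\<bar> \<le> 2 * real_of_int \<bar>?d\<^sup>2\<bar> / real_of_int L'" .
  also have "\<dots> \<le> 1 / t"
  proof -
   have "2 * \<bar>?d\<^sup>2\<bar> * t \<le> 2 * (9 * ?M\<^sup>2) * t" using d9 t0 by (intro mult_right_mono mult_left_mono) auto
   then have "2 * \<bar>?d\<^sup>2\<bar> * t \<le> L'" using L' by (simp add: mult_ac)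
   then have "real_of_int (2 * \<bar>?d\<^sup>2\<bar> * t) \<le> L'" by (simp only: of_int_le_iff)
   then have "2 * real_of_int \<bar>?d\<^sup>2\<bar> * t \<le> L'" by (simp only: of_int_mult of_int_numeral)
   then show ?thesis using t0 L'0(2) by (simp only: divide_le_eq le_divide_eq of_int_0_less_iff if_True times_divide_eq_left mult_1_left)
  qed
  finally have c: "\<bar>?s1 x (y + \<gamma>\<^sup>2 * ?d\<^sup>2) - ?s1 x y\<bar> \<le> 1 / t" .
  have "\<bar>f x y * f (x + \<gamma> * ?d) y * (?s1 x (y + \<gamma>\<^sup>2 * ?d\<^sup>2) - ?s1 x y)\<bar> \<le> 1 * (1 / t)"
   unfolding abs_mult[of "f x y * _"] by (intro mult_mono c abs_mult_le1 absf) auto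
  then show "f x y * f (x + \<gamma> * ?d) y * ?s1 x y - 1 / t \<le> f x y * f (x + \<gamma> * ?d) y * ?s1 x (y + (\<gamma> * ?d)\<^sup>2)"
   unfolding right_diff_distrib power_mult_distrib by linarith
 qed
 also have "\<dots> = avg ?X (\<lambda>x. avg ?X (\<lambda>y. ?F x y * ?s1 x y))"
  by (rule oconf_dual[OF p(2) per_sm[OF p(2)], symmetric])
 finally have a1: "(avg ?X (\<lambda>x. avg ?X (f x))) ^ 3 - 2 / t - 1 / t \<le> avg ?X (\<lambda>x. avg ?X (\<lambda>y. ?F x y * ?s1 x y))"
  using pattern_lower_bound[OF t _ _ L'0(2) N p f, of W D \<gamma> "\<gamma>\<^sup>2"] W1 D1 by linarith
 have "(avg ?X (\<lambda>x. avg ?X (f x))) ^ 3 - 2 * \<eta> - 3 / t \<le> avg ?X (\<lambda>x. avg ?X (\<lambda>y. ?F x y * f x y))"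
 proof -
  have "3 / real_of_int t = 2 / t + 1 / t" by simp
  then show ?thesis using a1 e1 e2 unfolding d1 d2 by linarith
 qed
 then show ?thesis unfolding oconf_dual[OF p(2) p(2)] .
qed

section \<open>From averages to configurations in the box\<close>

lemma exists_nonzero_displacement:
 fixes T :: "int \<Rightarrow> real"
 assumes fin: "finite \<Omega>" "\<Omega> \<noteq> {}" and M: "0 < M" and T: "\<And>d. T d \<le> 1"
  and big: "b \<le> avg \<Omega> (\<lambda>\<omega>. avg {0..<M} (\<lambda>c. T (dv \<omega> + c)))" and pos: "0 < b - 1 / M"
 shows "\<exists>\<omega>\<in>\<Omega>. \<exists>c\<in>{0..<M}. dv \<omega> + c \<noteq> 0 \<and> b - 1 / M \<le> T (dv \<omega> + c)"
proof -
 let ?T = "\<lambda>d. if d = 0 then 0 else T d"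
 have zero: "avg {0..<M} (\<lambda>c. if dv \<omega> + c = 0 then 1 else 0 :: real) \<le> 1 / M" for \<omega>
 proof -
  have "(\<Sum>c\<in>{0..<M}. if dv \<omega> + c = 0 then 1 else 0 :: real) = card ({0..<M} \<inter> {c. dv \<omega> + c = 0})"
   by (simp add: sum.If_cases)
  also have "\<dots> \<le> card {- dv \<omega>}" by (intro of_nat_mono card_mono) auto
  finally show ?thesis using M by (simp add: avg_def divide_right_mono)
 qed
 have "b \<le> avg \<Omega> (\<lambda>\<omega>. avg {0..<M} (\<lambda>c. ?T (dv \<omega> + c) + (if dv \<omega> + c = 0 then 1 else 0)))"
  by (rule order_trans[OF big], rule avg_mono, rule avg_mono) (simp add: T)
 also have "\<dots> = avg \<Omega> (\<lambda>\<omega>. avg {0..<M} (\<lambda>c. ?T (dv \<omega> + c))) + avg \<Omega> (\<lambda>\<omega>. avg {0..<M} (\<lambda>c. if dv \<omega> + c = 0 then 1 else 0))"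
  by (simp only: avg_add)
 also have "avg \<Omega> (\<lambda>\<omega>. avg {0..<M} (\<lambda>c. if dv \<omega> + c = 0 then 1 else 0 :: real)) \<le> 1 / M"
  by (rule avg_le[OF zero]) (use M in simp)
 finally have lb: "b - 1 / M \<le> avg \<Omega> (\<lambda>\<omega>. avg {0..<M} (\<lambda>c. ?T (dv \<omega> + c)))" by simp
 obtain \<omega> where w: "\<omega> \<in> \<Omega>" "avg \<Omega> (\<lambda>\<omega>. avg {0..<M} (\<lambda>c. ?T (dv \<omega> + c))) \<le> avg {0..<M} (\<lambda>c. ?T (dv \<omega> + c))"
  using avg_exists_ge[OF fin, of "\<lambda>\<omega>. avg {0..<M} (\<lambda>c. ?T (dv \<omega> + c))"] by blast
 have "{0..<M} \<noteq> {}" using M by simp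
 from avg_exists_ge[OF finite_atLeastLessThan_int this, of "\<lambda>c. ?T (dv \<omega> + c)"]
 obtain c where c: "c \<in> {0..<M}" "avg {0..<M} (\<lambda>c. ?T (dv \<omega> + c)) \<le> ?T (dv \<omega> + c)" by blast
 have "b - 1 / M \<le> ?T (dv \<omega> + c)" using lb w(2) c(2) by linarith
 then have "dv \<omega> + c \<noteq> 0 \<and> b - 1 / M \<le> T (dv \<omega> + c)" using pos by (auto split: if_splits)
 then show ?thesis using w(1) c(1) by blast
qed

lemma avg_plane: "0 < N \<Longrightarrow> avg {0..<N} (\<lambda>x. avg {0..<N} (g x)) = (\<Sum>z\<in>{0..<N} \<times> {0..<N}. case z of (x, y) \<Rightarrow> g x y) / (real_of_int N)\<^sup>2"
 by (simp add: avg_def sum.cartesian_product[symmetric] sum_divide_distrib[symmetric] power2_eq_square)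

text \<open>The N-periodic indicator of A; the added 1 matches the residues 0, ..., N - 1 with the
  coordinates 1, ..., N.\<close>

definition wrap :: "int \<Rightarrow> (int \<times> int) set \<Rightarrow> int \<Rightarrow> int \<Rightarrow> real" where
 "wrap N A x y = (if (x mod N + 1, y mod N + 1) \<in> A then 1 else 0)"

lemma wrap_mean:
 assumes N: "0 < N" and A: "A \<subseteq> {1..N} \<times> {1..N}"
 shows "avg {0..<N} (\<lambda>x. avg {0..<N} (wrap N A x)) = card A / (real_of_int N)\<^sup>2"
proof -
 let ?Z = "{0..<N} \<times> {0..<N}"
 have "(\<Sum>z\<in>?Z. case z of (x, y) \<Rightarrow> wrap N A x y) = (\<Sum>z\<in>?Z. if (fst z + 1, snd z + 1) \<in> A then 1 else 0)"
  by (rule sum.cong) (auto simp: wrap_def)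
 also have "\<dots> = card {z\<in>?Z. (fst z + 1, snd z + 1) \<in> A}" by (simp add: sum.If_cases Int_def)
 also have "card {z\<in>?Z. (fst z + 1, snd z + 1) \<in> A} = card A"
 proof (rule bij_betw_same_card[of "\<lambda>z. (fst z + 1, snd z + 1)"], rule bij_betwI[of _ _ _ "\<lambda>z. (fst z - 1, snd z - 1)"])
  show "(\<lambda>z. (fst z - 1, snd z - 1)) \<in> A \<rightarrow> {z \<in> ?Z. (fst z + 1, snd z + 1) \<in> A}"
   using A by fastforce
 qed auto
 finally show ?thesis using N by (simp only: avg_plane)
qed

text \<open>A wrapped configuration is genuine unless x + D or y + D^2 leaves the box. This happens
  for at most |D| N + D^2 N points, and |D| \<le> D^2 for integers.\<close>

lemma wrap_count:
 fixes D :: int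
 assumes N: "0 < N" and A: "A \<subseteq> {1..N} \<times> {1..N}"
 shows "avg {0..<N} (\<lambda>x. avg {0..<N} (\<lambda>y. wrap N A x y * wrap N A (x + D) y * wrap N A x (y + D\<^sup>2))) * (real_of_int N)\<^sup>2
  \<le> card {(x, y). (x, y) \<in> A \<and> (x + D, y) \<in> A \<and> (x, y + D\<^sup>2) \<in> A} + 2 * real_of_int (D\<^sup>2) * N"
proof -
 let ?Z = "{0..<N} \<times> {0..<N}"
 define S where "S = {(x, y). (x, y) \<in> A \<and> (x + D, y) \<in> A \<and> (x, y + D\<^sup>2) \<in> A}"
 define P where "P = {z\<in>?Z. (fst z mod N + 1, snd z mod N + 1) \<in> A \<and> ((fst z + D) mod N + 1, snd z mod N + 1) \<in> A \<and> (fst z mod N + 1, (snd z + D\<^sup>2) mod N + 1) \<in> A}"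
 define B1 where "B1 = {z\<in>?Z. fst z + D \<notin> {0..<N}}"
 define B2 where "B2 = {z\<in>?Z. snd z + D\<^sup>2 \<notin> {0..<N}}"
 have "avg {0..<N} (\<lambda>x. avg {0..<N} (\<lambda>y. wrap N A x y * wrap N A (x + D) y * wrap N A x (y + D\<^sup>2))) * (real_of_int N)\<^sup>2
  = (\<Sum>z\<in>?Z. case z of (x, y) \<Rightarrow> wrap N A x y * wrap N A (x + D) y * wrap N A x (y + D\<^sup>2))"
  using N by (simp add: avg_plane)
 also have "\<dots> = (\<Sum>z\<in>?Z. if (fst z mod N + 1, snd z mod N + 1) \<in> A \<and> ((fst z + D) mod N + 1, snd z mod N + 1) \<in> A \<and> (fst z mod N + 1, (snd z + D\<^sup>2) mod N + 1) \<in> A then 1 else 0)"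
  by (rule sum.cong) (auto simp: wrap_def)
 also have "\<dots> = card P" unfolding P_def by (simp add: sum.If_cases Int_def)
 finally have e: "avg {0..<N} (\<lambda>x. avg {0..<N} (\<lambda>y. wrap N A x y * wrap N A (x + D) y * wrap N A x (y + D\<^sup>2))) * (real_of_int N)\<^sup>2 = card P" .
 have finA: "finite A" using A by (rule finite_subset) simp
 have finS: "finite S" unfolding S_def by (rule finite_subset[OF _ finA]) auto
 have fB: "finite B1" "finite B2" unfolding B1_def B2_def by auto
 have "P - (B1 \<union> B2) \<subseteq> (\<lambda>z. (fst z - 1, snd z - 1)) ` S"
 proof
  fix z assume z: "z \<in> P - (B1 \<union> B2)"
  then have "(fst z + 1, snd z + 1) \<in> S" by (auto simp: P_def B1_def B2_def S_def add_ac)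
  then show "z \<in> (\<lambda>z. (fst z - 1, snd z - 1)) ` S" by (intro image_eqI[of _ _ "(fst z + 1, snd z + 1)"]) auto
 qed
 then have "card (P - (B1 \<union> B2)) \<le> card S" using finS by (meson card_image_le card_mono finite_imageI order_trans)
 moreover have "card P \<le> card (P - (B1 \<union> B2)) + card (B1 \<union> B2)"
  using card_mono[of "(P - (B1 \<union> B2)) \<union> (B1 \<union> B2)" P] card_Un_le[of "P - (B1 \<union> B2)" "B1 \<union> B2"] fB by (auto simp: P_def)
 moreover have "card (B1 \<union> B2) \<le> card B1 + card B2" by (rule card_Un_le)
 ultimately have c: "card P \<le> card S + card B1 + card B2" by linarith
 have line: "int (card {x\<in>{0..<N}. x + a \<notin> {0..<N}}) \<le> \<bar>a\<bar>" for a
 proof (cases "0 \<le> a")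
  case True
  have "{x\<in>{0..<N}. x + a \<notin> {0..<N}} \<subseteq> {N - a..<N}" using True by auto
  from card_mono[OF finite_atLeastLessThan_int this] have "card {x\<in>{0..<N}. x + a \<notin> {0..<N}} \<le> nat a" by simp
  then show ?thesis using True by linarith
 next
  case False
  have "{x\<in>{0..<N}. x + a \<notin> {0..<N}} \<subseteq> {0..<- a}" using False by auto
  from card_mono[OF finite_atLeastLessThan_int this] have "card {x\<in>{0..<N}. x + a \<notin> {0..<N}} \<le> nat (- a)" by simp
  then show ?thesis using False by linarith
 qed
 have real_card: "real k \<le> real_of_int m" if "int k \<le> m" for k m
 proof -
  have "real_of_int (int k) \<le> real_of_int m" using that by (simp only: of_int_le_iff)
  then show ?thesis by (simp only: of_int_of_nat_eq)
 qed
 have "B1 = {x\<in>{0..<N}. x + D \<notin> {0..<N}} \<times> {0..<N}" "B2 = {0..<N} \<times> {x\<in>{0..<N}. x + D\<^sup>2 \<notin> {0..<N}}"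
  by (auto simp: B1_def B2_def)
 then have "real (card B1) = real (card {x\<in>{0..<N}. x + D \<notin> {0..<N}}) * N" "real (card B2) = real (card {x\<in>{0..<N}. x + D\<^sup>2 \<notin> {0..<N}}) * N"
  using N by (simp_all add: card_cartesian_product)
 moreover have "real (card {x\<in>{0..<N}. x + D \<notin> {0..<N}}) \<le> real_of_int (D\<^sup>2)"
 proof -
  have "\<bar>D\<bar> * 1 \<le> \<bar>D\<bar> * \<bar>D\<bar>"
  proof (cases "D = 0")
   case False
   then have "1 \<le> \<bar>D\<bar>" by linarith
   then show ?thesis by (intro mult_left_mono) auto
  qed simp
  then have "\<bar>D\<bar> \<le> D\<^sup>2" by (simp add: power2_eq_square flip: abs_mult)
  then have "int (card {x\<in>{0..<N}. x + D \<notin> {0..<N}}) \<le> D\<^sup>2" using line[of D] by linarith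
  then show ?thesis by (rule real_card)
 qed
 moreover have "real (card {x\<in>{0..<N}. x + D\<^sup>2 \<notin> {0..<N}}) \<le> real_of_int (D\<^sup>2)"
 proof -
  have "int (card {x\<in>{0..<N}. x + D\<^sup>2 \<notin> {0..<N}}) \<le> D\<^sup>2" using line[of "D\<^sup>2"] zero_le_power2[of D] by linarith
  then show ?thesis by (rule real_card)
 qed
 ultimately have "real (card B1) \<le> real_of_int (D\<^sup>2) * N" "real (card B2) \<le> real_of_int (D\<^sup>2) * N"
  using N by (simp_all add: mult_right_mono)
 moreover have "real (card P) \<le> real (card S) + real (card B1) + real (card B2)" using c by linarith
 ultimately show ?thesis unfolding e S_def[symmetric] by (simp only: mult_2 distrib_right)
qed

text \<open>Level i uses the step (4W^4)^i and displacements of size M i. The sizes shrink by W^16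
  per level, so the smoothing at level i + 1 is both local for the structure theorem at level i and
  short compared with the smoothing at level i. The energies lie in [0, 1], so one of the t
  increments is at most 1/t.\<close>

lemma corners_large:
 fixes t W N :: int and A :: "(int \<times> int) set" and \<epsilon> :: real
 assumes t: "2 ^ 20 \<le> t" and W: "((t ^ 2900) ^ 530) ^ 200 \<le> W" "\<And>m. 1 \<le> m \<Longrightarrow> m \<le> ((t ^ 2900) ^ 530) ^ 200 \<Longrightarrow> m dvd W"
  and N: "W ^ (42 * nat t + 46) \<le> N" and A: "A \<subseteq> {1..N} \<times> {1..N}"
  and \<epsilon>: "0 < \<epsilon>" "\<epsilon> \<le> 1 / 2" "256 / \<epsilon>\<^sup>2 \<le> t" and big: "\<epsilon> \<le> (card A / (real_of_int N)\<^sup>2) ^ 3"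
 shows "\<exists>d::int. d \<noteq> 0 \<and> ((card A / (real_of_int N)\<^sup>2) ^ 3 - \<epsilon>) * (real_of_int N)\<^sup>2
  \<le> card {(x, y). (x, y) \<in> A \<and> (x + d, y) \<in> A \<and> (x, y + d\<^sup>2) \<in> A}"
proof -
 let ?X = "{0..<N}"
 define f where "f = wrap N A"
 define \<mu> where "\<mu> = card A / (real_of_int N)\<^sup>2"
 define Tn where "Tn = nat t"
 have t0: "1 \<le> t" "0 < t" using t by simp_all
 have Tt: "int Tn = t" "real Tn = t" using t0 by (simp_all add: Tn_def)
 have tW: "t ^ 148 \<le> W" "t \<le> W" "2 ^ 20 \<le> W" "1 \<le> W" "0 < W"
 proof -
  have s: "t ^ k \<le> ((t ^ 2900) ^ 530) ^ 200" if "k \<le> 2900 * 530 * 200" for k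
   using that t0 by (simp flip: power_mult add: power_increasing)
  show "t ^ 148 \<le> W" using s[of 148] W(1) by linarith
  show "t \<le> W" using s[of 1] W(1) by simp
  then show "2 ^ 20 \<le> W" using t by linarith
  then show "1 \<le> W" "0 < W" by simp_all
 qed
 have Wp: "1 \<le> W ^ k" "0 < W ^ k" for k using tW by auto
 \<comment> \<open>The exponent starts at 16(t + 1), decreases by 16 per level and ends at 16, the
   least value that satisfies W^16 \<le> D.\<close>
 define D where "D i = W ^ (16 * (Tn + 1 - i))" for i :: nat
 define M where "M i = msize t W (D i)" for i
 \<comment> \<open>Between two constraints: L i has to exceed 18t (M i)^2, so that shifts by squared
   displacements are invisible, and L (i + 1) W^17 must not exceed (D i)^2.\<close>
 define L where "L i = W * (M i)\<^sup>2" for i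
 define \<gamma> where "\<gamma> i = (4 * W ^ 4) ^ i" for i :: nat
 let ?v = "(4 * W ^ 4)\<^sup>2"
 have Meq: "M i = t ^ 74 * (W ^ 5 * D i)" for i by (simp add: M_def msize_def flip: mult.assoc power_Suc)
 have D0: "1 \<le> D i" "0 < D i" for i unfolding D_def by (rule Wp)+
 have M0: "1 \<le> M i" "0 < M i" for i
 proof -
  have "1 * (1 * 1) \<le> t ^ 74 * (W ^ 5 * D i)" using t0 Wp D0 tW(4,5) by (intro mult_mono one_le_power) auto
  then show "1 \<le> M i" "0 < M i" by (simp_all add: Meq)
 qed
 have L0: "0 < L i" for i using tW M0(2)[of i] by (simp add: L_def)
 have DS: "D i = W ^ 16 * D (Suc i)" if "i < Tn" for i
 proof -
  have "16 * (Tn + 1 - i) = 16 + 16 * (Tn + 1 - Suc i)" using that by simp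
  then show ?thesis unfolding D_def by (simp only: power_add)
 qed
 have D16: "W ^ 16 \<le> D i" if "i \<le> Tn" for i
  unfolding D_def using that tW by (intro power_increasing) auto
 have LS: "L i = W ^ 32 * L (Suc i)" if "i < Tn" for i
  unfolding L_def Meq DS[OF that] by (simp add: power_mult_distrib flip: power_mult)
 have LD: "L (Suc i) * W ^ 17 \<le> (D i)\<^sup>2" if "i < Tn" for i
 proof -
  have "L (Suc i) * W ^ 17 = t ^ 148 * (W ^ 28 * (D (Suc i))\<^sup>2)"
   unfolding L_def Meq by (simp add: power_mult_distrib flip: power_mult power_add power_Suc)
  also have "\<dots> \<le> W * (W ^ 28 * (D (Suc i))\<^sup>2)" using tW Wp(2)[of 28] by (intro mult_right_mono) auto
  also have "\<dots> = W ^ 29 * (D (Suc i))\<^sup>2" by (simp flip: power_Suc)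
  also have "\<dots> \<le> W ^ 32 * (D (Suc i))\<^sup>2" using tW by (intro mult_right_mono power_increasing) auto
  also have "\<dots> = (D i)\<^sup>2" unfolding DS[OF that] by (simp add: power_mult_distrib flip: power_mult)
  finally show ?thesis .
 qed
 have N0: "0 < N" using N Wp(1)[of "42 * nat t + 46"] by linarith
 have pf: "per N f" "\<And>x. per N (f x)" by (auto simp: per_def f_def wrap_def fun_eq_iff)
 have f01: "0 \<le> f x y" "f x y \<le> 1" "\<bar>f x y\<bar> \<le> 1" for x y by (auto simp: f_def wrap_def)
 have mean: "avg ?X (\<lambda>x. avg ?X (f x)) = \<mu>" unfolding f_def \<mu>_def by (rule wrap_mean[OF N0 A])
 define E where "E i = avg ?X (\<lambda>x. avg ?X (\<lambda>y. (cv ((\<gamma> i)\<^sup>2) (L i) (f x) y)\<^sup>2))" for i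
 have E01: "0 \<le> E i" "E i \<le> 1" for i
 proof -
  have "\<bar>cv ((\<gamma> i)\<^sup>2) (L i) (f x) y\<bar> \<le> 1" for x y unfolding cv_def by (rule abs_avg_bound) (auto simp: f01)
  then have "(cv ((\<gamma> i)\<^sup>2) (L i) (f x) y)\<^sup>2 \<le> 1" for x y by (simp add: abs_square_le_1)
  then show "0 \<le> E i" "E i \<le> 1" unfolding E_def by (auto intro!: avg_nonneg avg_le)
 qed
 obtain i where i: "i < Tn" "E (Suc i) - E i \<le> 1 / t"
 proof (rule ccontr)
  assume "\<not> thesis"
  then have "1 / t < E (Suc i) - E i" if "i < Tn" for i using that \<open>\<And>i. i < Tn \<Longrightarrow> E (Suc i) - E i \<le> 1 / real_of_int t \<Longrightarrow> thesis\<close> by (meson not_le)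
  moreover have "0 < Tn" using Tt t0 by simp
  ultimately have "(\<Sum>i<Tn. 1 / real_of_int t) < (\<Sum>i<Tn. E (Suc i) - E i)" by (intro sum_strict_mono) auto
  also have "\<dots> = E Tn - E 0" by (rule sum_lessThan_telescope)
  also have "\<dots> \<le> 1" using E01(1)[of 0] E01(2)[of Tn] by linarith
  finally show False using Tt t0 by simp
 qed
 \<comment> \<open>The losses are 2\<eta> = \<epsilon>/4, then 3/t from the level, 1/M for the zero
   displacement and 1/t for wrapping around, each 1/t being at most \<epsilon>/64.\<close>
 define \<eta> where "\<eta> = \<epsilon> / 8"
 have \<eta>: "0 \<le> \<eta>" "4 / t \<le> \<eta>\<^sup>2"
 proof -
  show "0 \<le> \<eta>" using \<epsilon> by (simp add: \<eta>_def)
  have "256 \<le> t * \<epsilon>\<^sup>2" using \<epsilon> by (simp add: divide_le_eq)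
  then show "4 / t \<le> \<eta>\<^sup>2" using t0 by (simp add: \<eta>_def power_divide divide_le_eq mult.commute)
 qed
 have g2: "(\<gamma> (Suc i))\<^sup>2 = (\<gamma> i)\<^sup>2 * ?v" by (simp add: \<gamma>_def power_mult_distrib)
 have v16: "?v = 16 * W ^ 8" by (simp add: power_mult_distrib flip: power_mult)
 have vL4: "4 * t * (?v * L (Suc i)) \<le> L i"
 proof -
  have "4 * t * (?v * L (Suc i)) = 64 * (t * (W ^ 8 * L (Suc i)))" unfolding v16 by simp
  also have "\<dots> \<le> W * (W * (W ^ 8 * L (Suc i)))" using tW L0[of "Suc i"] Wp(2)[of 8] t0 by (intro mult_mono) auto
  also have "\<dots> = W ^ 10 * L (Suc i)" by (simp flip: power_Suc add: mult.assoc[symmetric])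
  also have "\<dots> \<le> W ^ 32 * L (Suc i)" using tW L0[of "Suc i"] by (intro mult_right_mono power_increasing) auto
  finally show ?thesis using LS[OF i(1)] by simp
 qed
 have vpos: "0 < ?v" using tW by simp
 have vL1: "?v * L (Suc i) \<le> L i"
 proof -
  have "1 * (?v * L (Suc i)) \<le> 4 * t * (?v * L (Suc i))" using t0 vpos L0[of "Suc i"] by (intro mult_right_mono) auto
  then show ?thesis using vL4 by linarith
 qed
 have inc: "avg ?X (\<lambda>x. avg ?X (\<lambda>y. (sm ((\<gamma> i)\<^sup>2 * ?v) (L (Suc i)) (f x) y - sm ((\<gamma> i)\<^sup>2) (L i) (f x) y)\<^sup>2)) \<le> \<eta>\<^sup>2"
 proof -
  let ?r = "4 * real_of_int (?v * L (Suc i)) / real_of_int (L i)"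
  have "avg ?X (\<lambda>x. avg ?X (\<lambda>y. (sm ((\<gamma> i)\<^sup>2 * ?v) (L (Suc i)) (f x) y - sm ((\<gamma> i)\<^sup>2) (L i) (f x) y)\<^sup>2))
   \<le> avg ?X (\<lambda>x. avg ?X (\<lambda>y. (cv ((\<gamma> i)\<^sup>2 * ?v) (L (Suc i)) (f x) y)\<^sup>2) - avg ?X (\<lambda>y. (cv ((\<gamma> i)\<^sup>2) (L i) (f x) y)\<^sup>2) + ?r)"
   by (rule avg_mono, rule sm_increment[OF pf(2) f01(3) L0 L0 vpos vL1])
  also have "\<dots> = E (Suc i) - E i + ?r" unfolding E_def g2 using N0 by (simp add: avg_add avg_diff avg_const)
  also have "?r \<le> 1 / t"
  proof -
   have "real_of_int (4 * t * (?v * L (Suc i))) \<le> L i" using vL4 by (simp only: of_int_le_iff)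
   then show ?thesis using t0 L0[of i] by (simp add: field_simps)
  qed
  also have "E (Suc i) - E i + 1 / t \<le> \<eta>\<^sup>2"
  proof -
   have "2 / t \<le> 4 / real_of_int t" using t0 by (intro divide_right_mono) auto
   then show ?thesis using i(2) \<eta>(2) by simp
  qed
  finally show ?thesis by simp
 qed
 have L18: "18 * t * (msize t W (D i))\<^sup>2 \<le> L i"
 proof -
  have "18 * t ^ 1 \<le> t * t ^ 1" using t by (intro mult_right_mono) auto
  also have "\<dots> = t\<^sup>2" by (simp add: power2_eq_square)
  also have "\<dots> \<le> t ^ 148" using t0 by (intro power_increasing) auto
  finally have "18 * t \<le> W" using tW by simp
  then show ?thesis unfolding L_def M_def by (intro mult_right_mono) auto
 qed
 define Tf where "Tf d = avg ?X (\<lambda>x. avg ?X (\<lambda>y. f x y * f (x + \<gamma> i * d) y * f x (y + (\<gamma> i * d)\<^sup>2)))" for d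
 have lev: "\<mu> ^ 3 - 2 * \<eta> - 3 / t \<le> avg (params t W (D i)) (\<lambda>\<omega>. avg {0..<M i} (\<lambda>c. Tf (disp \<omega> + c)))"
  using level_bound[OF t W D16 L0 LD[OF i(1)] N0 pf f01(1,2) L18 \<eta> inc] i(1)
  unfolding mean Tf_def M_def by simp
 have small: "1 / t \<le> \<epsilon> / 64" "1 / M i \<le> 1 / t"
 proof -
  have "256 \<le> t * \<epsilon>\<^sup>2" using \<epsilon> by (simp add: divide_le_eq)
  also have "\<dots> \<le> t * (\<epsilon> * 1)" unfolding power2_eq_square using \<epsilon> t0 by (intro mult_left_mono) auto
  finally show "1 / t \<le> \<epsilon> / 64" using t0 \<epsilon> by (simp add: divide_le_eq mult.commute)
  have "t ^ 1 * (1 * 1) \<le> t ^ 74 * (W ^ 5 * D i)" using t0 Wp D0 tW(4,5) by (intro mult_mono power_increasing one_le_power) auto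
  then have "t \<le> M i" by (simp add: Meq)
  then show "1 / M i \<le> 1 / t" using t0 by (intro divide_left_mono) auto
 qed
 have T1: "Tf d \<le> 1" for d
  unfolding Tf_def using f01 by (intro avg_le mult_le_one) auto
 have "\<exists>\<omega>\<in>params t W (D i). \<exists>c\<in>{0..<M i}. disp \<omega> + c \<noteq> 0 \<and> (\<mu> ^ 3 - 2 * \<eta> - 3 / t) - 1 / M i \<le> Tf (disp \<omega> + c)"
 proof (rule exists_nonzero_displacement[OF finite_params params_nonempty M0(2) T1 lev])
  have "\<epsilon> \<le> \<mu> ^ 3" using big by (simp add: \<mu>_def)
  moreover have "3 / real_of_int t = 3 * (1 / t)" by simp
  ultimately show "0 < \<mu> ^ 3 - 2 * \<eta> - 3 / t - 1 / M i" using small \<epsilon>(1) unfolding \<eta>_def by linarith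
 qed (use t0 tW D0 in auto)
 then obtain \<omega> c where w: "\<omega> \<in> params t W (D i)" "c \<in> {0..<M i}" "disp \<omega> + c \<noteq> 0" "(\<mu> ^ 3 - 2 * \<eta> - 3 / t) - 1 / M i \<le> Tf (disp \<omega> + c)"
  by blast
 define d where "d = \<gamma> i * (disp \<omega> + c)"
 have g0: "1 \<le> \<gamma> i" unfolding \<gamma>_def using Wp(1)[of 4] by (intro one_le_power) linarith
 have d0: "d \<noteq> 0" using w(3) g0 by (simp add: d_def)
 have Tw: "Tf (disp \<omega> + c) * (real_of_int N)\<^sup>2 \<le> card {(x, y). (x, y) \<in> A \<and> (x + d, y) \<in> A \<and> (x, y + d\<^sup>2) \<in> A} + 2 * real_of_int (d\<^sup>2) * N"
  unfolding Tf_def f_def d_def by (rule wrap_count[OF N0 A])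
 \<comment> \<open>The step is at most W^(5t) and M i at most W^(16t + 22), so squaring gives W^(42t
   + 44) up to the factor 9. Two further factors W absorb 18t, whence the exponent 42t + 46 required
   of N.\<close>
 have dN: "2 * t * d\<^sup>2 \<le> N"
 proof -
  have "\<bar>disp \<omega> + c\<bar> \<le> 3 * M i" using w t tW D0 by (auto simp: M_def intro!: disp_bound3)
  then have "\<bar>disp \<omega> + c\<bar>\<^sup>2 \<le> (3 * M i)\<^sup>2" by (intro power_mono) auto
  then have "(disp \<omega> + c)\<^sup>2 \<le> (3 * M i)\<^sup>2" by (simp only: power2_abs)
  then have 1: "(disp \<omega> + c)\<^sup>2 \<le> 9 * (M i)\<^sup>2" by (simp add: power_mult_distrib)
  have "M i \<le> W * (W ^ 5 * W ^ (16 * (Tn + 1)))"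
   unfolding Meq D_def
  proof (intro mult_mono power_increasing)
   have "t ^ 74 \<le> t ^ 148" using t0 by (intro power_increasing) auto
   then show "t ^ 74 \<le> W" using tW by linarith
  qed (use tW t0 Wp in auto)
  also have "\<dots> = W ^ (1 + (5 + 16 * (Tn + 1)))" by (simp only: power_add power_one_right)
  also have "1 + (5 + 16 * (Tn + 1)) = 16 * Tn + 22" by simp
  finally have 2: "(M i)\<^sup>2 \<le> (W ^ (16 * Tn + 22))\<^sup>2" using M0(2)[of i] by (intro power_mono) auto
  have "4 * W ^ 4 \<le> W * W ^ 4" using tW by (intro mult_right_mono) auto
  then have "4 * W ^ 4 \<le> W ^ 5" by (simp flip: power_Suc)
  then have "\<gamma> i \<le> (W ^ 5) ^ i" unfolding \<gamma>_def using Wp(1)[of 4] by (intro power_mono) auto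
  also have "\<dots> \<le> (W ^ 5) ^ Tn" using i(1) Wp by (intro power_increasing) auto
  finally have 3: "(\<gamma> i)\<^sup>2 \<le> (W ^ (5 * Tn))\<^sup>2" using g0 by (intro power_mono) (auto simp: power_mult)
  have "d\<^sup>2 = (\<gamma> i)\<^sup>2 * (disp \<omega> + c)\<^sup>2" by (simp add: d_def power_mult_distrib)
  also have "\<dots> \<le> (W ^ (5 * Tn))\<^sup>2 * (9 * (W ^ (16 * Tn + 22))\<^sup>2)" using 1 2 3 by (intro mult_mono) auto
  also have "\<dots> = 9 * W ^ (42 * Tn + 44)"
  proof -
   have e1: "(W ^ (5 * Tn))\<^sup>2 = W ^ (5 * Tn * 2)" by (rule power_mult[symmetric])
   have e2: "(W ^ (16 * Tn + 22))\<^sup>2 = W ^ ((16 * Tn + 22) * 2)" by (rule power_mult[symmetric])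
   have e3: "W ^ (42 * Tn + 44) = W ^ (5 * Tn * 2) * W ^ ((16 * Tn + 22) * 2)"
    unfolding power_add[symmetric] by (rule arg_cong[of _ _ "\<lambda>k. W ^ k"]) simp
   show ?thesis unfolding e1 e2 e3 by (rule mult.left_commute)
  qed
  finally have "d\<^sup>2 \<le> 9 * W ^ (42 * Tn + 44)" .
  then have "2 * t * d\<^sup>2 \<le> 2 * t * (9 * W ^ (42 * Tn + 44))" using t0 by (intro mult_left_mono) auto
  also have "\<dots> = t * (18 * W ^ (42 * Tn + 44))" by simp
  also have "\<dots> \<le> W * (W * W ^ (42 * Tn + 44))" using tW t0 Wp(2)[of "42 * Tn + 44"] by (intro mult_mono) auto
  also have "\<dots> = W ^ (1 + (1 + (42 * Tn + 44)))" by (simp only: power_add power_one_right)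
  also have "\<dots> = W ^ (42 * Tn + 46)" by (rule arg_cong[of _ _ "\<lambda>k. W ^ k"]) simp
  also have "\<dots> \<le> N" using N by (simp add: Tn_def)
  finally show ?thesis .
 qed
 have Nr: "0 < real_of_int N" using N0 by simp
 have wrapsmall: "2 * real_of_int (d\<^sup>2) * N \<le> (1 / t) * (real_of_int N)\<^sup>2"
 proof -
  have "real_of_int (2 * t * d\<^sup>2) \<le> N" using dN by (simp only: of_int_le_iff)
  then have "2 * real_of_int (d\<^sup>2) \<le> N / t" using t0 by (simp add: le_divide_eq mult_ac)
  then have "2 * real_of_int (d\<^sup>2) * N \<le> N / t * N" using Nr by (intro mult_right_mono) auto
  then show ?thesis by (simp add: power2_eq_square)
 qed
 have "(\<mu> ^ 3 - \<epsilon>) * (real_of_int N)\<^sup>2 \<le> (Tf (disp \<omega> + c) - 1 / t) * (real_of_int N)\<^sup>2"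
 proof (rule mult_right_mono)
  have "3 / real_of_int t = 3 * (1 / t)" by simp
  then show "\<mu> ^ 3 - \<epsilon> \<le> Tf (disp \<omega> + c) - 1 / t" using w(4) small \<epsilon>(1) unfolding \<eta>_def by linarith
 qed simp
 also have "\<dots> = Tf (disp \<omega> + c) * (real_of_int N)\<^sup>2 - (1 / t) * (real_of_int N)\<^sup>2" by (simp only: left_diff_distrib)
 also have "\<dots> \<le> card {(x, y). (x, y) \<in> A \<and> (x + d, y) \<in> A \<and> (x, y + d\<^sup>2) \<in> A}" using Tw wrapsmall by linarith
 finally show ?thesis using d0 unfolding \<mu>_def by blast
qed

theorem theorem1p2:
  shows "\<exists>C::real. C > 0 \<and>
    (\<forall>(N::nat) (\<delta>::real) (A :: (int \<times> int) set) (\<epsilon>::real).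
      N > 0 \<longrightarrow> 0 < \<delta> \<longrightarrow> \<delta> \<le> 1 \<longrightarrow>
      A \<subseteq> {1..int N} \<times> {1..int N} \<longrightarrow> real (card A) \<ge> \<delta> * (real N)^2 \<longrightarrow>
      0 < \<epsilon> \<longrightarrow> \<epsilon> \<le> 1/2 \<longrightarrow>
      real N \<le> exp (C * \<epsilon> powr (- C)) \<or>
      (\<exists>d::int. d \<noteq> 0 \<and>
        real (card {(x, y). (x, y) \<in> A \<and> (x + d, y) \<in> A \<and> (x, y + d^2) \<in> A})
          \<ge> (\<delta>^3 - \<epsilon>) * (real N)^2))"
proof -
  \<comment> \<open>Obtained rather than written out, so that powers with this exponent stay
    symbolic.\<close>
  obtain w :: nat where w: "w = 2900 * 530 * 200" by blast
  \<comment> \<open>The final estimate is (2^22/\<epsilon>^2)^(2w + 3). Its numerical factor is C,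
    and C also exceeds the exponent 2(2w + 3) of 1/\<epsilon>, so one constant serves in both
    places.\<close>
  define C where "C = (2::real) ^ (22 * (2 * w + 3))"
  have C0: "0 < C" by (simp add: C_def)
  show ?thesis
  proof (intro exI[of _ C] conjI C0 allI impI)
    fix N :: nat and \<delta> \<epsilon> :: real and A :: "(int \<times> int) set"
    assume N: "0 < N" and \<delta>: "0 < \<delta>" "\<delta> \<le> 1" and A: "A \<subseteq> {1..int N} \<times> {1..int N}" and cA: "\<delta> * (real N)\<^sup>2 \<le> real (card A)"
      and \<epsilon>: "0 < \<epsilon>" "\<epsilon> \<le> 1 / 2"
    define u where "u = \<lceil>1 / \<epsilon>\<rceil>"
    \<comment> \<open>An integer of order \<epsilon>^-2 with both t \<ge> 2^20 and t \<ge>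
      256/\<epsilon>^2, the latter giving 4/t \<le> (\<epsilon>/8)^2.\<close>
    define t where "t = 2 ^ 20 * u\<^sup>2"
    have u: "1 / \<epsilon> \<le> u" "real_of_int u \<le> 2 / \<epsilon>" "1 \<le> u"
    proof -
      have "2 \<le> 1 / \<epsilon>" using \<epsilon> by (simp add: le_divide_eq)
      moreover have "2 / \<epsilon> = 1 / \<epsilon> + 1 / \<epsilon>" by simp
      ultimately show "1 / \<epsilon> \<le> u" "real_of_int u \<le> 2 / \<epsilon>" "1 \<le> u" unfolding u_def by linarith+
    qed
    have u2: "1 \<le> u\<^sup>2" using u(3) by (intro one_le_power)
    have t: "2 ^ 20 \<le> t" using u2 by (simp add: t_def)
    have t0: "1 \<le> t" "0 < t" using t by simp_all
    have te: "256 / \<epsilon>\<^sup>2 \<le> t" "real_of_int t \<le> 2 ^ 22 / \<epsilon>\<^sup>2"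
    proof -
      have "(1 / \<epsilon>)\<^sup>2 \<le> (real_of_int u)\<^sup>2" using u \<epsilon> by (intro power_mono) auto
      then have A: "1 / \<epsilon>\<^sup>2 \<le> (real_of_int u)\<^sup>2" by (simp add: power_divide)
      have "256 / \<epsilon>\<^sup>2 = 256 * (1 / \<epsilon>\<^sup>2)" by simp
      also have "\<dots> \<le> 2 ^ 20 * (real_of_int u)\<^sup>2" by (rule mult_mono[OF _ A]) auto
      also have "\<dots> = real_of_int t" by (simp add: t_def)
      finally show "256 / \<epsilon>\<^sup>2 \<le> t" .
      have "(real_of_int u)\<^sup>2 \<le> (2 / \<epsilon>)\<^sup>2" using u by (intro power_mono) auto
      then show "real_of_int t \<le> 2 ^ 22 / \<epsilon>\<^sup>2" by (simp add: t_def power_divide)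
    qed
    define s where "s = ((t ^ 2900) ^ 530) ^ 200"
    have sw: "s = t ^ w" unfolding s_def w by (simp only: power_mult)
    \<comment> \<open>A factorial is divisible by all integers up to s, and its logarithm is at most
      s log s, which is still polynomial in 1/\<epsilon>.\<close>
    define W where "W = (fact (nat s) :: int)"
    have s1: "1 \<le> s" unfolding sw using t0 by (intro one_le_power)
    have W1: "s \<le> W"
    proof -
      have "int (nat s) \<le> int (fact (nat s))" by (simp only: of_nat_le_iff fact_ge_self)
      then show ?thesis using s1 by (simp add: W_def)
    qed
    have W2: "m dvd W" if "1 \<le> m" "m \<le> s" for m
    proof -
      have "nat m dvd fact (nat s)" using that by (intro dvd_fact) auto
      then have "int (nat m) dvd int (fact (nat s))" by (simp only: of_nat_dvd_iff)
      then show ?thesis using that by (simp add: W_def)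
    qed
    define a where "a = card A / (real N)\<^sup>2"
    have \<delta>a: "\<delta> \<le> a" using cA N by (simp add: a_def le_divide_eq)
    have a3: "\<delta> ^ 3 \<le> a ^ 3" using \<delta> \<delta>a by (intro power_mono) auto
    show "real N \<le> exp (C * \<epsilon> powr (- C)) \<or>
      (\<exists>d::int. d \<noteq> 0 \<and> real (card {(x, y). (x, y) \<in> A \<and> (x + d, y) \<in> A \<and> (x, y + d^2) \<in> A}) \<ge> (\<delta>^3 - \<epsilon>) * (real N)^2)"
    proof (cases "\<epsilon> \<le> \<delta> ^ 3")
      case False
      \<comment> \<open>The required lower bound is not positive here, so d = 1 serves.\<close>
      then have "(\<delta> ^ 3 - \<epsilon>) * (real N)\<^sup>2 \<le> 0" by (intro mult_nonpos_nonneg) auto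
      also have "0 \<le> real (card {(x, y). (x, y) \<in> A \<and> (x + 1, y) \<in> A \<and> (x, y + 1^2) \<in> A})" by simp
      finally show ?thesis by (intro disjI2 exI[of _ 1]) simp
    next
      case eps: True
      show ?thesis
      proof (cases "W ^ (42 * nat t + 46) \<le> int N")
        case True
        have ea: "\<epsilon> \<le> (card A / (real_of_int (int N))\<^sup>2) ^ 3" using eps a3 by (simp add: a_def)
        obtain d where d: "d \<noteq> 0" "((card A / (real_of_int (int N))\<^sup>2) ^ 3 - \<epsilon>) * (real_of_int (int N))\<^sup>2
          \<le> card {(x, y). (x, y) \<in> A \<and> (x + d, y) \<in> A \<and> (x, y + d\<^sup>2) \<in> A}"
          using corners_large[OF t W1[unfolded s_def] W2[unfolded s_def] True A \<epsilon> te(1) ea] by blast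
        have "(\<delta> ^ 3 - \<epsilon>) * (real N)\<^sup>2 \<le> (a ^ 3 - \<epsilon>) * (real N)\<^sup>2" using a3 by (intro mult_right_mono) auto
        also have "\<dots> \<le> card {(x, y). (x, y) \<in> A \<and> (x + d, y) \<in> A \<and> (x, y + d\<^sup>2) \<in> A}" using d(2) by (simp add: a_def)
        finally show ?thesis using d(1) by blast
      next
        case False
        \<comment> \<open>For N below the threshold, log N is at most (42t + 46) log W. Here log W
          is bounded by T times s^2 with s = T^w, and 42T + 46 \<le> T^2 gives T^(2w + 3) in
          total.\<close>
        define T where "T = real_of_int t"
        have T: "2 ^ 20 \<le> T" "1 \<le> T" using t by (simp_all add: T_def)
        have rW: "real_of_int W \<le> exp (T * T ^ w * T ^ w)"
        proof -
          have rs: "real (nat s) = T ^ w" using s1 t0 by (simp add: sw T_def)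
          have "(fact (nat s) :: real) \<le> of_nat (nat s ^ nat s)" by (rule fact_le_power)
          also have "\<dots> = (T ^ w) ^ nat s" by (simp only: of_nat_power rs)
          also have "\<dots> \<le> exp (T ^ w) ^ nat s"
          proof (rule power_mono)
            show "T ^ w \<le> exp (T ^ w)" using exp_ge_add_one_self[of "T ^ w"] by linarith
          qed (use T in simp)
          also have "\<dots> = exp (real (nat s) * T ^ w)" by (rule exp_of_nat_mult[symmetric])
          also have "\<dots> = exp (T ^ w * T ^ w)" by (simp only: rs)
          also have "\<dots> \<le> exp (T * T ^ w * T ^ w)"
          proof -
            have "1 * (T ^ w * T ^ w) \<le> T * (T ^ w * T ^ w)" using T by (intro mult_right_mono) auto
            then show ?thesis by (simp add: mult.assoc)
          qed
          finally show ?thesis by (simp add: W_def)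
        qed
        have "real N \<le> real_of_int W ^ (42 * nat t + 46)"
        proof -
          have "int N \<le> W ^ (42 * nat t + 46)" using False by linarith
          then have "real_of_int (int N) \<le> real_of_int (W ^ (42 * nat t + 46))" by (simp only: of_int_le_iff)
          then show ?thesis by simp
        qed
        also have "\<dots> \<le> exp (T * T ^ w * T ^ w) ^ (42 * nat t + 46)" using rW s1 W1 by (intro power_mono) auto
        also have "\<dots> = exp (real (42 * nat t + 46) * (T * T ^ w * T ^ w))" by (rule exp_of_nat_mult[symmetric])
        also have "\<dots> \<le> exp (C * \<epsilon> powr (- C))"
        proof (subst exp_le_cancel_iff)
          have gen: "(2 ^ 22 / \<epsilon>\<^sup>2) ^ k = 2 ^ (22 * k) * (1 / \<epsilon>) ^ (2 * k)" for k :: nat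
            by (simp only: power_mult power_divide power_one times_divide_eq_right mult_1_right)
          have "real (42 * nat t + 46) = 42 * T + 46" using t0 by (simp add: T_def)
          also have "\<dots> \<le> T * T"
          proof -
            have "88 * T \<le> T * T" using T by (intro mult_right_mono) auto
            then show ?thesis using T(2) by linarith
          qed
          finally have "real (42 * nat t + 46) * (T * T ^ w * T ^ w) \<le> (T * T) * (T * T ^ w * T ^ w)" using T by (intro mult_right_mono) auto
          also have "\<dots> = T ^ (2 * w + 3)" 
          proof -
            have e: "T ^ (2 * w + 3) = T ^ w * T ^ w * T ^ 3" by (simp only: power_add mult_2)
            show ?thesis unfolding e power3_eq_cube by (simp only: mult_ac)
          qed
          also have "\<dots> \<le> (2 ^ 22 / \<epsilon>\<^sup>2) ^ (2 * w + 3)" by (rule power_mono) (use te(2) T in \<open>simp_all add: T_def\<close>)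
          also have "\<dots> = 2 ^ (22 * (2 * w + 3)) * (1 / \<epsilon>) ^ (2 * (2 * w + 3))"
            by (rule gen)
          also have "\<dots> \<le> C * \<epsilon> powr (- C)"
          proof -
            have "real (2 * (2 * w + 3)) \<le> 2 ^ (2 * (2 * w + 3))" by (rule less_imp_le[OF of_nat_less_two_power])
            also have "\<dots> \<le> C" unfolding C_def by (intro power_increasing) auto
            finally have k: "real (2 * (2 * w + 3)) \<le> C" .
            have "(1 / \<epsilon>) ^ (2 * (2 * w + 3)) = (1 / \<epsilon>) powr real (2 * (2 * w + 3))" using \<epsilon> by (intro powr_realpow[symmetric]) auto
            also have "\<dots> \<le> (1 / \<epsilon>) powr C" using \<epsilon> k by (intro powr_mono) auto
            also have "\<dots> = \<epsilon> powr (- C)" using \<epsilon> by (simp add: powr_divide powr_minus_divide)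
            finally show ?thesis using C0 unfolding C_def[symmetric] by (intro mult_left_mono) auto
          qed
          finally show "real (42 * nat t + 46) * (T * T ^ w * T ^ w) \<le> C * \<epsilon> powr (- C)" .
        qed
        finally show ?thesis by blast
      qed
    qed
  qed
qed

end
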